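(* Let $X$ be a compact connected Riemannian manifold with its geodesic distance, let $\mathbb{F}$ be a field, let $n=\dim_{\mathbb F}H_1(X,\mathbb F)$, and let $l_1\le l_2\le\dots\le l_n$ be the lengths of the loops in a shortest (i.e. lexicographically minimal) generating set of $H_1(X,\mathbb{F})$. Then the following persistences (families indexed by $r>0$) are pairwise isomorphic: (1) $\{H_1(\mathrm{Rips}(X,4r),\mathbb{F})\}_{r>0}$; (2) $\{H_1(\mathrm{Cech}(X,3r),\mathbb{F})\}_{r>0}$; (3) $\{H_1(X,\mathbb{F})/\mathcal{S}(X,6r)\}_{r>0}$; (4) $\{H_1(X,\mathbb{F})/\mathcal{L}(X,12r)\}_{r>0}$; (5) $\{H_1(X,\mathbb{F})/\mathcal{D}(X,6r)\}_{r>0}$; (6) $\bigoplus_{i=1}^n \mathbb{I}_{(0,\,l_i/12]}$.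
   Context: $\mathrm{Rips}(X,r)$ is the simplicial complex with vertex set $X$ in which a finite nonempty $\sigma\subset X$ is a simplex iff $\operatorname{diam}(\sigma)<r$. $\mathrm{Cech}(X,r)$ is the simplicial complex with vertex set $X$ in which a finite nonempty $\sigma\subset X$ is a simplex iff $\bigcap_{z\in\sigma}B(z,r)\ne\emptyset$ (open balls). For $a>0$, $\mathcal S(X,a)$, $\mathcal L(X,a)$, $\mathcal D(X,a)$ are the $\mathbb F$-subspaces of $H_1(X,\mathbb F)$ generated by the homology classes of loops of size less than $a$, where the size of a loop is measured, respectively, as the radius of the smallest closed ball enclosing the loop, the length of the loop, and the diameter of the loop. Shortest generating set: a base for $H_1(X,\mathbb F)\cong\mathbb F^n$ is a collection of loops $a_1,\dots,a_n$ with $\operatorname{length}(a_i)\le\operatorname{length}(a_j)$ for $i<j$ whose classes generate $H_1(X,\mathbb F)$; it is lexicographically minimal if its length vector $(\operatorname{length}(a_1),\dots,\operatorname{length}(a_n))$ is lexicographically minimal among the length vectors of all bases. A persistence is a family $\{A_r\}_{r>0}$ of vector spaces with compatible bonding homomorphisms $A_p\to A_q$ for $p<q$. In (1)-(2) they are induced by the inclusions of complexes; in (3)-(5) they are the natural quotient maps. The interval module $\mathbb I_{(0,b]}$ is $\mathbb F$ at $r\in(0,b]$ and $0$ at $r>b$, with identity bonding maps between parameters in $(0,b]$ and zero maps otherwise. An isomorphism of persistences $\{A_r\}\cong\{B_r\}$ is a family of isomorphisms $A_r\to B_r$, $r>0$, commuting with the bonding maps. *)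

theory Defs
  imports
    "HOL-Analysis.Analysis"
    "HOL-Homology.Homology"
    "Jordan_Normal_Form.Missing_VectorSpace"
begin

section \<open>Vector spaces over a field type\<close>

abbreviation scalars :: "'f::field ring" where
  "scalars \<equiv> \<lparr>carrier = UNIV, mult = (*), one = 1, zero = 0, add = (+)\<rparr>"

text \<open>Vector spaces are \<open>module\<close> records over \<open>scalars\<close>. Such a record inherits the
  fields \<open>mult\<close> and \<open>one\<close> from \<open>ring\<close>; they are meaningless for a vector space
  and are filled with \<open>zero\<close>.\<close>

definition free_space :: "'s set \<Rightarrow> ('f::field, 's \<Rightarrow>\<^sub>0 'f) module" where
  "free_space S = \<lparr>carrier = {c. Poly_Mapping.keys c \<subseteq> S}, mult = (\<lambda>x y. 0), one = 0,
     zero = 0, add = (+), smult = (\<lambda>a. Poly_Mapping.map ((*) a))\<rparr>"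

definition linear_extension ::
    "('s \<Rightarrow> ('t \<Rightarrow>\<^sub>0 'f::field)) \<Rightarrow> ('s \<Rightarrow>\<^sub>0 'f) \<Rightarrow> ('t \<Rightarrow>\<^sub>0 'f)" where
  "linear_extension f c =
     (\<Sum>s\<in>Poly_Mapping.keys c. Poly_Mapping.map ((*) (Poly_Mapping.lookup c s)) (f s))"

text \<open>The action on cosets of a map \<open>f\<close> into \<open>V\<close>, followed by the projection of
  \<open>V\<close> onto \<open>V / W\<close>. If \<open>f\<close> is linear and maps a subspace \<open>W'\<close> into \<open>W\<close>, a coset
  \<open>W' + v\<close> goes to \<open>W + f v\<close>.\<close>

definition coset_map :: "('f, 'v) module \<Rightarrow> 'v set \<Rightarrow> ('u \<Rightarrow> 'v) \<Rightarrow> 'u set \<Rightarrow> 'v set" where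
  "coset_map V W f A = (\<Union>u\<in>A. W +>\<^bsub>V\<^esub> f u)"

definition quotient_space :: "('f, 'v) module \<Rightarrow> 'v set \<Rightarrow> ('f, 'v set) module" where
  "quotient_space V W = \<lparr>carrier = a_rcosets\<^bsub>V\<^esub> W, mult = (\<lambda>A B. W), one = W,
     zero = W, add = (\<lambda>A B. A <+>\<^bsub>V\<^esub> B),
     smult = (\<lambda>a. coset_map V W (\<lambda>v. a \<odot>\<^bsub>V\<^esub> v))\<rparr>"

abbreviation vspan :: "('f::field, 'v) module \<Rightarrow> 'v set \<Rightarrow> 'v set" where
  "vspan V S \<equiv> LinearCombinations.module.span scalars V S"

definition direct_sum_space ::
    "nat \<Rightarrow> (nat \<Rightarrow> ('f, 'v) module) \<Rightarrow> ('f, nat \<Rightarrow> 'v) module" where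
  "direct_sum_space n V = \<lparr>carrier = (\<Pi>\<^sub>E i\<in>{..<n}. carrier (V i)),
     mult = (\<lambda>x y. \<lambda>i\<in>{..<n}. \<zero>\<^bsub>V i\<^esub>), one = (\<lambda>i\<in>{..<n}. \<zero>\<^bsub>V i\<^esub>),
     zero = (\<lambda>i\<in>{..<n}. \<zero>\<^bsub>V i\<^esub>), add = (\<lambda>x y. \<lambda>i\<in>{..<n}. x i \<oplus>\<^bsub>V i\<^esub> y i),
     smult = (\<lambda>a x. \<lambda>i\<in>{..<n}. a \<odot>\<^bsub>V i\<^esub> x i)\<rparr>"


section \<open>Homology with field coefficients\<close>

text \<open>A chain complex is given by its chain spaces \<open>C p\<close> and its boundary maps
  \<open>bd p\<close> from \<open>C p\<close> to \<open>C (p - 1)\<close>; \<open>bd 0\<close> counts as the zero map.\<close>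

definition cycles ::
    "(nat \<Rightarrow> ('f, 'v) module) \<Rightarrow> (nat \<Rightarrow> 'v \<Rightarrow> 'v) \<Rightarrow> nat \<Rightarrow> 'v set" where
  "cycles C bd p = {c \<in> carrier (C p). p = 0 \<or> bd p c = \<zero>\<^bsub>C (p - 1)\<^esub>}"

definition boundaries ::
    "(nat \<Rightarrow> ('f, 'v) module) \<Rightarrow> (nat \<Rightarrow> 'v \<Rightarrow> 'v) \<Rightarrow> nat \<Rightarrow> 'v set" where
  "boundaries C bd p = bd (Suc p) ` carrier (C (Suc p))"

definition homology ::
    "(nat \<Rightarrow> ('f, 'v) module) \<Rightarrow> (nat \<Rightarrow> 'v \<Rightarrow> 'v) \<Rightarrow> nat \<Rightarrow> ('f, 'v set) module" where
  "homology C bd p = quotient_space ((C p)\<lparr>carrier := cycles C bd p\<rparr>) (boundaries C bd p)"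


subsection \<open>Singular homology\<close>

definition singular_chains ::
    "'a topology \<Rightarrow> nat \<Rightarrow> ('f::field, ((nat \<Rightarrow> real) \<Rightarrow> 'a) \<Rightarrow>\<^sub>0 'f) module" where
  "singular_chains X p = free_space (singular_simplex_set p X)"

definition singular_bdry ::
    "nat \<Rightarrow> (((nat \<Rightarrow> real) \<Rightarrow> 'a) \<Rightarrow>\<^sub>0 'f::field) \<Rightarrow> (((nat \<Rightarrow> real) \<Rightarrow> 'a) \<Rightarrow>\<^sub>0 'f)" where
  "singular_bdry p =
     linear_extension (\<lambda>\<sigma>. \<Sum>k\<le>p. Poly_Mapping.single (singular_face p k \<sigma>) ((-1) ^ k))"

definition singular_H1 ::
    "'a topology \<Rightarrow> ('f::field, (((nat \<Rightarrow> real) \<Rightarrow> 'a) \<Rightarrow>\<^sub>0 'f) set) module" where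
  "singular_H1 X = homology (singular_chains X) singular_bdry 1"

definition is_loop :: "'a topology \<Rightarrow> (real \<Rightarrow> 'a) \<Rightarrow> bool" where
  "is_loop X \<gamma> \<longleftrightarrow> pathin X \<gamma> \<and> \<gamma> 0 = \<gamma> 1"

text \<open>A point \<open>x\<close> of the standard 1-simplex has barycentric coordinates
  \<open>(x 0, x 1) = (1 - t, t)\<close>, so that a path becomes a singular 1-simplex by
  evaluation at \<open>x 1\<close>.\<close>

definition loop_class ::
    "'a topology \<Rightarrow> (real \<Rightarrow> 'a) \<Rightarrow> (((nat \<Rightarrow> real) \<Rightarrow> 'a) \<Rightarrow>\<^sub>0 'f::field) set" where
  "loop_class X \<gamma> = boundaries (singular_chains X) singular_bdry 1
     +>\<^bsub>singular_chains X 1\<^esub>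
       Poly_Mapping.single (restrict (\<lambda>x. \<gamma> (x 1)) (standard_simplex 1)) 1"


subsection \<open>Simplicial homology\<close>

text \<open>A simplicial complex is the set of its simplices, which are finite nonempty vertex
  sets. Its homology is that of the oriented chain complex: \<open>p\<close>-chains are generated by
  orderings \<open>[v\<^sub>0,\<dots>,v\<^sub>p]\<close> of the \<open>p\<close>-simplices, modulo the relation that exchanging
  two adjacent vertices (hence any odd permutation) changes the sign.\<close>

definition ordered_simplices :: "'a set set \<Rightarrow> nat \<Rightarrow> 'a list set" where
  "ordered_simplices K p = {vs. distinct vs \<and> length vs = Suc p \<and> set vs \<in> K}"

definition orientation_relations ::
    "'a set set \<Rightarrow> nat \<Rightarrow> ('a list \<Rightarrow>\<^sub>0 'f::field) set" where
  "orientation_relations K p = vspan (free_space (ordered_simplices K p))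
     {Poly_Mapping.single (us @ x # y # ws) 1 + Poly_Mapping.single (us @ y # x # ws) 1 | us x y ws.
        us @ x # y # ws \<in> ordered_simplices K p}"

definition oriented_chains ::
    "'a set set \<Rightarrow> nat \<Rightarrow> ('f::field, ('a list \<Rightarrow>\<^sub>0 'f) set) module" where
  "oriented_chains K p =
     quotient_space (free_space (ordered_simplices K p)) (orientation_relations K p)"

definition ordered_bdry :: "nat \<Rightarrow> ('a list \<Rightarrow>\<^sub>0 'f::field) \<Rightarrow> ('a list \<Rightarrow>\<^sub>0 'f)" where
  "ordered_bdry p =
     linear_extension (\<lambda>vs. \<Sum>k\<le>p. Poly_Mapping.single (take k vs @ drop (Suc k) vs) ((-1) ^ k))"

definition oriented_bdry ::
    "'a set set \<Rightarrow> nat \<Rightarrow> ('a list \<Rightarrow>\<^sub>0 'f::field) set \<Rightarrow> ('a list \<Rightarrow>\<^sub>0 'f) set" where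
  "oriented_bdry K p =
     coset_map (free_space (ordered_simplices K (p - 1))) (orientation_relations K (p - 1))
       (ordered_bdry p)"

definition simplicial_H1 ::
    "'a set set \<Rightarrow> ('f::field, ('a list \<Rightarrow>\<^sub>0 'f) set set) module" where
  "simplicial_H1 K = homology (oriented_chains K) (oriented_bdry K) 1"

text \<open>The map on \<open>H\<^sub>1\<close> induced by the inclusion of a complex into a larger complex \<open>L\<close>.
  The inner \<open>coset_map\<close> is the chain map; on ordered chains it is the identity.\<close>

definition inclusion_H1 ::
    "'a set set \<Rightarrow> ('a list \<Rightarrow>\<^sub>0 'f::field) set set \<Rightarrow> ('a list \<Rightarrow>\<^sub>0 'f) set set" where
  "inclusion_H1 L =
     coset_map (oriented_chains L 1) (boundaries (oriented_chains L) (oriented_bdry L) 1)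
       (coset_map (free_space (ordered_simplices L 1)) (orientation_relations L 1) (\<lambda>c. c))"


section \<open>Persistences\<close>

text \<open>Only the spaces at parameters \<open>r > 0\<close> and the bonding maps for \<open>0 < p < q\<close> matter.\<close>

record ('f, 'v) persistence =
  pspace :: "real \<Rightarrow> ('f, 'v) module"
  pbond :: "real \<Rightarrow> real \<Rightarrow> 'v \<Rightarrow> 'v"

definition pers_iso ::
    "('f::field, 'u) persistence \<Rightarrow> ('f, 'v) persistence \<Rightarrow> bool" (infix \<open>\<cong>\<^sub>P\<close> 50) where
  "P \<cong>\<^sub>P Q \<longleftrightarrow> (\<exists>\<phi>.
     (\<forall>r>0. \<phi> r \<in> LinearCombinations.module_hom scalars (pspace P r) (pspace Q r) \<and>
            bij_betw (\<phi> r) (carrier (pspace P r)) (carrier (pspace Q r))) \<and>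
     (\<forall>p q. 0 < p \<and> p < q \<longrightarrow>
        (\<forall>x\<in>carrier (pspace P p). \<phi> q (pbond P p q x) = pbond Q p q (\<phi> p x))))"

definition filtration_H1_pers ::
    "(real \<Rightarrow> 'a set set) \<Rightarrow> ('f::field, ('a list \<Rightarrow>\<^sub>0 'f) set set) persistence" where
  "filtration_H1_pers K =
     \<lparr>pspace = (\<lambda>r. simplicial_H1 (K r)), pbond = (\<lambda>p q. inclusion_H1 (K q))\<rparr>"

definition quotient_pers ::
    "('f, 'v) module \<Rightarrow> (real \<Rightarrow> 'v set) \<Rightarrow> ('f, 'v set) persistence" where
  "quotient_pers V W =
     \<lparr>pspace = (\<lambda>r. quotient_space V (W r)), pbond = (\<lambda>p q. coset_map V (W q) (\<lambda>v. v))\<rparr>"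

text \<open>The interval module of \<open>(0,b]\<close>; \<open>b\<close> is extended real because lengths of
  loops are.\<close>

definition interval_pers :: "ereal \<Rightarrow> ('f::field, 'f) persistence" where
  "interval_pers b =
     \<lparr>pspace = (\<lambda>r. \<lparr>carrier = (if 0 < r \<and> ereal r \<le> b then UNIV else {0}),
        mult = (\<lambda>x y. 0), one = 0, zero = 0, add = (+), smult = (*)\<rparr>),
      pbond = (\<lambda>p q c. if 0 < p \<and> ereal q \<le> b then c else 0)\<rparr>"

definition direct_sum_pers ::
    "nat \<Rightarrow> (nat \<Rightarrow> ('f, 'v) persistence) \<Rightarrow> ('f, nat \<Rightarrow> 'v) persistence" where
  "direct_sum_pers n P =
     \<lparr>pspace = (\<lambda>r. direct_sum_space n (\<lambda>i. pspace (P i) r)),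
      pbond = (\<lambda>p q x. \<lambda>i\<in>{..<n}. pbond (P i) p q (x i))\<rparr>"


section \<open>Rips and Cech complexes, sizes of loops\<close>

text \<open>Below, \<open>M\<close> is the underlying set and \<open>d\<close> the distance function of a metric space.\<close>

definition set_diameter :: "('a \<Rightarrow> 'a \<Rightarrow> real) \<Rightarrow> 'a set \<Rightarrow> real" where
  "set_diameter d S = (SUP (x, y)\<in>S \<times> S. d x y)"

definition rips_complex :: "'a set \<Rightarrow> ('a \<Rightarrow> 'a \<Rightarrow> real) \<Rightarrow> real \<Rightarrow> 'a set set" where
  "rips_complex M d r = {\<sigma>. finite \<sigma> \<and> \<sigma> \<noteq> {} \<and> \<sigma> \<subseteq> M \<and> set_diameter d \<sigma> < r}"

definition cech_complex :: "'a set \<Rightarrow> ('a \<Rightarrow> 'a \<Rightarrow> real) \<Rightarrow> real \<Rightarrow> 'a set set" where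
  "cech_complex M d r =
     {\<sigma>. finite \<sigma> \<and> \<sigma> \<noteq> {} \<and> \<sigma> \<subseteq> M \<and> (\<Inter>z\<in>\<sigma>. Metric_space.mball M d z r) \<noteq> {}}"

definition loop_radius :: "'a set \<Rightarrow> ('a \<Rightarrow> 'a \<Rightarrow> real) \<Rightarrow> (real \<Rightarrow> 'a) \<Rightarrow> ereal" where
  "loop_radius M d \<gamma> =
     ereal (Inf {s. 0 \<le> s \<and> (\<exists>x\<in>M. \<gamma> ` {0..1} \<subseteq> Metric_space.mcball M d x s)})"

definition loop_length :: "('a \<Rightarrow> 'a \<Rightarrow> real) \<Rightarrow> (real \<Rightarrow> 'a) \<Rightarrow> ereal" where
  "loop_length d \<gamma> =
     (SUP ts\<in>{ts. sorted ts \<and> set ts \<subseteq> {0..1}}.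
        ereal (\<Sum>i<length ts - 1. d (\<gamma> (ts ! i)) (\<gamma> (ts ! Suc i))))"

definition loop_diameter :: "('a \<Rightarrow> 'a \<Rightarrow> real) \<Rightarrow> (real \<Rightarrow> 'a) \<Rightarrow> ereal" where
  "loop_diameter d \<gamma> = ereal (set_diameter d (\<gamma> ` {0..1}))"

definition small_loop_span ::
    "'a topology \<Rightarrow> ((real \<Rightarrow> 'a) \<Rightarrow> ereal) \<Rightarrow> real \<Rightarrow>
       (((nat \<Rightarrow> real) \<Rightarrow> 'a) \<Rightarrow>\<^sub>0 'f::field) set set" where
  "small_loop_span X sz a =
     vspan (singular_H1 X) {loop_class X \<gamma> | \<gamma>. is_loop X \<gamma> \<and> sz \<gamma> < ereal a}"

definition H1_dim :: "'f::field itself \<Rightarrow> 'a topology \<Rightarrow> nat" where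
  "H1_dim F X = vectorspace.dim scalars
     (singular_H1 X :: ('f, (((nat \<Rightarrow> real) \<Rightarrow> 'a) \<Rightarrow>\<^sub>0 'f) set) module)"

definition is_H1_base ::
    "'f::field itself \<Rightarrow> 'a topology \<Rightarrow> ('a \<Rightarrow> 'a \<Rightarrow> real) \<Rightarrow> (real \<Rightarrow> 'a) list \<Rightarrow> bool" where
  "is_H1_base F X d \<gamma>s \<longleftrightarrow>
     length \<gamma>s = H1_dim F X \<and> (\<forall>\<gamma>\<in>set \<gamma>s. is_loop X \<gamma>) \<and>
     sorted (map (loop_length d) \<gamma>s) \<and>
     vspan (singular_H1 X) (loop_class X ` set \<gamma>s) =
       carrier (singular_H1 X :: ('f, (((nat \<Rightarrow> real) \<Rightarrow> 'a) \<Rightarrow>\<^sub>0 'f) set) module)"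

definition shortest_generating_set ::
    "'f::field itself \<Rightarrow> 'a topology \<Rightarrow> ('a \<Rightarrow> 'a \<Rightarrow> real) \<Rightarrow> (real \<Rightarrow> 'a) list \<Rightarrow> bool" where
  "shortest_generating_set F X d \<gamma>s \<longleftrightarrow>
     is_H1_base F X d \<gamma>s \<and>
     (\<forall>\<delta>s. is_H1_base F X d \<delta>s \<longrightarrow>
        (map (loop_length d) \<delta>s, map (loop_length d) \<gamma>s) \<notin> lex {(x, y). x < y})"


section \<open>Riemannian manifolds\<close>

text \<open>Charts take values in a linear subspace \<open>E\<close> of a Euclidean space, and the dimension
  of the manifold is \<open>dim E\<close>. This admits dimension 0, since every type of class
  \<open>euclidean_space\<close> has positive dimension; otherwise one may think of \<open>E = UNIV\<close>. Only
  directions in \<open>E\<close> are relevant for derivatives.\<close>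

primrec Ck_on ::
    "'e::euclidean_space set \<Rightarrow> nat \<Rightarrow> 'e set \<Rightarrow> ('e \<Rightarrow> 'b::real_normed_vector) \<Rightarrow> bool" where
  "Ck_on E 0 S f \<longleftrightarrow> continuous_on S f"
| "Ck_on E (Suc k) S f \<longleftrightarrow>
     (\<exists>f'. (\<forall>x\<in>S. (f has_derivative f' x) (at x within S)) \<and>
           (\<forall>v\<in>E. Ck_on E k S (\<lambda>x. f' x v)))"

definition smooth_on ::
    "'e::euclidean_space set \<Rightarrow> 'e set \<Rightarrow> ('e \<Rightarrow> 'b::real_normed_vector) \<Rightarrow> bool" where
  "smooth_on E S f \<longleftrightarrow> (\<forall>k. Ck_on E k S f)"

text \<open>A chart is a pair \<open>(U, \<phi>)\<close>. The Riemannian metric is given in local coordinates: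
  \<open>g (U, \<phi>) x\<close> is the inner product at the coordinate point \<open>x \<in> \<phi> ` U\<close>, and the last
  assumption is its transformation rule under a change of coordinates.\<close>

locale riemannian_manifold =
  fixes X :: "'a topology"
    and E :: "'e::euclidean_space set"
    and \<A> :: "('a set \<times> ('a \<Rightarrow> 'e)) set"
    and g :: "'a set \<times> ('a \<Rightarrow> 'e) \<Rightarrow> 'e \<Rightarrow> 'e \<Rightarrow> 'e \<Rightarrow> real"
  assumes hausdorff: "Hausdorff_space X"
    and second_countable: "second_countable X"
    and model_space: "Real_Vector_Spaces.subspace E"
    and charts_cover: "(\<Union>(U, \<phi>)\<in>\<A>. U) = topspace X"
    and chart_domain: "(U, \<phi>) \<in> \<A> \<Longrightarrow> openin X U"
    and chart_range: "(U, \<phi>) \<in> \<A> \<Longrightarrow> openin (top_of_set E) (\<phi> ` U)"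
    and chart_homeo: "(U, \<phi>) \<in> \<A> \<Longrightarrow>
          homeomorphic_map (subtopology X U) (top_of_set (\<phi> ` U)) \<phi>"
    and transition_smooth: "\<lbrakk>(U, \<phi>) \<in> \<A>; (V, \<psi>) \<in> \<A>\<rbrakk> \<Longrightarrow>
          smooth_on E (\<phi> ` (U \<inter> V)) (\<psi> \<circ> inv_into U \<phi>)"
    and metric_smooth: "\<lbrakk>(U, \<phi>) \<in> \<A>; u \<in> E; v \<in> E\<rbrakk> \<Longrightarrow>
          smooth_on E (\<phi> ` U) (\<lambda>x. g (U, \<phi>) x u v)"
    and metric_bilinear: "\<lbrakk>(U, \<phi>) \<in> \<A>; x \<in> \<phi> ` U\<rbrakk> \<Longrightarrow> bilinear (g (U, \<phi>) x)"
    and metric_sym: "\<lbrakk>(U, \<phi>) \<in> \<A>; x \<in> \<phi> ` U; u \<in> E; v \<in> E\<rbrakk> \<Longrightarrow>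
          g (U, \<phi>) x u v = g (U, \<phi>) x v u"
    and metric_pos: "\<lbrakk>(U, \<phi>) \<in> \<A>; x \<in> \<phi> ` U; u \<in> E; u \<noteq> 0\<rbrakk> \<Longrightarrow> 0 < g (U, \<phi>) x u u"
    and metric_transform: "\<lbrakk>(U, \<phi>) \<in> \<A>; (V, \<psi>) \<in> \<A>; z \<in> U \<inter> V;
          ((\<psi> \<circ> inv_into U \<phi>) has_derivative D) (at (\<phi> z) within \<phi> ` (U \<inter> V));
          u \<in> E; v \<in> E\<rbrakk> \<Longrightarrow>
          g (U, \<phi>) (\<phi> z) u v = g (V, \<psi>) (\<psi> z) (D u) (D v)"

definition C1_in_chart ::
    "'a set \<times> ('a \<Rightarrow> 'e::euclidean_space) \<Rightarrow> (real \<Rightarrow> 'a) \<Rightarrow> real \<Rightarrow> real \<Rightarrow> bool" where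
  "C1_in_chart c \<gamma> a b \<longleftrightarrow> \<gamma> ` {a..b} \<subseteq> fst c \<and>
     (\<exists>D. continuous_on {a..b} D \<and>
          (\<forall>t\<in>{a..b}. ((snd c \<circ> \<gamma>) has_vector_derivative D t) (at t within {a..b})))"

definition piecewise_C1_curve ::
    "'a topology \<Rightarrow> ('a set \<times> ('a \<Rightarrow> 'e::euclidean_space)) set \<Rightarrow> (real \<Rightarrow> 'a) \<Rightarrow> bool" where
  "piecewise_C1_curve X \<A> \<gamma> \<longleftrightarrow> pathin X \<gamma> \<and>
     (\<exists>(m::nat) t. t 0 = 0 \<and> t m = 1 \<and>
        (\<forall>i<m. t i < t (Suc i) \<and> (\<exists>c\<in>\<A>. C1_in_chart c \<gamma> (t i) (t (Suc i)))))"

text \<open>The norm of the velocity vector, computed in a chart around \<open>\<gamma> t\<close>; by the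
  transformation rule the choice of the chart is immaterial. Where a piecewise
  \<open>C\<^sup>1\<close> curve breaks, the value is arbitrary and does not affect the length.\<close>

definition speed ::
    "('a set \<times> ('a \<Rightarrow> 'e::euclidean_space)) set \<Rightarrow>
     ('a set \<times> ('a \<Rightarrow> 'e) \<Rightarrow> 'e \<Rightarrow> 'e \<Rightarrow> 'e \<Rightarrow> real) \<Rightarrow> (real \<Rightarrow> 'a) \<Rightarrow> real \<Rightarrow> real" where
  "speed \<A> g \<gamma> t =
     (let c = (SOME c. c \<in> \<A> \<and> \<gamma> t \<in> fst c);
          v = vector_derivative (snd c \<circ> \<gamma>) (at t)
      in sqrt (g c (snd c (\<gamma> t)) v v))"

definition riemannian_length ::
    "('a set \<times> ('a \<Rightarrow> 'e::euclidean_space)) set \<Rightarrow>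
     ('a set \<times> ('a \<Rightarrow> 'e) \<Rightarrow> 'e \<Rightarrow> 'e \<Rightarrow> 'e \<Rightarrow> real) \<Rightarrow> (real \<Rightarrow> 'a) \<Rightarrow> real" where
  "riemannian_length \<A> g \<gamma> = integral {0..1} (speed \<A> g \<gamma>)"

text \<open>The value 0 outside the manifold is a convention of the locale \<open>Metric_space\<close>, which
  wants the distance function to be nonnegative and symmetric on the whole type.\<close>

definition geodesic_dist ::
    "'a topology \<Rightarrow> ('a set \<times> ('a \<Rightarrow> 'e::euclidean_space)) set \<Rightarrow>
     ('a set \<times> ('a \<Rightarrow> 'e) \<Rightarrow> 'e \<Rightarrow> 'e \<Rightarrow> 'e \<Rightarrow> real) \<Rightarrow> 'a \<Rightarrow> 'a \<Rightarrow> real" where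
  "geodesic_dist X \<A> g x y =
     (if x \<in> topspace X \<and> y \<in> topspace X
      then Inf {riemannian_length \<A> g \<gamma> | \<gamma>. piecewise_C1_curve X \<A> \<gamma> \<and> \<gamma> 0 = x \<and> \<gamma> 1 = y}
      else 0)"

end

theory Submission
  imports Defs
begin

text \<open>All persistences are compared with (4). For \<open>K\<close> one of the complexes \<open>Rips(X,4r)\<close> and
  \<open>Cech(X,3r)\<close>, a simplicial 1-cycle is realized in \<open>X\<close> by replacing its edges with short
  paths. The boundary of a 2-simplex then becomes a sum of loops of length less than \<open>12r\<close>,
  which gives a map from \<open>H\<^sub>1(K)\<close> to \<open>H\<^sub>1(X) / L(X,12r)\<close>. It is onto because a loop can be cut into
  small pieces. For injectivity, a path in \<open>X\<close> is sent to the sum of the edges of a fine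
  subdivision, modulo boundaries in \<open>K\<close>; this respects homologies in \<open>X\<close>, recovers every
  edge from its realization, and kills a loop shorter than \<open>12r\<close>, because such a loop breaks up into three arcs shorter than
  \<open>4r\<close> or four arcs shorter than \<open>3r\<close>, whose end points span simplices of \<open>K\<close>.

  A loop in a ball of radius less than \<open>6r\<close> is a sum of thin triangles with apex at the centre,
  of perimeter less than \<open>12r\<close>; hence (3) and (5) coincide with (4). Finally, an exchange
  argument shows that the classes of the loops shorter than \<open>12r\<close> are spanned by those
  members of a lexicographically minimal base that are shorter than \<open>12r\<close>.

  Of Riemannian geometry only this is used: the geodesic distance induces the topology, it is
  approximated by lengths of paths, and small balls lie in contractible sets.\<close>

section \<open>Presentations of vector spaces\<close>

text \<open>The constant 12 is 3 * 4 as well as 4 * 3. A triangle of the Rips complex of parameter s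
  has perimeter below 3 s. In the Cech complex of parameter s edges may be almost 2 s long, so a
  perimeter is only bounded by 6 s; coning a triangle off from the centre of its covering ball gives
  three triangles of perimeter below 4 s instead. This matches the four arcs of a loop shorter than
  4 s, whose odd division points serve as ball centres.

  All bounds are strict. Paths whose length merely approximates the distance therefore fit under
  them, and the gap between the length of a loop and its bound dictates how finely the loop has to
  be sampled.

  Neither passage between complex and manifold is canonical on chains: edges are realized by chosen
  paths, and paths are subdivided at chosen points. Both are determined only modulo relations. Hence
  every space is described by representatives and one subspace of relations, and squares have to
  commute only modulo relations.\<close>

abbreviation pscale :: "'f::field \<Rightarrow> ('s \<Rightarrow>\<^sub>0 'f) \<Rightarrow> ('s \<Rightarrow>\<^sub>0 'f)" where
  "pscale a \<equiv> Poly_Mapping.map ((*) a)"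

lemma lookup_pscale [simp]:
  "Poly_Mapping.lookup (pscale a c) s = a * Poly_Mapping.lookup c s"
  by (simp add: Poly_Mapping.map.rep_eq when_def)

text \<open>Spans and subspaces of chains come from the type-based linear algebra; the module
  records of the definitions are reached through \<open>presents\<close>.\<close>

interpretation pm: vector_space "pscale :: 'f::field \<Rightarrow> ('s \<Rightarrow>\<^sub>0 'f) \<Rightarrow> ('s \<Rightarrow>\<^sub>0 'f)"
  by unfold_locales (auto intro!: poly_mapping_eqI simp: lookup_add algebra_simps)

interpretation pm: vector_space_pair "pscale :: 'f::field \<Rightarrow> ('s \<Rightarrow>\<^sub>0 'f) \<Rightarrow> ('s \<Rightarrow>\<^sub>0 'f)"
  "pscale :: 'f::field \<Rightarrow> ('t \<Rightarrow>\<^sub>0 'f) \<Rightarrow> ('t \<Rightarrow>\<^sub>0 'f)"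
  by unfold_locales

abbreviation plinear :: "(('s \<Rightarrow>\<^sub>0 'f::field) \<Rightarrow> ('t \<Rightarrow>\<^sub>0 'f)) \<Rightarrow> bool" where
  "plinear \<equiv> Vector_Spaces.linear pscale pscale"

lemma pscale_single [simp]: "pscale a (Poly_Mapping.single s b) = Poly_Mapping.single s (a * b)"
  by (rule poly_mapping_eqI) (simp add: lookup_single when_def)

text \<open>A common finite index set for several chains, as additivity requires: the support of a
  sum may be smaller than the union of the supports.\<close>

lemma linear_extension_superset:
  assumes "finite S" "Poly_Mapping.keys c \<subseteq> S"
  shows "linear_extension f c = (\<Sum>s\<in>S. pscale (Poly_Mapping.lookup c s) (f s))"
  unfolding linear_extension_def
  by (rule sum.mono_neutral_left) (use assms in \<open>auto simp: in_keys_iff\<close>)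

lemma linear_linear_extension:
  fixes f :: "'s \<Rightarrow> ('t \<Rightarrow>\<^sub>0 'f::field)"
  shows "plinear (linear_extension f)"
proof (subst Vector_Spaces.linear_iff, intro conjI allI)
  fix c c' :: "'s \<Rightarrow>\<^sub>0 'f" and a :: 'f
  let ?S = "Poly_Mapping.keys c \<union> Poly_Mapping.keys c'"
  have k: "Poly_Mapping.keys (c + c') \<subseteq> ?S" by (rule Poly_Mapping.keys_add)
  show "linear_extension f (c + c') = linear_extension f c + linear_extension f c'"
    by (simp add: linear_extension_superset[of ?S] k lookup_add pm.scale_left_distrib sum.distrib)
  have k: "Poly_Mapping.keys (pscale a c) \<subseteq> Poly_Mapping.keys c"
    by (auto simp: in_keys_iff)
  show "linear_extension f (pscale a c) = pscale a (linear_extension f c)"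
    by (simp add: linear_extension_superset[of "Poly_Mapping.keys c"] k pm.scale_sum_right)
qed (unfold_locales)

lemma linear_extension_single [simp]: "linear_extension f (Poly_Mapping.single s a) = pscale a (f s)"
  by (subst linear_extension_superset[of "{s}"]) (auto simp: in_keys_iff lookup_single when_def)

definition free_chains :: "'s set \<Rightarrow> ('s \<Rightarrow>\<^sub>0 'f::field) set" where
  "free_chains S = {c. Poly_Mapping.keys c \<subseteq> S}"

lemma free_chains_eq_span:
  "(free_chains S :: ('s \<Rightarrow>\<^sub>0 'f::field) set) = pm.span ((\<lambda>s. Poly_Mapping.single s 1) ` S)"
proof
  show "free_chains S \<subseteq> (pm.span ((\<lambda>s. Poly_Mapping.single s 1) ` S) :: ('s \<Rightarrow>\<^sub>0 'f) set)"
  proof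
    fix c :: "'s \<Rightarrow>\<^sub>0 'f" assume c: "c \<in> free_chains S"
    have "c = (\<Sum>s\<in>Poly_Mapping.keys c. pscale (Poly_Mapping.lookup c s) (Poly_Mapping.single s 1))"
      by (rule poly_mapping_eqI)
        (auto simp: lookup_sum lookup_single when_def in_keys_iff)
    also have "\<dots> \<in> pm.span ((\<lambda>s. Poly_Mapping.single s 1) ` S)"
      using c by (intro pm.span_sum pm.span_scale pm.span_base) (auto simp: free_chains_def)
    finally show "c \<in> pm.span ((\<lambda>s. Poly_Mapping.single s 1) ` S)" .
  qed
  have "pm.subspace (free_chains S :: ('s \<Rightarrow>\<^sub>0 'f) set)"
  proof (rule pm.subspaceI)
    fix x y :: "'s \<Rightarrow>\<^sub>0 'f" assume "x \<in> free_chains S" "y \<in> free_chains S"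
    then show "x + y \<in> free_chains S" using Poly_Mapping.keys_add[of x y] by (auto simp: free_chains_def)
  qed (auto simp: free_chains_def in_keys_iff subset_iff)
  then show "pm.span ((\<lambda>s. Poly_Mapping.single s 1) ` S) \<subseteq> (free_chains S :: ('s \<Rightarrow>\<^sub>0 'f) set)"
    by (intro pm.span_minimal) (auto simp: free_chains_def)
qed

lemma subspace_chains [simp]: "pm.subspace (free_chains S)"
  by (simp add: free_chains_eq_span)

lemma single_in_chains [simp]: "s \<in> S \<Longrightarrow> Poly_Mapping.single s a \<in> free_chains S"
  by (simp add: free_chains_def)

text \<open>The induction principle for chains: statements about linear maps are checked on single
  simplices.\<close>

lemma linear_chains_into:
  assumes "plinear h" "pm.subspace W" "\<And>s. s \<in> S \<Longrightarrow> h (Poly_Mapping.single s 1) \<in> W" "c \<in> free_chains S"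
  shows "h c \<in> W"
proof -
  have "h ` free_chains S \<subseteq> W"
    unfolding free_chains_eq_span pm.linear_span_image[OF assms(1), symmetric]
    by (rule pm.span_minimal) (use assms in auto)
  then show ?thesis using assms(4) by blast
qed

lemma plinear_id: "plinear (\<lambda>x. x)"
  by (subst Vector_Spaces.linear_iff) (auto intro: pm.vector_space_axioms)

lemma plinear_diff:
  assumes "plinear f" "plinear g"
  shows "plinear (\<lambda>x. f x - g x)"
  using pm.linear_compose_sub[OF assms] by simp

lemma plinear_comp:
  assumes "plinear f" "plinear g"
  shows "plinear (\<lambda>x. f (g x))"
  using Vector_Spaces.linear_compose[OF assms(2,1)] by (simp add: o_def)

text \<open>The quotient \<open>Z / N\<close> is the space \<open>V\<close>, the map \<open>q\<close> being the projection; the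
  nested quotients of the definitions are handled through representatives in \<open>Z\<close>.\<close>

definition presents ::
    "('f::field, 'v) module \<Rightarrow> ('s \<Rightarrow>\<^sub>0 'f) set \<Rightarrow> ('s \<Rightarrow>\<^sub>0 'f) set \<Rightarrow> (('s \<Rightarrow>\<^sub>0 'f) \<Rightarrow> 'v) \<Rightarrow> bool" where
  "presents V Z N q \<longleftrightarrow> pm.subspace Z \<and> pm.subspace N \<and> N \<subseteq> Z \<and> carrier V = q ` Z \<and>
     (\<forall>x\<in>Z. \<forall>y\<in>Z. q x = q y \<longleftrightarrow> x - y \<in> N) \<and>
     (\<forall>x\<in>Z. \<forall>y\<in>Z. q x \<oplus>\<^bsub>V\<^esub> q y = q (x + y)) \<and>
     (\<forall>a. \<forall>x\<in>Z. a \<odot>\<^bsub>V\<^esub> q x = q (pscale a x)) \<and> \<zero>\<^bsub>V\<^esub> = q 0"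

lemma presentsD:
  assumes "presents V Z N q"
  shows "pm.subspace Z" "pm.subspace N" "N \<subseteq> Z" "carrier V = q ` Z"
    "\<And>x y. x \<in> Z \<Longrightarrow> y \<in> Z \<Longrightarrow> q x = q y \<longleftrightarrow> x - y \<in> N"
    "\<And>x y. x \<in> Z \<Longrightarrow> y \<in> Z \<Longrightarrow> q x \<oplus>\<^bsub>V\<^esub> q y = q (x + y)"
    "\<And>a x. x \<in> Z \<Longrightarrow> a \<odot>\<^bsub>V\<^esub> q x = q (pscale a x)" "\<zero>\<^bsub>V\<^esub> = q 0"
  using assms unfolding presents_def by blast+

lemma presents_free_space: "presents (free_space S) (free_chains S) {0} (\<lambda>c. c)"
  unfolding presents_def using pm.subspace_0[OF subspace_chains]
  by (auto simp: free_space_def free_chains_def[symmetric])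

text \<open>Passes from chains to cycles: the representatives shrink while the relations stay the
  same.\<close>

lemma presents_restrict:
  assumes "presents V Z N q" "pm.subspace Z'" "N \<subseteq> Z'" "Z' \<subseteq> Z"
  shows "presents (V\<lparr>carrier := q ` Z'\<rparr>) Z' N q"
  unfolding presents_def
  using assms presentsD[OF assms(1)] by (auto simp: subset_iff)

lemma field_scalars: "field (scalars :: 'f::field ring)"
proof -
  have "cring (scalars :: 'f ring)"
    by (rule cringI, rule abelian_groupI, auto simp: algebra_simps intro: comm_monoidI)
      (metis add.commute add.right_inverse)
  then show ?thesis
    by (rule cring.cring_fieldI2) (auto, metis right_inverse)
qed

lemma presents_vectorspace:
  assumes "presents V Z N q"
  shows "vectorspace scalars V"
proof -
  note P = presentsD[OF assms]
  note S = pm.subspace_add[OF P(1)] pm.subspace_scale[OF P(1)] pm.subspace_0[OF P(1)] pm.subspace_neg[OF P(1)]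
  show ?thesis
  proof (rule vs_criteria[OF field_scalars])
    show "\<forall>v\<in>carrier V. \<exists>neg_v\<in>carrier V. v \<oplus>\<^bsub>V\<^esub> neg_v = \<zero>\<^bsub>V\<^esub>"
    proof
      fix v assume "v \<in> carrier V"
      then obtain x where x: "x \<in> Z" "v = q x" by (auto simp: P(4))
      have "v \<oplus>\<^bsub>V\<^esub> q (- x) = \<zero>\<^bsub>V\<^esub>" using x S(4)[of x] P(6)[of x "-x"] by (simp add: P(8))
      then show "\<exists>neg_v\<in>carrier V. v \<oplus>\<^bsub>V\<^esub> neg_v = \<zero>\<^bsub>V\<^esub>" using x S(4) by (auto simp: P(4))
    qed
  qed (auto simp: P(4,6,7,8) S algebra_simps pm.scale_right_distrib pm.scale_left_distrib)
qed

text \<open>The quotient keeps its representatives \<open>Z\<close>; only the relations grow from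
  \<open>N\<close> to \<open>M\<close>. Iteration flattens a quotient of quotients to a single
  quotient of chains.\<close>

lemma presents_quotient:
  assumes "presents V Z N q" "pm.subspace M" "N \<subseteq> M" "M \<subseteq> Z" "W = q ` M"
  shows "presents (quotient_space V W) Z M (\<lambda>z. W +>\<^bsub>V\<^esub> q z)"
proof -
  note P = presentsD[OF assms(1)]
  note Z = pm.subspace_add[OF P(1)] pm.subspace_scale[OF P(1)] pm.subspace_0[OF P(1)] pm.subspace_diff[OF P(1)]
  note M = pm.subspace_add[OF assms(2)] pm.subspace_scale[OF assms(2)] pm.subspace_0[OF assms(2)]
    pm.subspace_diff[OF assms(2)]
  have MZ: "m \<in> M \<Longrightarrow> m \<in> Z" for m using assms(4) by blast
  have coset: "W +>\<^bsub>V\<^esub> q z = {q (m + z) | m. m \<in> M}" if "z \<in> Z" for z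
    using that P(6) MZ unfolding a_r_coset_def' assms(5) by (fastforce)
  \<comment> \<open>Membership through a representative \<open>y\<close> congruent to
    \<open>z\<close>; \<open>qM\<close> below makes the choice of \<open>y\<close> harmless, because
    \<open>N\<close> lies in \<open>M\<close>.\<close>
  have mem: "v \<in> W +>\<^bsub>V\<^esub> q z \<longleftrightarrow> (\<exists>y\<in>Z. v = q y \<and> y - z \<in> M)" if z: "z \<in> Z" for v z
  proof
    assume "v \<in> W +>\<^bsub>V\<^esub> q z"
    then obtain m where "m \<in> M" "v = q (m + z)" by (auto simp: coset[OF z])
    then show "\<exists>y\<in>Z. v = q y \<and> y - z \<in> M" using z MZ Z by (intro bexI[of _ "m + z"]) auto
  next
    assume "\<exists>y\<in>Z. v = q y \<and> y - z \<in> M"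
    then obtain y where "y \<in> Z" "v = q y" "y - z \<in> M" by blast
    then show "v \<in> W +>\<^bsub>V\<^esub> q z" unfolding coset[OF z] by (auto intro!: exI[of _ "y - z"])
  qed
  have qM: "q x = q y \<Longrightarrow> x \<in> Z \<Longrightarrow> y \<in> Z \<Longrightarrow> x - y \<in> M" for x y
    using P(5) assms(3) by blast
  have eq: "W +>\<^bsub>V\<^esub> q x = W +>\<^bsub>V\<^esub> q y \<longleftrightarrow> x - y \<in> M" if z: "x \<in> Z" "y \<in> Z" for x y
  proof
    assume "W +>\<^bsub>V\<^esub> q x = W +>\<^bsub>V\<^esub> q y"
    then have "q x \<in> W +>\<^bsub>V\<^esub> q y" using that mem[of x "q x"] M(3) by auto
    then obtain y' where y': "y' \<in> Z" "q x = q y'" "y' - y \<in> M" unfolding mem[OF z(2)] by blast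
    then have "x - y' \<in> M" using qM that by blast
    then show "x - y \<in> M" using M(1)[OF _ y'(3), of "x - y'"] by simp
  next
    assume xy: "x - y \<in> M"
    have "(w - x \<in> M) = (w - y \<in> M)" for w
      using M(1)[OF _ xy, of "w - x"] M(4)[OF _ xy, of "w - y"] by (auto simp: algebra_simps)
    then show "W +>\<^bsub>V\<^esub> q x = W +>\<^bsub>V\<^esub> q y" using that by (auto simp: mem)
  qed
  show ?thesis
    unfolding presents_def
  proof (intro conjI ballI allI)
    show "carrier (quotient_space V W) = (\<lambda>z. W +>\<^bsub>V\<^esub> q z) ` Z"
      by (auto simp: quotient_space_def A_RCOSETS_def' P(4))
    fix x y assume x: "x \<in> Z" and y: "y \<in> Z"
    show "(W +>\<^bsub>V\<^esub> q x = W +>\<^bsub>V\<^esub> q y) = (x - y \<in> M)" using eq x y .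
    show "(W +>\<^bsub>V\<^esub> q x) \<oplus>\<^bsub>quotient_space V W\<^esub> (W +>\<^bsub>V\<^esub> q y) = W +>\<^bsub>V\<^esub> q (x + y)" (is "?l = ?r")
    proof -
      have "?l = {v. \<exists>a b. a \<in> W +>\<^bsub>V\<^esub> q x \<and> b \<in> W +>\<^bsub>V\<^esub> q y \<and> v = a \<oplus>\<^bsub>V\<^esub> b}"
        by (auto simp: quotient_space_def set_add_def' )
      also have "\<dots> = ?r"
      proof (intro Set.set_eqI iffI)
        fix v assume "v \<in> {v. \<exists>a b. a \<in> W +>\<^bsub>V\<^esub> q x \<and> b \<in> W +>\<^bsub>V\<^esub> q y \<and> v = a \<oplus>\<^bsub>V\<^esub> b}"
        then obtain a b where ab: "a \<in> W +>\<^bsub>V\<^esub> q x" "b \<in> W +>\<^bsub>V\<^esub> q y" "v = a \<oplus>\<^bsub>V\<^esub> b" by blast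
        obtain x' where "x' \<in> Z" "a = q x'" "x' - x \<in> M" using ab(1) unfolding mem[OF x] by blast
        moreover obtain y' where "y' \<in> Z" "b = q y'" "y' - y \<in> M" using ab(2) unfolding mem[OF y] by blast
        moreover note ab(3)
        ultimately have "x' \<in> Z" "x' - x \<in> M" "y' \<in> Z" "y' - y \<in> M" "v = q x' \<oplus>\<^bsub>V\<^esub> q y'" by auto
        then show "v \<in> W +>\<^bsub>V\<^esub> q (x + y)"
          using x y Z(1) M(1)[of "x' - x" "y' - y"]
          by (subst mem) (auto simp: P(6) algebra_simps intro!: bexI[of _ "x' + y'"])
      next
        fix v assume "v \<in> W +>\<^bsub>V\<^esub> q (x + y)"
        then obtain m where m: "m \<in> M" "v = q (m + (x + y))" using x y coset[of "x + y"] Z(1) by auto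
        then have "v = q (m + x) \<oplus>\<^bsub>V\<^esub> q y" using x y MZ Z(1) by (simp add: P(6) algebra_simps)
        moreover have "q (m + x) \<in> W +>\<^bsub>V\<^esub> q x" using m coset[OF x] by auto
        moreover have "q y \<in> W +>\<^bsub>V\<^esub> q y" using y M(3) mem[OF y, of "q y"] by auto
        ultimately show "v \<in> {v. \<exists>a b. a \<in> W +>\<^bsub>V\<^esub> q x \<and> b \<in> W +>\<^bsub>V\<^esub> q y \<and> v = a \<oplus>\<^bsub>V\<^esub> b}"
          by blast
      qed
      finally show ?thesis .
    qed
    fix a
    show "a \<odot>\<^bsub>quotient_space V W\<^esub> (W +>\<^bsub>V\<^esub> q x) = W +>\<^bsub>V\<^esub> q (pscale a x)" (is "?l = ?r")
    proof -
      have "W +>\<^bsub>V\<^esub> (a \<odot>\<^bsub>V\<^esub> v) = ?r" if v: "v \<in> W +>\<^bsub>V\<^esub> q x" for v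
      proof -
        obtain y where y: "y \<in> Z" "v = q y" "y - x \<in> M" using v unfolding mem[OF x] by blast
        have "pscale a y - pscale a x \<in> M" using M(2)[OF y(3), of a] by (simp add: pm.scale_right_diff_distrib)
        then show ?thesis using y x Z(2) by (simp add: P(7) eq)
      qed
      moreover have "q x \<in> W +>\<^bsub>V\<^esub> q x" using x M(3) mem[OF x, of "q x"] by auto
      ultimately show ?thesis by (auto simp: quotient_space_def coset_map_def)
    qed
  next
    have "W +>\<^bsub>V\<^esub> q 0 = W" unfolding coset[OF Z(3)] by (auto simp: assms(5))
    then show "\<zero>\<^bsub>quotient_space V W\<^esub> = W +>\<^bsub>V\<^esub> q 0" by (simp add: quotient_space_def)
  qed (use P assms in auto)
qed

text \<open>All cosets in the union that defines \<open>coset_map\<close> coincide, so the union is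
  one of them.\<close>

lemma presents_coset_map:
  assumes "presents (quotient_space V W) Z M (\<lambda>z. W +>\<^bsub>V\<^esub> q z)"
    and "A \<noteq> {}" "z \<in> Z" "\<And>u. u \<in> A \<Longrightarrow> \<exists>y\<in>Z. f u = q y \<and> y - z \<in> M"
  shows "coset_map V W f A = W +>\<^bsub>V\<^esub> q z"
proof -
  have "W +>\<^bsub>V\<^esub> f u = W +>\<^bsub>V\<^esub> q z" if u: "u \<in> A" for u
    using assms(4)[OF u] presentsD(5)[OF assms(1) _ assms(3)] by fastforce
  then show ?thesis using assms(2) by (auto simp: coset_map_def)
qed

lemma presents_coset_mem:
  assumes "presents V Z N q" "M \<subseteq> Z" "W = q ` M" "z \<in> Z" "u \<in> W +>\<^bsub>V\<^esub> q z"
  shows "\<exists>m\<in>M. u = q (m + z)"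
  using assms presentsD(6)[OF assms(1) _ assms(4)] unfolding a_r_coset_def' by fastforce

lemma presents_coset_nonempty:
  assumes "W = q ` M" "0 \<in> M"
  shows "W +>\<^bsub>V\<^esub> v \<noteq> {}"
  using assms unfolding a_r_coset_def' by blast

text \<open>Adjoining \<open>N\<close> makes the span the full preimage of the generated subspace in
  \<open>Z\<close>; in this form it can be the larger relation space in
  \<open>presents_quotient\<close>.\<close>

lemma presents_vspan:
  assumes "presents V Z N q" "B \<subseteq> Z"
  shows "vspan V (q ` B) = q ` pm.span (N \<union> B)"
proof -
  note P = presentsD[OF assms(1)]
  interpret V: vectorspace scalars V by (rule presents_vectorspace[OF assms(1)])
  have sZ: "pm.span (N \<union> B) \<subseteq> Z" using assms(2) P(1,3) by (intro pm.span_minimal) auto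
  have md: "submodule scalars (q ` pm.span (N \<union> B)) V"
  proof
    show "q ` pm.span (N \<union> B) \<subseteq> carrier V" using sZ P(4) by auto
    fix v w assume "v \<in> q ` pm.span (N \<union> B)" "w \<in> q ` pm.span (N \<union> B)"
    then show "v \<oplus>\<^bsub>V\<^esub> w \<in> q ` pm.span (N \<union> B)" using sZ P(6) pm.span_add by fastforce
  next
    show "\<zero>\<^bsub>V\<^esub> \<in> q ` pm.span (N \<union> B)" using P(8) pm.span_zero by auto
    fix c v assume "v \<in> q ` pm.span (N \<union> B)"
    then show "c \<odot>\<^bsub>V\<^esub> v \<in> q ` pm.span (N \<union> B)" using sZ P(7) pm.span_scale by fastforce
  qed
  have BC: "q ` B \<subseteq> carrier V" using assms(2) P(4) by auto
  have sub: "submodule scalars (vspan V (q ` B)) V" by (rule V.span_is_submodule[OF BC])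
  \<comment> \<open>By minimality of the span it is enough that this preimage is a subspace
    containing \<open>N\<close> and \<open>B\<close>.\<close>
  have "pm.span (N \<union> B) \<subseteq> {y \<in> Z. q y \<in> vspan V (q ` B)}"
  proof (rule pm.span_minimal, rule subsetI)
    fix x assume x: "x \<in> N \<union> B"
    show "x \<in> {y \<in> Z. q y \<in> vspan V (q ` B)}"
    proof (cases "x \<in> B")
      case True then show ?thesis using assms(2) V.in_own_span[OF BC] by auto
    next
      case False
      then have "q x = q 0" using x P(3) by (subst P(5)) (auto intro: pm.subspace_0[OF P(1)])
      then show ?thesis using False x P(3,8) submodule.zero_closed[OF sub] by auto
    qed
  next
    show "pm.subspace {y \<in> Z. q y \<in> vspan V (q ` B)}"
    proof (rule pm.subspaceI)
      show "0 \<in> {y \<in> Z. q y \<in> vspan V (q ` B)}"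
        using pm.subspace_0[OF P(1)] submodule.zero_closed[OF sub] P(8) by auto
      fix x y assume "x \<in> {y \<in> Z. q y \<in> vspan V (q ` B)}" "y \<in> {y \<in> Z. q y \<in> vspan V (q ` B)}"
      then have "x \<in> Z" "q x \<in> vspan V (q ` B)" "y \<in> Z" "q y \<in> vspan V (q ` B)" by auto
      then show "x + y \<in> {y \<in> Z. q y \<in> vspan V (q ` B)}"
        using pm.subspace_add[OF P(1)] submodule.m_closed[OF sub, of "q x" "q y"] P(6)[of x y] by auto
    next
      fix c x assume "x \<in> {y \<in> Z. q y \<in> vspan V (q ` B)}"
      then have "x \<in> Z" "q x \<in> vspan V (q ` B)" by auto
      then show "pscale c x \<in> {y \<in> Z. q y \<in> vspan V (q ` B)}"
        using pm.subspace_scale[OF P(1)] submodule.smult_closed[OF sub, of c "q x"] P(7)[of x c] by auto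
    qed
  qed
  moreover have "vspan V (q ` B) \<subseteq> q ` pm.span (N \<union> B)"
    by (rule V.span_is_subset[OF _ md]) (auto intro: pm.span_base)
  ultimately show ?thesis by auto
qed

section \<open>Isomorphisms of persistences\<close>

text \<open>An isomorphism of persistences in terms of representatives. Surjectivity and
  \<open>compat\<close> hold only modulo relations, as needed for maps that depend on choices made
  separately at each parameter.\<close>

lemma pers_isoI:
  assumes P: "\<And>r. 0 < r \<Longrightarrow> presents (pspace P r) (Z r) (N r) (q r)"
    and Q: "\<And>r. 0 < r \<Longrightarrow> presents (pspace Q r) (Z' r) (N' r) (q' r)"
    and lin: "\<And>r. 0 < r \<Longrightarrow> plinear (h r)"
    and into: "\<And>r x. 0 < r \<Longrightarrow> x \<in> Z r \<Longrightarrow> h r x \<in> Z' r"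
    and inj: "\<And>r x. 0 < r \<Longrightarrow> x \<in> Z r \<Longrightarrow> h r x \<in> N' r \<longleftrightarrow> x \<in> N r"
    and sur: "\<And>r y. 0 < r \<Longrightarrow> y \<in> Z' r \<Longrightarrow> \<exists>x\<in>Z r. y - h r x \<in> N' r"
    and bP: "\<And>r s x. 0 < r \<Longrightarrow> r < s \<Longrightarrow> x \<in> Z r \<Longrightarrow> x \<in> Z s \<and> pbond P r s (q r x) = q s x"
    and bQ: "\<And>r s x. 0 < r \<Longrightarrow> r < s \<Longrightarrow> x \<in> Z' r \<Longrightarrow> x \<in> Z' s \<and> pbond Q r s (q' r x) = q' s x"
    and compat: "\<And>r s x. 0 < r \<Longrightarrow> r < s \<Longrightarrow> x \<in> Z r \<Longrightarrow> h s x - h r x \<in> N' s"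
  shows "P \<cong>\<^sub>P Q"
proof -
  \<comment> \<open>The representative picked by \<open>SOME\<close> has no influence, since
    \<open>inj\<close> sends \<open>N r\<close> into \<open>N' r\<close>.\<close>
  define \<phi> where "\<phi> r v = q' r (h r (SOME x. x \<in> Z r \<and> q r x = v))" for r v
  have \<phi>: "\<phi> r (q r x) = q' r (h r x)" if r: "0 < r" and x: "x \<in> Z r" for r x
  proof -
    let ?y = "SOME y. y \<in> Z r \<and> q r y = q r x"
    have y: "?y \<in> Z r \<and> q r ?y = q r x" by (rule someI[of _ x]) (use x in auto)
    then have "?y - x \<in> N r" using presentsD(5)[OF P[OF r]] x by auto
    then have "h r (?y - x) \<in> N' r" using inj[OF r] presentsD(3)[OF P[OF r]] by blast
    then have "h r ?y - h r x \<in> N' r" by (simp add: pm.linear_diff[OF lin[OF r]])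
    then show ?thesis
      unfolding \<phi>_def using presentsD(5)[OF Q[OF r]] into[OF r] x y by auto
  qed
  show ?thesis
    unfolding pers_iso_def
  proof (intro exI[of _ \<phi>] conjI allI impI ballI)
    fix r :: real assume r: "0 < r"
    note PD = presentsD[OF P[OF r]] and QD = presentsD[OF Q[OF r]]
    show "\<phi> r \<in> LinearCombinations.module_hom scalars (pspace P r) (pspace Q r)"
      unfolding LinearCombinations.module_hom_def
    proof (clarsimp simp: PD(4), intro conjI)
      show "\<phi> r \<in> q r ` Z r \<rightarrow> carrier (pspace Q r)"
        using into[OF r] by (auto simp: QD(4) \<phi>[OF r])
      show "\<forall>m1 m2. m1 \<in> q r ` Z r \<and> m2 \<in> q r ` Z r \<longrightarrow>
          \<phi> r (m1 \<oplus>\<^bsub>pspace P r\<^esub> m2) = \<phi> r m1 \<oplus>\<^bsub>pspace Q r\<^esub> \<phi> r m2"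
        using into[OF r] pm.subspace_add[OF PD(1)]
        by (auto simp: PD(6) QD(6) \<phi>[OF r] pm.linear_add[OF lin[OF r]])
      show "\<forall>a m. m \<in> q r ` Z r \<longrightarrow> \<phi> r (a \<odot>\<^bsub>pspace P r\<^esub> m) = a \<odot>\<^bsub>pspace Q r\<^esub> \<phi> r m"
        using into[OF r] pm.subspace_scale[OF PD(1)]
        by (auto simp: PD(7) QD(7) \<phi>[OF r] pm.linear_scale[OF lin[OF r]])
    qed
    show "bij_betw (\<phi> r) (carrier (pspace P r)) (carrier (pspace Q r))"
      unfolding bij_betw_def PD(4) QD(4)
    proof
      show "inj_on (\<phi> r) (q r ` Z r)"
      proof (rule inj_onI, clarsimp)
        fix x y assume xy: "x \<in> Z r" "y \<in> Z r" "\<phi> r (q r x) = \<phi> r (q r y)"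
        then have "h r x - h r y \<in> N' r" using into[OF r] by (simp add: \<phi>[OF r] QD(5))
        then have "h r (x - y) \<in> N' r" by (simp add: pm.linear_diff[OF lin[OF r]])
        then show "q r x = q r y" using inj[OF r] xy pm.subspace_diff[OF PD(1)] by (simp add: PD(5))
      qed
      show "\<phi> r ` q r ` Z r = q' r ` Z' r"
      proof (intro equalityI subsetI; clarsimp)
        fix x assume "x \<in> Z r" then show "\<phi> r (q r x) \<in> q' r ` Z' r" using into[OF r] \<phi>[OF r] by auto
      next
        fix y assume y: "y \<in> Z' r"
        then obtain x where x: "x \<in> Z r" "y - h r x \<in> N' r" using sur[OF r] by blast
        then have "q' r y = \<phi> r (q r x)" using y into[OF r] by (simp add: \<phi>[OF r] QD(5))
        then show "q' r y \<in> \<phi> r ` q r ` Z r" using x by auto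
      qed
    qed
  next
    fix r s v assume rs: "0 < r \<and> r < s" and "v \<in> carrier (pspace P r)"
    then obtain x where x: "x \<in> Z r" "v = q r x" using presentsD(4)[OF P] by blast
    have s: "0 < s" using rs by simp
    have xs: "x \<in> Z s" "pbond P r s (q r x) = q s x" using bP x rs by auto
    have hs: "h r x \<in> Z' s" "pbond Q r s (q' r (h r x)) = q' s (h r x)"
      using bQ[of r s "h r x"] into x rs by auto
    have "q' s (h s x) = q' s (h r x)"
      using presentsD(5)[OF Q[OF s]] into[OF s xs(1)] hs(1) compat x rs by auto
    then show "\<phi> s (pbond P r s v) = pbond Q r s (\<phi> r v)"
      using x xs hs rs s by (simp add: \<phi>)
  qed
qed

lemma pers_iso_refl: "P \<cong>\<^sub>P P"
  unfolding pers_iso_def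
  by (rule exI[of _ "\<lambda>_ x. x"]) (auto simp: LinearCombinations.module_hom_def bij_betw_def)

lemma pers_iso_trans:
  assumes "P \<cong>\<^sub>P Q" "Q \<cong>\<^sub>P R"
  shows "P \<cong>\<^sub>P R"
proof -
  obtain \<phi> where \<phi>: "\<And>r. r > 0 \<Longrightarrow> \<phi> r \<in> LinearCombinations.module_hom scalars (pspace P r) (pspace Q r)"
      "\<And>r. r > 0 \<Longrightarrow> bij_betw (\<phi> r) (carrier (pspace P r)) (carrier (pspace Q r))"
      "\<And>p q x. 0 < p \<Longrightarrow> p < q \<Longrightarrow> x\<in>carrier (pspace P p) \<Longrightarrow> \<phi> q (pbond P p q x) = pbond Q p q (\<phi> p x)"
    using assms(1) unfolding pers_iso_def by metis
  obtain \<psi> where \<psi>: "\<And>r. r > 0 \<Longrightarrow> \<psi> r \<in> LinearCombinations.module_hom scalars (pspace Q r) (pspace R r)"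
      "\<And>r. r > 0 \<Longrightarrow> bij_betw (\<psi> r) (carrier (pspace Q r)) (carrier (pspace R r))"
      "\<And>p q x. 0 < p \<Longrightarrow> p < q \<Longrightarrow> x\<in>carrier (pspace Q p) \<Longrightarrow> \<psi> q (pbond Q p q x) = pbond R p q (\<psi> p x)"
    using assms(2) unfolding pers_iso_def by metis
  show ?thesis
    unfolding pers_iso_def
  proof (intro exI[of _ "\<lambda>r. \<psi> r \<circ> \<phi> r"] conjI allI impI ballI)
    fix r :: real assume r: "0 < r"
    show "\<psi> r \<circ> \<phi> r \<in> LinearCombinations.module_hom scalars (pspace P r) (pspace R r)"
      using \<phi>(1)[OF r] \<psi>(1)[OF r] unfolding LinearCombinations.module_hom_def by (auto simp: Pi_iff)
    show "bij_betw (\<psi> r \<circ> \<phi> r) (carrier (pspace P r)) (carrier (pspace R r))"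
      using \<phi>(2)[OF r] \<psi>(2)[OF r] bij_betw_trans by blast
  next
    fix p q x assume pq: "0 < p \<and> p < q" and x: "x \<in> carrier (pspace P p)"
    then have "\<phi> p x \<in> carrier (pspace Q p)" using \<phi>(1)[of p] unfolding LinearCombinations.module_hom_def by auto
    then show "(\<psi> q \<circ> \<phi> q) (pbond P p q x) = pbond R p q ((\<psi> p \<circ> \<phi> p) x)"
      using \<phi>(3)[of p q x] \<psi>(3)[of p q "\<phi> p x"] pq x by simp
  qed
qed

text \<open>The relation itself demands neither that sums stay in the carriers nor that bonding maps
  do; both are used to compute with the inverse maps, hence the assumptions on
  \<open>P\<close>.\<close>

lemma pers_iso_sym:
  assumes iso: "P \<cong>\<^sub>P Q"
    and vs: "\<And>r. 0 < r \<Longrightarrow> vectorspace scalars (pspace P r)"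
    and bond: "\<And>r s x. 0 < r \<Longrightarrow> r < s \<Longrightarrow> x \<in> carrier (pspace P r) \<Longrightarrow> pbond P r s x \<in> carrier (pspace P s)"
  shows "Q \<cong>\<^sub>P P"
proof -
  obtain \<phi> where hom: "\<And>r. r > 0 \<Longrightarrow> \<phi> r \<in> LinearCombinations.module_hom scalars (pspace P r) (pspace Q r)"
      and bij: "\<And>r. r > 0 \<Longrightarrow> bij_betw (\<phi> r) (carrier (pspace P r)) (carrier (pspace Q r))"
      and comm: "\<And>p q x. 0 < p \<Longrightarrow> p < q \<Longrightarrow> x\<in>carrier (pspace P p) \<Longrightarrow> \<phi> q (pbond P p q x) = pbond Q p q (\<phi> p x)"
    using iso unfolding pers_iso_def by metis
  define \<psi> where "\<psi> r = inv_into (carrier (pspace P r)) (\<phi> r)" for r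
  have \<psi>: "\<psi> r (\<phi> r x) = x" if "0 < r" "x \<in> carrier (pspace P r)" for r x
    unfolding \<psi>_def using bij[OF that(1)] that(2) by (simp add: bij_betw_def inv_into_f_f)
  have sur: "\<exists>x\<in>carrier (pspace P r). y = \<phi> r x" if "0 < r" "y \<in> carrier (pspace Q r)" for r y
    using bij[OF that(1)] that(2) by (auto simp: bij_betw_def)
  show ?thesis
    unfolding pers_iso_def
  proof (intro exI[of _ \<psi>] conjI allI impI ballI)
    fix r :: real assume r: "0 < r"
    interpret V: vectorspace scalars "pspace P r" by (rule vs[OF r])
    show "bij_betw (\<psi> r) (carrier (pspace Q r)) (carrier (pspace P r))"
      unfolding \<psi>_def by (rule bij_betw_inv_into[OF bij[OF r]])
    show "\<psi> r \<in> LinearCombinations.module_hom scalars (pspace Q r) (pspace P r)"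
      unfolding LinearCombinations.module_hom_def
    proof (intro CollectI conjI allI impI)
      show "\<psi> r \<in> carrier (pspace Q r) \<rightarrow> carrier (pspace P r)"
        using sur[OF r] \<psi>[OF r] by fastforce
    next
      fix u v assume "u \<in> carrier (pspace Q r) \<and> v \<in> carrier (pspace Q r)"
      then obtain x y where x: "x \<in> carrier (pspace P r)" "u = \<phi> r x" and y: "y \<in> carrier (pspace P r)" "v = \<phi> r y"
        using sur[OF r] by blast
      then have "u \<oplus>\<^bsub>pspace Q r\<^esub> v = \<phi> r (x \<oplus>\<^bsub>pspace P r\<^esub> y)"
        using module_hom_add[OF hom[OF r]] by auto
      then show "\<psi> r (u \<oplus>\<^bsub>pspace Q r\<^esub> v) = \<psi> r u \<oplus>\<^bsub>pspace P r\<^esub> \<psi> r v" using x y by (simp add: \<psi>[OF r])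
    next
      fix a :: 'a and u assume "a \<in> carrier scalars \<and> u \<in> carrier (pspace Q r)"
      then obtain x where x: "x \<in> carrier (pspace P r)" "u = \<phi> r x" using sur[OF r] by blast
      then have "a \<odot>\<^bsub>pspace Q r\<^esub> u = \<phi> r (a \<odot>\<^bsub>pspace P r\<^esub> x)"
        using module_hom_smult[OF hom[OF r], of a x] by auto
      then show "\<psi> r (a \<odot>\<^bsub>pspace Q r\<^esub> u) = a \<odot>\<^bsub>pspace P r\<^esub> \<psi> r u" using x by (simp add: \<psi>[OF r])
    qed
  next
    fix p q u assume pq: "0 < p \<and> p < q" and "u \<in> carrier (pspace Q p)"
    then obtain x where x: "x \<in> carrier (pspace P p)" "u = \<phi> p x" using sur[of p u] by blast
    have "\<psi> q (pbond Q p q u) = \<psi> q (\<phi> q (pbond P p q x))" using comm[of p q x] pq x by simp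
    also have "\<dots> = pbond P p q (\<psi> p u)" using \<psi> bond pq x by simp
    finally show "\<psi> q (pbond Q p q u) = pbond P p q (\<psi> p u)" .
  qed
qed

section \<open>First homology of a simplicial complex\<close>

lemma vspan_free_space:
  fixes B :: "('s \<Rightarrow>\<^sub>0 'f::field) set"
  assumes "B \<subseteq> free_chains S"
  shows "vspan (free_space S) B = pm.span B"
proof -
  have "pm.span (insert 0 B) = pm.span B" by (rule pm.span_insert_0)
  then show ?thesis using presents_vspan[OF presents_free_space assms] by simp
qed

definition face_closed :: "'a set set \<Rightarrow> bool" where
  "face_closed K \<longleftrightarrow> (\<forall>\<sigma>\<in>K. \<forall>\<tau>. \<tau> \<subseteq> \<sigma> \<longrightarrow> \<tau> \<noteq> {} \<longrightarrow> \<tau> \<in> K)"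

lemma face_closedD: "face_closed K \<Longrightarrow> \<sigma> \<in> K \<Longrightarrow> \<tau> \<subseteq> \<sigma> \<Longrightarrow> \<tau> \<noteq> {} \<Longrightarrow> \<tau> \<in> K"
  by (auto simp: face_closed_def)

definition swap_chains :: "'a set set \<Rightarrow> nat \<Rightarrow> ('a list \<Rightarrow>\<^sub>0 'f::field) set" where
  "swap_chains K p =
     {Poly_Mapping.single (us @ x # y # ws) 1 + Poly_Mapping.single (us @ y # x # ws) 1 | us x y ws.
        us @ x # y # ws \<in> ordered_simplices K p}"

lemma ordered_simplices_swap:
  "us @ x # y # ws \<in> ordered_simplices K p \<longleftrightarrow> us @ y # x # ws \<in> ordered_simplices K p"
  by (auto simp: ordered_simplices_def insert_commute)

lemma swap_chains_subset: "swap_chains K p \<subseteq> free_chains (ordered_simplices K p)"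
  unfolding swap_chains_def
  by (auto intro!: pm.subspace_add[OF subspace_chains] simp: ordered_simplices_swap)

lemma orientation_relations_eq: "orientation_relations K p = pm.span (swap_chains K p)"
  using vspan_free_space[OF swap_chains_subset] by (simp add: orientation_relations_def swap_chains_def)

lemma orientation_relations_subset:
  "orientation_relations K p \<subseteq> free_chains (ordered_simplices K p)"
  unfolding orientation_relations_eq by (rule pm.span_minimal[OF swap_chains_subset subspace_chains])

text \<open>A single vertex has no adjacent pair to exchange. Hence the boundary of a 1-chain
  vanishes modulo orientation only if it vanishes.\<close>

lemma orientation_relations_0: "orientation_relations K 0 = {0}"
proof -
  have "swap_chains K 0 = {}" by (auto simp: swap_chains_def ordered_simplices_def)
  then show ?thesis unfolding orientation_relations_eq by (metis pm.span_empty)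
qed

lemma subspace_orientation_relations [simp]: "pm.subspace (orientation_relations K p)"
  by (simp add: orientation_relations_eq)

definition oriented_class :: "'a set set \<Rightarrow> nat \<Rightarrow> ('a list \<Rightarrow>\<^sub>0 'f::field) \<Rightarrow> ('a list \<Rightarrow>\<^sub>0 'f) set" where
  "oriented_class K p z = orientation_relations K p +>\<^bsub>free_space (ordered_simplices K p)\<^esub> z"

lemma presents_oriented_chains:
  "presents (oriented_chains K p) (free_chains (ordered_simplices K p)) (orientation_relations K p)
     (oriented_class K p)"
  using presents_quotient[OF presents_free_space subspace_orientation_relations _ orientation_relations_subset]
  by (auto simp: oriented_chains_def oriented_class_def[abs_def] orientation_relations_subset
      pm.subspace_0[OF subspace_orientation_relations])

lemma mem_oriented_class:
  assumes "z \<in> free_chains (ordered_simplices K p)" "u \<in> oriented_class K p z"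
  shows "\<exists>a\<in>orientation_relations K p. u = a + z"
  using presents_coset_mem[OF presents_free_space orientation_relations_subset _ assms(1)] assms(2)
  by (auto simp: oriented_class_def)

lemma oriented_class_nonempty: "oriented_class K p z \<noteq> {}"
  unfolding oriented_class_def
  by (rule presents_coset_nonempty[of _ "\<lambda>x. x"])
    (auto intro: pm.subspace_0[OF subspace_orientation_relations])

text \<open>Stated for an arbitrary linear map of ordered chains, so as to cover both the boundary
  maps and the inclusions of complexes.\<close>

lemma coset_map_oriented_class:
  fixes f :: "('a list \<Rightarrow>\<^sub>0 'f::field) \<Rightarrow> ('a list \<Rightarrow>\<^sub>0 'f)"
  assumes "plinear f"
    and "\<And>s. s \<in> ordered_simplices K p \<Longrightarrow> f (Poly_Mapping.single s 1) \<in> free_chains (ordered_simplices L q)"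
    and "\<And>c. c \<in> swap_chains K p \<Longrightarrow> f c \<in> orientation_relations L q"
    and "z \<in> free_chains (ordered_simplices K p)"
  shows "coset_map (free_space (ordered_simplices L q)) (orientation_relations L q) f (oriented_class K p z)
    = oriented_class L q (f z)"
  unfolding oriented_class_def[of L]
proof (rule presents_coset_map)
  show "presents (quotient_space (free_space (ordered_simplices L q)) (orientation_relations L q))
     (free_chains (ordered_simplices L q)) (orientation_relations L q)
     (\<lambda>z. orientation_relations L q +>\<^bsub>free_space (ordered_simplices L q)\<^esub> z)"
    using presents_oriented_chains[of L q] by (simp add: oriented_chains_def oriented_class_def[abs_def])
  show "oriented_class K p z \<noteq> {}" by (rule oriented_class_nonempty)
  show fz: "f z \<in> free_chains (ordered_simplices L q)"
    by (rule linear_chains_into[OF assms(1) subspace_chains assms(2,4)])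
  fix u assume "u \<in> oriented_class K p z"
  then obtain a where a: "a \<in> orientation_relations K p" "u = a + z"
    using mem_oriented_class[OF assms(4)] by blast
  have "f ` pm.span (swap_chains K p) \<subseteq> orientation_relations L q"
    unfolding pm.linear_span_image[OF assms(1), symmetric]
    by (rule pm.span_minimal) (use assms(3) in auto)
  then have fa: "f a \<in> orientation_relations L q" using a(1) by (auto simp: orientation_relations_eq)
  show "\<exists>y\<in>free_chains (ordered_simplices L q). f u = y \<and> y - f z \<in> orientation_relations L q"
  proof (intro bexI[of _ "f u"] conjI)
    show "f u - f z \<in> orientation_relations L q" using fa by (simp add: a(2) pm.linear_add[OF assms(1)])
    show "f u \<in> free_chains (ordered_simplices L q)"
      using pm.subspace_add[OF subspace_chains subsetD[OF orientation_relations_subset fa] fz]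
      by (simp add: a(2) pm.linear_add[OF assms(1)])
  qed simp
qed

lemma ordered_bdry_linear: "plinear (ordered_bdry p)"
  unfolding ordered_bdry_def by (rule linear_linear_extension)

lemma ordered_bdry_1 [simp]:
  "ordered_bdry 1 (Poly_Mapping.single [x, y] (a::'f::field)) = Poly_Mapping.single [y] a - Poly_Mapping.single [x] a"
  by (simp add: ordered_bdry_def single_uminus pm.scale_right_diff_distrib)

lemma ordered_bdry_2 [simp]:
  "ordered_bdry 2 (Poly_Mapping.single [x, y, z] (a::'f::field)) =
     Poly_Mapping.single [y, z] a - Poly_Mapping.single [x, z] a + Poly_Mapping.single [x, y] a"
  by (simp add: ordered_bdry_def numeral_2_eq_2 single_uminus pm.scale_right_diff_distrib pm.scale_right_distrib)

lemma ordered_simplices_1: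
  "vs \<in> ordered_simplices K 1 \<longleftrightarrow> (\<exists>x y. vs = [x, y] \<and> x \<noteq> y \<and> {x, y} \<in> K)"
  by (auto simp: ordered_simplices_def length_Suc_conv)

lemma ordered_simplices_2:
  "vs \<in> ordered_simplices K 2 \<longleftrightarrow>
     (\<exists>x y z. vs = [x, y, z] \<and> x \<noteq> y \<and> y \<noteq> z \<and> x \<noteq> z \<and> {x, y, z} \<in> K)"
  by (auto simp: ordered_simplices_def length_Suc_conv numeral_2_eq_2)

lemma ordered_simplices_0: "vs \<in> ordered_simplices K 0 \<longleftrightarrow> (\<exists>x. vs = [x] \<and> {x} \<in> K)"
  by (auto simp: ordered_simplices_def length_Suc_conv)

lemma swap_chains_1I:
  "x \<noteq> y \<Longrightarrow> {x, y} \<in> K \<Longrightarrow> Poly_Mapping.single [x, y] 1 + Poly_Mapping.single [y, x] 1 \<in> swap_chains K 1"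
  unfolding swap_chains_def ordered_simplices_1 by (intro CollectI exI[of _ "[]"]) auto

lemma swap_chains_1E:
  assumes "c \<in> swap_chains K 1"
  obtains x y where "x \<noteq> y" "{x, y} \<in> K" "c = Poly_Mapping.single [x, y] 1 + Poly_Mapping.single [y, x] 1"
  using assms unfolding swap_chains_def ordered_simplices_1 by (auto simp: append_eq_Cons_conv Cons_eq_append_conv)

lemma swap_chains_2E:
  assumes "c \<in> swap_chains K 2"
  obtains x y z where "x \<noteq> y" "y \<noteq> z" "x \<noteq> z" "{x, y, z} \<in> K"
    "c = Poly_Mapping.single [x, y, z] 1 + Poly_Mapping.single [y, x, z] 1 \<or>
     c = Poly_Mapping.single [x, y, z] 1 + Poly_Mapping.single [x, z, y] 1"
  using assms unfolding swap_chains_def ordered_simplices_2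
  by (auto simp: append_eq_Cons_conv Cons_eq_append_conv)

text \<open>Of the six faces of two orderings of a triangle that differ by a swap, four cancel and
  the other two are the swapped edge in both directions. For edges everything cancels.\<close>

lemma ordered_bdry_swap:
  fixes c :: "'a list \<Rightarrow>\<^sub>0 'f::field"
  assumes K: "face_closed K"
  shows "c \<in> swap_chains K 1 \<Longrightarrow> ordered_bdry 1 c = 0"
    "c \<in> swap_chains K 2 \<Longrightarrow> ordered_bdry 2 c \<in> orientation_relations K 1"
proof -
  show "ordered_bdry 1 c = 0" if c: "c \<in> swap_chains K 1"
  proof -
    obtain x y where "c = Poly_Mapping.single [x, y] 1 + Poly_Mapping.single [y, x] 1"
      using swap_chains_1E[OF c] by metis
    then show ?thesis by (simp add: pm.linear_add[OF ordered_bdry_linear] del: One_nat_def)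
  qed
  assume "c \<in> swap_chains K 2"
  then show "ordered_bdry 2 c \<in> orientation_relations K 1"
  proof (rule swap_chains_2E)
    fix x y z assume d: "x \<noteq> y" "y \<noteq> z" "x \<noteq> z" "{x, y, z} \<in> K"
      and c: "c = Poly_Mapping.single [x, y, z] 1 + Poly_Mapping.single [y, x, z] 1 \<or>
       c = Poly_Mapping.single [x, y, z] 1 + Poly_Mapping.single [x, z, y] 1"
    have e: "{x, y} \<in> K" "{y, z} \<in> K" using d(4) face_closedD[OF K] by auto
    from c show "ordered_bdry 2 c \<in> orientation_relations K 1"
    proof
      assume "c = Poly_Mapping.single [x, y, z] 1 + Poly_Mapping.single [y, x, z] 1"
      then have "ordered_bdry 2 c = Poly_Mapping.single [x, y] 1 + Poly_Mapping.single [y, x] 1"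
        by (simp add: pm.linear_add[OF ordered_bdry_linear])
      then show ?thesis using d e
        by (auto simp: orientation_relations_eq simp del: One_nat_def intro!: pm.span_base swap_chains_1I)
    next
      assume "c = Poly_Mapping.single [x, y, z] 1 + Poly_Mapping.single [x, z, y] 1"
      then have "ordered_bdry 2 c = Poly_Mapping.single [y, z] 1 + Poly_Mapping.single [z, y] 1"
        by (simp add: pm.linear_add[OF ordered_bdry_linear])
      then show ?thesis using d e
        by (auto simp: orientation_relations_eq simp del: One_nat_def intro!: pm.span_base swap_chains_1I)
    qed
  qed
qed

lemma oriented_bdry_1:
  fixes z :: "'a list \<Rightarrow>\<^sub>0 'f::field"
  assumes "face_closed K" "z \<in> free_chains (ordered_simplices K 1)"
  shows "oriented_bdry K 1 (oriented_class K 1 z) = oriented_class K 0 (ordered_bdry 1 z)"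
proof -
  have "coset_map (free_space (ordered_simplices K 0)) (orientation_relations K 0) (ordered_bdry 1)
      (oriented_class K 1 z) = oriented_class K 0 (ordered_bdry 1 z)"
  proof (rule coset_map_oriented_class[OF ordered_bdry_linear _ _ assms(2)])
    fix s assume "s \<in> ordered_simplices K 1"
    then show "ordered_bdry 1 (Poly_Mapping.single s (1::'f)) \<in> free_chains (ordered_simplices K 0)"
      using face_closedD[OF assms(1)]
      by (auto simp: ordered_simplices_1 ordered_simplices_0 simp del: One_nat_def intro!: pm.subspace_diff[OF subspace_chains])
  qed (use ordered_bdry_swap(1)[OF assms(1)] in \<open>simp add: orientation_relations_0\<close>)
  then show ?thesis by (simp add: oriented_bdry_def)
qed

lemma ordered_bdry_2_in:
  fixes z :: "'a list \<Rightarrow>\<^sub>0 'f::field"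
  assumes "face_closed K" "z \<in> free_chains (ordered_simplices K 2)"
  shows "ordered_bdry 2 z \<in> free_chains (ordered_simplices K 1)" "ordered_bdry 1 (ordered_bdry 2 z) = 0"
proof -
  show "ordered_bdry 2 z \<in> free_chains (ordered_simplices K 1)"
  proof (rule linear_chains_into[OF ordered_bdry_linear subspace_chains _ assms(2)])
    fix s assume "s \<in> ordered_simplices K 2"
    then show "ordered_bdry 2 (Poly_Mapping.single s (1::'f)) \<in> free_chains (ordered_simplices K 1)"
      using face_closedD[OF assms(1)]
      by (auto simp: ordered_simplices_2 ordered_simplices_1 simp del: One_nat_def
          intro!: pm.subspace_diff[OF subspace_chains] pm.subspace_add[OF subspace_chains])
  qed
  have "ordered_bdry 1 (ordered_bdry 2 z) \<in> {0}"
    by (rule linear_chains_into[OF plinear_comp[OF ordered_bdry_linear ordered_bdry_linear] _ _ assms(2)])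
      (auto simp: ordered_simplices_2 pm.linear_add[OF ordered_bdry_linear] pm.linear_diff[OF ordered_bdry_linear]
        simp del: One_nat_def)
  then show "ordered_bdry 1 (ordered_bdry 2 z) = 0" by simp
qed

lemma oriented_bdry_2:
  fixes z :: "'a list \<Rightarrow>\<^sub>0 'f::field"
  assumes "face_closed K" "z \<in> free_chains (ordered_simplices K 2)"
  shows "oriented_bdry K 2 (oriented_class K 2 z) = oriented_class K 1 (ordered_bdry 2 z)"
proof -
  have "coset_map (free_space (ordered_simplices K 1)) (orientation_relations K 1) (ordered_bdry 2)
      (oriented_class K 2 z) = oriented_class K 1 (ordered_bdry 2 z)"
    by (rule coset_map_oriented_class[OF ordered_bdry_linear _ _ assms(2)])
      (simp_all add: ordered_bdry_2_in(1)[OF assms(1)] ordered_bdry_swap(2)[OF assms(1)] del: One_nat_def)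
  then show ?thesis by (simp add: oriented_bdry_def)
qed

definition simp_cycles :: "'a set set \<Rightarrow> ('a list \<Rightarrow>\<^sub>0 'f::field) set" where
  "simp_cycles K = {z \<in> free_chains (ordered_simplices K 1). ordered_bdry 1 z = 0}"

text \<open>The relations of both nested quotients at once: those of orientation and those of
  homology.\<close>

definition simp_bds :: "'a set set \<Rightarrow> ('a list \<Rightarrow>\<^sub>0 'f::field) set" where
  "simp_bds K = pm.span (swap_chains K 1 \<union> ordered_bdry 2 ` free_chains (ordered_simplices K 2))"

definition simp_class :: "'a set set \<Rightarrow> ('a list \<Rightarrow>\<^sub>0 'f::field) \<Rightarrow> ('a list \<Rightarrow>\<^sub>0 'f) set set" where
  "simp_class K z =
     boundaries (oriented_chains K) (oriented_bdry K) 1 +>\<^bsub>oriented_chains K 1\<^esub> oriented_class K 1 z"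

lemma subspace_simp_cycles: "pm.subspace (simp_cycles K)"
  unfolding simp_cycles_def
  by (rule pm.subspaceI)
    (auto simp: pm.linear_0[OF ordered_bdry_linear] pm.linear_add[OF ordered_bdry_linear]
      pm.linear_scale[OF ordered_bdry_linear] pm.subspace_0 pm.subspace_add pm.subspace_scale)

lemma simp_bds_subset:
  assumes "face_closed K"
  shows "simp_bds K \<subseteq> simp_cycles K"
  unfolding simp_bds_def
proof (rule pm.span_minimal[OF _ subspace_simp_cycles])
  show "swap_chains K 1 \<union> ordered_bdry 2 ` free_chains (ordered_simplices K 2) \<subseteq> simp_cycles K"
    using swap_chains_subset[of K 1] ordered_bdry_swap(1)[OF assms] ordered_bdry_2_in[OF assms]
    by (auto simp: simp_cycles_def simp del: One_nat_def)
qed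

lemma a_r_coset_carrier_update [simp]: "A +>\<^bsub>V\<lparr>carrier := C\<rparr>\<^esub> v = A +>\<^bsub>V\<^esub> v"
  by (simp add: a_r_coset_def')

text \<open>Since vertices carry no orientation relations, a chain is a cycle modulo orientation
  exactly if its ordered representative is one.\<close>

lemma cycles_oriented:
  assumes "face_closed K"
  shows "cycles (oriented_chains K) (oriented_bdry K) 1 = oriented_class K 1 ` simp_cycles K"
proof -
  note P = presentsD[OF presents_oriented_chains]
  have "oriented_bdry K 1 (oriented_class K 1 z) = \<zero>\<^bsub>oriented_chains K 0\<^esub> \<longleftrightarrow> ordered_bdry 1 z = 0"
    if z: "z \<in> free_chains (ordered_simplices K 1)" for z :: "'a list \<Rightarrow>\<^sub>0 'b"
  proof -
    have "ordered_bdry 1 z \<in> free_chains (ordered_simplices K 0)"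
    proof (rule linear_chains_into[OF ordered_bdry_linear subspace_chains _ z])
      fix s assume "s \<in> ordered_simplices K 1"
      then show "ordered_bdry 1 (Poly_Mapping.single s (1::'b)) \<in> free_chains (ordered_simplices K 0)"
        using face_closedD[OF assms(1)]
        by (auto simp: ordered_simplices_1 ordered_simplices_0 simp del: One_nat_def intro!: pm.subspace_diff[OF subspace_chains])
    qed
    then show ?thesis
      using P(5)[of "ordered_bdry 1 z" K 0 0] pm.subspace_0[OF subspace_chains[of "ordered_simplices K 0"]]
      by (simp add: oriented_bdry_1[OF assms z] P(8) orientation_relations_0 del: One_nat_def)
  qed
  then show ?thesis
    by (auto simp: cycles_def P(4) simp_cycles_def simp del: One_nat_def)
qed

text \<open>The orientation relations inside \<open>simp_bds\<close> have trivial oriented class, so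
  the surplus over boundaries of 2-chains adds no new classes.\<close>

lemma boundaries_oriented:
  assumes "face_closed K"
  shows "boundaries (oriented_chains K) (oriented_bdry K) 1 =
    oriented_class K 1 ` (simp_bds K :: ('a list \<Rightarrow>\<^sub>0 'f::field) set)"
proof -
  note P = presentsD[OF presents_oriented_chains]
  have "boundaries (oriented_chains K) (oriented_bdry K) 1 =
      (\<lambda>z::'a list \<Rightarrow>\<^sub>0 'f. oriented_class K 1 (ordered_bdry 2 z)) ` free_chains (ordered_simplices K 2)"
    using oriented_bdry_2[OF assms] by (auto simp: boundaries_def P(4) image_image Suc_1 simp flip: One_nat_def)
  also have "\<dots> = oriented_class K 1 ` (simp_bds K :: ('a list \<Rightarrow>\<^sub>0 'f) set)"
  proof (rule equalityI; rule image_subsetI)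
    fix z :: "'a list \<Rightarrow>\<^sub>0 'f" assume "z \<in> free_chains (ordered_simplices K 2)"
    then show "oriented_class K 1 (ordered_bdry 2 z) \<in> oriented_class K 1 ` simp_bds K"
      by (auto simp: simp_bds_def intro!: imageI pm.span_base)
  next
    fix c :: "'a list \<Rightarrow>\<^sub>0 'f" assume c: "c \<in> simp_bds K"
    have sp: "pm.subspace (ordered_bdry 2 ` free_chains (ordered_simplices K 2) :: ('a list \<Rightarrow>\<^sub>0 'f) set)"
      by (rule pm.linear_subspace_image[OF ordered_bdry_linear subspace_chains])
    obtain a z where az: "c = a + ordered_bdry 2 z" "a \<in> orientation_relations K 1"
        "z \<in> free_chains (ordered_simplices K 2)"
      using c unfolding simp_bds_def pm.span_Un orientation_relations_eq
      by (auto simp: pm.span_eq_iff[THEN iffD2, OF sp])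
    have b: "ordered_bdry 2 z \<in> free_chains (ordered_simplices K 1)" using ordered_bdry_2_in[OF assms az(3)] by simp
    have "oriented_class K 1 c = oriented_class K 1 (ordered_bdry 2 z)"
      using az b orientation_relations_subset[of K 1] pm.subspace_add[OF subspace_chains _ b, of a]
      by (subst P(5)) (auto simp del: One_nat_def)
    then show "oriented_class K 1 c \<in> (\<lambda>z. oriented_class K 1 (ordered_bdry 2 z)) ` free_chains (ordered_simplices K 2)"
      using az(3) by blast
  qed
  finally show ?thesis .
qed

lemma presents_simplicial_H1:
  assumes "face_closed K"
  shows "presents (simplicial_H1 K) (simp_cycles K) (simp_bds K) (simp_class K)"
proof -
  have s: "orientation_relations K 1 \<subseteq> simp_bds K"
    unfolding simp_bds_def orientation_relations_eq by (rule pm.span_mono) auto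
  have "presents ((oriented_chains K 1)\<lparr>carrier := cycles (oriented_chains K) (oriented_bdry K) 1\<rparr>)
      (simp_cycles K) (orientation_relations K 1) (oriented_class K 1)"
    unfolding cycles_oriented[OF assms]
    by (rule presents_restrict[OF presents_oriented_chains subspace_simp_cycles])
      (use s simp_bds_subset[OF assms] in \<open>auto simp: simp_cycles_def\<close>)
  from presents_quotient[OF this _ s simp_bds_subset[OF assms] boundaries_oriented[OF assms]]
  show ?thesis by (simp add: simplicial_H1_def homology_def simp_class_def[abs_def] simp_bds_def del: One_nat_def)
qed

text \<open>\<open>inclusion_H1\<close> forms its cosets in the space of all oriented 1-chains and
  not in that of the cycles, so this larger quotient has to be presented as well.\<close>

lemma presents_simplicial_chains:
  assumes "face_closed K"
  shows "presents (quotient_space (oriented_chains K 1) (boundaries (oriented_chains K) (oriented_bdry K) 1))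
    (free_chains (ordered_simplices K 1)) (simp_bds K) (simp_class K)"
proof -
  have s: "orientation_relations K 1 \<subseteq> simp_bds K"
    unfolding simp_bds_def orientation_relations_eq by (rule pm.span_mono) auto
  show ?thesis
    unfolding simp_class_def[abs_def]
    by (rule presents_quotient[OF presents_oriented_chains _ s _ boundaries_oriented[OF assms]])
      (use simp_bds_subset[OF assms] in \<open>auto simp: simp_cycles_def simp_bds_def\<close>)
qed

lemma simp_bds_mono:
  assumes "K \<subseteq> L"
  shows "simp_bds K \<subseteq> simp_bds L"
proof -
  have o: "ordered_simplices K p \<subseteq> ordered_simplices L p" for p
    using assms by (auto simp: ordered_simplices_def)
  show ?thesis
    unfolding simp_bds_def
  proof (rule pm.span_mono, rule Un_mono)
    show "swap_chains K 1 \<subseteq> swap_chains L 1" using o[of 1] unfolding swap_chains_def by blast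
    show "ordered_bdry 2 ` free_chains (ordered_simplices K 2) \<subseteq> ordered_bdry 2 ` free_chains (ordered_simplices L 2)"
      using o[of 2] by (auto simp: free_chains_def)
  qed
qed

lemma simp_cycles_mono: "K \<subseteq> L \<Longrightarrow> simp_cycles K \<subseteq> simp_cycles L"
  by (fastforce simp: simp_cycles_def free_chains_def ordered_simplices_def)

text \<open>On representatives the induced map is the identity. Relations of \<open>K\<close> are
  relations of \<open>L\<close>, so every element of the class of \<open>z\<close> leads to the same
  result.\<close>

lemma inclusion_H1_simp_class:
  assumes K: "face_closed K" and L: "face_closed L" and KL: "K \<subseteq> L" and z: "z \<in> simp_cycles K"
  shows "inclusion_H1 L (simp_class K z) = simp_class L z"
proof -
  have o: "ordered_simplices K p \<subseteq> ordered_simplices L p" for p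
    using KL by (auto simp: ordered_simplices_def)
  have zK: "z \<in> free_chains (ordered_simplices K 1)" and zL: "z \<in> free_chains (ordered_simplices L 1)"
    using z simp_cycles_mono[OF KL] by (auto simp: simp_cycles_def)
  show ?thesis
    unfolding inclusion_H1_def simp_class_def[of L]
  proof (rule presents_coset_map)
    show "presents (quotient_space (oriented_chains L 1) (boundaries (oriented_chains L) (oriented_bdry L) 1))
      (free_chains (ordered_simplices L 1)) (simp_bds L)
      (\<lambda>z. boundaries (oriented_chains L) (oriented_bdry L) 1 +>\<^bsub>oriented_chains L 1\<^esub> oriented_class L 1 z)"
      using presents_simplicial_chains[OF L] by (simp add: simp_class_def[abs_def])
    show "simp_class K z \<noteq> {}"
      unfolding simp_class_def
      by (rule presents_coset_nonempty[OF boundaries_oriented[OF K]]) (simp add: simp_bds_def pm.span_zero)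
    show "z \<in> free_chains (ordered_simplices L 1)" by (rule zL)
    fix u assume "u \<in> simp_class K z"
    then obtain m where m: "m \<in> simp_bds K" "u = oriented_class K 1 (m + z)"
      using presents_coset_mem[OF presents_oriented_chains _ boundaries_oriented[OF K] zK, of u] simp_bds_subset[OF K]
      by (auto simp: simp_class_def simp_cycles_def)
    have mz: "m + z \<in> free_chains (ordered_simplices K 1)"
      using m simp_bds_subset[OF K] zK by (auto simp: simp_cycles_def intro!: pm.subspace_add[OF subspace_chains])
    have "coset_map (free_space (ordered_simplices L 1)) (orientation_relations L 1) (\<lambda>c. c) u
        = oriented_class L 1 (m + z)"
      unfolding m(2)
    proof (rule coset_map_oriented_class[OF plinear_id _ _ mz])
      fix c :: "'a list \<Rightarrow>\<^sub>0 'b" assume "c \<in> swap_chains K 1"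
      then show "c \<in> orientation_relations L 1"
        using o[of 1] unfolding orientation_relations_eq swap_chains_def
        by (intro pm.span_base) blast
    qed (use o[of 1] in \<open>auto\<close>)
    moreover have "m + z \<in> free_chains (ordered_simplices L 1)" using mz o[of 1] by (auto simp: free_chains_def)
    ultimately show "\<exists>y\<in>free_chains (ordered_simplices L 1).
        coset_map (free_space (ordered_simplices L 1)) (orientation_relations L 1) (\<lambda>c. c) u = oriented_class L 1 y
        \<and> y - z \<in> simp_bds L"
      using m(1) simp_bds_mono[OF KL] by (intro bexI[of _ "m + z"]) auto
  qed
qed

section \<open>First singular homology\<close>

definition path_simplex :: "(real \<Rightarrow> 'a) \<Rightarrow> (nat \<Rightarrow> real) \<Rightarrow> 'a" where
  "path_simplex f = restrict (\<lambda>x. f (x 1)) (standard_simplex 1)"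

text \<open>Barycentric coordinates for the first three vertices. Points of the 1-simplex are the
  case \<open>c = 0\<close>, so that simplices of dimensions 1 and 2 share one notation.\<close>

definition bary :: "real \<Rightarrow> real \<Rightarrow> real \<Rightarrow> nat \<Rightarrow> real" where
  "bary a b c i = (if i = 0 then a else if i = 1 then b else if i = 2 then c else 0)"

definition path_chain :: "(real \<Rightarrow> 'a) \<Rightarrow> ((nat \<Rightarrow> real) \<Rightarrow> 'a) \<Rightarrow>\<^sub>0 'f::field" where
  "path_chain f = Poly_Mapping.single (path_simplex f) 1"

definition point_simplex :: "'a \<Rightarrow> (nat \<Rightarrow> real) \<Rightarrow> 'a" where
  "point_simplex x = restrict (\<lambda>_. x) (standard_simplex 0)"

lemma standard_simplex_1: "x \<in> standard_simplex 1 \<longleftrightarrow> (\<exists>t\<in>{0..1}. x = bary (1 - t) t 0)"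
proof
  assume x: "x \<in> standard_simplex 1"
  then have "x 0 + x 1 = 1" "\<forall>i>1. x i = 0" "0 \<le> x 1" "x 1 \<le> 1" by (auto simp: standard_simplex_def)
  then have "x = bary (1 - x 1) (x 1) 0" by (auto simp: bary_def fun_eq_iff)
  then show "\<exists>t\<in>{0..1}. x = bary (1 - t) t 0" using \<open>0 \<le> x 1\<close> \<open>x 1 \<le> 1\<close> by auto
qed (auto simp: standard_simplex_def bary_def)

lemma standard_simplex_2:
  "x \<in> standard_simplex 2 \<longleftrightarrow> (\<exists>a b c. 0 \<le> a \<and> 0 \<le> b \<and> 0 \<le> c \<and> a + b + c = 1 \<and> x = bary a b c)"
proof
  assume x: "x \<in> standard_simplex 2"
  then have "x 0 + x 1 + x 2 = 1" "\<forall>i>2. x i = 0" "0 \<le> x 0" "0 \<le> x 1" "0 \<le> x 2"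
    by (auto simp: standard_simplex_def numeral_2_eq_2)
  moreover from this have "x = bary (x 0) (x 1) (x 2)" by (auto simp: bary_def fun_eq_iff)
  ultimately show "\<exists>a b c. 0 \<le> a \<and> 0 \<le> b \<and> 0 \<le> c \<and> a + b + c = 1 \<and> x = bary a b c" by blast
next
  assume "\<exists>a b c. 0 \<le> a \<and> 0 \<le> b \<and> 0 \<le> c \<and> a + b + c = 1 \<and> x = bary a b c"
  then show "x \<in> standard_simplex 2"
    by (auto simp: standard_simplex_def bary_def numeral_2_eq_2)
qed

lemma bary_in_simplex:
  "t \<in> {0..1} \<Longrightarrow> bary (1 - t) t 0 \<in> standard_simplex 1"
  "0 \<le> a \<Longrightarrow> 0 \<le> b \<Longrightarrow> 0 \<le> c \<Longrightarrow> a + b + c = 1 \<Longrightarrow> bary a b c \<in> standard_simplex 2"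
  by (auto simp: standard_simplex_1 standard_simplex_2 simp del: One_nat_def)

lemma bary_simps [simp]: "bary a b c 0 = a" "bary a b c (Suc 0) = b" "bary a b c 2 = c"
  by (auto simp: bary_def)

lemma path_simplex_cong: "(\<And>t. t \<in> {0..1} \<Longrightarrow> f t = h t) \<Longrightarrow> path_simplex f = path_simplex h"
  unfolding path_simplex_def
  by (rule restrict_ext) (auto simp: standard_simplex_1 simp del: One_nat_def, simp)

lemma path_simplex_bary [simp]: "t \<in> {0..1} \<Longrightarrow> path_simplex f (bary (1 - t) t 0) = f t"
  unfolding path_simplex_def
  by (subst restrict_apply') (auto simp: standard_simplex_1 simp del: One_nat_def, simp)

lemma continuous_map_coordinate:
  "continuous_map (subtopology (powertop_real UNIV) S) euclideanreal (\<lambda>x. x i)"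
  by (rule continuous_map_from_subtopology)
    (use continuous_map_product_projection[of i UNIV "\<lambda>_. euclideanreal"] in simp)

lemma singular_simplex_path_simplex:
  assumes "pathin X f"
  shows "singular_simplex 1 X (path_simplex f)"
proof -
  have "continuous_map (subtopology (powertop_real UNIV) (standard_simplex 1)) (top_of_set {0..1}) (\<lambda>x. x 1)"
    by (auto simp: continuous_map_in_subtopology continuous_map_coordinate standard_simplex_1 simp del: One_nat_def) simp_all
  from continuous_map_compose[OF this assms[unfolded pathin_def]]
  have "continuous_map (subtopology (powertop_real UNIV) (standard_simplex 1)) X (path_simplex f)"
    by (rule continuous_map_eq) (auto simp: path_simplex_def)
  then show ?thesis by (simp add: singular_simplex_def path_simplex_def)
qed

lemma continuous_map_bary:
  assumes "continuous_map T euclideanreal a" "continuous_map T euclideanreal b" "continuous_map T euclideanreal c"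
  shows "continuous_map T (powertop_real UNIV) (\<lambda>x. bary (a x) (b x) (c x))"
  unfolding continuous_map_componentwise_UNIV
proof
  fix k :: nat
  show "continuous_map T euclideanreal (\<lambda>x. bary (a x) (b x) (c x) k)"
    using assms by (cases "k = 0"; cases "k = 1"; cases "k = 2") (auto simp: bary_def)
qed

text \<open>Singular simplices are extensional, hence recovered exactly from the path along their
  edge; 1-chains may be treated as chains of paths.\<close>

lemma path_of_simplex:
  assumes "singular_simplex 1 X s"
  shows "pathin X (\<lambda>t. s (bary (1 - t) t 0))" "path_simplex (\<lambda>t. s (bary (1 - t) t 0)) = s"
proof -
  have c: "continuous_map (top_of_set {0..1::real}) (subtopology (powertop_real UNIV) (standard_simplex 1))
      (\<lambda>t. bary (1 - t) t 0)"
    unfolding continuous_map_in_subtopology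
    by (auto simp: bary_in_simplex simp del: One_nat_def intro!: continuous_map_bary continuous_intros)
  show "pathin X (\<lambda>t. s (bary (1 - t) t 0))"
    using continuous_map_compose[OF c] assms by (auto simp: singular_simplex_def pathin_def o_def)
  have "s \<in> extensional (standard_simplex 1)" using assms by (simp add: singular_simplex_def)
  then show "path_simplex (\<lambda>t. s (bary (1 - t) t 0)) = s"
    unfolding path_simplex_def
    by (intro extensionalityI[of _ "standard_simplex 1"]) (auto simp: standard_simplex_1 simp del: One_nat_def, simp)
qed

lemma singular_faces_1:
  "singular_face 1 0 (path_simplex f) = point_simplex (f 1)"
  "singular_face 1 1 (path_simplex f) = point_simplex (f 0)"
proof -
  have z: "x \<in> standard_simplex 0 \<Longrightarrow> simplical_face 0 x = bary (1 - 1) 1 0"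
       "x \<in> standard_simplex 0 \<Longrightarrow> simplical_face 1 x = bary (1 - 0) 0 0" for x :: "nat \<Rightarrow> real"
    by (auto simp: standard_simplex_0 simplical_face_def bary_def fun_eq_iff)
  show "singular_face 1 0 (path_simplex f) = point_simplex (f 1)"
       "singular_face 1 1 (path_simplex f) = point_simplex (f 0)"
    unfolding singular_face_def point_simplex_def
    by (auto intro!: restrict_ext simp: z simp del: One_nat_def) (use path_simplex_bary[of 1 f] path_simplex_bary[of 0 f] in simp_all)
qed

lemma singular_faces_2:
  "singular_face 2 0 s = path_simplex (\<lambda>t. s (bary 0 (1 - t) t))"
  "singular_face 2 1 s = path_simplex (\<lambda>t. s (bary (1 - t) 0 t))"
  "singular_face 2 2 s = path_simplex (\<lambda>t. s (bary (1 - t) t 0))"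
proof -
  have z: "simplical_face 0 (bary (1 - t) t 0) = bary 0 (1 - t) t"
       "simplical_face 1 (bary (1 - t) t 0) = bary (1 - t) 0 t"
       "simplical_face 2 (bary (1 - t) t 0) = bary (1 - t) t 0" for t
    by (auto simp: simplical_face_def bary_def fun_eq_iff)
  have z2: "2 - Suc 0 = 1" by simp
  show "singular_face 2 0 s = path_simplex (\<lambda>t. s (bary 0 (1 - t) t))"
    "singular_face 2 1 s = path_simplex (\<lambda>t. s (bary (1 - t) 0 t))"
    "singular_face 2 2 s = path_simplex (\<lambda>t. s (bary (1 - t) t 0))"
    unfolding singular_face_def path_simplex_def z2
    by (auto intro!: restrict_ext simp: standard_simplex_1 z simp del: One_nat_def) simp_all
qed

lemma singular_bdry_linear: "plinear (singular_bdry p)"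
  unfolding singular_bdry_def by (rule linear_linear_extension)

lemma singular_bdry_1:
  "singular_bdry 1 (Poly_Mapping.single (path_simplex f) (a::'f::field)) =
     Poly_Mapping.single (point_simplex (f 1)) a - Poly_Mapping.single (point_simplex (f 0)) a"
  by (simp add: singular_bdry_def singular_faces_1[simplified] single_uminus pm.scale_right_diff_distrib)

lemma singular_bdry_path_chain:
  "singular_bdry 1 (path_chain f :: _ \<Rightarrow>\<^sub>0 'f::field) =
     Poly_Mapping.single (point_simplex (f 1)) 1 - Poly_Mapping.single (point_simplex (f 0)) 1"
  by (simp add: path_chain_def singular_bdry_1 del: One_nat_def)

lemma singular_bdry_2:
  "singular_bdry 2 (Poly_Mapping.single s (1::'f::field)) =
     path_chain (\<lambda>t. s (bary 0 (1 - t) t)) - path_chain (\<lambda>t. s (bary (1 - t) 0 t))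
     + path_chain (\<lambda>t. s (bary (1 - t) t 0))"
proof -
  have "{..2::nat} = {0, 1, 2}" by auto
  then show ?thesis
    by (simp add: singular_bdry_def singular_faces_2[simplified] path_chain_def single_uminus
        pm.scale_right_diff_distrib pm.scale_right_distrib)
qed

definition sing_cycles :: "'a topology \<Rightarrow> (((nat \<Rightarrow> real) \<Rightarrow> 'a) \<Rightarrow>\<^sub>0 'f::field) set" where
  "sing_cycles X = {z \<in> free_chains (singular_simplex_set 1 X). singular_bdry 1 z = 0}"

definition sing_bds :: "'a topology \<Rightarrow> (((nat \<Rightarrow> real) \<Rightarrow> 'a) \<Rightarrow>\<^sub>0 'f::field) set" where
  "sing_bds X = singular_bdry 2 ` free_chains (singular_simplex_set 2 X)"

definition sing_class ::
    "'a topology \<Rightarrow> (((nat \<Rightarrow> real) \<Rightarrow> 'a) \<Rightarrow>\<^sub>0 'f::field) \<Rightarrow> (((nat \<Rightarrow> real) \<Rightarrow> 'a) \<Rightarrow>\<^sub>0 'f) set" where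
  "sing_class X z = sing_bds X +>\<^bsub>singular_chains X 1\<^esub> z"

lemma subspace_sing_cycles: "pm.subspace (sing_cycles X)"
  unfolding sing_cycles_def
  by (rule pm.subspaceI)
    (auto simp: pm.linear_0[OF singular_bdry_linear] pm.linear_add[OF singular_bdry_linear]
      pm.linear_scale[OF singular_bdry_linear] pm.subspace_0 pm.subspace_add pm.subspace_scale)

lemma subspace_sing_bds: "pm.subspace (sing_bds X)"
  unfolding sing_bds_def by (rule pm.linear_subspace_image[OF singular_bdry_linear subspace_chains])

lemma pathin_edge_of_simplex:
  assumes "singular_simplex 2 X s"
    and "continuous_on {0..1} a" "continuous_on {0..1} b" "continuous_on {0..1} c"
    and "\<And>t. t \<in> {0..1} \<Longrightarrow> 0 \<le> a t \<and> 0 \<le> b t \<and> 0 \<le> c t \<and> a t + b t + c t = 1"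
  shows "pathin X (\<lambda>t. s (bary (a t) (b t) (c t)))"
proof -
  have c: "continuous_map (top_of_set {0..1::real}) (subtopology (powertop_real UNIV) (standard_simplex 2))
      (\<lambda>t. bary (a t) (b t) (c t))"
    using assms(2-5) unfolding continuous_map_in_subtopology
    by (auto intro!: bary_in_simplex continuous_map_bary)
  show ?thesis
    using continuous_map_compose[OF c] assms(1) by (auto simp: singular_simplex_def pathin_def o_def)
qed

lemma sing_bds_subset: "sing_bds X \<subseteq> (sing_cycles X :: (((nat \<Rightarrow> real) \<Rightarrow> 'a) \<Rightarrow>\<^sub>0 'f::field) set)"
  unfolding sing_bds_def
proof (rule image_subsetI)
  fix c :: "((nat \<Rightarrow> real) \<Rightarrow> 'a) \<Rightarrow>\<^sub>0 'f" assume c: "c \<in> free_chains (singular_simplex_set 2 X)"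
  show "singular_bdry 2 c \<in> sing_cycles X"
  proof (rule linear_chains_into[OF singular_bdry_linear subspace_sing_cycles _ c])
    fix s assume "s \<in> singular_simplex_set 2 X"
    then have s: "singular_simplex 2 X s" by simp
    have "pathin X (\<lambda>t. s (bary 0 (1 - t) t))" "pathin X (\<lambda>t. s (bary (1 - t) 0 t))" "pathin X (\<lambda>t. s (bary (1 - t) t 0))"
      by (rule pathin_edge_of_simplex[OF s]; auto intro!: continuous_intros)+
    then show "singular_bdry 2 (Poly_Mapping.single s (1::'f)) \<in> sing_cycles X"
      unfolding sing_cycles_def singular_bdry_2
      by (auto simp: pm.linear_add[OF singular_bdry_linear] pm.linear_diff[OF singular_bdry_linear]
          singular_bdry_path_chain path_chain_def singular_simplex_path_simplex simp del: One_nat_def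
          intro!: pm.subspace_add[OF subspace_chains] pm.subspace_diff[OF subspace_chains])
         (simp_all add: singular_bdry_1[simplified])
  qed
qed

lemma presents_singular_H1: "presents (singular_H1 X) (sing_cycles X) (sing_bds X) (sing_class X)"
proof -
  have cy: "cycles (singular_chains X) singular_bdry 1 = (sing_cycles X :: (_ \<Rightarrow>\<^sub>0 'b) set)"
    by (auto simp: cycles_def singular_chains_def free_space_def sing_cycles_def free_chains_def simp del: One_nat_def)
  have bo: "boundaries (singular_chains X) singular_bdry 1 = (sing_bds X :: (_ \<Rightarrow>\<^sub>0 'b) set)"
    by (auto simp: boundaries_def singular_chains_def free_space_def sing_bds_def free_chains_def Suc_1 simp flip: One_nat_def)
  have "presents ((singular_chains X 1)\<lparr>carrier := (\<lambda>c. c) ` sing_cycles X\<rparr>) (sing_cycles X) {0} (\<lambda>c. c)"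
    unfolding singular_chains_def
    by (rule presents_restrict[OF presents_free_space subspace_sing_cycles])
      (use pm.subspace_0[OF subspace_sing_cycles] in auto, auto simp: sing_cycles_def)
  from presents_quotient[OF this subspace_sing_bds _ sing_bds_subset, of "sing_bds X"]
  show ?thesis
    using pm.subspace_0[OF subspace_sing_bds[of X]]
    by (simp add: singular_H1_def homology_def cy bo sing_class_def[abs_def] del: One_nat_def)
qed

lemma loop_class_eq: "loop_class X f = sing_class X (path_chain f)"
proof -
  have bo: "boundaries (singular_chains X) singular_bdry 1 = (sing_bds X :: (_ \<Rightarrow>\<^sub>0 'b) set)"
    by (auto simp: boundaries_def singular_chains_def free_space_def sing_bds_def free_chains_def Suc_1 simp flip: One_nat_def)
  show ?thesis by (simp add: loop_class_def sing_class_def bo path_chain_def path_simplex_def del: One_nat_def)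
qed

lemma path_chain_in_chains: "pathin X f \<Longrightarrow> path_chain f \<in> free_chains (singular_simplex_set 1 X)"
  unfolding path_chain_def by (rule single_in_chains) (simp add: singular_simplex_path_simplex del: One_nat_def)

lemma path_chain_loop: "is_loop X f \<Longrightarrow> path_chain f \<in> sing_cycles X"
  by (auto simp: is_loop_def sing_cycles_def path_chain_in_chains singular_bdry_path_chain simp del: One_nat_def)

subsection \<open>Relations between paths modulo boundaries\<close>

text \<open>The source of all homologies between paths below: each of them is a map of the standard
  triangle whose edges are recognized.\<close>

lemma sing_bds_triangle:
  assumes "\<And>t. continuous_map (subtopology (powertop_real UNIV) (standard_simplex 2)) X h"
  shows "path_chain (\<lambda>t. h (bary 0 (1 - t) t)) - path_chain (\<lambda>t. h (bary (1 - t) 0 t))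
     + path_chain (\<lambda>t. h (bary (1 - t) t 0)) \<in> (sing_bds X :: (_ \<Rightarrow>\<^sub>0 'f::field) set)"
proof -
  let ?s = "restrict h (standard_simplex 2)"
  have "singular_simplex 2 X ?s"
    unfolding singular_simplex_def using assms by (auto intro: continuous_map_eq)
  then have "singular_bdry 2 (Poly_Mapping.single ?s (1::'f)) \<in> sing_bds X"
    by (auto simp: sing_bds_def)
  moreover have "path_chain (\<lambda>t. ?s (bary (a t) (b t) (c t))) = (path_chain (\<lambda>t. h (bary (a t) (b t) (c t))) :: _ \<Rightarrow>\<^sub>0 'f)"
    if "\<And>t. t \<in> {0..1} \<Longrightarrow> 0 \<le> a t \<and> 0 \<le> b t \<and> 0 \<le> c t \<and> a t + b t + c t = 1" for a b c
    unfolding path_chain_def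
    by (rule arg_cong[where f = "\<lambda>x. Poly_Mapping.single x 1"], rule path_simplex_cong)
      (use that in \<open>auto simp: standard_simplex_2\<close>)
  ultimately show ?thesis by (simp add: singular_bdry_2)
qed

text \<open>The parameters may come in either order; \<open>segment f 1 0\<close> is
  \<open>f\<close> run backwards.\<close>

definition segment :: "(real \<Rightarrow> 'a) \<Rightarrow> real \<Rightarrow> real \<Rightarrow> real \<Rightarrow> 'a" where
  "segment f a b t = f ((1 - t) * a + t * b)"

lemma convex_combination_01:
  fixes a b t :: real
  assumes "a \<in> {0..1}" "b \<in> {0..1}" "t \<in> {0..1}"
  shows "(1 - t) * a + t * b \<in> {0..1}"
  using convexD[of "{0..1::real}" a b "1 - t" t] assms by auto

lemma pathin_segment:
  assumes "pathin X f" "a \<in> {0..1}" "b \<in> {0..1}"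
  shows "pathin X (segment f a b)"
proof -
  have "continuous_map (top_of_set {0..1}) (top_of_set {0..1}) (\<lambda>t. (1 - t) * a + t * b)"
    using convex_combination_01[OF assms(2,3)]
    by (auto simp: continuous_map_in_subtopology intro!: continuous_intros)
  from continuous_map_compose[OF this assms(1)[unfolded pathin_def]]
  show ?thesis by (simp add: pathin_def segment_def[abs_def] o_def)
qed

text \<open>The triangle is mapped affinely into the unit interval, its vertices going to
  \<open>a\<close>, \<open>b\<close>, \<open>c\<close>, and then by \<open>f\<close>. The order of
  the three parameters is arbitrary, so this also covers reversal.\<close>

lemma path_chain_subdivide:
  assumes f: "pathin X f" and "a \<in> {0..1}" "b \<in> {0..1}" "c \<in> {0..1}"
  shows "path_chain (segment f b c) - path_chain (segment f a c) + path_chain (segment f a b)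
    \<in> (sing_bds X :: (_ \<Rightarrow>\<^sub>0 'f::field) set)"
proof -
  have "continuous_map (subtopology (powertop_real UNIV) (standard_simplex 2)) (top_of_set {0..1})
      (\<lambda>x. a * x 0 + b * x 1 + c * x 2)"
  proof -
    have "a * u + b * v + c * w \<in> {0..1}" if "0 \<le> u" "0 \<le> v" "0 \<le> w" "u + v + w = 1" for u v w :: real
    proof -
      have "a * u + b * v + c * w \<le> 1 * u + 1 * v + 1 * w"
        using assms that by (intro add_mono mult_right_mono) auto
      then show ?thesis using assms that by auto
    qed
    then show ?thesis
      by (auto simp: continuous_map_in_subtopology standard_simplex_2
          intro!: continuous_map_add continuous_map_real_mult continuous_map_coordinate)
  qed
  from sing_bds_triangle[OF continuous_map_compose[OF this f[unfolded pathin_def]], where 'f = 'f]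
  show ?thesis by (simp add: segment_def[abs_def] algebra_simps o_def)
qed

text \<open>A constant triangle has boundary \<open>p - p + p = p\<close> for the constant path
  \<open>p\<close>.\<close>

lemma path_chain_const: "x \<in> topspace X \<Longrightarrow> path_chain (\<lambda>_. x) \<in> (sing_bds X :: (_ \<Rightarrow>\<^sub>0 'f::field) set)"
  using sing_bds_triangle[of X "\<lambda>_. x"] by simp

lemma segment_0_1 [simp]: "segment f 0 1 = f"
  by (simp add: segment_def[abs_def])

lemma segment_refl [simp]: "segment f a a = (\<lambda>_. f a)"
  by (auto simp: segment_def fun_eq_iff algebra_simps)

lemma topspace_pathin: "pathin X f \<Longrightarrow> t \<in> {0..1} \<Longrightarrow> f t \<in> topspace X"
  unfolding pathin_def continuous_map_def by auto

text \<open>Subdivision with \<open>c = a\<close>: the long edge is constant, hence a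
  boundary.\<close>

lemma path_chain_reverse:
  assumes f: "pathin X f" and "a \<in> {0..1}" "b \<in> {0..1}"
  shows "path_chain (segment f a b) + path_chain (segment f b a) \<in> (sing_bds X :: (_ \<Rightarrow>\<^sub>0 'f::field) set)"
proof -
  have "path_chain (segment f a a) \<in> (sing_bds X :: (_ \<Rightarrow>\<^sub>0 'f) set)"
    using topspace_pathin[OF f assms(2)] by (simp add: path_chain_const)
  from pm.subspace_add[OF subspace_sing_bds path_chain_subdivide[OF f assms(2,3,2)] this]
  show ?thesis by (simp add: algebra_simps)
qed

text \<open>The square is cut along its diagonal into two triangles. The diagonal cancels, and the
  sides on which the end points are fixed are constant paths.\<close>

lemma path_chain_homotopic:
  fixes H :: "real \<Rightarrow> real \<Rightarrow> 'a"
  assumes H: "continuous_map (prod_topology (top_of_set {0..1}) (top_of_set {0..1})) X (\<lambda>(s, t). H s t)"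
    and "\<And>s. s \<in> {0..1} \<Longrightarrow> H s 0 = x" "\<And>s. s \<in> {0..1} \<Longrightarrow> H s 1 = y"
  shows "path_chain (H 0) - path_chain (H 1) \<in> (sing_bds X :: (_ \<Rightarrow>\<^sub>0 'f::field) set)"
proof -
  let ?T = "subtopology (powertop_real UNIV) (standard_simplex 2)"
  let ?I = "top_of_set {0..1::real}"
  \<comment> \<open>The triangle with vertices (0,0), (0,1), (1,1).\<close>
  have "continuous_map ?T (prod_topology ?I ?I) (\<lambda>x. (x 2, x 1 + x 2))"
    by (subst continuous_map_paired) (auto simp: continuous_map_in_subtopology standard_simplex_2
          intro!: continuous_map_add continuous_map_coordinate)
  from sing_bds_triangle[OF continuous_map_compose[OF this H], where 'f = 'f]
  have 1: "path_chain (\<lambda>t. H t 1) - path_chain (\<lambda>t. H t t) + path_chain (H 0) \<in> (sing_bds X :: (_ \<Rightarrow>\<^sub>0 'f) set)"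
    by (simp add: o_def)
  \<comment> \<open>The triangle with vertices (0,0), (1,0), (1,1).\<close>
  have "continuous_map ?T (prod_topology ?I ?I) (\<lambda>x. (x 1 + x 2, x 2))"
    by (subst continuous_map_paired) (auto simp: continuous_map_in_subtopology standard_simplex_2
          intro!: continuous_map_add continuous_map_coordinate)
  from sing_bds_triangle[OF continuous_map_compose[OF this H], where 'f = 'f]
  have 2: "path_chain (H 1) - path_chain (\<lambda>t. H t t) + path_chain (\<lambda>t. H t 0) \<in> (sing_bds X :: (_ \<Rightarrow>\<^sub>0 'f) set)"
    by (simp add: o_def)
  have "(0, 0) \<in> topspace (prod_topology ?I ?I)" "(0, 1) \<in> topspace (prod_topology ?I ?I)" by auto
  then have "H 0 0 \<in> topspace X" "H 0 1 \<in> topspace X"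
    using continuous_map_image_subset_topspace[OF H] by fastforce+
  then have xy: "x \<in> topspace X" "y \<in> topspace X" using assms(2,3)[of 0] by auto
  have e: "path_chain (\<lambda>t. H t 1) = path_chain (\<lambda>_. y)" "path_chain (\<lambda>t. H t 0) = path_chain (\<lambda>_. x)"
    unfolding path_chain_def
    by (rule arg_cong[where f = "\<lambda>x. Poly_Mapping.single x 1"], rule path_simplex_cong, simp add: assms(2,3))+
  have "path_chain (H 0) - path_chain (H 1)
    = (path_chain (\<lambda>t. H t 1) - path_chain (\<lambda>t. H t t) + path_chain (H 0))
      - (path_chain (H 1) - path_chain (\<lambda>t. H t t) + path_chain (\<lambda>t. H t 0))
      + path_chain (\<lambda>_. x) - (path_chain (\<lambda>_. y) :: _ \<Rightarrow>\<^sub>0 'f)"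
    by (simp add: e)
  also have "\<dots> \<in> sing_bds X"
    by (intro pm.subspace_add[OF subspace_sing_bds] pm.subspace_diff[OF subspace_sing_bds] 1 2 path_chain_const xy)
  finally show ?thesis .
qed

section \<open>Loops and their size\<close>

text \<open>Subtracting a projection onto \<open>N\<close> from the identity leaves a map with
  kernel \<open>N\<close>. Membership in \<open>N\<close> becomes an equation, and sums modulo
  \<open>N\<close> are computed in an abelian group.\<close>

lemma exists_linear_projection:
  fixes N :: "('s \<Rightarrow>\<^sub>0 'f::field) set"
  assumes "pm.subspace N"
  shows "\<exists>k :: ('s \<Rightarrow>\<^sub>0 'f) \<Rightarrow> ('s \<Rightarrow>\<^sub>0 'f). plinear k \<and> (\<forall>x. k x = 0 \<longleftrightarrow> x \<in> N)"
proof -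
  have "inj_on (\<lambda>x. x) N" by simp
  from pm.linear_exists_left_inverse_on[OF plinear_id assms this]
  obtain g :: "('s \<Rightarrow>\<^sub>0 'f) \<Rightarrow> ('s \<Rightarrow>\<^sub>0 'f)" where g: "range g \<subseteq> N" "plinear g" "\<forall>v\<in>N. g v = v" by blast
  show ?thesis
  proof (intro exI[of _ "\<lambda>x. x - g x"] conjI allI)
    show "plinear (\<lambda>x. x - g x)" by (rule plinear_diff[OF plinear_id g(2)])
    show "x - g x = 0 \<longleftrightarrow> x \<in> N" for x using g(1,3) by (metis eq_iff_diff_eq_0 rangeI subsetD)
  qed
qed

text \<open>The full preimage of \<open>small_loop_span\<close> among the cycles, whence the
  boundaries among the generators.\<close>

definition loop_span ::
    "'a topology \<Rightarrow> ((real \<Rightarrow> 'a) \<Rightarrow> ereal) \<Rightarrow> real \<Rightarrow> (((nat \<Rightarrow> real) \<Rightarrow> 'a) \<Rightarrow>\<^sub>0 'f::field) set" where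
  "loop_span X sz a = pm.span (sing_bds X \<union> path_chain ` {\<gamma>. is_loop X \<gamma> \<and> sz \<gamma> < ereal a})"

lemma small_loop_span_eq: "small_loop_span X sz a = sing_class X ` loop_span X sz a"
proof -
  have e: "{loop_class X \<gamma> | \<gamma>. is_loop X \<gamma> \<and> sz \<gamma> < ereal a}
    = sing_class X ` path_chain ` {\<gamma>. is_loop X \<gamma> \<and> sz \<gamma> < ereal a}"
    by (auto simp: loop_class_eq)
  then show ?thesis
    unfolding small_loop_span_def loop_span_def e
    by (intro presents_vspan[OF presents_singular_H1]) (auto simp: path_chain_loop)
qed

lemma loop_span_subset: "loop_span X sz a \<subseteq> sing_cycles X"
  unfolding loop_span_def
  by (rule pm.span_minimal) (use sing_bds_subset path_chain_loop subspace_sing_cycles in auto)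

lemma sing_bds_loop_span: "sing_bds X \<subseteq> loop_span X sz a"
  unfolding loop_span_def by (rule order_trans[OF _ pm.span_superset]) blast

lemma loop_in_loop_span: "is_loop X \<gamma> \<Longrightarrow> sz \<gamma> < ereal a \<Longrightarrow> path_chain \<gamma> \<in> loop_span X sz a"
  unfolding loop_span_def by (rule pm.span_base) auto

lemma subspace_loop_span: "pm.subspace (loop_span X sz a)"
  by (simp add: loop_span_def)

lemma loop_span_mono: "a \<le> b \<Longrightarrow> loop_span X sz a \<subseteq> loop_span X sz b"
  unfolding loop_span_def
  by (intro pm.span_mono Un_mono image_mono subset_refl) (auto intro: order_less_le_trans)

definition quotient_class ::
    "'a topology \<Rightarrow> ((real \<Rightarrow> 'a) \<Rightarrow> ereal) \<Rightarrow> real \<Rightarrow> (((nat \<Rightarrow> real) \<Rightarrow> 'a) \<Rightarrow>\<^sub>0 'f::field) \<Rightarrow>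
       (((nat \<Rightarrow> real) \<Rightarrow> 'a) \<Rightarrow>\<^sub>0 'f) set set" where
  "quotient_class X sz a z = small_loop_span X sz a +>\<^bsub>singular_H1 X\<^esub> sing_class X z"

lemma presents_quotient_class:
  "presents (quotient_space (singular_H1 X) (small_loop_span X sz a)) (sing_cycles X) (loop_span X sz a)
     (quotient_class X sz a)"
  unfolding quotient_class_def[abs_def]
  by (rule presents_quotient[OF presents_singular_H1 subspace_loop_span sing_bds_loop_span loop_span_subset
        small_loop_span_eq])

lemma quotient_class_bond:
  assumes "a \<le> b" "z \<in> sing_cycles X"
  shows "coset_map (singular_H1 X) (small_loop_span X sz b) (\<lambda>v. v) (quotient_class X sz a z) = quotient_class X sz b z"
  unfolding quotient_class_def[of _ _ b]
proof (rule presents_coset_map)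
  show "presents (quotient_space (singular_H1 X) (small_loop_span X sz b)) (sing_cycles X) (loop_span X sz b)
     (\<lambda>z. small_loop_span X sz b +>\<^bsub>singular_H1 X\<^esub> sing_class X z)"
    using presents_quotient_class[of X sz b] by (simp add: quotient_class_def[abs_def])
  show "quotient_class X sz a z \<noteq> {}"
    unfolding quotient_class_def
    by (rule presents_coset_nonempty[OF small_loop_span_eq]) (rule pm.subspace_0[OF subspace_loop_span])
  fix u assume "u \<in> quotient_class X sz a z"
  then obtain m where m: "m \<in> loop_span X sz a" "u = sing_class X (m + z)"
    using presents_coset_mem[OF presents_singular_H1 loop_span_subset small_loop_span_eq assms(2)]
    unfolding quotient_class_def by blast
  then show "\<exists>y\<in>sing_cycles X. u = sing_class X y \<and> y - z \<in> loop_span X sz b"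
    using pm.subspace_add[OF subspace_sing_cycles subsetD[OF loop_span_subset m(1)] assms(2)]
      subsetD[OF loop_span_mono[OF assms(1)] m(1)]
    by (intro bexI[of _ "m + z"]) auto
qed (rule assms(2))

text \<open>The function \<open>v\<close> plays the role of the arc length.\<close>

definition length_at_most :: "('a \<Rightarrow> 'a \<Rightarrow> real) \<Rightarrow> (real \<Rightarrow> 'a) \<Rightarrow> real \<Rightarrow> bool" where
  "length_at_most d \<gamma> L \<longleftrightarrow> (\<exists>v. v 0 = 0 \<and> v 1 = L \<and>
     (\<forall>s t. 0 \<le> s \<longrightarrow> s \<le> t \<longrightarrow> t \<le> 1 \<longrightarrow> d (\<gamma> s) (\<gamma> t) \<le> v t - v s))"

lemma loop_length_le:
  assumes "length_at_most d \<gamma> L" "\<And>x y. 0 \<le> d x y"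
  shows "loop_length d \<gamma> \<le> ereal L"
proof -
  obtain v where v: "v 0 = 0" "v 1 = L"
    and dv: "\<And>s t. 0 \<le> s \<Longrightarrow> s \<le> t \<Longrightarrow> t \<le> 1 \<Longrightarrow> d (\<gamma> s) (\<gamma> t) \<le> v t - v s"
    using assms(1) unfolding length_at_most_def by blast
  have mono: "v s \<le> v t" if "0 \<le> s" "s \<le> t" "t \<le> 1" for s t
    using dv[OF that] assms(2)[of "\<gamma> s" "\<gamma> t"] by linarith
  show ?thesis
    unfolding loop_length_def
  proof (rule SUP_least, clarify)
    fix ts :: "real list" assume ts: "sorted ts" "set ts \<subseteq> {0..1}"
    show "ereal (\<Sum>i<length ts - 1. d (\<gamma> (ts ! i)) (\<gamma> (ts ! Suc i))) \<le> ereal L"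
    proof (cases "ts = []")
      \<comment> \<open>The empty partition contributes the value 0, so that
        \<open>0 \<le> L\<close> has to be known.\<close>
      case True
      then show ?thesis using mono[of 0 1] v by simp
    next
      case False
      have I: "ts ! i \<in> {0..1}" if "i < length ts" for i using ts(2) that nth_mem by blast
      have "(\<Sum>i<length ts - 1. d (\<gamma> (ts ! i)) (\<gamma> (ts ! Suc i))) \<le> (\<Sum>i<length ts - 1. v (ts ! Suc i) - v (ts ! i))"
      proof (rule sum_mono)
        fix i assume "i \<in> {..<length ts - 1}"
        then have "Suc i < length ts" by auto
        then show "d (\<gamma> (ts ! i)) (\<gamma> (ts ! Suc i)) \<le> v (ts ! Suc i) - v (ts ! i)"
          using I[of i] I[of "Suc i"] sorted_nth_mono[OF ts(1), of i "Suc i"] by (intro dv) auto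
      qed
      also have "\<dots> = v (ts ! (length ts - 1)) - v (ts ! 0)"
        by (simp add: sum_lessThan_telescope[of "\<lambda>i. v (ts ! i)"])
      also have "\<dots> \<le> v 1 - v 0"
        using False I[of 0] I[of "length ts - 1"] by (intro diff_mono mono) auto
      finally show ?thesis using v by simp
    qed
  qed
qed

lemma length_at_most_dist:
  assumes "length_at_most d \<gamma> L" "\<And>x y. 0 \<le> d x y" "0 \<le> s" "s \<le> t" "t \<le> 1"
  shows "d (\<gamma> s) (\<gamma> t) \<le> L"
proof -
  obtain v where v: "v 0 = 0" "v 1 = L"
    and dv: "\<And>s t. 0 \<le> s \<Longrightarrow> s \<le> t \<Longrightarrow> t \<le> 1 \<Longrightarrow> d (\<gamma> s) (\<gamma> t) \<le> v t - v s"
    using assms(1) unfolding length_at_most_def by blast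
  have "0 \<le> v s - v 0" using dv[of 0 s] assms(2)[of "\<gamma> 0" "\<gamma> s"] assms(3-5) by linarith
  moreover have "0 \<le> v 1 - v t" using dv[of t 1] assms(2)[of "\<gamma> t" "\<gamma> 1"] assms(3-5) by linarith
  ultimately show ?thesis using dv[OF assms(3-5)] v by linarith
qed

lemma loop_length_ge_sum:
  assumes "0 < m"
  shows "ereal (\<Sum>i<m. d (\<gamma> (real i / real m)) (\<gamma> (real (Suc i) / real m))) \<le> loop_length d \<gamma>"
proof -
  let ?ts = "map (\<lambda>i. real i / real m) [0..<Suc m]"
  have "sorted ?ts" by (auto simp: sorted_iff_nth_mono divide_right_mono simp del: upt_Suc)
  moreover have "set ?ts \<subseteq> {0..1}" using assms by auto
  ultimately have "ereal (\<Sum>i<length ?ts - 1. d (\<gamma> (?ts ! i)) (\<gamma> (?ts ! Suc i))) \<le> loop_length d \<gamma>"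
    unfolding loop_length_def by (intro SUP_upper) auto
  moreover have "(\<Sum>i<length ?ts - 1. d (\<gamma> (?ts ! i)) (\<gamma> (?ts ! Suc i)))
      = (\<Sum>i<m. d (\<gamma> (real i / real m)) (\<gamma> (real (Suc i) / real m)))"
    by (rule sum.cong) (auto simp del: upt_Suc)
  ultimately show ?thesis by simp
qed

section \<open>Concatenation and reversal of paths\<close>

definition join_path :: "(real \<Rightarrow> 'a) \<Rightarrow> (real \<Rightarrow> 'a) \<Rightarrow> real \<Rightarrow> 'a" where
  "join_path f h t = (if t \<le> 1 / 2 then f (2 * t) else h (2 * t - 1))"

definition rev_path :: "(real \<Rightarrow> 'a) \<Rightarrow> real \<Rightarrow> 'a" where
  "rev_path f t = f (1 - t)"

lemma pathin_join_path:
  assumes f: "pathin X f" and h: "pathin X h" and e: "f 1 = h 0"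
  shows "pathin X (join_path f h)"
  unfolding pathin_def join_path_def
proof (rule continuous_map_cases_le)
  let ?I = "top_of_set {0..1::real}"
  have "continuous_map (subtopology ?I {x \<in> topspace ?I. x \<le> 1 / 2}) ?I (\<lambda>t. 2 * t)"
    by (auto simp: continuous_map_in_subtopology subtopology_subtopology intro!: continuous_intros)
  from continuous_map_compose[OF this f[unfolded pathin_def]]
  show "continuous_map (subtopology ?I {x \<in> topspace ?I. x \<le> 1 / 2}) X (\<lambda>t. f (2 * t))" by (simp add: o_def)
  have "continuous_map (subtopology ?I {x \<in> topspace ?I. 1 / 2 \<le> x}) ?I (\<lambda>t. 2 * t - 1)"
    by (auto simp: continuous_map_in_subtopology subtopology_subtopology intro!: continuous_intros)
  from continuous_map_compose[OF this h[unfolded pathin_def]]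
  show "continuous_map (subtopology ?I {x \<in> topspace ?I. 1 / 2 \<le> x}) X (\<lambda>t. h (2 * t - 1))" by (simp add: o_def)
next
  show "f (2 * t) = h (2 * t - 1)" if "t \<in> topspace (top_of_set {0..1})" "t = 1 / 2" for t
    unfolding that(2) using e by simp
qed (auto intro!: continuous_intros)

lemma rev_path_eq_segment: "rev_path f = segment f 1 0"
  by (auto simp: rev_path_def segment_def fun_eq_iff)

lemma pathin_rev_path: "pathin X f \<Longrightarrow> pathin X (rev_path f)"
  by (simp add: rev_path_eq_segment pathin_segment)

lemma join_path_ends [simp]: "join_path f h 0 = f 0" "join_path f h 1 = h 1"
  and rev_path_ends [simp]: "rev_path f 0 = f 1" "rev_path f 1 = f 0"
  by (auto simp: join_path_def rev_path_def)

lemma path_chain_cong: "(\<And>t. t \<in> {0..1} \<Longrightarrow> f t = h t) \<Longrightarrow> path_chain f = path_chain h"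
  unfolding path_chain_def by (metis path_simplex_cong)

lemma path_chain_join_path:
  assumes f: "pathin X f" and h: "pathin X h" and e: "f 1 = h 0"
  shows "path_chain f + path_chain h - path_chain (join_path f h) \<in> (sing_bds X :: (_ \<Rightarrow>\<^sub>0 'f::field) set)"
proof -
  have "path_chain (segment (join_path f h) 0 (1 / 2)) = (path_chain f :: _ \<Rightarrow>\<^sub>0 'f)"
    by (rule path_chain_cong) (auto simp: segment_def join_path_def)
  moreover have "path_chain (segment (join_path f h) (1 / 2) 1) = (path_chain h :: _ \<Rightarrow>\<^sub>0 'f)"
    by (rule path_chain_cong) (auto simp: segment_def join_path_def e field_simps)
  ultimately show ?thesis
    using path_chain_subdivide[OF pathin_join_path[OF assms], of 0 "1 / 2" 1, where 'f = 'f]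
    by (simp add: algebra_simps)
qed

lemma path_chain_rev_path:
  "pathin X f \<Longrightarrow> path_chain f + path_chain (rev_path f) \<in> (sing_bds X :: (_ \<Rightarrow>\<^sub>0 'f::field) set)"
  using path_chain_reverse[of X f 0 1] by (simp add: rev_path_eq_segment)

context Metric_space begin

text \<open>The new arc length runs through \<open>v\<close> and then through \<open>w\<close>
  shifted by \<open>K\<close>. Only parameters on different sides of \<open>1 / 2\<close> need the
  triangle inequality, applied at the junction.\<close>

lemma length_at_most_join_path:
  assumes "length_at_most d f K" "length_at_most d h L" "f 1 = h 0"
    and M: "\<And>t. t \<in> {0..1} \<Longrightarrow> f t \<in> M \<and> h t \<in> M"
  shows "length_at_most d (join_path f h) (K + L)"
proof -
  obtain v where v: "v 0 = 0" "v 1 = K"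
    and dv: "\<And>s t. 0 \<le> s \<Longrightarrow> s \<le> t \<Longrightarrow> t \<le> 1 \<Longrightarrow> d (f s) (f t) \<le> v t - v s"
    using assms(1) unfolding length_at_most_def by blast
  obtain w where w: "w 0 = 0" "w 1 = L"
    and dw: "\<And>s t. 0 \<le> s \<Longrightarrow> s \<le> t \<Longrightarrow> t \<le> 1 \<Longrightarrow> d (h s) (h t) \<le> w t - w s"
    using assms(2) unfolding length_at_most_def by blast
  show ?thesis
    unfolding length_at_most_def
  proof (intro exI[of _ "\<lambda>t. if t \<le> 1 / 2 then v (2 * t) else K + w (2 * t - 1)"] conjI allI impI)
    fix s t :: real assume st: "0 \<le> s" "s \<le> t" "t \<le> 1"
    consider "t \<le> 1 / 2" | "1 / 2 < s" | "s \<le> 1 / 2" "1 / 2 < t" by linarith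
    then show "d (join_path f h s) (join_path f h t) \<le> (if t \<le> 1 / 2 then v (2 * t) else K + w (2 * t - 1)) -
        (if s \<le> 1 / 2 then v (2 * s) else K + w (2 * s - 1))"
    proof cases
      case 1 then show ?thesis using st dv[of "2 * s" "2 * t"] by (auto simp: join_path_def)
    next
      case 2 then show ?thesis using st dw[of "2 * s - 1" "2 * t - 1"] by (auto simp: join_path_def)
    next
      case 3
      have "d (f (2 * s)) (h (2 * t - 1)) \<le> d (f (2 * s)) (f 1) + d (h 0) (h (2 * t - 1))"
        using triangle[of "f (2 * s)" "f 1" "h (2 * t - 1)"] M[of "2 * s"] M[of 1] M[of "2 * t - 1"] 3 st assms(3)
        by auto
      also have "\<dots> \<le> (v 1 - v (2 * s)) + (w (2 * t - 1) - w 0)"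
        using 3 st by (intro add_mono dv dw) auto
      finally show ?thesis using 3 v w by (auto simp: join_path_def)
    qed
  qed (use v w in auto)
qed

lemma length_at_most_rev_path:
  assumes "length_at_most d f K"
  shows "length_at_most d (rev_path f) K"
proof -
  obtain v where v: "v 0 = 0" "v 1 = K"
    and dv: "\<And>s t. 0 \<le> s \<Longrightarrow> s \<le> t \<Longrightarrow> t \<le> 1 \<Longrightarrow> d (f s) (f t) \<le> v t - v s"
    using assms unfolding length_at_most_def by blast
  show ?thesis
    unfolding length_at_most_def
  proof (intro exI[of _ "\<lambda>t. K - v (1 - t)"] conjI allI impI)
    fix s t :: real assume "0 \<le> s" "s \<le> t" "t \<le> 1"
    then show "d (rev_path f s) (rev_path f t) \<le> K - v (1 - t) - (K - v (1 - s))"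
      using dv[of "1 - t" "1 - s"] commute[of "f (1 - s)"] by (simp add: rev_path_def)
  qed (use v in auto)
qed

text \<open>The closed path through \<open>\<alpha>\<close>, \<open>\<beta>\<close> and the reverse
  of \<open>\<gamma>\<close> is shorter than \<open>a\<close> and hence a generator of the span;
  concatenation and reversal cost only boundaries.\<close>

lemma short_triangle:
  assumes \<alpha>: "pathin mtopology \<alpha>" "length_at_most d \<alpha> K1" and \<beta>: "pathin mtopology \<beta>" "length_at_most d \<beta> K2"
    and \<gamma>: "pathin mtopology \<gamma>" "length_at_most d \<gamma> K3"
    and e: "\<alpha> 1 = \<beta> 0" "\<alpha> 0 = \<gamma> 0" "\<beta> 1 = \<gamma> 1" and K: "K1 + K2 + K3 < a"
  shows "path_chain \<alpha> + path_chain \<beta> - path_chain \<gamma> \<in>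
    (loop_span mtopology (loop_length d) a :: (_ \<Rightarrow>\<^sub>0 'f::field) set)"
proof -
  let ?L = "loop_span mtopology (loop_length d) a :: (_ \<Rightarrow>\<^sub>0 'f) set"
  have M: "t \<in> {0..1} \<Longrightarrow> \<alpha> t \<in> M" "t \<in> {0..1} \<Longrightarrow> \<beta> t \<in> M" "t \<in> {0..1} \<Longrightarrow> \<gamma> t \<in> M" for t
    using topspace_pathin[OF \<alpha>(1)] topspace_pathin[OF \<beta>(1)] topspace_pathin[OF \<gamma>(1)] by auto
  have ab: "pathin mtopology (join_path \<alpha> \<beta>)" "length_at_most d (join_path \<alpha> \<beta>) (K1 + K2)"
    using \<alpha> \<beta> e M by (auto intro!: pathin_join_path length_at_most_join_path)
  have g: "pathin mtopology (rev_path \<gamma>)" "length_at_most d (rev_path \<gamma>) K3"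
    using \<gamma> by (auto intro!: pathin_rev_path length_at_most_rev_path)
  let ?l = "join_path (join_path \<alpha> \<beta>) (rev_path \<gamma>)"
  have l: "pathin mtopology ?l" "length_at_most d ?l (K1 + K2 + K3)"
    using topspace_pathin[OF ab(1)] topspace_pathin[OF g(1)] e
    by (auto intro!: pathin_join_path length_at_most_join_path ab g)
  have "is_loop mtopology ?l" using l e by (simp add: is_loop_def)
  moreover have "loop_length d ?l < ereal a"
    using loop_length_le[OF l(2)] K order_le_less_trans by fastforce
  ultimately have 0: "path_chain ?l \<in> ?L" by (rule loop_in_loop_span)
  have B: "sing_bds mtopology \<subseteq> ?L" by (rule sing_bds_loop_span)
  have 1: "path_chain \<alpha> + path_chain \<beta> - path_chain (join_path \<alpha> \<beta>) \<in> ?L"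
    using path_chain_join_path[OF \<alpha>(1) \<beta>(1) e(1)] B by blast
  have 2: "path_chain (join_path \<alpha> \<beta>) + path_chain (rev_path \<gamma>) - path_chain ?l \<in> ?L"
    using path_chain_join_path[OF ab(1) g(1)] e B by auto
  have 3: "path_chain \<gamma> + path_chain (rev_path \<gamma>) \<in> ?L"
    using path_chain_rev_path[OF \<gamma>(1)] B by blast
  have "path_chain \<alpha> + path_chain \<beta> - path_chain \<gamma> =
    (path_chain \<alpha> + path_chain \<beta> - path_chain (join_path \<alpha> \<beta>))
    + (path_chain (join_path \<alpha> \<beta>) + path_chain (rev_path \<gamma>) - path_chain ?l)
    - (path_chain \<gamma> + path_chain (rev_path \<gamma>)) + (path_chain ?l :: _ \<Rightarrow>\<^sub>0 'f)"
    by (simp add: algebra_simps)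
  also have "\<dots> \<in> ?L"
    by (intro pm.subspace_add[OF subspace_loop_span] pm.subspace_diff[OF subspace_loop_span] 0 1 2 3)
  finally show ?thesis .
qed

lemma length_at_most_const: "x \<in> M \<Longrightarrow> length_at_most d (\<lambda>_. x) 0"
  unfolding length_at_most_def by (rule exI[of _ "\<lambda>_. 0"]) auto

text \<open>A triangle whose second side is constant and has length 0.\<close>

lemma short_bigon:
  assumes \<alpha>: "pathin mtopology \<alpha>" "length_at_most d \<alpha> K1" and \<gamma>: "pathin mtopology \<gamma>" "length_at_most d \<gamma> K2"
    and e: "\<alpha> 0 = \<gamma> 0" "\<alpha> 1 = \<gamma> 1" and K: "K1 + K2 < a"
  shows "path_chain \<alpha> - path_chain \<gamma> \<in> (loop_span mtopology (loop_length d) a :: (_ \<Rightarrow>\<^sub>0 'f::field) set)"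
proof -
  have M: "\<alpha> 1 \<in> M" using topspace_pathin[OF \<alpha>(1), of 1] by simp
  have "path_chain \<alpha> + path_chain (\<lambda>_. \<alpha> 1) - path_chain \<gamma> \<in> (loop_span mtopology (loop_length d) a :: (_ \<Rightarrow>\<^sub>0 'f) set)"
    by (rule short_triangle[OF \<alpha> _ length_at_most_const[OF M] \<gamma>]) (use M e K in auto)
  moreover have "path_chain (\<lambda>_. \<alpha> 1) \<in> (loop_span mtopology (loop_length d) a :: (_ \<Rightarrow>\<^sub>0 'f) set)"
    using path_chain_const[of "\<alpha> 1" mtopology] M sing_bds_loop_span by auto
  ultimately show ?thesis
    using pm.subspace_diff[OF subspace_loop_span] by fastforce
qed

end

text \<open>The initial segment up to \<open>k / m\<close> grows by one piece at a time, each time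
  by one relation of \<open>path_chain_subdivide\<close>.\<close>

lemma path_chain_subdivision:
  assumes f: "pathin X f" and m: "0 < m"
  shows "path_chain f - (\<Sum>i<m. path_chain (segment f (real i / real m) (real (Suc i) / real m)))
    \<in> (sing_bds X :: (_ \<Rightarrow>\<^sub>0 'f::field) set)"
proof -
  have "path_chain (segment f 0 (real k / real m)) -
      (\<Sum>i<k. path_chain (segment f (real i / real m) (real (Suc i) / real m))) \<in> (sing_bds X :: (_ \<Rightarrow>\<^sub>0 'f) set)"
    if "k \<le> m" for k
    using that
  proof (induction k)
    case 0
    then show ?case using topspace_pathin[OF f, of 0] by (simp add: path_chain_const)
  next
    case (Suc k)
    let ?a = "real k / real m" and ?b = "real (Suc k) / real m"
    have "?a \<in> {0..1}" "?b \<in> {0..1}" using Suc m by (auto simp: field_simps)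
    then have 1: "path_chain (segment f ?a ?b) - path_chain (segment f 0 ?b) + path_chain (segment f 0 ?a)
        \<in> (sing_bds X :: (_ \<Rightarrow>\<^sub>0 'f) set)"
      by (intro path_chain_subdivide[OF f]) auto
    have 2: "path_chain (segment f 0 ?a) -
      (\<Sum>i<k. path_chain (segment f (real i / real m) (real (Suc i) / real m))) \<in> (sing_bds X :: (_ \<Rightarrow>\<^sub>0 'f) set)"
      using Suc by simp
    show ?case using pm.subspace_diff[OF subspace_sing_bds 2 1] by (simp add: algebra_simps)
  qed
  from this[of m] show ?thesis using m by simp
qed

section \<open>Sums along fine sequences of points\<close>

text \<open>Coning off from \<open>p\<close> turns every summand into a difference of two spokes,
  and the sum telescopes.\<close>

lemma cone_sum:
  fixes E :: "'a \<Rightarrow> 'a \<Rightarrow> 'b::ab_group_add"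
  assumes "a \<le> b" "\<And>i. a \<le> i \<Longrightarrow> i < b \<Longrightarrow> E p (x i) + E (x i) (x (Suc i)) = E p (x (Suc i))"
  shows "(\<Sum>i=a..<b. E (x i) (x (Suc i))) = E p (x b) - E p (x a)"
proof -
  have "(\<Sum>i=a..<b. E (x i) (x (Suc i))) = (\<Sum>i=a..<b. E p (x (Suc i)) - E p (x i))"
  proof (rule sum.cong[OF refl])
    fix i assume "i \<in> {a..<b}"
    then show "E (x i) (x (Suc i)) = E p (x (Suc i)) - E p (x i)"
      using assms(2)[of i] by (auto simp flip: assms(2))
  qed
  also have "\<dots> = E p (x b) - E p (x a)" using assms(1) by (rule sum_Suc_diff')
  finally show ?thesis .
qed

text \<open>\<open>x\<close> and \<open>y\<close> are consecutive rows of a triangulated triangle.\<close>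

lemma two_rows_sum:
  fixes E :: "'a \<Rightarrow> 'a \<Rightarrow> 'b::ab_group_add"
  assumes "\<And>i. i \<le> n \<Longrightarrow> E (x i) (x (Suc i)) + E (x (Suc i)) (y i) = E (x i) (y i)"
    and "\<And>i. i < n \<Longrightarrow> E (x (Suc i)) (y i) + E (y i) (y (Suc i)) = E (x (Suc i)) (y (Suc i))"
  shows "(\<Sum>i<Suc n. E (x i) (x (Suc i))) = E (x 0) (y 0) + (\<Sum>i<n. E (y i) (y (Suc i))) - E (x (Suc n)) (y n)"
  using assms
proof (induction n)
  case 0
  then show ?case using 0(1)[of 0] by (simp add: eq_diff_eq)
next
  case (Suc n)
  have IH: "(\<Sum>i<Suc n. E (x i) (x (Suc i))) = E (x 0) (y 0) + (\<Sum>i<n. E (y i) (y (Suc i))) - E (x (Suc n)) (y n)"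
    using Suc by auto
  have "E (x (Suc n)) (x (Suc (Suc n))) + E (x (Suc (Suc n))) (y (Suc n)) = E (x (Suc n)) (y (Suc n))"
    using Suc.prems(1)[of "Suc n"] by simp
  moreover have "E (x (Suc n)) (y n) + E (y n) (y (Suc n)) = E (x (Suc n)) (y (Suc n))"
    using Suc.prems(2)[of n] by simp
  ultimately have "E (x (Suc n)) (x (Suc (Suc n))) = E (x (Suc n)) (y n) + E (y n) (y (Suc n)) - E (x (Suc (Suc n))) (y (Suc n))"
    by (metis eq_diff_eq)
  then show ?case unfolding sum.lessThan_Suc[of _ "Suc n"] IH by simp
qed

text \<open>The points \<open>P i j\<close> with \<open>i + j \<le> m\<close> form a triangular
  grid; the assumptions concern its upright and its inverted cells. A discrete Stokes formula for
  the large triangle.\<close>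

lemma triangle_grid_sum:
  fixes E :: "'a \<Rightarrow> 'a \<Rightarrow> 'b::ab_group_add" and P :: "nat \<Rightarrow> nat \<Rightarrow> 'a"
  assumes "\<And>i j. Suc (i + j) \<le> m \<Longrightarrow>
      E (P i j) (P (Suc i) j) + E (P (Suc i) j) (P i (Suc j)) = E (P i j) (P i (Suc j))"
    and "\<And>i j. Suc (Suc (i + j)) \<le> m \<Longrightarrow>
      E (P (Suc i) j) (P i (Suc j)) + E (P i (Suc j)) (P (Suc i) (Suc j)) = E (P (Suc i) j) (P (Suc i) (Suc j))"
  shows "(\<Sum>j<m. E (P (m - j) j) (P (m - Suc j) (Suc j))) - (\<Sum>j<m. E (P 0 j) (P 0 (Suc j)))
    + (\<Sum>i<m. E (P i 0) (P (Suc i) 0)) = 0"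
proof -
  \<comment> \<open>Sweeping upwards: the bottom row is pushed to row \<open>k\<close> along the two
    lateral sides.\<close>
  have "(\<Sum>i<m. E (P i 0) (P (Suc i) 0)) = (\<Sum>j<k. E (P 0 j) (P 0 (Suc j))) + (\<Sum>i<m - k. E (P i k) (P (Suc i) k))
      - (\<Sum>j<k. E (P (m - j) j) (P (m - Suc j) (Suc j)))" if "k \<le> m" for k
    using that
  proof (induction k)
    case (Suc k)
    define n where "n = m - Suc k"
    have n: "m - k = Suc n" "m - Suc k = n" using Suc.prems by (auto simp: n_def)
    have "(\<Sum>i<Suc n. E (P i k) (P (Suc i) k)) =
        E (P 0 k) (P 0 (Suc k)) + (\<Sum>i<n. E (P i (Suc k)) (P (Suc i) (Suc k))) - E (P (Suc n) k) (P n (Suc k))"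
      by (rule two_rows_sum[where x = "\<lambda>i. P i k" and y = "\<lambda>i. P i (Suc k)"])
        (use assms n_def Suc.prems in auto)
    then show ?case using Suc by (simp add: n)
  qed simp
  from this[of m] show ?thesis by simp
qed

section \<open>Compact length spaces\<close>

text \<open>Everything below that does not concern shortest bases uses the manifold through these
  properties alone. \<open>short_path\<close> does not ask for the distance to be attained, only to
  be approximated; the homotopy in \<open>locally_simply_connected\<close> may leave the
  ball.\<close>

locale compact_length_space = Metric_space M d for M :: "'a set" and d :: "'a \<Rightarrow> 'a \<Rightarrow> real" +
  assumes compact: "compact_space mtopology"
    and short_path: "\<lbrakk>x \<in> M; y \<in> M; d x y < R\<rbrakk> \<Longrightarrow>
      \<exists>\<gamma> L. pathin mtopology \<gamma> \<and> \<gamma> 0 = x \<and> \<gamma> 1 = y \<and> length_at_most d \<gamma> L \<and> L < R"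
    and locally_simply_connected: "p \<in> M \<Longrightarrow> \<exists>\<epsilon>>0. \<forall>\<alpha> \<beta>. pathin mtopology \<alpha> \<longrightarrow> pathin mtopology \<beta> \<longrightarrow>
      \<alpha> ` {0..1} \<subseteq> mball p \<epsilon> \<longrightarrow> \<beta> ` {0..1} \<subseteq> mball p \<epsilon> \<longrightarrow> \<alpha> 0 = \<beta> 0 \<longrightarrow> \<alpha> 1 = \<beta> 1 \<longrightarrow>
      (\<exists>H. continuous_map (prod_topology (top_of_set {0..1::real}) (top_of_set {0..1::real})) mtopology (\<lambda>(s, t). H s t) \<and>
        (\<forall>s\<in>{0..1}. H s 0 = \<alpha> 0 \<and> H s 1 = \<alpha> 1) \<and> (\<forall>t\<in>{0..1}. H 0 t = \<alpha> t \<and> H 1 t = \<beta> t))"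
begin

text \<open>Makes the radius uniform in the centre, by compactness.\<close>

lemma homologous_small_paths:
  "\<exists>\<epsilon>>0. \<forall>p\<in>M. \<forall>\<alpha> \<beta>. pathin mtopology \<alpha> \<longrightarrow> pathin mtopology \<beta> \<longrightarrow>
      \<alpha> ` {0..1} \<subseteq> mball p \<epsilon> \<longrightarrow> \<beta> ` {0..1} \<subseteq> mball p \<epsilon> \<longrightarrow> \<alpha> 0 = \<beta> 0 \<longrightarrow> \<alpha> 1 = \<beta> 1 \<longrightarrow>
      path_chain \<alpha> - path_chain \<beta> \<in> (sing_bds mtopology :: (_ \<Rightarrow>\<^sub>0 'f::field) set)"
proof -
  define simple where "simple p \<epsilon> \<longleftrightarrow> (\<forall>\<alpha> \<beta>. pathin mtopology \<alpha> \<longrightarrow> pathin mtopology \<beta> \<longrightarrow>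
      \<alpha> ` {0..1} \<subseteq> mball p \<epsilon> \<longrightarrow> \<beta> ` {0..1} \<subseteq> mball p \<epsilon> \<longrightarrow> \<alpha> 0 = \<beta> 0 \<longrightarrow> \<alpha> 1 = \<beta> 1 \<longrightarrow>
      (\<exists>H. continuous_map (prod_topology (top_of_set {0..1::real}) (top_of_set {0..1::real})) mtopology (\<lambda>(s, t). H s t) \<and>
        (\<forall>s\<in>{0..1}. H s 0 = \<alpha> 0 \<and> H s 1 = \<alpha> 1) \<and> (\<forall>t\<in>{0..1}. H 0 t = \<alpha> t \<and> H 1 t = \<beta> t)))"
    for p \<epsilon>
  have "\<exists>\<epsilon>>0. simple p \<epsilon>" if "p \<in> M" for p
    unfolding simple_def by (rule locally_simply_connected[OF that])
  then obtain e where e: "\<And>p. p \<in> M \<Longrightarrow> 0 < e p" and H: "\<And>p. p \<in> M \<Longrightarrow> simple p (e p)" by metis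
  \<comment> \<open>A Lebesgue number of the cover by good balls: every ball of this radius lies in
    a good one.\<close>
  have "\<exists>\<epsilon>>0. \<forall>x\<in>M. \<exists>U\<in>(\<lambda>p. mball p (e p)) ` M. mball x \<epsilon> \<subseteq> U"
    by (rule lebesgue_number) (use compact e in \<open>auto simp: compact_space_def\<close>)
  then obtain \<epsilon> where \<epsilon>: "0 < \<epsilon>" "\<And>x. x \<in> M \<Longrightarrow> \<exists>p\<in>M. mball x \<epsilon> \<subseteq> mball p (e p)" by auto
  show ?thesis
  proof (intro exI[of _ \<epsilon>] conjI ballI allI impI \<epsilon>(1))
    fix x \<alpha> \<beta> assume x: "x \<in> M" and *: "pathin mtopology \<alpha>" "pathin mtopology \<beta>" "\<alpha> ` {0..1} \<subseteq> mball x \<epsilon>"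
      "\<beta> ` {0..1} \<subseteq> mball x \<epsilon>" "\<alpha> 0 = \<beta> 0" "\<alpha> 1 = \<beta> 1"
    obtain p where p: "p \<in> M" "mball x \<epsilon> \<subseteq> mball p (e p)" using \<epsilon>(2)[OF x] by blast
    obtain H where H1: "continuous_map (prod_topology (top_of_set {0..1::real}) (top_of_set {0..1::real})) mtopology (\<lambda>(s, t). H s t)"
      and H2: "\<And>s. s \<in> {0..1} \<Longrightarrow> H s 0 = \<alpha> 0" "\<And>s. s \<in> {0..1} \<Longrightarrow> H s 1 = \<alpha> 1"
      and H3: "\<And>t. t \<in> {0..1} \<Longrightarrow> H 0 t = \<alpha> t" "\<And>t. t \<in> {0..1} \<Longrightarrow> H 1 t = \<beta> t"
      using H[OF p(1), unfolded simple_def, rule_format, OF *(1,2) order_trans[OF *(3) p(2)] order_trans[OF *(4) p(2)] *(5,6)]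
      by blast
    have "path_chain (H 0) = (path_chain \<alpha> :: _ \<Rightarrow>\<^sub>0 'f)" "path_chain (H 1) = (path_chain \<beta> :: _ \<Rightarrow>\<^sub>0 'f)"
      by (auto intro!: path_chain_cong H3)
    then show "path_chain \<alpha> - path_chain \<beta> \<in> (sing_bds mtopology :: (_ \<Rightarrow>\<^sub>0 'f::field) set)"
      using path_chain_homotopic[OF H1 H2, where 'f = 'f] by simp
  qed
qed

end

section \<open>Fine subdivisions of paths and sums over them\<close>

context Metric_space begin

lemma uniformly_continuous:
  fixes h :: "'b::metric_space \<Rightarrow> 'a"
  assumes "compact S" "continuous_map (top_of_set S) mtopology h" "0 < \<epsilon>"
  shows "\<exists>\<delta>>0. \<forall>x\<in>S. \<forall>y\<in>S. dist x y < \<delta> \<longrightarrow> d (h x) (h y) < \<epsilon>"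
proof -
  have "uniformly_continuous_map (submetric euclidean_metric S) (metric (M, d)) h"
    using continuous_eq_uniformly_continuous_map[of "submetric euclidean_metric S" "metric (M, d)" h] assms(1,2)
    by (simp add: mtopology_of_submetric compact_space_subtopology)
  then show ?thesis
    using assms(3) unfolding uniformly_continuous_map_def by (auto simp: commute dist_commute)
qed

text \<open>The oscillation is bounded on whole pieces and not just between their end points, so
  that refinements are controlled and pieces stay in small balls. \<open>0 < m\<close> matters
  because division by 0 would turn all subdivision points into \<open>f 0\<close>.\<close>

definition is_fine :: "(real \<Rightarrow> 'a) \<Rightarrow> nat \<Rightarrow> real \<Rightarrow> bool" where
  "is_fine f m \<epsilon> \<longleftrightarrow> 0 < m \<and> (\<forall>i<m. \<forall>s\<in>{real i / real m .. real (Suc i) / real m}.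
     \<forall>t\<in>{real i / real m .. real (Suc i) / real m}. d (f s) (f t) < \<epsilon>)"

lemma fineD:
  assumes "is_fine f m \<epsilon>" "i < m" "real i / real m \<le> s" "s \<le> real (Suc i) / real m"
    "real i / real m \<le> t" "t \<le> real (Suc i) / real m"
  shows "d (f s) (f t) < \<epsilon>"
  using assms unfolding is_fine_def by auto

lemma fine_step: "is_fine f m \<epsilon> \<Longrightarrow> i < m \<Longrightarrow> d (f (real i / real m)) (f (real (Suc i) / real m)) < \<epsilon>"
  by (rule fineD) (auto simp: divide_right_mono)

text \<open>All large \<open>m\<close> are fine, so that finitely many requirements can be met by
  one \<open>m\<close>.\<close>

lemma exists_fine:
  assumes "pathin mtopology f" "0 < \<epsilon>"
  shows "\<exists>m0. \<forall>m\<ge>m0. is_fine f m \<epsilon>"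
proof -
  obtain \<delta> where \<delta>: "0 < \<delta>" "\<And>x y. x \<in> {0..1} \<Longrightarrow> y \<in> {0..1} \<Longrightarrow> dist x y < \<delta> \<Longrightarrow> d (f x) (f y) < \<epsilon>"
    using uniformly_continuous[OF _ assms(1)[unfolded pathin_def] assms(2)] by auto
  obtain m0 :: nat where m0: "1 / \<delta> < real m0" using reals_Archimedean2 by blast
  show ?thesis
  proof (intro exI[of _ m0] allI impI)
    fix m assume m: "m0 \<le> m"
    have m': "1 / \<delta> < real m" using m0 m by linarith
    then have pos: "0 < m" using \<delta>(1) by (cases m) (auto simp: field_simps)
    have small: "1 / real m < \<delta>" using m' pos \<delta>(1) by (simp add: field_simps)
    show "is_fine f m \<epsilon>"
      unfolding is_fine_def
    proof (intro conjI allI impI ballI pos)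
      fix i s t assume i: "i < m" and s: "s \<in> {real i / real m .. real (Suc i) / real m}"
        and t: "t \<in> {real i / real m .. real (Suc i) / real m}"
      have w: "real (Suc i) / real m = real i / real m + 1 / real m" by (simp add: add_divide_distrib)
      have "0 \<le> real i / real m" "real (Suc i) / real m \<le> 1" using i by (auto simp: field_simps)
      then have "s \<in> {0..1}" "t \<in> {0..1}" using s t by (meson atLeastAtMost_iff order_trans)+
      then show "d (f s) (f t) < \<epsilon>"
        using s t small w by (intro \<delta>(2)) (auto simp: dist_real_def)
    qed
  qed
qed

end

lemma fraction_01: "i \<le> m \<Longrightarrow> real i / real m \<in> {0..1}"
  by (cases "m = 0") (auto simp: field_simps)

definition path_sum :: "('a \<Rightarrow> 'a \<Rightarrow> 'b::ab_group_add) \<Rightarrow> (real \<Rightarrow> 'a) \<Rightarrow> nat \<Rightarrow> 'b" where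
  "path_sum E f m = (\<Sum>i<m. E (f (real i / real m)) (f (real (Suc i) / real m)))"

lemma path_sum_cong:
  assumes "\<And>t. t \<in> {0..1} \<Longrightarrow> f t = g t"
  shows "path_sum E f m = path_sum E g m"
  unfolding path_sum_def
proof (rule sum.cong[OF refl])
  fix i assume "i \<in> {..<m}"
  then show "E (f (real i / real m)) (f (real (Suc i) / real m)) = E (g (real i / real m)) (g (real (Suc i) / real m))"
    using fraction_01[of i m] fraction_01[of "Suc i" m] by (simp add: assms)
qed

context Metric_space begin

text \<open>All points inside one coarse piece are mutually closer than \<open>\<epsilon>\<close>,
  so the cone from the first of them collapses the fine sum to the coarse summand.\<close>

lemma path_sum_refine:
  fixes E :: "'a \<Rightarrow> 'a \<Rightarrow> 'b::ab_group_add"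
  assumes tri: "\<And>x y z. x \<in> M \<Longrightarrow> y \<in> M \<Longrightarrow> z \<in> M \<Longrightarrow> d x y < \<epsilon> \<Longrightarrow> d y z < \<epsilon> \<Longrightarrow> d x z < \<epsilon> \<Longrightarrow> E x y + E y z = E x z"
    and f: "pathin mtopology f" "is_fine f m \<epsilon>" and "0 < k" and \<epsilon>: "0 < \<epsilon>"
  shows "path_sum E f (m * k) = path_sum E f m"
proof -
  have M: "f (real i / real n) \<in> M" if "i \<le> n" for i n
    using topspace_pathin[OF f(1) fraction_01[OF that]] by simp
  have E0: "E x x = 0" if "x \<in> M" for x using tri[of x x x] that \<epsilon> by simp
  have m: "0 < m" using f(2) by (simp add: is_fine_def)
  define x where "x j = f (real j / real (m * k))" for j
  have "(\<Sum>j=i*k..<i*k+k. E (x j) (x (Suc j))) = E (f (real i / real m)) (f (real (Suc i) / real m))"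
    if i: "i < m" for i
  proof -
    have e: "i * k + k = Suc i * k" by simp
    have ends: "x (i * k) = f (real i / real m)" "x (i * k + k) = f (real (Suc i) / real m)"
      using \<open>0 < k\<close> unfolding x_def e of_nat_mult by simp_all
    have "i * k + k \<le> m * k" using i by (metis Suc_leI add.commute mult_Suc mult_le_mono1)
    then have xM: "x j \<in> M" if "j \<le> i * k + k" for j using that M[of j "m * k"] by (simp add: x_def)
    have close: "d (x a) (x b) < \<epsilon>" if "i * k \<le> a" "a \<le> i * k + k" "i * k \<le> b" "b \<le> i * k + k" for a b
    proof -
      have "real i / real m \<le> real c / real (m * k)" "real c / real (m * k) \<le> real (Suc i) / real m"
        if "i * k \<le> c" "c \<le> i * k + k" for c
      proof -
        have "real i * real k \<le> real c" "real c \<le> real i * real k + real k"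
          using that by (metis of_nat_le_iff of_nat_mult, metis of_nat_add of_nat_le_iff of_nat_mult)
        then show "real i / real m \<le> real c / real (m * k)" "real c / real (m * k) \<le> real (Suc i) / real m"
          using m \<open>0 < k\<close> by (simp_all add: field_simps)
      qed
      then show ?thesis unfolding x_def using fineD[OF f(2) i] that by blast
    qed
    have "(\<Sum>j=i*k..<i*k+k. E (x j) (x (Suc j))) = E (x (i * k)) (x (i * k + k)) - E (x (i * k)) (x (i * k))"
      by (rule cone_sum) (auto intro!: tri xM close)
    then show ?thesis using E0[OF xM[of "i * k"]] by (simp add: ends)
  qed
  then have "path_sum E f m = (\<Sum>i<m. \<Sum>j=i*k..<i*k+k. E (x j) (x (Suc j)))"
    unfolding path_sum_def by (intro sum.cong) auto
  also have "\<dots> = (\<Sum>j<m * k. E (x j) (x (Suc j)))" by (rule sum.nat_group)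
  finally show ?thesis by (simp add: path_sum_def x_def)
qed

text \<open>Both sums agree with the one over the common refinement into \<open>m * n\<close>
  pieces.\<close>

lemma path_sum_unique:
  fixes E :: "'a \<Rightarrow> 'a \<Rightarrow> 'b::ab_group_add"
  assumes "\<And>x y z. x \<in> M \<Longrightarrow> y \<in> M \<Longrightarrow> z \<in> M \<Longrightarrow> d x y < \<epsilon> \<Longrightarrow> d y z < \<epsilon> \<Longrightarrow> d x z < \<epsilon> \<Longrightarrow> E x y + E y z = E x z"
    and f: "pathin mtopology f" "is_fine f m \<epsilon>" "is_fine f n \<epsilon>" and "0 < \<epsilon>"
  shows "path_sum E f m = path_sum E f n"
  using path_sum_refine[of \<epsilon> E f m n, OF assms(1) f(1,2)] path_sum_refine[of \<epsilon> E f n m, OF assms(1) f(1,3)] f assms(5)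
  by (auto simp: is_fine_def mult.commute)

text \<open>A fine triangular grid in the singular simplex reduces the claim to
  \<open>triangle_grid_sum\<close>. This is what makes sums along paths respect homology.\<close>

lemma path_sum_boundary:
  fixes E :: "'a \<Rightarrow> 'a \<Rightarrow> 'b::ab_group_add"
  assumes tri: "\<And>x y z. x \<in> M \<Longrightarrow> y \<in> M \<Longrightarrow> z \<in> M \<Longrightarrow> d x y < \<epsilon> \<Longrightarrow> d y z < \<epsilon> \<Longrightarrow> d x z < \<epsilon> \<Longrightarrow> E x y + E y z = E x z"
    and s: "singular_simplex 2 mtopology s" and \<epsilon>: "0 < \<epsilon>"
  shows "\<exists>m0. \<forall>m\<ge>m0. path_sum E (\<lambda>t. s (bary 0 (1 - t) t)) m - path_sum E (\<lambda>t. s (bary (1 - t) 0 t)) m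
    + path_sum E (\<lambda>t. s (bary (1 - t) t 0)) m = 0"
proof -
  \<comment> \<open>The simplex is flattened to a compact planar triangle, so that uniform
    continuity applies.\<close>
  define T where "T = {z::real \<times> real. 0 \<le> fst z \<and> 0 \<le> snd z \<and> fst z + snd z \<le> 1}"
  define h where "h z = s (bary (1 - fst z - snd z) (fst z) (snd z))" for z :: "real \<times> real"
  have "T \<subseteq> {0..1} \<times> {0..1}" by (auto simp: T_def)
  then have "bounded T" by (rule bounded_subset[rotated]) (intro bounded_Times bounded_closed_interval)
  moreover have "closed T"
    unfolding T_def Collect_conj_eq
    by (intro closed_Int closed_Collect_le continuous_intros)
  ultimately have "compact T" by (simp add: compact_eq_bounded_closed)
  have "continuous_map (top_of_set T) (subtopology (powertop_real UNIV) (standard_simplex 2))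
      (\<lambda>z. bary (1 - fst z - snd z) (fst z) (snd z))"
    unfolding continuous_map_in_subtopology
    by (auto simp: T_def intro!: bary_in_simplex continuous_map_bary continuous_intros)
  from continuous_map_compose[OF this] s
  have h: "continuous_map (top_of_set T) mtopology h"
    by (auto simp: singular_simplex_def o_def h_def[abs_def])
  obtain \<delta> where \<delta>: "0 < \<delta>" "\<And>x y. x \<in> T \<Longrightarrow> y \<in> T \<Longrightarrow> dist x y < \<delta> \<Longrightarrow> d (h x) (h y) < \<epsilon>"
    using uniformly_continuous[OF \<open>compact T\<close> h \<epsilon>] by blast
  \<comment> \<open>Vertices of a grid cell differ by at most \<open>1 / m\<close> in each of the
    two coordinates, hence have distance at most \<open>2 / m\<close>.\<close>
  obtain m0 :: nat where m0: "2 / \<delta> < real m0" using reals_Archimedean2 by blast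
  show ?thesis
  proof (intro exI[of _ m0] allI impI)
    fix m assume "m0 \<le> m"
    then have "2 / \<delta> < real m" using m0 by linarith
    then have m: "0 < m" "2 / real m < \<delta>" using \<delta>(1) by (cases m; auto simp: field_simps)+
    define P where "P i j = h (real i / real m, real j / real m)" for i j
    have inT: "(real i / real m, real j / real m) \<in> T" if "i + j \<le> m" for i j
      using that m unfolding T_def by (auto simp: field_simps simp flip: of_nat_add)
    have PM: "P i j \<in> M" if "i + j \<le> m" for i j
      using continuous_map_image_subset_topspace[OF h] inT[OF that] by (auto simp: P_def)
    have close: "d (P i j) (P i' j') < \<epsilon>"
      if "i + j \<le> m" "i' + j' \<le> m" "i \<le> Suc i'" "i' \<le> Suc i" "j \<le> Suc j'" "j' \<le> Suc j" for i j i' j'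
    proof -
      have "dist (real i / real m, real j / real m) (real i' / real m, real j' / real m)
        \<le> dist (real i / real m) (real i' / real m) + dist (real j / real m) (real j' / real m)"
        by (simp add: dist_Pair_Pair sqrt_sum_squares_le_sum)
      also have "\<dots> = \<bar>real i - real i'\<bar> / real m + \<bar>real j - real j'\<bar> / real m"
        by (simp add: dist_real_def flip: diff_divide_distrib)
      also have "\<dots> \<le> 1 / real m + 1 / real m"
        using that by (intro add_mono divide_right_mono) auto
      finally have "dist (real i / real m, real j / real m) (real i' / real m, real j' / real m) < \<delta>"
        using m by simp
      then show ?thesis unfolding P_def using inT that by (intro \<delta>(2)) auto
    qed
    have "(\<Sum>j<m. E (P (m - j) j) (P (m - Suc j) (Suc j))) - (\<Sum>j<m. E (P 0 j) (P 0 (Suc j)))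
      + (\<Sum>i<m. E (P i 0) (P (Suc i) 0)) = 0"
      by (rule triangle_grid_sum) (auto intro!: tri PM close)
    moreover have "path_sum E (\<lambda>t. s (bary 0 (1 - t) t)) m = (\<Sum>j<m. E (P (m - j) j) (P (m - Suc j) (Suc j)))"
      unfolding path_sum_def
    proof (rule sum.cong[OF refl])
      \<comment> \<open>The slanted side consists of the grid points with
        \<open>i + j = m\<close>.\<close>
      have e: "s (bary 0 (1 - real j / real m) (real j / real m)) = P (m - j) j" if "j \<le> m" for j
        using that m by (simp add: P_def h_def of_nat_diff diff_divide_distrib)
      fix j assume "j \<in> {..<m}"
      then show "E (s (bary 0 (1 - real j / real m) (real j / real m)))
          (s (bary 0 (1 - real (Suc j) / real m) (real (Suc j) / real m))) = E (P (m - j) j) (P (m - Suc j) (Suc j))"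
        using e[of j] e[of "Suc j"] by simp
    qed
    moreover have "path_sum E (\<lambda>t. s (bary (1 - t) 0 t)) m = (\<Sum>j<m. E (P 0 j) (P 0 (Suc j)))"
      by (simp add: path_sum_def P_def h_def)
    moreover have "path_sum E (\<lambda>t. s (bary (1 - t) t 0)) m = (\<Sum>i<m. E (P i 0) (P (Suc i) 0))"
      by (simp add: path_sum_def P_def h_def)
    ultimately show "path_sum E (\<lambda>t. s (bary 0 (1 - t) t)) m - path_sum E (\<lambda>t. s (bary (1 - t) 0 t)) m
      + path_sum E (\<lambda>t. s (bary (1 - t) t 0)) m = 0" by simp
  qed
qed

end

section \<open>Comparison of simplicial and singular homology\<close>

context compact_length_space begin

text \<open>One path is fixed for each pair of points and each bound \<open>R\<close>. Choices for
  different bounds are unrelated; they are compared by \<open>short_bigon\<close>.\<close>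

definition short :: "real \<Rightarrow> 'a \<Rightarrow> 'a \<Rightarrow> real \<Rightarrow> 'a" where
  "short R x y = (SOME \<gamma>. pathin mtopology \<gamma> \<and> \<gamma> 0 = x \<and> \<gamma> 1 = y \<and> (\<exists>L<R. length_at_most d \<gamma> L))"

lemma short:
  assumes "x \<in> M" "y \<in> M" "d x y < R"
  shows "pathin mtopology (short R x y)" "short R x y 0 = x" "short R x y 1 = y"
    "\<exists>L<R. length_at_most d (short R x y) L"
proof -
  have "\<exists>\<gamma>. pathin mtopology \<gamma> \<and> \<gamma> 0 = x \<and> \<gamma> 1 = y \<and> (\<exists>L<R. length_at_most d \<gamma> L)"
    using short_path[OF assms] by blast
  from someI_ex[OF this]
  show "pathin mtopology (short R x y)" "short R x y 0 = x" "short R x y 1 = y"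
    "\<exists>L<R. length_at_most d (short R x y) L"
    by (auto simp: short_def)
qed

definition realize :: "real \<Rightarrow> ('a list \<Rightarrow>\<^sub>0 'f::field) \<Rightarrow> (((nat \<Rightarrow> real) \<Rightarrow> 'a) \<Rightarrow>\<^sub>0 'f)" where
  "realize R = linear_extension (\<lambda>vs. path_chain (short R (vs ! 0) (vs ! 1)))"

lemma linear_realize: "plinear (realize R)"
  unfolding realize_def by (rule linear_linear_extension)

lemma realize_edge [simp]:
  "realize R (Poly_Mapping.single [x, y] (1::'f::field)) = path_chain (short R x y)"
  by (simp add: realize_def)

text \<open>The piece of \<open>f\<close> stays near its initial point by fineness, the chosen path
  by its length; so both lie in one ball in which paths with the same ends are homologous.\<close>

lemma short_path_homologous:
  assumes "\<epsilon> > 0"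
    and \<epsilon>: "\<forall>p\<in>M. \<forall>\<alpha> \<beta>. pathin mtopology \<alpha> \<longrightarrow> pathin mtopology \<beta> \<longrightarrow>
      \<alpha> ` {0..1} \<subseteq> mball p \<epsilon> \<longrightarrow> \<beta> ` {0..1} \<subseteq> mball p \<epsilon> \<longrightarrow> \<alpha> 0 = \<beta> 0 \<longrightarrow> \<alpha> 1 = \<beta> 1 \<longrightarrow>
      path_chain \<alpha> - path_chain \<beta> \<in> (sing_bds mtopology :: (_ \<Rightarrow>\<^sub>0 'f::field) set)"
    and f: "pathin mtopology f" "is_fine f m \<delta>" "i < m" and \<delta>: "\<delta> \<le> \<epsilon>"
  shows "path_chain (segment f (real i / real m) (real (Suc i) / real m))
    - path_chain (short \<delta> (f (real i / real m)) (f (real (Suc i) / real m)))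
    \<in> (sing_bds mtopology :: (_ \<Rightarrow>\<^sub>0 'f) set)"
proof -
  let ?a = "real i / real m" and ?b = "real (Suc i) / real m"
  have ab: "?a \<in> {0..1}" "?b \<in> {0..1}" "?a \<le> ?b" using f(3) by (auto simp: field_simps)
  have M: "f ?a \<in> M" "f ?b \<in> M" using topspace_pathin[OF f(1)] ab by auto
  have p: "pathin mtopology (segment f ?a ?b)" by (rule pathin_segment[OF f(1) ab(1,2)])
  note s = short[OF M fine_step[OF f(2,3)]]
  obtain L where L: "L < \<delta>" "length_at_most d (short \<delta> (f ?a) (f ?b)) L" using s(4) by blast
  have "segment f ?a ?b ` {0..1} \<subseteq> mball (f ?a) \<epsilon>"
  proof clarify
    fix t :: real assume t: "t \<in> {0..1}"
    have "(1 - t) * ?a + t * ?b \<in> {?a .. ?b}"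
      using convexD[of "{?a .. ?b}" ?a ?b "1 - t" t] ab t by auto
    then have "d (f ?a) (segment f ?a ?b t) < \<delta>"
      unfolding segment_def using ab by (intro fineD[OF f(2,3)]) auto
    then show "segment f ?a ?b t \<in> mball (f ?a) \<epsilon>"
      using M topspace_pathin[OF p t] \<delta> by auto
  qed
  moreover have "short \<delta> (f ?a) (f ?b) ` {0..1} \<subseteq> mball (f ?a) \<epsilon>"
  proof clarify
    fix t :: real assume t: "t \<in> {0..1}"
    have "d (short \<delta> (f ?a) (f ?b) 0) (short \<delta> (f ?a) (f ?b) t) \<le> L"
      by (rule length_at_most_dist[OF L(2)]) (use t in auto)
    then show "short \<delta> (f ?a) (f ?b) t \<in> mball (f ?a) \<epsilon>"
      using M topspace_pathin[OF s(1) t] \<delta> L(1) s(2) by auto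
  qed
  ultimately show ?thesis
    using \<epsilon> M p s by (auto simp: segment_def)
qed

text \<open>Replacing the pieces of a fine subdivision by chosen short paths changes a path only by
  boundaries. The cap \<open>\<delta>\<close> lets the length estimates of the applications be
  met.\<close>

lemma path_chain_homologous_short:
  assumes "0 < \<delta>" and f: "pathin mtopology f"
  shows "\<exists>\<epsilon>>0. \<epsilon> \<le> \<delta> \<and> (\<forall>m. is_fine f m \<epsilon> \<longrightarrow>
    path_chain f - path_sum (\<lambda>x y. path_chain (short \<epsilon> x y)) f m \<in> (sing_bds mtopology :: (_ \<Rightarrow>\<^sub>0 'f::field) set))"
proof -
  obtain \<epsilon> where "\<epsilon> > 0" and \<epsilon>: "\<forall>p\<in>M. \<forall>\<alpha> \<beta>. pathin mtopology \<alpha> \<longrightarrow> pathin mtopology \<beta> \<longrightarrow>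
      \<alpha> ` {0..1} \<subseteq> mball p \<epsilon> \<longrightarrow> \<beta> ` {0..1} \<subseteq> mball p \<epsilon> \<longrightarrow> \<alpha> 0 = \<beta> 0 \<longrightarrow> \<alpha> 1 = \<beta> 1 \<longrightarrow>
      path_chain \<alpha> - path_chain \<beta> \<in> (sing_bds mtopology :: (_ \<Rightarrow>\<^sub>0 'f::field) set)"
    using homologous_small_paths[where 'f = 'f] by blast
  show ?thesis
  proof (intro exI[of _ "min \<epsilon> \<delta>"] conjI allI impI)
    fix m assume m: "is_fine f m (min \<epsilon> \<delta>)"
    let ?a = "\<lambda>i. real i / real m"
    have "path_chain f - (\<Sum>i<m. path_chain (segment f (?a i) (?a (Suc i)))) \<in> (sing_bds mtopology :: (_ \<Rightarrow>\<^sub>0 'f) set)"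
      using path_chain_subdivision[OF f] m by (auto simp: is_fine_def)
    moreover have "(\<Sum>i<m. path_chain (segment f (?a i) (?a (Suc i)))
        - path_chain (short (min \<epsilon> \<delta>) (f (?a i)) (f (?a (Suc i))))) \<in> (sing_bds mtopology :: (_ \<Rightarrow>\<^sub>0 'f) set)"
      by (rule pm.subspace_sum[OF subspace_sing_bds])
        (use short_path_homologous[OF \<open>\<epsilon> > 0\<close> \<epsilon> f m] in auto)
    ultimately show "path_chain f - path_sum (\<lambda>x y. path_chain (short (min \<epsilon> \<delta>) x y)) f m
        \<in> (sing_bds mtopology :: (_ \<Rightarrow>\<^sub>0 'f) set)"
      using pm.subspace_add[OF subspace_sing_bds] unfolding path_sum_def sum_subtractf by fastforce
  qed (use assms \<open>\<epsilon> > 0\<close> in auto)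
qed

text \<open>Two realizations of one edge bound a bigon of length below
  \<open>R + R' \<le> 2 * R'\<close>. This gives compatibility with the bonding maps.\<close>

lemma realize_mono:
  assumes "R \<le> R'" "2 * R' \<le> a" and z: "z \<in> free_chains (ordered_simplices K 1)"
    and K: "\<And>\<sigma>. \<sigma> \<in> K \<Longrightarrow> \<sigma> \<subseteq> M" "\<And>x y. {x, y} \<in> K \<Longrightarrow> d x y < R"
  shows "realize R' z - realize R z \<in> (loop_span mtopology (loop_length d) a :: (_ \<Rightarrow>\<^sub>0 'f::field) set)"
proof (rule linear_chains_into[OF plinear_diff[OF linear_realize linear_realize] subspace_loop_span _ z])
  fix vs assume "vs \<in> ordered_simplices K 1"
  then obtain x y where xy: "vs = [x, y]" "{x, y} \<in> K" by (auto simp: ordered_simplices_1 simp del: One_nat_def)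
  then have M: "x \<in> M" "y \<in> M" "d x y < R" "d x y < R'" using K assms(1) by fastforce+
  note s = short[OF M(1,2,3)] and s' = short[OF M(1,2,4)]
  obtain L L' where L: "L < R" "length_at_most d (short R x y) L" "L' < R'" "length_at_most d (short R' x y) L'"
    using s(4) s'(4) by blast
  have "path_chain (short R' x y) - path_chain (short R x y)
      \<in> (loop_span mtopology (loop_length d) a :: (_ \<Rightarrow>\<^sub>0 'f) set)"
    by (rule short_bigon[OF s'(1) L(4) s(1) L(2)]) (use s s' L assms in auto)
  then show "realize R' (Poly_Mapping.single vs 1) - realize R (Poly_Mapping.single vs (1::'f))
      \<in> loop_span mtopology (loop_length d) a" by (simp add: xy)
qed

end

definition additive_on :: "'a set set \<Rightarrow> ('a \<Rightarrow> 'a \<Rightarrow> 'b::ab_group_add) \<Rightarrow> bool" where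
  "additive_on K E \<longleftrightarrow> (\<forall>u v w. {u, v, w} \<in> K \<longrightarrow> E u v + E v w = E u w)"

definition (in Metric_space) polygon :: "(nat \<Rightarrow> 'a) \<Rightarrow> nat \<Rightarrow> real \<Rightarrow> real \<Rightarrow> bool" where
  "polygon x m \<eta> L \<longleftrightarrow> (\<forall>i\<le>m. x i \<in> M) \<and> (\<forall>i<m. d (x i) (x (Suc i)) < \<eta>) \<and>
     (\<Sum>i<m. d (x i) (x (Suc i))) \<le> L"

lemma (in Metric_space) polygon_of_path:
  assumes p: "pathin mtopology f" and m: "is_fine f m \<eta>" and L: "loop_length d f \<le> ereal L"
  shows "polygon (\<lambda>i. f (real i / real m)) m \<eta> L"
  unfolding polygon_def
proof (intro conjI)
  have m': "0 < m" using m by (simp add: is_fine_def)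
  show "\<forall>i\<le>m. f (real i / real m) \<in> M" using topspace_pathin[OF p fraction_01] by auto
  show "\<forall>i<m. d (f (real i / real m)) (f (real (Suc i) / real m)) < \<eta>" using fine_step[OF m] by blast
  have "ereal (\<Sum>i<m. d (f (real i / real m)) (f (real (Suc i) / real m))) \<le> ereal L"
    using loop_length_ge_sum[OF m', of d f] L by (rule order_trans)
  then show "(\<Sum>i<m. d (f (real i / real m)) (f (real (Suc i) / real m))) \<le> L" by simp
qed

text \<open>\<open>R\<close> bounds the lengths of the paths that represent edges of \<open>K\<close>, and loops shorter than
  \<open>a\<close> are to become trivial in \<open>K\<close>. For \<open>Rips s\<close> one takes \<open>R = s\<close> and \<open>a = 3 s\<close>, for
  \<open>Cech s\<close> one takes \<open>R = 2 s\<close> and \<open>a = 4 s\<close>. The type argument fixes the field.\<close>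

locale adapted_complex = compact_length_space M d for M :: "'a set" and d +
  fixes K :: "'a set set" and R a :: real and F :: "'f::field itself"
  assumes face_closed: "face_closed K"
    and simplex_subset: "\<sigma> \<in> K \<Longrightarrow> \<sigma> \<subseteq> M"
    and small_simplex: "\<exists>\<epsilon>>0. \<forall>x\<in>M. \<forall>y\<in>M. \<forall>z\<in>M. d x y < \<epsilon> \<longrightarrow> d y z < \<epsilon> \<longrightarrow> d x z < \<epsilon> \<longrightarrow> {x, y, z} \<in> K"
    and edge_dist: "{x, y} \<in> K \<Longrightarrow> d x y < R"
    and double: "2 * R \<le> a"
    and centre: "{x, y, z} \<in> K \<Longrightarrow> \<exists>w\<in>M. \<exists>\<rho>. d w x < \<rho> \<and> d w y < \<rho> \<and> d w z < \<rho> \<and> 2 * \<rho> + R \<le> a"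
    and edge_sum: "L < R \<Longrightarrow> \<exists>\<eta>>0. \<forall>(E :: 'a \<Rightarrow> 'a \<Rightarrow> ('a list \<Rightarrow>\<^sub>0 'f)) x m.
        additive_on K E \<longrightarrow> polygon x m \<eta> L \<longrightarrow> {x 0, x m} \<in> K \<longrightarrow> (\<Sum>i<m. E (x i) (x (Suc i))) = E (x 0) (x m)"
    and loop_sum: "L < a \<Longrightarrow> \<exists>\<eta>>0. \<forall>(E :: 'a \<Rightarrow> 'a \<Rightarrow> ('a list \<Rightarrow>\<^sub>0 'f)) x m.
        additive_on K E \<longrightarrow> polygon x m \<eta> L \<longrightarrow> x 0 = x m \<longrightarrow> (\<Sum>i<m. E (x i) (x (Suc i))) = 0"
begin

section \<open>Realization and subdivision as mutually inverse maps modulo relations\<close>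

definition mesh :: real where
  "mesh = (SOME \<epsilon>. \<epsilon> > 0 \<and> (\<forall>x\<in>M. \<forall>y\<in>M. \<forall>z\<in>M. d x y < \<epsilon> \<longrightarrow> d y z < \<epsilon> \<longrightarrow> d x z < \<epsilon> \<longrightarrow> {x, y, z} \<in> K))"

lemma mesh: "mesh > 0"
  "x \<in> M \<Longrightarrow> y \<in> M \<Longrightarrow> z \<in> M \<Longrightarrow> d x y < mesh \<Longrightarrow> d y z < mesh \<Longrightarrow> d x z < mesh \<Longrightarrow> {x, y, z} \<in> K"
  using someI_ex[OF small_simplex[unfolded Bex_def]] unfolding mesh_def by blast+

lemma mesh_edge: "x \<in> M \<Longrightarrow> y \<in> M \<Longrightarrow> d x y < mesh \<Longrightarrow> {x, y} \<in> K"
  using mesh(2)[of x y y] mesh(1) by simp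

text \<open>A subdivided path may rest at a point, but \<open>[x, x]\<close> is not an ordered
  simplex; such steps count as 0.\<close>

definition edge :: "'a \<Rightarrow> 'a \<Rightarrow> ('a list \<Rightarrow>\<^sub>0 'f)" where
  "edge x y = (if x = y then 0 else Poly_Mapping.single [x, y] 1)"

text \<open>A linear stand-in for the projection modulo boundaries that stays within the type of chains.\<close>

definition proj :: "('a list \<Rightarrow>\<^sub>0 'f) \<Rightarrow> ('a list \<Rightarrow>\<^sub>0 'f)" where
  "proj = (SOME k. plinear k \<and> (\<forall>c. k c = 0 \<longleftrightarrow> c \<in> simp_bds K))"

lemma proj: "plinear proj" "proj c = 0 \<longleftrightarrow> c \<in> simp_bds K"
proof -
  have "pm.subspace (simp_bds K :: ('a list \<Rightarrow>\<^sub>0 'f) set)" by (simp add: simp_bds_def)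
  from someI_ex[OF exists_linear_projection[OF this]]
  show "plinear proj" "proj c = 0 \<longleftrightarrow> c \<in> simp_bds K" by (auto simp: proj_def)
qed

definition E :: "'a \<Rightarrow> 'a \<Rightarrow> ('a list \<Rightarrow>\<^sub>0 'f)" where
  "E x y = proj (edge x y)"

text \<open>Proper triangles use a boundary relation, the degenerate case \<open>x = z\<close> uses
  an orientation relation, and the other degenerate cases are trivial.\<close>

lemma E_triangle:
  assumes xyz: "{x, y, z} \<in> K"
  shows "E x y + E y z = E x z"
proof -
  have E0: "E u u = 0" for u by (simp add: E_def edge_def pm.linear_0[OF proj(1)])
  consider "x = y" | "y = z" | "x \<noteq> y" "x = z" | "x \<noteq> y" "y \<noteq> z" "x \<noteq> z" by blast
  then show ?thesis
  proof cases
    case 3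
    then have "{x, y} \<in> K" using xyz by (simp add: insert_commute)
    from swap_chains_1I[OF 3(1) this, where 'b = 'f]
    have "proj (Poly_Mapping.single [x, y] 1 + Poly_Mapping.single [y, x] 1) = 0"
      unfolding proj(2) simp_bds_def by (intro pm.span_base) blast
    then have "E x y + E y x = 0" using 3 by (simp add: E_def edge_def pm.linear_add[OF proj(1)])
    then show ?thesis using 3 E0 by simp
  next
    case 4
    then have "Poly_Mapping.single [x, y, z] (1::'f) \<in> free_chains (ordered_simplices K 2)"
      using xyz by (simp add: ordered_simplices_2)
    then have "proj (ordered_bdry 2 (Poly_Mapping.single [x, y, z] (1::'f))) = 0"
      unfolding proj(2) simp_bds_def by (intro pm.span_base) blast
    then show ?thesis
      using 4 by (simp add: E_def edge_def pm.linear_add[OF proj(1)] pm.linear_diff[OF proj(1)] algebra_simps)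
  qed (simp_all add: E0)
qed

lemma additive_E: "additive_on K E"
  unfolding additive_on_def using E_triangle by blast

lemma E_mesh:
  "x \<in> M \<Longrightarrow> y \<in> M \<Longrightarrow> z \<in> M \<Longrightarrow> d x y < mesh \<Longrightarrow> d y z < mesh \<Longrightarrow> d x z < mesh \<Longrightarrow> E x y + E y z = E x z"
  by (intro E_triangle mesh(2))

definition steps :: "(real \<Rightarrow> 'a) \<Rightarrow> nat" where
  "steps f = (SOME m. is_fine f m mesh)"

lemma steps: "pathin mtopology f \<Longrightarrow> is_fine f (steps f) mesh"
  using exists_fine[OF _ mesh(1), of f] unfolding steps_def by (metis order_refl someI_ex)

text \<open>The number of pieces is an arbitrary choice for every simplex; only the value after
  \<open>proj\<close> is independent of it.\<close>

definition subdivide :: "(((nat \<Rightarrow> real) \<Rightarrow> 'a) \<Rightarrow>\<^sub>0 'f) \<Rightarrow> ('a list \<Rightarrow>\<^sub>0 'f)" where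
  "subdivide = linear_extension (\<lambda>s. path_sum edge (\<lambda>t. s (bary (1 - t) t 0)) (steps (\<lambda>t. s (bary (1 - t) t 0))))"

lemma linear_subdivide: "plinear subdivide"
  unfolding subdivide_def by (rule linear_linear_extension)

lemma linear_path_sum: "plinear k \<Longrightarrow> k (path_sum e f m) = path_sum (\<lambda>x y. k (e x y)) f m"
  unfolding path_sum_def by (rule pm.linear_sum)

lemma subdivide_path_chain:
  assumes f: "pathin mtopology f" and m: "is_fine f m mesh"
  shows "proj (subdivide (path_chain f)) = path_sum E f m"
proof -
  let ?f = "\<lambda>t. path_simplex f (bary (1 - t) t 0)"
  \<comment> \<open>The path recovered from the simplex agrees with \<open>f\<close> on the unit
    interval only, so fineness and sums are carried over from one to the other.\<close>
  have f': "?f t = f t" if "t \<in> {0..1}" for t using that by simp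
  have p: "pathin mtopology ?f" by (rule path_of_simplex(1)[OF singular_simplex_path_simplex[OF f]])
  have fine: "is_fine ?f m mesh"
    unfolding is_fine_def
  proof (intro conjI allI impI ballI)
    fix i s t assume i: "i < m" and s: "s \<in> {real i / real m .. real (Suc i) / real m}"
      and t: "t \<in> {real i / real m .. real (Suc i) / real m}"
    have "real i / real m \<in> {0..1}" "real (Suc i) / real m \<in> {0..1}" using i by (intro fraction_01; simp)+
    then have "s \<in> {0..1}" "t \<in> {0..1}" using s t by (meson atLeastAtMost_iff order_trans)+
    then show "d (?f s) (?f t) < mesh" using f' s t fineD[OF m i, of s t] by auto
  qed (use m in \<open>simp add: is_fine_def\<close>)
  have "proj (subdivide (path_chain f)) = path_sum E ?f (steps ?f)"
    by (simp add: subdivide_def path_chain_def linear_path_sum[OF proj(1)] E_def[abs_def])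
  also have "\<dots> = path_sum E ?f m"
    by (rule path_sum_unique[OF E_mesh p steps[OF p] fine mesh(1)])
  also have "\<dots> = path_sum E f m" by (rule path_sum_cong[OF f'])
  finally show ?thesis .
qed

lemma subdivide_sing_bds:
  assumes "c \<in> sing_bds mtopology"
  shows "proj (subdivide c) = 0"
proof -
  obtain b where b: "b \<in> free_chains (singular_simplex_set 2 mtopology)" "c = singular_bdry 2 b"
    using assms by (auto simp: sing_bds_def)
  have "proj (subdivide (singular_bdry 2 b)) \<in> {0}"
  proof (rule linear_chains_into[OF plinear_comp[OF proj(1) plinear_comp[OF linear_subdivide singular_bdry_linear]] _ _ b(1)])
    fix s assume "s \<in> singular_simplex_set 2 mtopology"
    then have s: "singular_simplex 2 mtopology s" by simp
    let ?f0 = "\<lambda>t. s (bary 0 (1 - t) t)" and ?f1 = "\<lambda>t. s (bary (1 - t) 0 t)" and ?f2 = "\<lambda>t. s (bary (1 - t) t 0)"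
    have p: "pathin mtopology ?f0" "pathin mtopology ?f1" "pathin mtopology ?f2"
      by (rule pathin_edge_of_simplex[OF s]; auto intro!: continuous_intros)+
    obtain m0 where m0: "\<forall>m\<ge>m0. is_fine ?f0 m mesh" using exists_fine[OF p(1) mesh(1)] by blast
    obtain m1 where m1: "\<forall>m\<ge>m1. is_fine ?f1 m mesh" using exists_fine[OF p(2) mesh(1)] by blast
    obtain m2 where m2: "\<forall>m\<ge>m2. is_fine ?f2 m mesh" using exists_fine[OF p(3) mesh(1)] by blast
    obtain m3 where m3: "\<forall>m\<ge>m3. path_sum E ?f0 m - path_sum E ?f1 m + path_sum E ?f2 m = 0"
      using path_sum_boundary[of mesh E, OF E_mesh s mesh(1)] by blast
    \<comment> \<open>One number of pieces that exceeds all four thresholds.\<close>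
    define n where "n = m0 + m1 + m2 + m3"
    have "is_fine ?f0 n mesh" "is_fine ?f1 n mesh" "is_fine ?f2 n mesh"
       "path_sum E ?f0 n - path_sum E ?f1 n + path_sum E ?f2 n = 0"
      using m0 m1 m2 m3 unfolding n_def by auto
    then show "proj (subdivide (singular_bdry 2 (Poly_Mapping.single s 1))) \<in> {0}"
      by (simp add: singular_bdry_2 pm.linear_add[OF linear_subdivide] pm.linear_diff[OF linear_subdivide]
          pm.linear_add[OF proj(1)] pm.linear_diff[OF proj(1)] subdivide_path_chain p)
  qed simp
  then show ?thesis using b by simp
qed

text \<open>The length \<open>L\<close> is strictly below \<open>a\<close>, and
  \<open>loop_sum\<close> turns this gap into a fineness \<open>\<eta>\<close>. Sampling finer than
  both \<open>\<eta>\<close> and \<open>mesh\<close> gives a polygon whose edge sum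
  vanishes.\<close>

lemma subdivide_short_loop:
  assumes f: "is_loop mtopology f" "loop_length d f < ereal a"
  shows "proj (subdivide (path_chain f)) = 0"
proof -
  have p: "pathin mtopology f" and f01: "f 0 = f 1" using f by (auto simp: is_loop_def)
  have "0 \<le> loop_length d f"
    using loop_length_ge_sum[of 1 d f] nonneg[of "f 0" "f 1"] by (auto intro: order_trans[rotated])
  then obtain L where L: "loop_length d f = ereal L" "L < a" using f(2) by (cases "loop_length d f") auto
  obtain \<eta> where \<eta>: "\<eta> > 0" and sum0: "\<And>x m. polygon x m \<eta> L \<Longrightarrow> x 0 = x m \<Longrightarrow> (\<Sum>i<m. E (x i) (x (Suc i))) = 0"
    using loop_sum[OF L(2)] additive_E by blast
  obtain m0 m1 where "\<forall>m\<ge>m0. is_fine f m mesh" "\<forall>m\<ge>m1. is_fine f m \<eta>"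
    using exists_fine[OF p mesh(1)] exists_fine[OF p \<eta>] by blast
  then obtain m where m: "is_fine f m mesh" "is_fine f m \<eta>" by (metis le_add1 le_add2)
  have "0 < m" using m by (simp add: is_fine_def)
  then have "path_sum E f m = 0"
    unfolding path_sum_def using f01 L(1)
    by (intro sum0[of "\<lambda>i. f (real i / real m)"] polygon_of_path[OF p m(2)]) auto
  then show ?thesis using subdivide_path_chain[OF p m(1)] by simp
qed

lemma subdivide_loop_span:
  assumes "c \<in> loop_span mtopology (loop_length d) a"
  shows "proj (subdivide c) = 0"
proof -
  have "loop_span mtopology (loop_length d) a \<subseteq> {c. proj (subdivide c) = 0}"
    unfolding loop_span_def
  proof (rule pm.span_minimal)
    show "pm.subspace {c. proj (subdivide c) = 0}"
      by (rule pm.linear_subspace_kernel[OF plinear_comp[OF proj(1) linear_subdivide]])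
  qed (use subdivide_sing_bds subdivide_short_loop in auto)
  then show ?thesis using assms by blast
qed

lemma edge_in_M: "{x, y} \<in> K \<Longrightarrow> x \<in> M" "{x, y} \<in> K \<Longrightarrow> y \<in> M"
  using simplex_subset by blast+

text \<open>The realized boundary of a triangle may be longer than \<open>a\<close>. It is the sum
  of three triangles with apex \<open>w\<close> and perimeter below
  \<open>2 * \<rho> + R \<le> a\<close>, whose spokes cancel.\<close>

lemma realize_loop_span:
  assumes "c \<in> simp_bds K"
  shows "realize R c \<in> (loop_span mtopology (loop_length d) a :: (_ \<Rightarrow>\<^sub>0 'f) set)"
proof -
  let ?L = "loop_span mtopology (loop_length d) a :: (_ \<Rightarrow>\<^sub>0 'f) set"
  \<comment> \<open>Going along an edge and back is a loop shorter than \<open>2 * R\<close>, which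
    \<open>double\<close> bounds by \<open>a\<close>.\<close>
  have swap: "path_chain (short R x y) + path_chain (short R y x) \<in> ?L" if xy: "{x, y} \<in> K" for x y
  proof -
    have M: "x \<in> M" "y \<in> M" "d x y < R" "d y x < R" using edge_in_M[OF xy] edge_dist[OF xy] commute[of y x] by auto
    obtain L1 L2 where L: "L1 < R" "length_at_most d (short R x y) L1" "L2 < R" "length_at_most d (short R y x) L2"
      using short(4)[OF M(1,2,3)] short(4)[OF M(2,1,4)] by blast
    have "path_chain (short R x y) + path_chain (short R y x) - path_chain (\<lambda>_. x) \<in> ?L"
      by (rule short_triangle[OF short(1)[OF M(1,2,3)] L(2) short(1)[OF M(2,1,4)] L(4) _ length_at_most_const])
        (use M L double short[OF M(1,2,3)] short[OF M(2,1,4)] in auto)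
    moreover have "path_chain (\<lambda>_. x) \<in> ?L" using path_chain_const[of x mtopology] M sing_bds_loop_span by auto
    ultimately show ?thesis using pm.subspace_add[OF subspace_loop_span] by fastforce
  qed
  have triangle: "path_chain (short R y z) - path_chain (short R x z) + path_chain (short R x y) \<in> ?L"
    if xyz: "{x, y, z} \<in> K" for x y z
  proof -
    obtain w \<rho> where w: "w \<in> M" "d w x < \<rho>" "d w y < \<rho>" "d w z < \<rho>" "2 * \<rho> + R \<le> a" using centre[OF xyz] by blast
    have cone: "path_chain (short \<rho> w u) + path_chain (short R u v) - path_chain (short \<rho> w v) \<in> ?L"
      if uv: "{u, v} \<subseteq> {x, y, z}" for u v
    proof -
      have uvK: "{u, v} \<in> K" by (rule face_closedD[OF face_closed xyz uv]) simp
      have M: "u \<in> M" "v \<in> M" "d u v < R" using edge_in_M[OF uvK] edge_dist[OF uvK] by auto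
      have wuv: "d w u < \<rho>" "d w v < \<rho>" using uv w by auto
      note s = short[OF w(1) M(1) wuv(1)] short[OF w(1) M(2) wuv(2)] short[OF M]
      obtain L1 L2 L3 where L: "L1 < \<rho>" "length_at_most d (short \<rho> w u) L1" "L2 < \<rho>" "length_at_most d (short \<rho> w v) L2"
          "L3 < R" "length_at_most d (short R u v) L3"
        using s(4,8,12) by blast
      show ?thesis by (rule short_triangle[OF s(1) L(2) s(9) L(6) s(5) L(4)]) (use s L w(5) in auto)
    qed
    have "path_chain (short R y z) - path_chain (short R x z) + path_chain (short R x y) =
        (path_chain (short \<rho> w y) + path_chain (short R y z) - path_chain (short \<rho> w z))
        - (path_chain (short \<rho> w x) + path_chain (short R x z) - path_chain (short \<rho> w z))
        + (path_chain (short \<rho> w x) + path_chain (short R x y) - path_chain (short \<rho> w y) :: _ \<Rightarrow>\<^sub>0 'f)"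
      by (simp add: algebra_simps)
    also have "\<dots> \<in> ?L"
      by (intro pm.subspace_add[OF subspace_loop_span] pm.subspace_diff[OF subspace_loop_span] cone) auto
    finally show ?thesis .
  qed
  have "simp_bds K \<subseteq> {c. realize R c \<in> ?L}"
    unfolding simp_bds_def
  proof (rule pm.span_minimal)
    show "pm.subspace {c. realize R c \<in> ?L}"
      by (rule pm.linear_subspace_linear_preimage[OF linear_realize subspace_loop_span])
    have "realize R (ordered_bdry 2 c) \<in> ?L" if c: "c \<in> free_chains (ordered_simplices K 2)" for c
    proof (rule linear_chains_into[OF plinear_comp[OF linear_realize ordered_bdry_linear] subspace_loop_span _ c])
      fix vs assume "vs \<in> ordered_simplices K 2"
      then obtain x y z where "vs = [x, y, z]" "{x, y, z} \<in> K" by (auto simp: ordered_simplices_2)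
      then show "realize R (ordered_bdry 2 (Poly_Mapping.single vs 1)) \<in> ?L"
        using triangle by (simp add: pm.linear_add[OF linear_realize] pm.linear_diff[OF linear_realize])
    qed
    moreover have "realize R c \<in> ?L" if "c \<in> swap_chains K 1" for c
    proof (rule swap_chains_1E[OF that])
      fix x y assume "x \<noteq> y" "{x, y} \<in> K" "c = Poly_Mapping.single [x, y] 1 + Poly_Mapping.single [y, x] 1"
      then show ?thesis using swap by (simp add: pm.linear_add[OF linear_realize])
    qed
    ultimately show "swap_chains K 1 \<union> ordered_bdry 2 ` free_chains (ordered_simplices K 2) \<subseteq> {c. realize R c \<in> ?L}"
      by auto
  qed
  then show ?thesis using assms by blast
qed

text \<open>The path representing an edge is shorter than \<open>R\<close>, so by
  \<open>edge_sum\<close> its fine polygon contributes the same as the edge itself.\<close>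

lemma subdivide_realize:
  assumes z: "z \<in> free_chains (ordered_simplices K 1)"
  shows "proj (subdivide (realize R z)) = proj z"
proof -
  have "proj (subdivide (realize R z)) - proj z \<in> {0}"
  proof (rule linear_chains_into[OF plinear_diff[OF plinear_comp[OF proj(1) plinear_comp[OF linear_subdivide linear_realize]] proj(1)] _ _ z])
    fix vs assume "vs \<in> ordered_simplices K 1"
    then obtain x y where xy: "vs = [x, y]" "x \<noteq> y" "{x, y} \<in> K" by (auto simp: ordered_simplices_1 simp del: One_nat_def)
    have M: "x \<in> M" "y \<in> M" "d x y < R" using edge_in_M[OF xy(3)] edge_dist[OF xy(3)] by auto
    let ?f = "short R x y"
    note s = short[OF M]
    obtain L where L: "L < R" "length_at_most d ?f L" using s(4) by blast
    obtain \<eta> where \<eta>: "\<eta> > 0" and sumE: "\<And>x m. polygon x m \<eta> L \<Longrightarrow> {x 0, x m} \<in> K \<Longrightarrow>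
        (\<Sum>i<m. E (x i) (x (Suc i))) = E (x 0) (x m)"
      using edge_sum[OF L(1)] additive_E by blast
    obtain m0 m1 where "\<forall>m\<ge>m0. is_fine ?f m mesh" "\<forall>m\<ge>m1. is_fine ?f m \<eta>"
      using exists_fine[OF s(1) mesh(1)] exists_fine[OF s(1) \<eta>] by blast
    then obtain m where m: "is_fine ?f m mesh" "is_fine ?f m \<eta>" by (metis le_add1 le_add2)
    have m': "0 < m" using m by (simp add: is_fine_def)
    have "path_sum E ?f m = E (?f (real 0 / real m)) (?f (real m / real m))"
      unfolding path_sum_def
      by (rule sumE[of "\<lambda>i. ?f (real i / real m)", OF polygon_of_path[OF s(1) m(2) loop_length_le[OF L(2)]]])
        (use s xy m' in simp_all)
    also have "\<dots> = E x y" using s m' by simp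
    finally show "proj (subdivide (realize R (Poly_Mapping.single vs 1))) - proj (Poly_Mapping.single vs 1) \<in> {0}"
      using subdivide_path_chain[OF s(1) m(1)] xy by (simp add: E_def edge_def)
  qed simp
  then show ?thesis by simp
qed

text \<open>Injectivity: modulo boundaries \<open>subdivide\<close> undoes \<open>realize\<close>,
  and it kills short loops.\<close>

lemma realize_in_loop_span_iff:
  assumes "z \<in> free_chains (ordered_simplices K 1)"
  shows "realize R z \<in> (loop_span mtopology (loop_length d) a :: (_ \<Rightarrow>\<^sub>0 'f) set) \<longleftrightarrow> z \<in> simp_bds K"
  using realize_loop_span subdivide_loop_span[of "realize R z"] subdivide_realize[OF assms] proj(2) by auto

text \<open>\<open>pt\<close> turns vertices into point simplices; the boundary of a realized chain
  is the \<open>pt\<close> of its simplicial boundary.\<close>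

lemma realize_cycle:
  assumes z: "z \<in> simp_cycles K"
  shows "realize R z \<in> (sing_cycles mtopology :: (_ \<Rightarrow>\<^sub>0 'f) set)"
proof -
  define pt where "pt = (linear_extension (\<lambda>vs. Poly_Mapping.single (point_simplex (hd vs)) 1)
      :: ('a list \<Rightarrow>\<^sub>0 'f) \<Rightarrow> (((nat \<Rightarrow> real) \<Rightarrow> 'a) \<Rightarrow>\<^sub>0 'f))"
  have pt: "plinear pt" unfolding pt_def by (rule linear_linear_extension)
  have zc: "z \<in> free_chains (ordered_simplices K 1)" "ordered_bdry 1 z = 0" using z by (auto simp: simp_cycles_def)
  have e: "realize R (Poly_Mapping.single vs (1::'f)) \<in> free_chains (singular_simplex_set 1 mtopology)"
       "singular_bdry 1 (realize R (Poly_Mapping.single vs 1)) - pt (ordered_bdry 1 (Poly_Mapping.single vs (1::'f))) \<in> {0}"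
    if vs: "vs \<in> ordered_simplices K 1" for vs
  proof -
    obtain x y where xy: "vs = [x, y]" "{x, y} \<in> K" using vs by (auto simp: ordered_simplices_1 simp del: One_nat_def)
    have M: "x \<in> M" "y \<in> M" "d x y < R" using edge_in_M[OF xy(2)] edge_dist[OF xy(2)] by auto
    show "realize R (Poly_Mapping.single vs (1::'f)) \<in> free_chains (singular_simplex_set 1 mtopology)"
      using path_chain_in_chains[OF short(1)[OF M]] xy by simp
    show "singular_bdry 1 (realize R (Poly_Mapping.single vs 1)) - pt (ordered_bdry 1 (Poly_Mapping.single vs (1::'f))) \<in> {0}"
      unfolding xy realize_edge singular_bdry_path_chain ordered_bdry_1 pm.linear_diff[OF pt]
      by (simp add: pt_def short[OF M])
  qed
  have "singular_bdry 1 (realize R z) - pt (ordered_bdry 1 z) \<in> {0}"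
    by (rule linear_chains_into[OF plinear_diff[OF plinear_comp[OF singular_bdry_linear linear_realize]
          plinear_comp[OF pt ordered_bdry_linear]] _ _ zc(1)]) (use e in auto)
  moreover have "realize R z \<in> free_chains (singular_simplex_set 1 mtopology)"
    by (rule linear_chains_into[OF linear_realize subspace_chains _ zc(1)]) (use e in auto)
  ultimately show ?thesis using zc pm.linear_0[OF pt] by (simp add: sing_cycles_def del: One_nat_def)
qed

lemma bary_in_standard_simplex_0: "bary 1 0 0 \<in> standard_simplex 0"
  by (auto simp: standard_simplex_0 bary_def fun_eq_iff)

lemma edge_bdry: "ordered_bdry 1 (edge x y) = Poly_Mapping.single [y] 1 - Poly_Mapping.single [x] 1"
  by (simp add: edge_def pm.linear_0[OF ordered_bdry_linear] del: One_nat_def)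

text \<open>For the last claim the simplex passes through three stages: paths shorter than
  \<open>\<epsilon>\<close> over a very fine subdivision, realized edges over the same subdivision,
  realized edges over the subdivision that \<open>steps\<close> has chosen.\<close>

lemma subdivide_singular_simplex:
  assumes s: "singular_simplex 1 mtopology s"
  shows "subdivide (Poly_Mapping.single s 1) \<in> free_chains (ordered_simplices K 1)"
    "ordered_bdry 1 (subdivide (Poly_Mapping.single s 1)) =
      Poly_Mapping.single [s (bary 0 1 0)] 1 - Poly_Mapping.single [s (bary 1 0 0)] 1"
    "Poly_Mapping.single s 1 - realize R (subdivide (Poly_Mapping.single s 1))
      \<in> (loop_span mtopology (loop_length d) a :: (_ \<Rightarrow>\<^sub>0 'f) set)"
proof -
  let ?L = "loop_span mtopology (loop_length d) a :: (_ \<Rightarrow>\<^sub>0 'f) set"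
  define f where "f = (\<lambda>t. s (bary (1 - t) t 0))"
  have f: "pathin mtopology f" "path_simplex f = s" using path_of_simplex[OF s] by (auto simp: f_def)
  define m where "m = steps f"
  have m: "is_fine f m mesh" "0 < m" using steps[OF f(1)] by (auto simp: m_def is_fine_def)
  have sub: "subdivide (Poly_Mapping.single s 1) = path_sum edge f m"
    by (simp add: subdivide_def f_def m_def)
  have M: "f (real i / real m) \<in> M" if "i \<le> m" for i using topspace_pathin[OF f(1) fraction_01[OF that]] by simp
  have K: "{f (real i / real m), f (real (Suc i) / real m)} \<in> K" if "i < m" for i
    using that by (intro mesh_edge M fine_step[OF m(1)]) auto
  show "subdivide (Poly_Mapping.single s 1) \<in> free_chains (ordered_simplices K 1)"
    unfolding sub path_sum_def
  proof (rule pm.subspace_sum[OF subspace_chains])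
    fix i assume "i \<in> {..<m}"
    then show "edge (f (real i / real m)) (f (real (Suc i) / real m)) \<in> free_chains (ordered_simplices K 1)"
      using K[of i] pm.subspace_0[OF subspace_chains[of "ordered_simplices K 1"]]
      by (auto simp: edge_def ordered_simplices_1 simp del: One_nat_def of_nat_Suc)
  qed
  have "ordered_bdry 1 (path_sum edge f m) = (\<Sum>i<m. Poly_Mapping.single [f (real (Suc i) / real m)] 1
      - Poly_Mapping.single [f (real i / real m)] 1)"
    by (simp add: path_sum_def pm.linear_sum[OF ordered_bdry_linear] edge_bdry del: One_nat_def)
  also have "\<dots> = Poly_Mapping.single [f (real m / real m)] 1 - Poly_Mapping.single [f (real 0 / real m)] 1"
    by (rule sum_lessThan_telescope)
  finally show "ordered_bdry 1 (subdivide (Poly_Mapping.single s 1)) =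
      Poly_Mapping.single [s (bary 0 1 0)] 1 - Poly_Mapping.single [s (bary 1 0 0)] 1"
    using m(2) by (simp add: sub f_def)
  \<comment> \<open>Makes \<open>min mesh R\<close> a legitimate cap for
    \<open>\<epsilon>\<close>.\<close>
  have "0 < R"
  proof -
    have "{f 0, f 0} \<in> K" using M[of 0] mesh(1) by (intro mesh_edge) auto
    then show ?thesis using edge_dist[of "f 0" "f 0"] M[of 0] by simp
  qed
  then obtain \<epsilon> where \<epsilon>: "0 < \<epsilon>" "\<epsilon> \<le> mesh" "\<epsilon> \<le> R" and fine_sum: "\<And>n. is_fine f n \<epsilon> \<Longrightarrow>
      path_chain f - path_sum (\<lambda>x y. path_chain (short \<epsilon> x y)) f n \<in> (sing_bds mtopology :: (_ \<Rightarrow>\<^sub>0 'f) set)"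
    using path_chain_homologous_short[OF _ f(1), of "min mesh R", where 'f = 'f] mesh(1) by auto
  obtain n where n: "is_fine f n \<epsilon>" using exists_fine[OF f(1) \<epsilon>(1)] by blast
  have n': "is_fine f n mesh" using n \<epsilon>(2) unfolding is_fine_def by (meson less_le_trans)
  have Mn: "f (real i / real n) \<in> M" if "i \<le> n" for i using topspace_pathin[OF f(1) fraction_01[OF that]] by simp
  \<comment> \<open>The two realizations form a bigon of length below
    \<open>\<epsilon> + R \<le> 2 * R\<close>; for \<open>x = y\<close> the second one is replaced
    by a constant path.\<close>
  have local: "path_chain (short \<epsilon> x y) - realize R (edge x y) \<in> ?L" if xy: "x \<in> M" "y \<in> M" "d x y < \<epsilon>" for x y
  proof (cases "x = y")
    case True
    note s = short[OF xy]
    obtain L where L: "L < \<epsilon>" "length_at_most d (short \<epsilon> x y) L" using s(4) by blast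
    have "path_chain (short \<epsilon> x y) - path_chain (\<lambda>_. x) \<in> ?L"
      by (rule short_bigon[OF s(1) L(2) _ length_at_most_const]) (use s L \<epsilon> \<open>0 < R\<close> double xy True in auto)
    moreover have "path_chain (\<lambda>_. x) \<in> ?L" using path_chain_const[of x mtopology] xy sing_bds_loop_span by auto
    ultimately show ?thesis
      using True pm.subspace_add[OF subspace_loop_span] by (fastforce simp: edge_def pm.linear_0[OF linear_realize])
  next
    case False
    have R: "d x y < R" using xy \<epsilon> by simp
    note s = short[OF xy] and s' = short[OF xy(1,2) R]
    obtain L L' where L: "L < \<epsilon>" "length_at_most d (short \<epsilon> x y) L" "L' < R" "length_at_most d (short R x y) L'"
      using s(4) s'(4) by blast
    have "path_chain (short \<epsilon> x y) - path_chain (short R x y) \<in> ?L"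
      by (rule short_bigon[OF s(1) L(2) s'(1) L(4)]) (use s s' L \<epsilon> double in auto)
    then show ?thesis using False by (simp add: edge_def)
  qed
  have "path_sum (\<lambda>x y. path_chain (short \<epsilon> x y)) f n - realize R (path_sum edge f n) \<in> ?L"
    unfolding linear_path_sum[OF linear_realize] unfolding path_sum_def sum_subtractf[symmetric]
    by (rule pm.subspace_sum[OF subspace_loop_span]) (auto intro!: local Mn fine_step[OF n] simp del: of_nat_Suc)
  moreover have "path_chain f - path_sum (\<lambda>x y. path_chain (short \<epsilon> x y)) f n \<in> ?L"
    using fine_sum[OF n] sing_bds_loop_span by blast
  \<comment> \<open>The two subdivisions differ by a boundary in \<open>K\<close>, and
    \<open>realize\<close> maps it into the span of short loops.\<close>
  moreover have "realize R (path_sum edge f n) - realize R (path_sum edge f m) \<in> ?L"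
  proof -
    have "proj (path_sum edge f n - path_sum edge f m) = 0"
      using path_sum_unique[OF E_mesh f(1) n' m(1) mesh(1)]
      by (simp add: pm.linear_diff[OF proj(1)] linear_path_sum[OF proj(1)] E_def[abs_def])
    then show ?thesis
      using realize_loop_span by (simp add: proj(2) flip: pm.linear_diff[OF linear_realize])
  qed
  ultimately have "path_chain f - path_sum (\<lambda>x y. path_chain (short \<epsilon> x y)) f n
      + (path_sum (\<lambda>x y. path_chain (short \<epsilon> x y)) f n - realize R (path_sum edge f n))
      + (realize R (path_sum edge f n) - realize R (path_sum edge f m)) \<in> ?L"
    by (intro pm.subspace_add[OF subspace_loop_span])
  then show "Poly_Mapping.single s 1 - realize R (subdivide (Poly_Mapping.single s 1)) \<in> ?L"
    by (simp add: sub path_chain_def f(2))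
qed

text \<open>The preimage is \<open>subdivide y\<close>. It is a cycle because its boundary is
  \<open>pt\<close> of the boundary of \<open>y\<close>, where \<open>pt\<close> reads the point off
  a point simplex.\<close>

lemma realize_surj:
  assumes y: "y \<in> (sing_cycles mtopology :: (_ \<Rightarrow>\<^sub>0 'f) set)"
  shows "\<exists>x\<in>simp_cycles K. y - realize R x \<in> (loop_span mtopology (loop_length d) a :: (_ \<Rightarrow>\<^sub>0 'f) set)"
proof
  define pt where "pt = (linear_extension (\<lambda>s. Poly_Mapping.single [s (bary 1 0 0)] 1)
      :: (((nat \<Rightarrow> real) \<Rightarrow> 'a) \<Rightarrow>\<^sub>0 'f) \<Rightarrow> ('a list \<Rightarrow>\<^sub>0 'f))"
  have pt: "plinear pt" unfolding pt_def by (rule linear_linear_extension)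
  have yc: "y \<in> free_chains (singular_simplex_set 1 mtopology)" "singular_bdry 1 y = 0"
    using y by (auto simp: sing_cycles_def)
  have "y - realize R (subdivide y) \<in> (loop_span mtopology (loop_length d) a :: (_ \<Rightarrow>\<^sub>0 'f) set)"
    by (rule linear_chains_into[OF plinear_diff[OF plinear_id plinear_comp[OF linear_realize linear_subdivide]]
          subspace_loop_span _ yc(1)])
      (use subdivide_singular_simplex(3) in auto)
  then show "y - realize R (subdivide y) \<in> (loop_span mtopology (loop_length d) a :: (_ \<Rightarrow>\<^sub>0 'f) set)" .
  have "ordered_bdry 1 (subdivide y) - pt (singular_bdry 1 y) \<in> {0}"
  proof (rule linear_chains_into[OF plinear_diff[OF plinear_comp[OF ordered_bdry_linear linear_subdivide]
          plinear_comp[OF pt singular_bdry_linear]] _ _ yc(1)])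
    fix s assume "s \<in> singular_simplex_set 1 mtopology"
    then have s: "singular_simplex 1 mtopology s" by simp
    have "pt (singular_bdry 1 (path_chain (\<lambda>t. s (bary (1 - t) t 0)))) =
        Poly_Mapping.single [s (bary 0 1 0)] 1 - Poly_Mapping.single [s (bary 1 0 0)] 1"
      unfolding singular_bdry_path_chain pm.linear_diff[OF pt]
      using bary_in_standard_simplex_0 by (simp add: pt_def point_simplex_def)
    then show "ordered_bdry 1 (subdivide (Poly_Mapping.single s 1)) - pt (singular_bdry 1 (Poly_Mapping.single s 1)) \<in> {0}"
      unfolding subdivide_singular_simplex(2)[OF s] path_chain_def path_of_simplex(2)[OF s] by simp
  qed simp
  moreover have "subdivide y \<in> free_chains (ordered_simplices K 1)"
    by (rule linear_chains_into[OF linear_subdivide subspace_chains _ yc(1)])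
      (use subdivide_singular_simplex(1) in auto)
  ultimately show "subdivide y \<in> simp_cycles K"
    using yc pm.linear_0[OF pt] by (simp add: simp_cycles_def del: One_nat_def)
qed

end

section \<open>Rips and Cech complexes\<close>

text \<open>With \<open>c\<close> the length run through so far, this walks from \<open>k\<close>
  until length \<open>\<delta>\<close> is gained or the polygon ends. As single steps are below
  \<open>\<eta>\<close>, the overshoot is, too.\<close>

lemma greedy_partial_sum:
  fixes c :: "nat \<Rightarrow> real"
  assumes "\<And>i. i < m \<Longrightarrow> c (Suc i) - c i < \<eta>" "0 < \<eta>" "0 \<le> \<delta>" "k \<le> m"
  shows "\<exists>i. k \<le> i \<and> i \<le> m \<and> c i - c k < \<delta> + \<eta> \<and> (\<delta> \<le> c i - c k \<or> i = m)"
proof (cases "\<exists>i\<ge>k. i \<le> m \<and> \<delta> \<le> c i - c k")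
  case True
  let ?P = "\<lambda>i. k \<le> i \<and> i \<le> m \<and> \<delta> \<le> c i - c k"
  let ?i = "LEAST i. ?P i"
  have i: "?P ?i" by (rule LeastI_ex) (use True in auto)
  have "c ?i - c k < \<delta> + \<eta>"
  proof (cases "?i = k")
    case True then show ?thesis using assms by simp
  next
    case False
    \<comment> \<open>The index before the least one has gained less than
      \<open>\<delta>\<close>.\<close>
    then obtain j where j: "?i = Suc j" "k \<le> j" using i by (cases ?i) auto
    then have "c j - c k < \<delta>" using not_less_Least[of j ?P] i by auto
    then show ?thesis using assms(1)[of j] i j by simp
  qed
  then show ?thesis using i by blast
next
  case False
  then show ?thesis using assms by (intro exI[of _ m]) force
qed

context Metric_space begin

lemma dist_le_partial_sum:
  assumes "\<And>i. i \<le> m \<Longrightarrow> x i \<in> M" "i \<le> j" "j \<le> m"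
  shows "d (x i) (x j) \<le> (\<Sum>k<j. d (x k) (x (Suc k))) - (\<Sum>k<i. d (x k) (x (Suc k)))"
  using assms(2,3)
proof (induction j)
  case (Suc j)
  show ?case
  proof (cases "i = Suc j")
    case False
    then have "d (x i) (x j) \<le> (\<Sum>k<j. d (x k) (x (Suc k))) - (\<Sum>k<i. d (x k) (x (Suc k)))" using Suc by auto
    moreover have "d (x i) (x (Suc j)) \<le> d (x i) (x j) + d (x j) (x (Suc j))"
      using Suc.prems by (intro triangle assms(1)) auto
    ultimately show ?thesis by simp
  qed (use assms Suc in auto)
qed (use assms in auto)

text \<open>The condition common to both complexes: it describes Rips triangles, and in the Cech
  case \<open>p\<close> itself is the centre of the ball.\<close>

definition star :: "'a set set \<Rightarrow> real \<Rightarrow> bool" where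
  "star K s \<longleftrightarrow> (\<forall>p\<in>M. \<forall>y\<in>M. \<forall>z\<in>M. d p y < s \<longrightarrow> d p z < s \<longrightarrow> d y z < s \<longrightarrow> {p, y, z} \<in> K)"

lemma starD: "star K s \<Longrightarrow> p \<in> M \<Longrightarrow> y \<in> M \<Longrightarrow> z \<in> M \<Longrightarrow> d p y < s \<Longrightarrow> d p z < s \<Longrightarrow> d y z < s \<Longrightarrow> {p, y, z} \<in> K"
  by (auto simp: star_def)

lemma additive_onD: "additive_on K E \<Longrightarrow> {u, v, w} \<in> K \<Longrightarrow> E u v + E v w = E u w"
  by (auto simp: additive_on_def)

lemma additive_refl:
  assumes "star K s" "0 < s" "additive_on K E" "p \<in> M"
  shows "E p p = 0"
  using additive_onD[OF assms(3), of p p p] starD[OF assms(1), of p p p] assms(2,4) by simp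

lemma polygonD:
  assumes "polygon x m \<eta> L"
  shows "\<And>i. i \<le> m \<Longrightarrow> x i \<in> M"
    "\<And>i. i < m \<Longrightarrow> (\<Sum>k<Suc i. d (x k) (x (Suc k))) - (\<Sum>k<i. d (x k) (x (Suc k))) < \<eta>"
    "(\<Sum>k<m. d (x k) (x (Suc k))) \<le> L"
  using assms by (auto simp: polygon_def)

text \<open>All points of an arc shorter than \<open>s\<close> are within \<open>s\<close> of its
  initial point, so the cone from there consists of simplices.\<close>

lemma arc_sum:
  fixes E :: "'a \<Rightarrow> 'a \<Rightarrow> 'b::ab_group_add"
  assumes K: "star K s" "0 < s" "additive_on K E" and poly: "polygon x m \<eta> L" and ij: "i \<le> j" "j \<le> m"
    and len: "(\<Sum>k<j. d (x k) (x (Suc k))) - (\<Sum>k<i. d (x k) (x (Suc k))) < s"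
  shows "(\<Sum>k=i..<j. E (x k) (x (Suc k))) = E (x i) (x j)"
proof -
  define c where "c j = (\<Sum>k<j. d (x k) (x (Suc k)))" for j
  note x = polygonD(1)[OF poly]
  have dc: "d (x a) (x b) \<le> c b - c a" if "a \<le> b" "b \<le> m" for a b
    unfolding c_def by (rule dist_le_partial_sum[OF x that])
  have mono: "c a \<le> c b" if "a \<le> b" "b \<le> m" for a b using dc[OF that] nonneg[of "x a" "x b"] by linarith
  have "(\<Sum>k=i..<j. E (x k) (x (Suc k))) = E (x i) (x j) - E (x i) (x i)"
  proof (rule cone_sum[OF ij(1)])
    fix k assume k: "i \<le> k" "k < j"
    have "d (x i) (x k) < s" "d (x i) (x (Suc k)) < s" "d (x k) (x (Suc k)) < s"
      using dc[of i k] dc[of i "Suc k"] dc[of k "Suc k"] mono[of k j] mono[of "Suc k" j] mono[of i k] k ij len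
      unfolding c_def[symmetric] by auto
    then show "E (x i) (x k) + E (x k) (x (Suc k)) = E (x i) (x (Suc k))"
      using k ij by (intro additive_onD[OF K(3)] starD[OF K(1)] x) auto
  qed
  then show ?thesis using additive_refl[OF K] x ij by simp
qed

lemma sum_split_at:
  fixes h :: "nat \<Rightarrow> 'b::ab_group_add"
  assumes "i \<le> j" "j \<le> m"
  shows "(\<Sum>k=i..<m. h k) = (\<Sum>k=i..<j. h k) + (\<Sum>k=j..<m. h k)"
  using sum.atLeastLessThan_concat[OF assms, of h] by simp

lemma polygon_length_nonneg: "0 \<le> (\<Sum>k<m. d (x k) (x (Suc k)))"
  by (simp add: sum_nonneg)

lemma rips_edge_sum:
  fixes E :: "'a \<Rightarrow> 'a \<Rightarrow> 'b::ab_group_add"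
  assumes K: "star K s" "0 < s" "additive_on K E" and x: "polygon x m \<eta> L" and L: "L < s"
  shows "(\<Sum>i<m. E (x i) (x (Suc i))) = E (x 0) (x m)"
  using arc_sum[OF K x, of 0 m] polygonD(3)[OF x] L
  by (simp add: lessThan_atLeast0)

text \<open>Cuts the polygon into three arcs shorter than \<open>s\<close>. Their end points form a
  triangle of diameter below \<open>s\<close>.\<close>

lemma rips_loop_sum:
  fixes E :: "'a \<Rightarrow> 'a \<Rightarrow> 'b::ab_group_add"
  assumes K: "star K s" "0 < s" "additive_on K E" and x: "polygon x m (s - L / 3) L" and L: "L < 3 * s" and e: "x 0 = x m"
  shows "(\<Sum>i<m. E (x i) (x (Suc i))) = 0"
proof -
  define c where "c j = (\<Sum>k<j. d (x k) (x (Suc k)))" for j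
  note D = polygonD[OF x, folded c_def]
  have c: "0 \<le> c m" "c 0 = 0" using polygon_length_nonneg[of x m] by (auto simp: c_def)
  have dc: "d (x a) (x b) \<le> c b - c a" if "a \<le> b" "b \<le> m" for a b
    unfolding c_def by (rule dist_le_partial_sum[OF D(1) that])
  have arc: "(\<Sum>k=a..<b. E (x k) (x (Suc k))) = E (x a) (x b)" if "a \<le> b" "b \<le> m" "c b - c a < s" for a b
    using arc_sum[OF K x that(1,2)] that(3) by (simp add: c_def)
  \<comment> \<open>A greedy arc is shorter than \<open>c m / 3 + (s - L / 3) \<le> s\<close>, which
    is the origin of the step bound \<open>s - L / 3\<close>.\<close>
  have pos: "0 < s - L / 3" "0 \<le> c m / 3" using L c by auto
  obtain i where i: "i \<le> m" "c i - c 0 < c m / 3 + (s - L / 3)" "c m / 3 \<le> c i - c 0 \<or> i = m"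
    using greedy_partial_sum[of m c, OF D(2) pos, of 0] by auto
  obtain j where j: "i \<le> j" "j \<le> m" "c j - c i < c m / 3 + (s - L / 3)" "c m / 3 \<le> c j - c i \<or> j = m"
    using greedy_partial_sum[of m c, OF D(2) pos i(1)] by auto
  \<comment> \<open>Either both walks gained a third of the length, leaving at most a third for the
    last arc, or the end was reached and the last arc is empty.\<close>
  have arcs: "c i - c 0 < s" "c j - c i < s" "c m - c j < s"
    using i j D(3) c K(2) L by (auto simp: field_simps)
  have d0j: "d (x 0) (x j) < s" using dc[of j m] commute[of "x j" "x m"] e j arcs by simp
  have "(\<Sum>k<m. E (x k) (x (Suc k))) = E (x 0) (x i) + (E (x i) (x j) + E (x j) (x m))"
    using arcs i j
    by (simp add: lessThan_atLeast0 arc sum_split_at[of 0 i m] sum_split_at[of i j m] )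
  also have "\<dots> = E (x 0) (x j) + E (x j) (x 0)"
  proof -
    have "{x 0, x i, x j} \<in> K"
      using dc[of 0 i] dc[of i j] d0j i j arcs
      by (intro starD[OF K(1)] D(1)) auto
    from additive_onD[OF K(3) this] show ?thesis using e by (simp add: algebra_simps)
  qed
  also have "\<dots> = E (x 0) (x 0)"
    using d0j commute[of "x j" "x 0"] j K(2)
    by (intro additive_onD[OF K(3)] starD[OF K(1)] D(1)) (auto simp: D(1))
  also have "\<dots> = 0" by (rule additive_refl[OF K D(1)]) simp
  finally show ?thesis .
qed

definition centred :: "'a set set \<Rightarrow> real \<Rightarrow> bool" where
  "centred K s \<longleftrightarrow> (\<forall>w\<in>M. \<forall>x\<in>M. \<forall>y\<in>M. \<forall>z\<in>M. d w x < s \<longrightarrow> d w y < s \<longrightarrow> d w z < s \<longrightarrow> {x, y, z} \<in> K)"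

lemma centredD:
  "centred K s \<Longrightarrow> w \<in> M \<Longrightarrow> x \<in> M \<Longrightarrow> y \<in> M \<Longrightarrow> z \<in> M \<Longrightarrow> d w x < s \<Longrightarrow> d w y < s \<Longrightarrow> d w z < s \<Longrightarrow> {x, y, z} \<in> K"
  by (auto simp: centred_def)

lemma centred_star: "centred K s \<Longrightarrow> 0 < s \<Longrightarrow> star K s"
  unfolding centred_def star_def by (metis mdist_zero)

text \<open>Two arcs shorter than \<open>s\<close> meet at a point \<open>x i\<close> near the
  middle, which is the centre of a ball containing \<open>x 0\<close> and
  \<open>x m\<close>.\<close>

lemma cech_edge_sum:
  fixes E :: "'a \<Rightarrow> 'a \<Rightarrow> 'b::ab_group_add"
  assumes K: "centred K s" "0 < s" "additive_on K E" and x: "polygon x m (s - L / 2) L" and L: "L < 2 * s"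
  shows "(\<Sum>i<m. E (x i) (x (Suc i))) = E (x 0) (x m)"
proof -
  define c where "c j = (\<Sum>k<j. d (x k) (x (Suc k)))" for j
  note D = polygonD[OF x, folded c_def]
  note S = centred_star[OF K(1,2)] K(2,3)
  have c: "0 \<le> c m" "c 0 = 0" using polygon_length_nonneg[of x m] by (auto simp: c_def)
  have dc: "d (x a) (x b) \<le> c b - c a" if "a \<le> b" "b \<le> m" for a b
    unfolding c_def by (rule dist_le_partial_sum[OF D(1) that])
  have arc: "(\<Sum>k=a..<b. E (x k) (x (Suc k))) = E (x a) (x b)" if "a \<le> b" "b \<le> m" "c b - c a < s" for a b
    using arc_sum[OF S x that(1,2)] that(3) by (simp add: c_def)
  have pos: "0 < s - L / 2" "0 \<le> c m / 2" using L c by auto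
  obtain i where i: "i \<le> m" "c i - c 0 < c m / 2 + (s - L / 2)" "c m / 2 \<le> c i - c 0 \<or> i = m"
    using greedy_partial_sum[of m c, OF D(2) pos, of 0] by auto
  have arcs: "c i - c 0 < s" "c m - c i < s"
    using i D(3) c K(2) L by (auto simp: field_simps)
  have "(\<Sum>k<m. E (x k) (x (Suc k))) = E (x 0) (x i) + E (x i) (x m)"
    using arcs i
    by (simp add: lessThan_atLeast0 arc sum_split_at[of 0 i m] )
  also have "\<dots> = E (x 0) (x m)"
    using dc[of 0 i] dc[of i m] commute[of "x i" "x 0"] i arcs K(2)
    by (intro additive_onD[OF K(3)] centredD[OF K(1), of "x i"] D(1)) (auto simp: D(1))
  finally show ?thesis .
qed

text \<open>Four arcs shorter than \<open>s\<close>, with division points \<open>x i\<close>,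
  \<open>x j\<close>, \<open>x k\<close>. The triangle \<open>x 0\<close>, \<open>x i\<close>,
  \<open>x j\<close> has centre \<open>x i\<close>, the triangle \<open>x j\<close>,
  \<open>x k\<close>, \<open>x 0\<close> has centre \<open>x k\<close>, and they share the edge from
  \<open>x 0\<close> to \<open>x j\<close>.\<close>

lemma cech_loop_sum:
  fixes E :: "'a \<Rightarrow> 'a \<Rightarrow> 'b::ab_group_add"
  assumes K: "centred K s" "0 < s" "additive_on K E" and x: "polygon x m (s - L / 4) L" and L: "L < 4 * s" and e: "x 0 = x m"
  shows "(\<Sum>i<m. E (x i) (x (Suc i))) = 0"
proof -
  define c where "c j = (\<Sum>k<j. d (x k) (x (Suc k)))" for j
  note D = polygonD[OF x, folded c_def]
  note S = centred_star[OF K(1,2)] K(2,3)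
  have c: "0 \<le> c m" "c 0 = 0" using polygon_length_nonneg[of x m] by (auto simp: c_def)
  have dc: "d (x a) (x b) \<le> c b - c a" if "a \<le> b" "b \<le> m" for a b
    unfolding c_def by (rule dist_le_partial_sum[OF D(1) that])
  have arc: "(\<Sum>k=a..<b. E (x k) (x (Suc k))) = E (x a) (x b)" if "a \<le> b" "b \<le> m" "c b - c a < s" for a b
    using arc_sum[OF S x that(1,2)] that(3) by (simp add: c_def)
  have pos: "0 < s - L / 4" "0 \<le> c m / 4" using L c by auto
  obtain i where i: "i \<le> m" "c i - c 0 < c m / 4 + (s - L / 4)" "c m / 4 \<le> c i - c 0 \<or> i = m"
    using greedy_partial_sum[of m c, OF D(2) pos, of 0] by auto
  obtain j where j: "i \<le> j" "j \<le> m" "c j - c i < c m / 4 + (s - L / 4)" "c m / 4 \<le> c j - c i \<or> j = m"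
    using greedy_partial_sum[of m c, OF D(2) pos i(1)] by auto
  obtain k where k: "j \<le> k" "k \<le> m" "c k - c j < c m / 4 + (s - L / 4)" "c m / 4 \<le> c k - c j \<or> k = m"
    using greedy_partial_sum[of m c, OF D(2) pos j(2)] by auto
  have arcs: "c i - c 0 < s" "c j - c i < s" "c k - c j < s" "c m - c k < s"
    using i j k D(3) c K(2) L by (auto simp: field_simps)
  have d4: "d (x i) (x 0) < s" "d (x i) (x j) < s" "d (x k) (x j) < s" "d (x k) (x 0) < s"
    using dc[of 0 i] dc[of i j] dc[of j k] dc[of k m] commute e i j k arcs by fastforce+
  have M: "x 0 \<in> M" "x i \<in> M" "x j \<in> M" "x k \<in> M" using D(1) i j k by auto
  have "(\<Sum>k<m. E (x k) (x (Suc k))) = (E (x 0) (x i) + E (x i) (x j)) + (E (x j) (x k) + E (x k) (x m))"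
    using arcs i j k
    by (simp add: lessThan_atLeast0 arc sum_split_at[of 0 i m] sum_split_at[of i j m] sum_split_at[of j k m] add.assoc)
  also have "E (x 0) (x i) + E (x i) (x j) = E (x 0) (x j)"
    using M d4 K(2) by (intro additive_onD[OF K(3)] centredD[OF K(1) M(2)]) auto
  also have "E (x j) (x k) + E (x k) (x m) = E (x j) (x 0)"
    unfolding e[symmetric] using M d4 K(2) by (intro additive_onD[OF K(3)] centredD[OF K(1) M(4)]) auto
  also have "E (x 0) (x j) + E (x j) (x 0) = E (x 0) (x 0)"
    using M d4 K(2) by (intro additive_onD[OF K(3)] centredD[OF K(1) M(2)]) auto
  also have "\<dots> = 0" by (rule additive_refl[OF S M(1)])
  finally show ?thesis .
qed

lemma rips_complex_iff:
  "\<sigma> \<in> rips_complex M d s \<longleftrightarrow> finite \<sigma> \<and> \<sigma> \<noteq> {} \<and> \<sigma> \<subseteq> M \<and> (\<forall>x\<in>\<sigma>. \<forall>y\<in>\<sigma>. d x y < s)"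
proof -
  have "set_diameter d \<sigma> < s \<longleftrightarrow> (\<forall>x\<in>\<sigma>. \<forall>y\<in>\<sigma>. d x y < s)" if "finite \<sigma>" "\<sigma> \<noteq> {}"
  proof -
    \<comment> \<open>On a finite simplex the supremum is attained, so the strict bound passes to
      all pairs and back.\<close>
    have "set_diameter d \<sigma> = Max ((\<lambda>(x, y). d x y) ` (\<sigma> \<times> \<sigma>))"
      unfolding set_diameter_def using that by (intro cSup_eq_Max) auto
    then show ?thesis using that by (simp add: Max_less_iff)
  qed
  then show ?thesis by (auto simp: rips_complex_def)
qed

lemma cech_complex_iff:
  "\<sigma> \<in> cech_complex M d s \<longleftrightarrow> finite \<sigma> \<and> \<sigma> \<noteq> {} \<and> \<sigma> \<subseteq> M \<and> (\<exists>w\<in>M. \<forall>z\<in>\<sigma>. d w z < s)"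
  unfolding cech_complex_def using commute by (auto simp: ex_in_conv[symmetric] subset_iff)

end

context compact_length_space begin

text \<open>A vertex of the triangle serves as apex: \<open>w = x\<close> and
  \<open>\<rho> = s\<close> give \<open>2 * s + s = 3 * s\<close>. A polygon shorter than
  \<open>s\<close> is a single arc, so for edges any step bound works.\<close>

lemma adapted_rips:
  assumes s: "0 < s"
  shows "adapted_complex TYPE('f::field) M d (rips_complex M d s) s (3 * s)"
proof -
  have st: "star (rips_complex M d s) s"
    using commute s by (auto simp: star_def rips_complex_iff)
  show ?thesis
  proof
    show "face_closed (rips_complex M d s)"
      by (auto simp: face_closed_def rips_complex_iff subset_iff intro: finite_subset)
    show "\<exists>\<epsilon>>0. \<forall>x\<in>M. \<forall>y\<in>M. \<forall>z\<in>M. d x y < \<epsilon> \<longrightarrow> d y z < \<epsilon> \<longrightarrow> d x z < \<epsilon> \<longrightarrow> {x, y, z} \<in> rips_complex M d s"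
      using st s unfolding star_def by blast
    fix x y z assume "{x, y, z} \<in> rips_complex M d s"
    then show "\<exists>w\<in>M. \<exists>\<rho>. d w x < \<rho> \<and> d w y < \<rho> \<and> d w z < \<rho> \<and> 2 * \<rho> + s \<le> 3 * s"
      by (intro bexI[of _ x] exI[of _ s]) (auto simp: rips_complex_iff)
  next
    fix L assume "L < s"
    then show "\<exists>\<eta>>0. \<forall>(E :: 'a \<Rightarrow> 'a \<Rightarrow> ('a list \<Rightarrow>\<^sub>0 'f)) x m. additive_on (rips_complex M d s) E \<longrightarrow>
        polygon x m \<eta> L \<longrightarrow> {x 0, x m} \<in> rips_complex M d s \<longrightarrow> (\<Sum>i<m. E (x i) (x (Suc i))) = E (x 0) (x m)"
      using rips_edge_sum[OF st s] by (intro exI[of _ 1]) auto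
  next
    fix L assume "L < 3 * s"
    then show "\<exists>\<eta>>0. \<forall>(E :: 'a \<Rightarrow> 'a \<Rightarrow> ('a list \<Rightarrow>\<^sub>0 'f)) x m. additive_on (rips_complex M d s) E \<longrightarrow>
        polygon x m \<eta> L \<longrightarrow> x 0 = x m \<longrightarrow> (\<Sum>i<m. E (x i) (x (Suc i))) = 0"
      using rips_loop_sum[OF st s] by (intro exI[of _ "s - L / 3"]) auto
  qed (use s in \<open>auto simp: rips_complex_iff\<close>)
qed

text \<open>The apex is a common point of the balls around the vertices, with
  \<open>\<rho> = s\<close>; edges are shorter than \<open>2 * s\<close>, and
  \<open>2 * s + 2 * s = 4 * s\<close>.\<close>

lemma adapted_cech:
  assumes s: "0 < s"
  shows "adapted_complex TYPE('f::field) M d (cech_complex M d s) (2 * s) (4 * s)"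
proof -
  have ce: "centred (cech_complex M d s) s" by (auto simp: centred_def cech_complex_iff)
  note st = centred_star[OF ce s]
  show ?thesis
  proof
    show "face_closed (cech_complex M d s)"
      unfolding face_closed_def
    proof (intro ballI allI impI)
      fix \<sigma> \<tau> assume "\<sigma> \<in> cech_complex M d s" and \<tau>: "\<tau> \<subseteq> \<sigma>" "\<tau> \<noteq> {}"
      then obtain w where "finite \<sigma>" "\<sigma> \<subseteq> M" "w \<in> M" "\<forall>z\<in>\<sigma>. d w z < s" unfolding cech_complex_iff by auto
      then show "\<tau> \<in> cech_complex M d s"
        unfolding cech_complex_iff using \<tau> finite_subset[OF \<tau>(1)] by blast
    qed
    show "\<exists>\<epsilon>>0. \<forall>x\<in>M. \<forall>y\<in>M. \<forall>z\<in>M. d x y < \<epsilon> \<longrightarrow> d y z < \<epsilon> \<longrightarrow> d x z < \<epsilon> \<longrightarrow> {x, y, z} \<in> cech_complex M d s"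
      using st s unfolding star_def by blast
  next
    fix x y assume "{x, y} \<in> cech_complex M d s"
    then obtain w where "w \<in> M" "x \<in> M" "y \<in> M" "d w x < s" "d w y < s" by (auto simp: cech_complex_iff)
    then show "d x y < 2 * s" using triangle[of x w y] commute[of x w] by simp
  next
    fix x y z assume "{x, y, z} \<in> cech_complex M d s"
    then obtain w where "w \<in> M" "d w x < s" "d w y < s" "d w z < s" by (auto simp: cech_complex_iff)
    then show "\<exists>w\<in>M. \<exists>\<rho>. d w x < \<rho> \<and> d w y < \<rho> \<and> d w z < \<rho> \<and> 2 * \<rho> + 2 * s \<le> 4 * s"
      by (intro bexI[of _ w] exI[of _ s]) auto
  next
    fix L assume "L < 2 * s"
    then show "\<exists>\<eta>>0. \<forall>(E :: 'a \<Rightarrow> 'a \<Rightarrow> ('a list \<Rightarrow>\<^sub>0 'f)) x m. additive_on (cech_complex M d s) E \<longrightarrow>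
        polygon x m \<eta> L \<longrightarrow> {x 0, x m} \<in> cech_complex M d s \<longrightarrow> (\<Sum>i<m. E (x i) (x (Suc i))) = E (x 0) (x m)"
      using cech_edge_sum[OF ce s] by (intro exI[of _ "s - L / 2"]) auto
  next
    fix L assume "L < 4 * s"
    then show "\<exists>\<eta>>0. \<forall>(E :: 'a \<Rightarrow> 'a \<Rightarrow> ('a list \<Rightarrow>\<^sub>0 'f)) x m. additive_on (cech_complex M d s) E \<longrightarrow>
        polygon x m \<eta> L \<longrightarrow> x 0 = x m \<longrightarrow> (\<Sum>i<m. E (x i) (x (Suc i))) = 0"
      using cech_loop_sum[OF ce s] by (intro exI[of _ "s - L / 4"]) auto
  qed (auto simp: cech_complex_iff)
qed

text \<open>Monotonicity of \<open>R\<close> makes realizations at different parameters agree modulo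
  short loops, that of \<open>a\<close> provides the quotient maps.\<close>

lemma filtration_iso:
  fixes K :: "real \<Rightarrow> 'a set set"
  assumes adapted: "\<And>r. 0 < r \<Longrightarrow> adapted_complex TYPE('f::field) M d (K r) (R r) (a r)"
    and mono: "\<And>r s. 0 < r \<Longrightarrow> r < s \<Longrightarrow> K r \<subseteq> K s \<and> R r \<le> R s \<and> a r \<le> a s"
  shows "(filtration_H1_pers K :: ('f, _) persistence) \<cong>\<^sub>P
    quotient_pers (singular_H1 mtopology) (\<lambda>r. small_loop_span mtopology (loop_length d) (a r))"
proof (rule pers_isoI[where h = "\<lambda>r. realize (R r)"])
  fix r :: real assume r: "0 < r"
  interpret A: adapted_complex M d "K r" "R r" "a r" "TYPE('f)" by (rule adapted[OF r])
  show "presents (pspace (filtration_H1_pers K :: ('f, _) persistence) r) (simp_cycles (K r)) (simp_bds (K r)) (simp_class (K r))"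
    using presents_simplicial_H1[OF A.face_closed] by (simp add: filtration_H1_pers_def)
  show "presents (pspace (quotient_pers (singular_H1 mtopology :: ('f, _) module)
      (\<lambda>r. small_loop_span mtopology (loop_length d) (a r))) r)
      (sing_cycles mtopology) (loop_span mtopology (loop_length d) (a r)) (quotient_class mtopology (loop_length d) (a r))"
    using presents_quotient_class by (simp add: quotient_pers_def)
  show "plinear (realize (R r) :: ('a list \<Rightarrow>\<^sub>0 'f) \<Rightarrow> _)" by (rule linear_realize)
  fix x :: "'a list \<Rightarrow>\<^sub>0 'f" assume x: "x \<in> simp_cycles (K r)"
  show "realize (R r) x \<in> sing_cycles mtopology" by (rule A.realize_cycle[OF x])
  show "realize (R r) x \<in> loop_span mtopology (loop_length d) (a r) \<longleftrightarrow> x \<in> simp_bds (K r)"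
    using x by (intro A.realize_in_loop_span_iff) (simp add: simp_cycles_def)
next
  fix r :: real and y :: "_ \<Rightarrow>\<^sub>0 'f" assume r: "0 < r" and y: "y \<in> sing_cycles mtopology"
  interpret A: adapted_complex M d "K r" "R r" "a r" "TYPE('f)" by (rule adapted[OF r])
  show "\<exists>x\<in>simp_cycles (K r). y - realize (R r) x \<in> loop_span mtopology (loop_length d) (a r)"
    by (rule A.realize_surj[OF y])
next
  fix r s :: real and x :: "'a list \<Rightarrow>\<^sub>0 'f" assume rs: "0 < r" "r < s" and x: "x \<in> simp_cycles (K r)"
  then have s: "0 < s" by simp
  interpret A: adapted_complex M d "K r" "R r" "a r" "TYPE('f)" by (rule adapted[OF rs(1)])
  interpret B: adapted_complex M d "K s" "R s" "a s" "TYPE('f)" by (rule adapted[OF s])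
  have KL: "K r \<subseteq> K s" "R r \<le> R s" using mono[OF rs] by auto
  show "x \<in> simp_cycles (K s) \<and> pbond (filtration_H1_pers K :: ('f, _) persistence) r s (simp_class (K r) x) = simp_class (K s) x"
    using simp_cycles_mono[OF KL(1)] x inclusion_H1_simp_class[OF A.face_closed B.face_closed KL(1) x]
    by (auto simp: filtration_H1_pers_def)
  show "realize (R s) x - realize (R r) x \<in> loop_span mtopology (loop_length d) (a s)"
    using x A.simplex_subset A.edge_dist
    by (intro realize_mono[OF KL(2) B.double, of x "K r"]) (auto simp: simp_cycles_def)
next
  fix r s :: real and x :: "_ \<Rightarrow>\<^sub>0 'f" assume rs: "0 < r" "r < s" and x: "x \<in> sing_cycles mtopology"
  show "x \<in> sing_cycles mtopology \<and> pbond (quotient_pers (singular_H1 mtopology)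
      (\<lambda>r. small_loop_span mtopology (loop_length d) (a r))) r s (quotient_class mtopology (loop_length d) (a r) x) =
      quotient_class mtopology (loop_length d) (a s) x"
    using quotient_class_bond[of "a r" "a s"] mono[OF rs] x by (simp add: quotient_pers_def)
qed

section \<open>Comparison of length, radius and diameter\<close>

text \<open>\<open>set_diameter\<close> is a real supremum and meaningful only for bounded
  sets.\<close>

lemma bounded: "\<exists>B. \<forall>x\<in>M. \<forall>y\<in>M. d x y \<le> B"
proof -
  have "mbounded M" using compactin_imp_mbounded[of M] compact by (simp add: compact_space_def)
  then obtain c b where cb: "M \<subseteq> mcball c b" by (auto simp: mbounded_def)
  have "d x y \<le> b + b" if "x \<in> M" "y \<in> M" for x y
    using cb that triangle[of x c y] commute[of x c] by (auto simp: subset_iff) (smt (verit))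
  then show ?thesis by blast
qed

text \<open>Two points cut the loop into two arcs, and their distance is bounded by the length of
  either, hence by half the total. The bound \<open>L / 2\<close> is uniform, so the supremum stays
  below \<open>b\<close>.\<close>

lemma loop_diameter_less:
  assumes f: "is_loop mtopology f" "loop_length d f < ereal (2 * b)"
  shows "loop_diameter d f < ereal b"
proof -
  have f01: "f 0 = f 1" and p: "pathin mtopology f" using f by (auto simp: is_loop_def)
  have "0 \<le> loop_length d f"
    using loop_length_ge_sum[of 1 d f] nonneg[of "f 0" "f 1"] by (auto intro: order_trans[rotated])
  then obtain L where L: "loop_length d f = ereal L" "L < 2 * b" using f(2) by (cases "loop_length d f") auto
  have le: "d (f s) (f t) \<le> L / 2" if st: "0 \<le> s" "s \<le> t" "t \<le> 1" for s t
  proof -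
    \<comment> \<open>The first and the last interval of this partition make up the second arc, as
      the loop closes.\<close>
    have "ereal (\<Sum>i<length [0, s, t, 1] - 1. d (f ([0, s, t, 1] ! i)) (f ([0, s, t, 1] ! Suc i))) \<le> loop_length d f"
      unfolding loop_length_def by (rule SUP_upper) (use st in auto)
    then have "d (f 0) (f s) + d (f s) (f t) + d (f t) (f 1) \<le> L"
      using L(1) by (simp add: eval_nat_numeral)
    moreover have "d (f s) (f t) \<le> d (f 0) (f s) + d (f t) (f 1)"
      using triangle[of "f s" "f 0" "f t"] topspace_pathin[OF p, of s] topspace_pathin[OF p, of 0]
        topspace_pathin[OF p, of t] st commute[of "f s" "f 0"] commute[of "f t" "f 0"] f01 by auto
    ultimately show ?thesis by simp
  qed
  have "set_diameter d (f ` {0..1}) \<le> L / 2"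
    unfolding set_diameter_def
  proof (rule cSUP_least)
    fix z assume "z \<in> f ` {0..1} \<times> f ` {0..1}"
    then obtain s t where "z = (f s, f t)" "s \<in> {0..1}" "t \<in> {0..1}" by auto
    then show "(case z of (x, y) \<Rightarrow> d x y) \<le> L / 2"
      using le[of s t] le[of t s] commute[of "f s" "f t"] by (cases "s \<le> t") auto
  qed auto
  then show ?thesis using L(2) by (simp add: loop_diameter_def)
qed

text \<open>The ball around the base point whose radius is the diameter encloses the loop.\<close>

lemma loop_radius_less:
  assumes f: "is_loop mtopology f" "loop_diameter d f < ereal b"
  shows "loop_radius M d f < ereal b"
proof -
  have M: "f t \<in> M" if "t \<in> {0..1}" for t using topspace_pathin[of mtopology f] f that by (auto simp: is_loop_def)
  let ?D = "set_diameter d (f ` {0..1})"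
  obtain B where B: "\<forall>x\<in>M. \<forall>y\<in>M. d x y \<le> B" using bounded by blast
  have le: "d (f 0) (f t) \<le> ?D" if t: "t \<in> {0..1}" for t
  proof -
    have "(case (f 0, f t) of (x, y) \<Rightarrow> d x y) \<le> ?D"
      unfolding set_diameter_def
      by (rule cSUP_upper) (use t B M in \<open>auto intro!: bdd_aboveI2[where M = B]\<close>)
    then show ?thesis by simp
  qed
  then have "f ` {0..1} \<subseteq> mcball (f 0) ?D" using M by auto
  moreover have "0 \<le> ?D" using le[of 0] M[of 0] by simp
  ultimately have "Inf {s. 0 \<le> s \<and> (\<exists>x\<in>M. f ` {0..1} \<subseteq> mcball x s)} \<le> ?D"
    using M[of 0] by (intro cInf_lower) (auto intro!: bdd_belowI[of _ 0])
  then show ?thesis using f(2) by (simp add: loop_diameter_def loop_radius_def)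
qed

text \<open>Cutting a loop into small pieces and joining the cutting points to the centre of an
  enclosing ball of radius less than \<open>b\<close> writes the loop as a sum of triangles of
  perimeter less than \<open>2 b\<close>.\<close>

lemma enclosed_loop_in_loop_span:
  assumes f: "is_loop mtopology f" "loop_radius M d f < ereal b"
  shows "path_chain f \<in> (loop_span mtopology (loop_length d) (2 * b) :: (_ \<Rightarrow>\<^sub>0 'f::field) set)"
proof -
  let ?L = "loop_span mtopology (loop_length d) (2 * b) :: (_ \<Rightarrow>\<^sub>0 'f) set"
  have f01: "f 0 = f 1" and p: "pathin mtopology f" using f by (auto simp: is_loop_def)
  have M: "f t \<in> M" if "t \<in> {0..1}" for t using topspace_pathin[OF p] that by auto
  let ?S = "{s. 0 \<le> s \<and> (\<exists>x\<in>M. f ` {0..1} \<subseteq> mcball x s)}"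
  obtain B where B: "\<forall>x\<in>M. \<forall>y\<in>M. d x y \<le> B" using bounded by blast
  have "0 \<le> B" using B M[of 0] nonneg[of "f 0" "f 0"] by (meson atLeastAtMost_iff order_refl order_trans zero_le_one)
  then have "B \<in> ?S" using B M by (auto intro!: bexI[of _ "f 0"])
  then have "?S \<noteq> {}" by blast
  moreover have "Inf ?S < b" using f(2) by (simp add: loop_radius_def)
  ultimately have "\<exists>s\<in>?S. s < b" by (rule cInf_lessD)
  then obtain s where "s \<in> ?S" "s < b" by blast
  then obtain w where s: "0 \<le> s" "s < b" and w: "w \<in> M" "f ` {0..1} \<subseteq> mcball w s" by auto
  \<comment> \<open>The midpoint makes the spokes strictly shorter than \<open>\<rho>\<close>, and
    with \<open>\<epsilon> \<le> b - s\<close> perimeters are below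
    \<open>2 * \<rho> + \<epsilon> \<le> 2 * b\<close>.\<close>
  define \<rho> where "\<rho> = (s + b) / 2"
  have dw: "d w (f t) < \<rho>" if "t \<in> {0..1}" for t using w(2) that s by (force simp: \<rho>_def)
  obtain \<epsilon> where \<epsilon>: "0 < \<epsilon>" "\<epsilon> \<le> b - s" and sum: "\<And>m. is_fine f m \<epsilon> \<Longrightarrow>
      path_chain f - path_sum (\<lambda>x y. path_chain (short \<epsilon> x y)) f m \<in> (sing_bds mtopology :: (_ \<Rightarrow>\<^sub>0 'f) set)"
    using path_chain_homologous_short[OF _ p, of "b - s", where 'f = 'f] s by auto
  obtain m where m: "is_fine f m \<epsilon>" using exists_fine[OF p \<epsilon>(1)] by blast
  define x where "x i = f (real i / real m)" for i
  define c where "c i = (path_chain (short \<rho> w (x i)) :: _ \<Rightarrow>\<^sub>0 'f)" for i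
  have "c i + path_chain (short \<epsilon> (x i) (x (Suc i))) - c (Suc i) \<in> ?L" if i: "i < m" for i
  proof -
    have I: "real i / real m \<in> {0..1}" "real (Suc i) / real m \<in> {0..1}" using i by (intro fraction_01; simp)+
    have xM: "x i \<in> M" "x (Suc i) \<in> M" using M I by (auto simp: x_def)
    have dx: "d w (x i) < \<rho>" "d w (x (Suc i)) < \<rho>" "d (x i) (x (Suc i)) < \<epsilon>"
      using dw I fine_step[OF m i] by (auto simp: x_def)
    note S = short[OF w(1) xM(1) dx(1)] short[OF w(1) xM(2) dx(2)] short[OF xM dx(3)]
    obtain L1 L2 L3 where L: "L1 < \<rho>" "length_at_most d (short \<rho> w (x i)) L1" "L2 < \<rho>"
        "length_at_most d (short \<rho> w (x (Suc i))) L2" "L3 < \<epsilon>" "length_at_most d (short \<epsilon> (x i) (x (Suc i))) L3"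
      using S(4,8,12) by blast
    show ?thesis
      unfolding c_def by (rule short_triangle[OF S(1) L(2) S(9) L(6) S(5) L(4)])
        (use S L \<epsilon> in \<open>auto simp: \<rho>_def field_simps\<close>)
  qed
  then have "(\<Sum>i<m. c i + path_chain (short \<epsilon> (x i) (x (Suc i))) - c (Suc i)) \<in> ?L"
    by (intro pm.subspace_sum[OF subspace_loop_span]) auto
  also have "(\<Sum>i<m. c i + path_chain (short \<epsilon> (x i) (x (Suc i))) - c (Suc i)) =
      (\<Sum>i<m. path_chain (short \<epsilon> (x i) (x (Suc i)))) - (\<Sum>i<m. c (Suc i) - c i)"
    unfolding sum_subtractf[symmetric] by (rule sum.cong) (auto simp: algebra_simps)
  also have "(\<Sum>i<m. c (Suc i) - c i) = c m - c 0" by (rule sum_lessThan_telescope)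
  \<comment> \<open>The chosen spoke depends only on its end points, so the last one equals the
    first one.\<close>
  also have "c m = c 0" using m f01 by (simp add: c_def x_def is_fine_def)
  finally have "path_sum (\<lambda>x y. path_chain (short \<epsilon> x y)) f m \<in> ?L" by (simp add: path_sum_def x_def)
  moreover have "path_chain f - path_sum (\<lambda>x y. path_chain (short \<epsilon> x y)) f m \<in> ?L"
    using sum[OF m] sing_bds_loop_span by blast
  ultimately show ?thesis using pm.subspace_add[OF subspace_loop_span] by fastforce
qed

text \<open>A circle of inclusions: half the length bounds the diameter, the diameter bounds the
  radius, and loops of small radius are sums of loops of small length.\<close>

lemma loop_span_eq:
  "loop_span mtopology (loop_radius M d) b = (loop_span mtopology (loop_length d) (2 * b) :: (_ \<Rightarrow>\<^sub>0 'f::field) set)"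
  "loop_span mtopology (loop_diameter d) b = (loop_span mtopology (loop_length d) (2 * b) :: (_ \<Rightarrow>\<^sub>0 'f) set)"
proof -
  let ?L = "loop_span mtopology (loop_length d) (2 * b) :: (_ \<Rightarrow>\<^sub>0 'f) set"
  let ?S = "loop_span mtopology (loop_radius M d) b :: (_ \<Rightarrow>\<^sub>0 'f) set"
  let ?D = "loop_span mtopology (loop_diameter d) b :: (_ \<Rightarrow>\<^sub>0 'f) set"
  have "?L \<subseteq> ?D"
    unfolding loop_span_def using loop_diameter_less by (intro pm.span_mono) auto
  moreover have "?D \<subseteq> ?S"
    unfolding loop_span_def using loop_radius_less by (intro pm.span_mono) auto
  moreover have "?S \<subseteq> ?L"
    unfolding loop_span_def[of _ "loop_radius M d"]
    by (rule pm.span_minimal[OF Un_least[OF sing_bds_loop_span] subspace_loop_span])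
      (use enclosed_loop_in_loop_span in auto)
  ultimately show "?S = ?L" "?D = ?L" by auto
qed

end

section \<open>Shortest bases of loops\<close>

text \<open>The projection of the free space on \<open>n\<close> generators onto the direct sum at
  \<open>r\<close>: coordinates whose interval has ended are forgotten.\<close>

definition interval_coords :: "nat \<Rightarrow> (nat \<Rightarrow> ereal) \<Rightarrow> real \<Rightarrow> (nat \<Rightarrow>\<^sub>0 'f::field) \<Rightarrow> nat \<Rightarrow> 'f" where
  "interval_coords n b r c = (\<lambda>i\<in>{..<n}. if ereal r \<le> b i then Poly_Mapping.lookup c i else 0)"

lemma presents_interval_sum:
  fixes b :: "nat \<Rightarrow> ereal"
  assumes r: "0 < r"
  shows "presents (pspace (direct_sum_pers n (\<lambda>i. interval_pers (b i)) :: ('f::field, _) persistence) r)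
    (free_chains {..<n}) (free_chains {i. i < n \<and> \<not> ereal r \<le> b i}) (interval_coords n b r)"
proof -
  let ?V = "pspace (direct_sum_pers n (\<lambda>i. interval_pers (b i)) :: ('f, _) persistence) r"
  have carrier: "carrier ?V = (\<Pi>\<^sub>E i\<in>{..<n}. if ereal r \<le> b i then UNIV else {0})"
    using r by (simp add: direct_sum_pers_def direct_sum_space_def interval_pers_def)
  show ?thesis
    unfolding presents_def
  proof (intro conjI ballI allI)
    show "carrier ?V = interval_coords n b r ` free_chains {..<n}"
    proof (intro equalityI subsetI)
      fix x assume x: "x \<in> carrier ?V"
      define c where "c = (\<Sum>i<n. Poly_Mapping.single i (x i))"
      have "Poly_Mapping.lookup c i = (if i < n then x i else 0)" for i
        by (auto simp: c_def lookup_sum lookup_single when_def)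
      moreover have "i < n \<Longrightarrow> \<not> ereal r \<le> b i \<Longrightarrow> x i = 0" "\<not> i < n \<Longrightarrow> x i = undefined" for i
        using PiE_mem[OF x[unfolded carrier], of i] PiE_arb[OF x[unfolded carrier], of i] by auto
      ultimately have "x = interval_coords n b r c"
        by (simp add: interval_coords_def fun_eq_iff restrict_def)
      moreover have "c \<in> free_chains {..<n}"
        unfolding c_def by (rule pm.subspace_sum[OF subspace_chains]) auto
      ultimately show "x \<in> interval_coords n b r ` free_chains {..<n}" by blast
    qed (auto simp: carrier interval_coords_def split: if_splits)
    fix x y :: "nat \<Rightarrow>\<^sub>0 'f" assume x: "x \<in> free_chains {..<n}" and y: "y \<in> free_chains {..<n}"
    have out: "Poly_Mapping.lookup x i = Poly_Mapping.lookup y i" if "\<not> i < n" for i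
    proof -
      have "i \<notin> Poly_Mapping.keys x" "i \<notin> Poly_Mapping.keys y" using x y that by (auto simp: free_chains_def)
      then show ?thesis by (simp add: in_keys_iff)
    qed
    show "(interval_coords n b r x = interval_coords n b r y) \<longleftrightarrow> x - y \<in> free_chains {i. i < n \<and> \<not> ereal r \<le> b i}"
      using out by (auto simp: interval_coords_def free_chains_def fun_eq_iff in_keys_iff lookup_minus subset_iff restrict_def)
    show "interval_coords n b r x \<oplus>\<^bsub>?V\<^esub> interval_coords n b r y = interval_coords n b r (x + y)"
      by (auto simp: direct_sum_pers_def direct_sum_space_def interval_pers_def interval_coords_def lookup_add fun_eq_iff)
    show "a \<odot>\<^bsub>?V\<^esub> interval_coords n b r x = interval_coords n b r (pscale a x)" for a
      by (auto simp: direct_sum_pers_def direct_sum_space_def interval_pers_def interval_coords_def fun_eq_iff)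
  next
    show "\<zero>\<^bsub>?V\<^esub> = interval_coords n b r 0"
      by (auto simp: direct_sum_pers_def direct_sum_space_def interval_pers_def interval_coords_def fun_eq_iff)
  qed (rule subspace_chains | auto simp: free_chains_def)+
qed

text \<open>The closed right end of the interval reflects that loops of length exactly
  \<open>12 * r\<close> are not yet divided out.\<close>

lemma ereal_le_divide_12: "ereal r \<le> x / 12 \<longleftrightarrow> \<not> x < ereal (12 * r)"
  by (cases x) (auto simp: field_simps)

locale shortest_base =
  fixes X :: "'a topology" and d :: "'a \<Rightarrow> 'a \<Rightarrow> real" and \<gamma>s :: "(real \<Rightarrow> 'a) list" and F :: "'f::field itself"
  assumes shortest: "shortest_generating_set TYPE('f) X d \<gamma>s"
begin

abbreviation "n \<equiv> length \<gamma>s"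
abbreviation "len \<equiv> loop_length d"
abbreviation "B \<equiv> sing_bds X :: (((nat \<Rightarrow> real) \<Rightarrow> 'a) \<Rightarrow>\<^sub>0 'f) set"

definition c :: "nat \<Rightarrow> ((nat \<Rightarrow> real) \<Rightarrow> 'a) \<Rightarrow>\<^sub>0 'f" where
  "c i = path_chain (\<gamma>s ! i)"

lemma base: "is_H1_base TYPE('f) X d \<gamma>s" "n = H1_dim TYPE('f) X"
  "\<And>\<gamma>. \<gamma> \<in> set \<gamma>s \<Longrightarrow> is_loop X \<gamma>" "sorted (map len \<gamma>s)"
  using shortest by (auto simp: shortest_generating_set_def is_H1_base_def)

text \<open>As the span contains the relations \<open>B\<close>, it is determined by its image in
  homology.\<close>

lemma generates_iff:
  assumes "\<And>\<delta>. \<delta> \<in> D \<Longrightarrow> is_loop X \<delta>"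
  shows "vspan (singular_H1 X) (loop_class X ` D) = carrier (singular_H1 X :: ('f, _) module) \<longleftrightarrow>
    pm.span (B \<union> path_chain ` D) = sing_cycles X"
proof -
  let ?S = "pm.span (B \<union> path_chain ` D)"
  note P = presentsD[OF presents_singular_H1[of X]]
  have D: "path_chain ` D \<subseteq> (sing_cycles X :: (_ \<Rightarrow>\<^sub>0 'f) set)" using assms path_chain_loop by auto
  have e: "loop_class X ` D = (sing_class X :: (_ \<Rightarrow>\<^sub>0 'f) \<Rightarrow> _) ` path_chain ` D"
    by (auto simp: loop_class_eq)
  have v: "vspan (singular_H1 X) (loop_class X ` D) = sing_class X ` ?S"
    unfolding e by (rule presents_vspan[OF presents_singular_H1 D])
  have SZ: "?S \<subseteq> sing_cycles X"
    by (rule pm.span_minimal[OF Un_least[OF sing_bds_subset D] subspace_sing_cycles])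
  have "?S = sing_cycles X" if eq: "sing_class X ` ?S = sing_class X ` (sing_cycles X :: (_ \<Rightarrow>\<^sub>0 'f) set)"
  proof (rule equalityI[OF SZ subsetI])
    fix z :: "_ \<Rightarrow>\<^sub>0 'f" assume z: "z \<in> sing_cycles X"
    then obtain w where w: "w \<in> ?S" "sing_class X z = sing_class X w" using eq by blast
    then have "z - w \<in> B" using P(5) z SZ by blast
    then have "z - w \<in> ?S" by (intro pm.span_base) simp
    from pm.span_add[OF this w(1)] show "z \<in> ?S" by simp
  qed
  then show ?thesis unfolding v P(4) by metis
qed

lemma card_generating:
  assumes "finite D" "\<And>\<delta>. \<delta> \<in> D \<Longrightarrow> is_loop X \<delta>" "pm.span (B \<union> path_chain ` D) = sing_cycles X"
  shows "n \<le> card D"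
proof -
  interpret V: vectorspace scalars "singular_H1 X :: ('f, _) module"
    by (rule presents_vectorspace[OF presents_singular_H1])
  let ?A = "(loop_class X :: _ \<Rightarrow> (_ \<Rightarrow>\<^sub>0 'f) set) ` D"
  have "V.dim \<le> card ?A"
  proof (rule V.gen_ge_dim)
    show "?A \<subseteq> carrier (singular_H1 X :: ('f, _) module)"
      using assms(2) path_chain_loop presentsD(4)[OF presents_singular_H1] by (fastforce simp: loop_class_eq)
  qed (use assms generates_iff in auto)
  also have "\<dots> \<le> card D" by (rule card_image_le[OF assms(1)])
  finally show ?thesis using base(2) by (simp add: H1_dim_def)
qed

lemma set_conv: "path_chain ` set \<gamma>s = c ` {..<n}"
  by (force simp: c_def in_set_conv_nth image_iff)

lemma span_base: "pm.span (B \<union> c ` {..<n}) = sing_cycles X"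
  using base(1) generates_iff[of "set \<gamma>s"] base(3) unfolding is_H1_base_def set_conv by auto

lemma c_cycle: "i < n \<Longrightarrow> c i \<in> sing_cycles X"
  unfolding c_def by (intro path_chain_loop base(3) nth_mem)

text \<open>Otherwise \<open>n - 1\<close> loops would generate, contradicting
  \<open>card_generating\<close>.\<close>

lemma independent:
  assumes j: "j < n"
  shows "c j \<notin> pm.span (B \<union> c ` ({..<n} - {j}))"
proof
  assume cj: "c j \<in> pm.span (B \<union> c ` ({..<n} - {j}))"
  let ?D = "(\<lambda>i. \<gamma>s ! i) ` ({..<n} - {j})"
  have "c ` {..<n} = insert (c j) (c ` ({..<n} - {j}))" using j by auto
  then have "B \<union> c ` {..<n} = insert (c j) (B \<union> c ` ({..<n} - {j}))" by simp
  then have "pm.span (B \<union> c ` ({..<n} - {j})) = sing_cycles X"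
    using pm.span_redundant[OF cj] span_base by simp
  then have "pm.span (B \<union> path_chain ` ?D) = sing_cycles X"
    by (simp add: image_image c_def)
  then have "n \<le> card ?D" by (rule card_generating[rotated 2]) (use base(3) in auto)
  also have "\<dots> \<le> card ({..<n} - {j})" by (rule card_image_le) simp
  also have "\<dots> < n" using j by simp
  finally show False by simp
qed

text \<open>Otherwise \<open>\<delta>\<close> could replace a loop \<open>\<gamma>s ! j\<close> that is longer than \<open>\<delta>\<close>; to keep the base
  sorted, \<open>\<delta>\<close> has to be inserted further to the left.\<close>

lemma short_loop_in_span:
  assumes \<delta>: "is_loop X \<delta>" "len \<delta> < a"
  shows "path_chain \<delta> \<in> pm.span (B \<union> c ` {i. i < n \<and> len (\<gamma>s ! i) < a})"
proof (rule ccontr)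
  \<comment> \<open>The boundaries, the short base loops, and the first \<open>k\<close> base loops
    of whatever length; at \<open>k = n\<close> all cycles are spanned.\<close>
  let ?T = "\<lambda>k. B \<union> c ` ({i. i < n \<and> len (\<gamma>s ! i) < a} \<union> {..<k})"
  assume no: "path_chain \<delta> \<notin> pm.span (B \<union> c ` {i. i < n \<and> len (\<gamma>s ! i) < a})"
  have "?T n = B \<union> c ` {..<n}" by auto
  then have n: "path_chain \<delta> \<in> pm.span (?T n)" using path_chain_loop[OF \<delta>(1)] span_base by simp
  define k where "k = (LEAST k. path_chain \<delta> \<in> pm.span (?T k))"
  have k: "path_chain \<delta> \<in> pm.span (?T k)" "k \<le> n"
    unfolding k_def using LeastI[of "\<lambda>k. path_chain \<delta> \<in> pm.span (?T k)", OF n]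
      Least_le[of "\<lambda>k. path_chain \<delta> \<in> pm.span (?T k)", OF n] by auto
  have "k \<noteq> 0" using k(1) no by (intro notI) simp
  then obtain j where j: "k = Suc j" by (cases k) auto
  have nj: "path_chain \<delta> \<notin> pm.span (?T j)" using not_less_Least[of j "\<lambda>k. path_chain \<delta> \<in> pm.span (?T k)"] j k_def by auto
  have jn: "j < n" using j k by simp
  have Tk: "?T k = insert (c j) (?T j)" using j by (auto simp: lessThan_Suc)
  \<comment> \<open>A short base loop belongs to \<open>?T j\<close> already and could not have
    enlarged the span.\<close>
  have long: "\<not> len (\<gamma>s ! j) < a"
  proof
    assume "len (\<gamma>s ! j) < a"
    then have "?T k = ?T j" unfolding Tk using jn by auto
    then show False using k nj by simp
  qed
  \<comment> \<open>The exchange step: \<open>\<delta>\<close> involves \<open>c j\<close>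
    essentially, so \<open>c j\<close> can be recovered from it.\<close>
  have cj: "c j \<in> pm.span (insert (path_chain \<delta>) (?T j))"
    using k(1) nj unfolding Tk by (rule pm.in_span_insert)
  \<comment> \<open>The place of \<open>\<delta>\<close> in the sorted list: behind all loops that
    are not longer. As loop \<open>j\<close> is longer, \<open>p \<le> j\<close>.\<close>
  define p where "p = length (takeWhile (\<lambda>\<gamma>. len \<gamma> \<le> len \<delta>) \<gamma>s)"
  have take_p: "take p \<gamma>s = takeWhile (\<lambda>\<gamma>. len \<gamma> \<le> len \<delta>) \<gamma>s" unfolding p_def by (rule takeWhile_eq_take[symmetric])
  have le_p: "len \<gamma> \<le> len \<delta>" if "\<gamma> \<in> set (take p \<gamma>s)" for \<gamma>
    using that unfolding take_p by (rule set_takeWhileD[THEN conjunct2])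
  have pj: "p \<le> j"
  proof (rule ccontr)
    assume "\<not> p \<le> j"
    then have "\<gamma>s ! j \<in> set (take p \<gamma>s)" using jn by (auto simp: in_set_conv_nth)
    then show False using le_p long \<delta>(2) by fastforce
  qed
  then have pn: "p < n" using jn by simp
  have len_p: "len \<delta> < len (\<gamma>s ! p)"
    using nth_length_takeWhile[of "\<lambda>\<gamma>. len \<gamma> \<le> len \<delta>" \<gamma>s] pn unfolding p_def by simp
  have gt_p: "len \<delta> \<le> len (\<gamma>s ! i)" if "p \<le> i" "i < n" for i
    using sorted_nth_mono[OF base(4), of p i] that pn len_p by auto
  define rest where "rest = drop p (take j \<gamma>s) @ drop (Suc j) \<gamma>s"
  define \<delta>s where "\<delta>s = take p \<gamma>s @ \<delta> # rest"
  have split: "\<gamma>s = take p \<gamma>s @ drop p (take j \<gamma>s) @ \<gamma>s ! j # drop (Suc j) \<gamma>s"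
  proof -
    have "take p \<gamma>s @ drop p (take j \<gamma>s) = take j \<gamma>s"
      using append_take_drop_id[of p "take j \<gamma>s"] pj by (simp add: min_def)
    then show ?thesis using id_take_nth_drop[OF jn] by (metis append.assoc)
  qed
  have set_rest: "\<exists>i. \<gamma> = \<gamma>s ! i \<and> p \<le> i \<and> i < n" if "\<gamma> \<in> set rest" for \<gamma>
  proof -
    have "set rest \<subseteq> set (drop p \<gamma>s)" unfolding rest_def using pj
      by (auto simp: drop_take dest: in_set_takeD set_drop_subset_set_drop[of p "Suc j" \<gamma>s, THEN subsetD, rotated])
    then have "\<gamma> \<in> set (drop p \<gamma>s)" using that by blast
    then obtain i where "i < n - p" "\<gamma> = \<gamma>s ! (p + i)" by (auto simp: in_set_conv_nth)
    then show ?thesis by (intro exI[of _ "p + i"]) auto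
  qed
  have others: "insert \<delta> ((\<lambda>i. \<gamma>s ! i) ` ({..<n} - {j})) \<subseteq> set \<delta>s"
  proof -
    have "\<gamma>s ! i \<in> set \<delta>s" if "i < n" "i \<noteq> j" for i
    proof (cases "i < j")
      case True
      then have "\<gamma>s ! i \<in> set (take j \<gamma>s)" using jn by (auto simp: in_set_conv_nth)
      also have "set (take j \<gamma>s) = set (take p \<gamma>s) \<union> set (drop p (take j \<gamma>s))"
        using append_take_drop_id[of p "take j \<gamma>s"] pj by (metis min.absorb1 set_append take_take)
      finally show ?thesis by (auto simp: \<delta>s_def rest_def)
    next
      case False
      then have "\<gamma>s ! i \<in> set (drop (Suc j) \<gamma>s)"
        using that by (auto simp: in_set_conv_nth intro!: exI[of _ "i - Suc j"])
      then show ?thesis by (auto simp: \<delta>s_def rest_def)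
    qed
    then show ?thesis by (auto simp: \<delta>s_def)
  qed
  have set\<delta>s: "set \<delta>s \<subseteq> insert \<delta> (set \<gamma>s)"
  proof -
    have "\<gamma> \<in> set \<gamma>s" if "\<gamma> \<in> set rest" for \<gamma> using set_rest[OF that] by auto
    then show ?thesis by (auto simp: \<delta>s_def dest: in_set_takeD)
  qed
  have loops: "is_loop X \<gamma>" if "\<gamma> \<in> set \<delta>s" for \<gamma> using set\<delta>s that \<delta>(1) base(3) by blast
  have "is_H1_base TYPE('f) X d \<delta>s"
    unfolding is_H1_base_def
  proof (intro conjI ballI loops)
    show "length \<delta>s = H1_dim TYPE('f) X"
      unfolding base(2)[symmetric] using pj jn by (simp add: \<delta>s_def rest_def)
    have "sorted (map len \<gamma>s)" by (rule base(4))
    then have "sorted (map len (take p \<gamma>s @ rest))"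
      unfolding rest_def by (subst (asm) split) (auto simp: sorted_append)
    then show "sorted (map len \<delta>s)"
      unfolding \<delta>s_def using le_p set_rest gt_p by (auto simp: sorted_append)
    have "sing_cycles X \<subseteq> pm.span (B \<union> path_chain ` set \<delta>s)"
      unfolding span_base[symmetric]
    proof (rule pm.span_minimal)
      have "insert (path_chain \<delta>) (?T j) \<subseteq> B \<union> path_chain ` set \<delta>s"
      proof -
        have ij: "{i. i < n \<and> len (\<gamma>s ! i) < a} \<union> {..<j} \<subseteq> {..<n} - {j}" using long jn by auto
        have "c i \<in> path_chain ` set \<delta>s" if "i \<in> {..<n} - {j}" for i
          using others that unfolding c_def by blast
        then have "c ` ({i. i < n \<and> len (\<gamma>s ! i) < a} \<union> {..<j}) \<subseteq> path_chain ` set \<delta>s" using ij by blast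
        moreover have "path_chain \<delta> \<in> path_chain ` set \<delta>s" using others by blast
        ultimately show ?thesis by blast
      qed
      then have "c j \<in> pm.span (B \<union> path_chain ` set \<delta>s)" using cj pm.span_mono by blast
      moreover have "c i \<in> pm.span (B \<union> path_chain ` set \<delta>s)" if "i < n" "i \<noteq> j" for i
        using others that unfolding c_def by (intro pm.span_base) blast
      ultimately show "B \<union> c ` {..<n} \<subseteq> pm.span (B \<union> path_chain ` set \<delta>s)"
        using pm.span_superset[of "B \<union> path_chain ` set \<delta>s"] by blast
    qed simp
    moreover have "pm.span (B \<union> path_chain ` set \<delta>s) \<subseteq> sing_cycles X"
      using loops path_chain_loop
      by (intro pm.span_minimal[OF Un_least[OF sing_bds_subset] subspace_sing_cycles]) auto
    ultimately show "vspan (singular_H1 X) (loop_class X ` set \<delta>s) = carrier (singular_H1 X :: ('f, _) module)"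
      using generates_iff[OF loops] by blast
  qed
  \<comment> \<open>The length vectors agree before \<open>p\<close>, and at \<open>p\<close> the
    entry drops to the length of \<open>\<delta>\<close>.\<close>
  moreover have "(map len \<delta>s, map len \<gamma>s) \<in> lex {(x, y). x < y}"
  proof -
    have "map len \<gamma>s = map len (take p \<gamma>s) @ len (\<gamma>s ! p) # map len (drop (Suc p) \<gamma>s)"
      using id_take_nth_drop[OF pn] by (metis list.simps(9) map_append)
    moreover have "map len \<delta>s = map len (take p \<gamma>s) @ len \<delta> # map len rest" by (simp add: \<delta>s_def)
    moreover have "length (map len \<delta>s) = length (map len \<gamma>s)" using pj jn by (simp add: \<delta>s_def rest_def)
    ultimately show ?thesis using len_p unfolding lex_conv by blast
  qed
  ultimately show False using shortest unfolding shortest_generating_set_def by blast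
qed

lemma loop_span_eq_span_base:
  "loop_span X len a = pm.span (B \<union> c ` {i. i < n \<and> len (\<gamma>s ! i) < ereal a})" (is "?l = pm.span ?r")
proof
  show "?l \<subseteq> pm.span ?r"
    unfolding loop_span_def
  proof (rule pm.span_minimal)
    show "B \<union> path_chain ` {\<gamma>. is_loop X \<gamma> \<and> len \<gamma> < ereal a} \<subseteq> pm.span ?r"
      using short_loop_in_span[of _ "ereal a"] pm.span_superset[of ?r] by auto
  qed simp
  show "pm.span ?r \<subseteq> ?l"
    by (rule pm.span_minimal[OF Un_least[OF sing_bds_loop_span] subspace_loop_span])
      (auto simp: c_def base(3) intro: loop_in_loop_span)
qed

text \<open>The generator \<open>i\<close> goes to the base loop \<open>i\<close>. It vanishes at
  \<open>r\<close> exactly if that loop is shorter than \<open>12 * r\<close>, that is, if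
  \<open>r\<close> has left its interval.\<close>

lemma interval_sum_iso:
  assumes l: "\<And>i. i < n \<Longrightarrow> l i = len (\<gamma>s ! i)"
  defines "P \<equiv> direct_sum_pers n (\<lambda>i. interval_pers (l i / 12)) :: ('f, _) persistence"
  shows "P \<cong>\<^sub>P quotient_pers (singular_H1 X) (\<lambda>r. small_loop_span X len (12 * r))"
    and "quotient_pers (singular_H1 X) (\<lambda>r. small_loop_span X len (12 * r)) \<cong>\<^sub>P P"
proof -
  let ?Q = "quotient_pers (singular_H1 X :: ('f, _) module) (\<lambda>r. small_loop_span X len (12 * r))"
  define h where "h = linear_extension c"
  have h: "plinear h" unfolding h_def by (rule linear_linear_extension)
  have hs: "h (Poly_Mapping.single i 1) = c i" for i by (simp add: h_def)
  have bond: "pbond P r s (interval_coords n (\<lambda>i. l i / 12) r x) = interval_coords n (\<lambda>i. l i / 12) s x"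
    if "0 < r" "r < s" for r s x
  proof -
    have "ereal r \<le> b" if "ereal s \<le> b" for b using \<open>r < s\<close> that by (meson ereal_less_eq(3) less_imp_le order_trans)
    then show ?thesis using that
      by (auto simp: P_def direct_sum_pers_def interval_pers_def interval_coords_def fun_eq_iff)
  qed
  have N: "{i. i < n \<and> \<not> ereal r \<le> l i / 12} = {i. i < n \<and> len (\<gamma>s ! i) < ereal (12 * r)}" for r
    using l ereal_le_divide_12[of r] by (intro Collect_cong) metis
  have pres: "presents (pspace P r) (free_chains {..<n}) (free_chains {i. i < n \<and> \<not> ereal r \<le> l i / 12})
      (interval_coords n (\<lambda>i. l i / 12) r)" if "0 < r" for r
    unfolding P_def by (rule presents_interval_sum[OF that])
  show iso: "P \<cong>\<^sub>P ?Q"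
  proof (rule pers_isoI[where h = "\<lambda>_. h"])
    fix r :: real assume r: "0 < r"
    show "presents (pspace P r) (free_chains {..<n}) (free_chains {i. i < n \<and> \<not> ereal r \<le> l i / 12})
      (interval_coords n (\<lambda>i. l i / 12) r)" by (rule pres[OF r])
    show "presents (pspace ?Q r) (sing_cycles X) (loop_span X len (12 * r)) (quotient_class X len (12 * r))"
      using presents_quotient_class by (simp add: quotient_pers_def)
    show "plinear h" by (rule h)
    fix x :: "nat \<Rightarrow>\<^sub>0 'f" assume x: "x \<in> free_chains {..<n}"
    show "h x \<in> sing_cycles X"
      by (rule linear_chains_into[OF h subspace_sing_cycles _ x]) (simp add: hs c_cycle)
    show "h x \<in> loop_span X len (12 * r) \<longleftrightarrow> x \<in> free_chains {i. i < n \<and> \<not> ereal r \<le> l i / 12}"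
    proof
      assume "x \<in> free_chains {i. i < n \<and> \<not> ereal r \<le> l i / 12}"
      then show "h x \<in> loop_span X len (12 * r)"
        unfolding N by (rule linear_chains_into[OF h subspace_loop_span, rotated])
          (auto simp: hs c_def intro!: loop_in_loop_span base(3))
    next
      let ?I = "{i. i < n \<and> len (\<gamma>s ! i) < ereal (12 * r)}"
      assume hx: "h x \<in> loop_span X len (12 * r)"
      show "x \<in> free_chains {i. i < n \<and> \<not> ereal r \<le> l i / 12}"
        unfolding N free_chains_def
      proof (rule CollectI, rule subsetI, rule ccontr)
        \<comment> \<open>A nonzero coordinate at a long loop would put \<open>c j\<close> into the
          span of the boundaries and the other base loops.\<close>
        fix j assume j: "j \<in> Poly_Mapping.keys x" "j \<notin> ?I"
        then have jn: "j < n" using x by (auto simp: free_chains_def)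
        let ?S = "pm.span (B \<union> c ` ({..<n} - {j}))"
        have "pm.span (B \<union> c ` ?I) \<subseteq> ?S" using j by (intro pm.span_mono) auto
        then have hS: "h x \<in> ?S" using hx unfolding loop_span_eq_span_base by blast
        have "h x = pscale (Poly_Mapping.lookup x j) (c j) + (\<Sum>i\<in>{..<n} - {j}. pscale (Poly_Mapping.lookup x i) (c i))"
          unfolding h_def using x jn
          by (subst linear_extension_superset[of "{..<n}"]) (auto simp: free_chains_def intro: sum.remove)
        moreover have "(\<Sum>i\<in>{..<n} - {j}. pscale (Poly_Mapping.lookup x i) (c i)) \<in> ?S"
          by (intro pm.span_sum pm.span_scale pm.span_base) auto
        ultimately have "pscale (Poly_Mapping.lookup x j) (c j) \<in> ?S"
          using pm.span_diff[OF hS, of "\<Sum>i\<in>{..<n} - {j}. pscale (Poly_Mapping.lookup x i) (c i)"] by simp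
        then have "pscale (inverse (Poly_Mapping.lookup x j)) (pscale (Poly_Mapping.lookup x j) (c j)) \<in> ?S"
          by (rule pm.span_scale)
        moreover have "Poly_Mapping.lookup x j \<noteq> 0" using j(1) by (simp add: in_keys_iff)
        ultimately have "c j \<in> ?S" by simp
        then show False using independent[OF jn] by simp
      qed
    qed
  next
    fix r :: real and y :: "_ \<Rightarrow>\<^sub>0 'f" assume "0 < r" and y: "y \<in> sing_cycles X"
    then have "y \<in> pm.span (B \<union> c ` {..<n})" using span_base by simp
    then obtain b w where bw: "y = b + w" "b \<in> pm.span B" "w \<in> pm.span (c ` {..<n})" unfolding pm.span_Un by blast
    have "c ` {..<n} = h ` (\<lambda>i. Poly_Mapping.single i 1) ` {..<n}" by (simp add: image_image hs)
    then have "w \<in> h ` free_chains {..<n}"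
      using bw(3) unfolding free_chains_eq_span by (simp only: pm.linear_span_image[OF h])
    then obtain x where x: "x \<in> free_chains {..<n}" "w = h x" by blast
    have "b \<in> loop_span X len (12 * r)"
    proof -
      have "pm.span B = B" by (simp add: subspace_sing_bds)
      then show ?thesis using bw(2) sing_bds_loop_span by blast
    qed
    then show "\<exists>x\<in>free_chains {..<n}. y - h x \<in> loop_span X len (12 * r)"
      using x bw(1) by (intro bexI[of _ x]) auto
  next
    fix r s :: real and x :: "nat \<Rightarrow>\<^sub>0 'f" assume "0 < r" "r < s" "x \<in> free_chains {..<n}"
    then show "x \<in> free_chains {..<n} \<and> pbond P r s (interval_coords n (\<lambda>i. l i / 12) r x) = interval_coords n (\<lambda>i. l i / 12) s x"
      using bond by simp
    show "h x - h x \<in> loop_span X len (12 * s)" using pm.subspace_0[OF subspace_loop_span] by simp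
  next
    fix r s :: real and x :: "_ \<Rightarrow>\<^sub>0 'f" assume "0 < r" "r < s" "x \<in> sing_cycles X"
    then show "x \<in> sing_cycles X \<and> pbond ?Q r s (quotient_class X len (12 * r) x) = quotient_class X len (12 * s) x"
      using quotient_class_bond[of "12 * r" "12 * s" x X len] by (simp add: quotient_pers_def)
  qed
  show "?Q \<cong>\<^sub>P P"
  proof (rule pers_iso_sym[OF iso])
    show "vectorspace scalars (pspace P r)" if "0 < r" for r by (rule presents_vectorspace[OF pres[OF that]])
    fix r s x assume rs: "0 < r" "r < s" and "x \<in> carrier (pspace P r)"
    then obtain z where "z \<in> free_chains {..<n}" "x = interval_coords n (\<lambda>i. l i / 12) r z"
      using presentsD(4)[OF pres[OF rs(1)]] by blast
    then show "pbond P r s x \<in> carrier (pspace P s)"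
      using bond[OF rs] presentsD(4)[OF pres[of s]] rs by auto
  qed
qed

end

section \<open>Curves on Riemannian manifolds\<close>

lemma exists_projection_onto_subspace:
  fixes E :: "'e::euclidean_space set"
  assumes "Real_Vector_Spaces.subspace E"
  shows "\<exists>P. bounded_linear P \<and> (\<forall>x. P x \<in> E) \<and> (\<forall>x\<in>E. P x = x)"
proof -
  obtain B where B: "B \<subseteq> E" "pairwise orthogonal B" "\<And>x. x \<in> B \<Longrightarrow> norm x = 1" "independent B" "span B = E"
    using orthonormal_basis_subspace[OF assms] by metis
  have fB: "finite B" using B(4) by (simp add: independent_imp_finite)
  show ?thesis
  proof (intro exI[of _ "\<lambda>x. \<Sum>b\<in>B. (x \<bullet> b) *\<^sub>R b"] conjI allI ballI)
    show "bounded_linear (\<lambda>x. \<Sum>b\<in>B. (x \<bullet> b) *\<^sub>R b)"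
      by (intro bounded_linear_sum bounded_linear_compose[OF bounded_linear_scaleR_left bounded_linear_inner_left])
    show "(\<Sum>b\<in>B. (x \<bullet> b) *\<^sub>R b) \<in> E" for x
      using B(1) by (intro subspace_sum[OF assms] subspace_scale[OF assms]) auto
    show "(\<Sum>b\<in>B. (x \<bullet> b) *\<^sub>R b) = x" if "x \<in> E" for x
      by (rule orthonormal_basis_expand) (use B fB that in auto)
  qed
qed

text \<open>A projection onto \<open>E\<close> fixes the curve and hence its derivative. Needed
  because the metric is controlled only on vectors of \<open>E\<close>.\<close>

lemma derivative_in_subspace:
  fixes f :: "real \<Rightarrow> 'e::euclidean_space"
  assumes E: "Real_Vector_Spaces.subspace E" and ab: "a < b" "t \<in> {a..b}"
    and f: "\<And>s. s \<in> {a..b} \<Longrightarrow> f s \<in> E" "(f has_vector_derivative v) (at t within {a..b})"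
  shows "v \<in> E"
proof -
  obtain P where P: "bounded_linear P" "\<And>x. P x \<in> E" "\<And>x. x \<in> E \<Longrightarrow> P x = x"
    using exists_projection_onto_subspace[OF E] by blast
  have "((\<lambda>s. P (f s)) has_vector_derivative P v) (at t within {a..b})"
    by (rule bounded_linear.has_vector_derivative[OF P(1) f(2)])
  then have "(f has_vector_derivative P v) (at t within {a..b})"
    by (rule has_vector_derivative_transform[OF ab(2), rotated]) (use f(1) P(3) in auto)
  then have "v = P v"
    using vector_derivative_unique_within_closed_interval[of a b t f v "P v"] ab f(2) by (simp add: cbox_interval)
  then show ?thesis using P(2) by metis
qed

context riemannian_manifold
begin

definition chart_inv :: "'a set \<times> ('a \<Rightarrow> 'e) \<Rightarrow> 'e \<Rightarrow> 'a" where
  "chart_inv c = inv_into (fst c) (snd c)"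

lemma chart_open: "c \<in> \<A> \<Longrightarrow> openin X (fst c)"
  using chart_domain by (cases c) auto

lemma chart_subset: "c \<in> \<A> \<Longrightarrow> fst c \<subseteq> topspace X"
  using chart_open openin_subset by blast

lemma chart_map: "c \<in> \<A> \<Longrightarrow> homeomorphic_map (subtopology X (fst c)) (top_of_set (snd c ` fst c)) (snd c)"
  using chart_homeo by (cases c) auto

lemma chart_inj: "c \<in> \<A> \<Longrightarrow> inj_on (snd c) (fst c)"
  using homeomorphic_imp_injective_map[OF chart_map] chart_subset by (metis topspace_subtopology_subset)

lemma chart_inv [simp]:
  assumes "c \<in> \<A>"
  shows "z \<in> fst c \<Longrightarrow> chart_inv c (snd c z) = z"
    and "x \<in> snd c ` fst c \<Longrightarrow> chart_inv c x \<in> fst c"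
    and "x \<in> snd c ` fst c \<Longrightarrow> snd c (chart_inv c x) = x"
  using chart_inj[OF assms] by (auto simp: chart_inv_def inv_into_f_f)

lemma chart_image_open:
  assumes c: "c \<in> \<A>" and W: "openin X W"
  shows "openin (top_of_set E) (snd c ` (fst c \<inter> W))"
proof -
  have "openin (subtopology X (fst c)) (fst c \<inter> W)"
    using W by (simp add: openin_subtopology_Int2)
  then have "openin (top_of_set (snd c ` fst c)) (snd c ` (fst c \<inter> W))"
    using homeomorphic_imp_open_map[OF chart_map[OF c]] by (auto simp: open_map_def)
  moreover have "openin (top_of_set E) (snd c ` fst c)" using chart_range c by (cases c) auto
  ultimately show ?thesis using openin_trans by blast
qed

lemma chart_image_subset: "c \<in> \<A> \<Longrightarrow> snd c ` fst c \<subseteq> E"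
  using chart_image_open[of c "topspace X"] chart_subset openin_subset
  by (metis inf.absorb1 openin_topspace topspace_euclidean_subtopology)

lemma continuous_chart: "c \<in> \<A> \<Longrightarrow> continuous_map (subtopology X (fst c)) euclidean (snd c)"
  using homeomorphic_imp_continuous_map[OF chart_map] by (simp add: continuous_map_in_subtopology)

lemma continuous_chart_inv:
  assumes c: "c \<in> \<A>"
  shows "continuous_map (top_of_set (snd c ` fst c)) X (chart_inv c)"
proof -
  obtain h where h: "homeomorphic_maps (subtopology X (fst c)) (top_of_set (snd c ` fst c)) (snd c) h"
    using chart_map[OF c] homeomorphic_map_maps by blast
  then have "continuous_map (top_of_set (snd c ` fst c)) X h"
    by (auto simp: homeomorphic_maps_def continuous_map_in_subtopology)
  moreover have "h x = chart_inv c x" if "x \<in> snd c ` fst c" for x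
    using h that c chart_subset[OF c] by (auto simp: homeomorphic_maps_def)
  ultimately show ?thesis by (auto intro: continuous_map_eq)
qed

lemma transition_differentiable:
  assumes "c \<in> \<A>" "c' \<in> \<A>" "z \<in> fst c \<inter> fst c'"
  shows "\<exists>D. ((snd c' \<circ> chart_inv c) has_derivative D) (at (snd c z) within snd c ` (fst c \<inter> fst c'))"
proof -
  obtain U \<phi> V \<psi> where e: "c = (U, \<phi>)" "c' = (V, \<psi>)" by (cases c, cases c') auto
  have "smooth_on E (\<phi> ` (U \<inter> V)) (\<psi> \<circ> inv_into U \<phi>)"
    using transition_smooth[of U \<phi> V \<psi>] assms by (simp add: e)
  then have "Ck_on E (Suc 0) (\<phi> ` (U \<inter> V)) (\<psi> \<circ> inv_into U \<phi>)"
    unfolding smooth_on_def by (rule spec)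
  then obtain D where "\<forall>x\<in>\<phi> ` (U \<inter> V). ((\<psi> \<circ> inv_into U \<phi>) has_derivative D x) (at x within \<phi> ` (U \<inter> V))"
    by auto
  then have "((\<psi> \<circ> inv_into U \<phi>) has_derivative D (\<phi> z)) (at (\<phi> z) within \<phi> ` (U \<inter> V))"
    using assms(3) by (auto simp: e)
  then show ?thesis by (auto simp: e chart_inv_def)
qed

lemma metric_transform':
  assumes "c \<in> \<A>" "c' \<in> \<A>" "z \<in> fst c \<inter> fst c'"
    and "((snd c' \<circ> chart_inv c) has_derivative D) (at (snd c z) within snd c ` (fst c \<inter> fst c'))" "v \<in> E"
  shows "g c (snd c z) v v = g c' (snd c' z) (D v) (D v)"
  using metric_transform[of "fst c" "snd c" "fst c'" "snd c'" z D v v] assms by (simp add: chart_inv_def)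

text \<open>By the chain rule the velocity transforms with the derivative \<open>D\<close> of the
  transition map, and the metric is invariant under \<open>D\<close>.\<close>

lemma change_of_chart:
  assumes c: "c \<in> \<A>" "c' \<in> \<A>" and t: "a < t" "t < b" "\<gamma> ` {a..b} \<subseteq> fst c" "\<gamma> t \<in> fst c'"
    and cont: "continuous_on {a..b} (snd c \<circ> \<gamma>)"
    and deriv: "((snd c \<circ> \<gamma>) has_vector_derivative v) (at t)" and v: "v \<in> E"
  shows "\<exists>w. ((snd c' \<circ> \<gamma>) has_vector_derivative w) (at t) \<and>
    g c' (snd c' (\<gamma> t)) w w = g c (snd c (\<gamma> t)) v v"
proof -
  let ?z = "\<gamma> t"
  have z: "?z \<in> fst c \<inter> fst c'" using t by auto
  obtain D where D: "((snd c' \<circ> chart_inv c) has_derivative D) (at (snd c ?z) within snd c ` (fst c \<inter> fst c'))"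
    using transition_differentiable[OF c z] by blast
  \<comment> \<open>The overlap is open only relative to \<open>E\<close>. Since the curve runs in
    \<open>E\<close>, the preimage of \<open>W\<close> is nevertheless an open set of times.\<close>
  obtain W where W: "open W" "snd c ` (fst c \<inter> fst c') = E \<inter> W"
    using chart_image_open[OF c(1) chart_open[OF c(2)]] by (auto simp: openin_open)
  define N where "N = {a<..<b} \<inter> (snd c \<circ> \<gamma>) -` W"
  have "continuous_on {a<..<b} (snd c \<circ> \<gamma>)" by (rule continuous_on_subset[OF cont]) auto
  then have "open N" unfolding N_def by (rule continuous_open_preimage[OF _ open_greaterThanLessThan W(1)])
  have tN: "t \<in> N" using t z W by (auto simp: N_def)
  have NU: "snd c (\<gamma> s) \<in> snd c ` (fst c \<inter> fst c')" "\<gamma> s \<in> fst c" if "s \<in> N" for s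
  proof -
    show s: "\<gamma> s \<in> fst c" using that t(3) by (auto simp: N_def)
    then show "snd c (\<gamma> s) \<in> snd c ` (fst c \<inter> fst c')"
      unfolding W(2) using that chart_image_subset[OF c(1)] by (auto simp: N_def)
  qed
  have at: "at t within N = at t" by (rule at_within_open[OF tN \<open>open N\<close>])
  have "((snd c \<circ> \<gamma>) has_derivative (\<lambda>h. h *\<^sub>R v)) (at t within N)"
    using deriv by (simp add: at has_vector_derivative_def)
  moreover have "((snd c' \<circ> chart_inv c) has_derivative D) (at ((snd c \<circ> \<gamma>) t) within (snd c \<circ> \<gamma>) ` N)"
    using has_derivative_subset[OF D] NU(1) by (auto simp: image_subset_iff)
  ultimately have "((snd c' \<circ> chart_inv c \<circ> (snd c \<circ> \<gamma>)) has_derivative (D \<circ> (\<lambda>h. h *\<^sub>R v))) (at t within N)"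
    by (rule diff_chain_within)
  moreover have "D \<circ> (\<lambda>h. h *\<^sub>R v) = (\<lambda>h. h *\<^sub>R D v)"
    using linear_scale[OF has_derivative_linear[OF D]] by auto
  ultimately have "((snd c' \<circ> chart_inv c \<circ> (snd c \<circ> \<gamma>)) has_vector_derivative D v) (at t)"
    by (simp add: at has_vector_derivative_def)
  then have "((snd c' \<circ> \<gamma>) has_vector_derivative D v) (at t)"
    by (rule has_vector_derivative_transform_within_open[OF _ \<open>open N\<close> tN]) (use NU(2) c in auto)
  then show ?thesis using metric_transform'[OF c z D v] by auto
qed

text \<open>Frees \<open>speed\<close> from the arbitrary chart in its definition, at interior times
  of a piece.\<close>

lemma speed_in_chart:
  assumes c: "c \<in> \<A>" and t: "a < t" "t < b" "\<gamma> ` {a..b} \<subseteq> fst c"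
    and cont: "continuous_on {a..b} (snd c \<circ> \<gamma>)"
    and deriv: "((snd c \<circ> \<gamma>) has_vector_derivative v) (at t)" and v: "v \<in> E"
  shows "speed \<A> g \<gamma> t = sqrt (g c (snd c (\<gamma> t)) v v)"
proof -
  define c' where "c' = (SOME c. c \<in> \<A> \<and> \<gamma> t \<in> fst c)"
  have "c \<in> \<A> \<and> \<gamma> t \<in> fst c" using t c by auto
  then have c': "c' \<in> \<A>" "\<gamma> t \<in> fst c'" unfolding c'_def using someI[of "\<lambda>c. c \<in> \<A> \<and> \<gamma> t \<in> fst c" c] by blast+
  obtain w where w: "((snd c' \<circ> \<gamma>) has_vector_derivative w) (at t)"
      "g c' (snd c' (\<gamma> t)) w w = g c (snd c (\<gamma> t)) v v"
    using change_of_chart[OF c c'(1) t c'(2) cont deriv v] by blast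
  then show ?thesis
    by (simp add: speed_def c'_def[symmetric] Let_def vector_derivative_at[OF w(1)])
qed

text \<open>Smoothness of the metric is given for fixed vectors only; expanding the moving vector in
  an orthonormal basis of \<open>E\<close> reduces to that.\<close>

lemma metric_continuous:
  assumes c: "c \<in> \<A>" and x: "continuous_on T x" "x ` T \<subseteq> snd c ` fst c"
    and v: "continuous_on T v" "v ` T \<subseteq> E"
  shows "continuous_on T (\<lambda>t. g c (x t) (v t) (v t))"
proof -
  obtain B where B: "B \<subseteq> E" "pairwise orthogonal B" "\<And>x. x \<in> B \<Longrightarrow> norm x = 1" "independent B" "span B = E"
    using orthonormal_basis_subspace[OF model_space] by metis
  have fB: "finite B" using B(4) by (simp add: independent_imp_finite)
  have e: "g c (x t) (v t) (v t) = (\<Sum>(i, j)\<in>B \<times> B. (v t \<bullet> i) * (v t \<bullet> j) * g c (x t) i j)" if t: "t \<in> T" for t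
  proof -
    have vt: "(\<Sum>b\<in>B. (v t \<bullet> b) *\<^sub>R b) = v t"
      by (rule orthonormal_basis_expand) (use B fB v t in auto)
    have bl: "bilinear (g c (x t))" using metric_bilinear[of "fst c" "snd c" "x t"] c x t by auto
    have "g c (x t) (v t) (v t) = g c (x t) (\<Sum>b\<in>B. (v t \<bullet> b) *\<^sub>R b) (\<Sum>b\<in>B. (v t \<bullet> b) *\<^sub>R b)"
      by (simp only: vt)
    also have "\<dots> = (\<Sum>(i, j)\<in>B \<times> B. g c (x t) ((v t \<bullet> i) *\<^sub>R i) ((v t \<bullet> j) *\<^sub>R j))"
      by (rule bilinear_sum[OF bl])
    finally show ?thesis by (simp add: bilinear_lmul[OF bl] bilinear_rmul[OF bl] mult_ac case_prod_unfold)
  qed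
  have "continuous_on T (\<lambda>t. \<Sum>(i, j)\<in>B \<times> B. (v t \<bullet> i) * (v t \<bullet> j) * g c (x t) i j)"
    unfolding case_prod_unfold
  proof (intro continuous_on_sum continuous_on_mult continuous_on_inner v(1) continuous_on_const)
    fix p assume "p \<in> B \<times> B"
    then have p: "fst p \<in> E" "snd p \<in> E" using B(1) by auto
    have "smooth_on E (snd c ` fst c) (\<lambda>x. g c x (fst p) (snd p))"
      using metric_smooth[of "fst c" "snd c", OF _ p] c by simp
    then have "Ck_on E 0 (snd c ` fst c) (\<lambda>x. g c x (fst p) (snd p))"
      unfolding smooth_on_def by (rule spec)
    then show "continuous_on T (\<lambda>t. g c (x t) (fst p) (snd p))"
      using continuous_on_compose2[OF _ x(1), of "snd c ` fst c" "\<lambda>x. g c x (fst p) (snd p)"] x(2) by auto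
  qed
  then show ?thesis by (rule continuous_on_eq) (use e in auto)
qed

subsection \<open>Piecewise \<open>C\<^sup>1\<close> curves and their lengths\<close>

text \<open>Partitions are replaced by an inductive predicate, so that lengths, restrictions and
  reparametrizations are treated piece by piece without indices.\<close>

inductive pw_C1 :: "(real \<Rightarrow> 'a) \<Rightarrow> real \<Rightarrow> real \<Rightarrow> bool" for \<gamma> where
  piece: "a < b \<Longrightarrow> c \<in> \<A> \<Longrightarrow> C1_in_chart c \<gamma> a b \<Longrightarrow> pw_C1 \<gamma> a b"
| combine: "pw_C1 \<gamma> a b \<Longrightarrow> pw_C1 \<gamma> b c \<Longrightarrow> pw_C1 \<gamma> a c"

lemma pw_C1_less: "pw_C1 \<gamma> a b \<Longrightarrow> a < b"
  by (induction rule: pw_C1.induct) auto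

lemma pw_C1_of_partition:
  assumes "\<forall>i<m. t i < t (Suc i) \<and> (\<exists>c\<in>\<A>. C1_in_chart c \<gamma> (t i) (t (Suc i)))" "0 < m"
  shows "pw_C1 \<gamma> (t 0) (t (m::nat))"
  using assms
proof (induction m)
  case (Suc m)
  have last: "pw_C1 \<gamma> (t m) (t (Suc m))" using Suc.prems by (auto intro: piece)
  show ?case
  proof (cases "m = 0")
    case False
    then have "pw_C1 \<gamma> (t 0) (t m)" using Suc by auto
    then show ?thesis using last by (rule combine)
  qed (use last in simp)
qed simp

lemma partition_of_pw_C1:
  assumes "pw_C1 \<gamma> a b"
  shows "\<exists>(m::nat) t. t 0 = a \<and> t m = b \<and> (\<forall>i<m. t i < t (Suc i) \<and> (\<exists>c\<in>\<A>. C1_in_chart c \<gamma> (t i) (t (Suc i))))"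
  using assms
proof (induction rule: pw_C1.induct)
  case (piece a b c)
  then show ?case by (intro exI[of _ "1::nat"] exI[of _ "\<lambda>i. if i = 0 then a else b"]) auto
next
  case (combine a b c)
  then obtain m t m' t' where t: "t 0 = a" "t (m::nat) = b"
      "\<forall>i<m. t i < t (Suc i) \<and> (\<exists>c\<in>\<A>. C1_in_chart c \<gamma> (t i) (t (Suc i)))"
    and t': "t' 0 = b" "t' (m'::nat) = c"
      "\<forall>i<m'. t' i < t' (Suc i) \<and> (\<exists>c\<in>\<A>. C1_in_chart c \<gamma> (t' i) (t' (Suc i)))" by blast
  \<comment> \<open>The second partition is shifted by \<open>m\<close>; the common value
    \<open>t m = t' 0\<close> joins the two.\<close>
  define u where "u i = (if i \<le> m then t i else t' (i - m))" for i
  have u': "u (m + i) = t' i" for i using t t' by (cases i) (auto simp: u_def)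
  have "u i < u (Suc i) \<and> (\<exists>c\<in>\<A>. C1_in_chart c \<gamma> (u i) (u (Suc i)))" if "i < m + m'" for i
  proof (cases "i < m")
    case True
    then show ?thesis using t(3) by (auto simp: u_def)
  next
    case False
    then obtain j where j: "i = m + j" using le_Suc_ex not_less by blast
    then show ?thesis using t'(3) that u'[of j] u'[of "Suc j"] by auto
  qed
  moreover have "u 0 = a" "u (m + m') = c" using u'[of m'] t t' by (auto simp: u_def)
  ultimately show ?case by blast
qed

lemma piecewise_C1_curve_iff: "piecewise_C1_curve X \<A> \<gamma> \<longleftrightarrow> pathin X \<gamma> \<and> pw_C1 \<gamma> 0 1"
proof -
  \<comment> \<open>The case \<open>m = 0\<close> is impossible, as it would give
    \<open>0 = 1\<close>.\<close>
  have "pw_C1 \<gamma> 0 1" if "t 0 = (0::real)" "t (m::nat) = 1"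
      "\<forall>i<m. t i < t (Suc i) \<and> (\<exists>c\<in>\<A>. C1_in_chart c \<gamma> (t i) (t (Suc i)))" for m t
    using pw_C1_of_partition[OF that(3)] that(1,2) by (cases "m = 0") auto
  then show ?thesis unfolding piecewise_C1_curve_def using partition_of_pw_C1[of \<gamma> 0 1] by blast
qed

text \<open>At the ends of a piece the two-sided derivative in \<open>speed\<close> also sees the
  neighbouring piece, so the formula for the speed is confined to the open interval.\<close>

lemma C1_in_chartE:
  assumes c: "c \<in> \<A>" "C1_in_chart c \<gamma> a b" and ab: "a < b"
  obtains D where "continuous_on {a..b} D" "\<gamma> ` {a..b} \<subseteq> fst c" "continuous_on {a..b} (snd c \<circ> \<gamma>)"
    "\<And>t. t \<in> {a..b} \<Longrightarrow> ((snd c \<circ> \<gamma>) has_vector_derivative D t) (at t within {a..b})"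
    "\<And>t. t \<in> {a..b} \<Longrightarrow> D t \<in> E"
    "\<And>t. t \<in> {a<..<b} \<Longrightarrow> ((snd c \<circ> \<gamma>) has_vector_derivative D t) (at t)"
    "\<And>t. t \<in> {a<..<b} \<Longrightarrow> speed \<A> g \<gamma> t = sqrt (g c (snd c (\<gamma> t)) (D t) (D t))"
proof -
  obtain D where D: "continuous_on {a..b} D" "\<gamma> ` {a..b} \<subseteq> fst c"
    "\<And>t. t \<in> {a..b} \<Longrightarrow> ((snd c \<circ> \<gamma>) has_vector_derivative D t) (at t within {a..b})"
    using c(2) unfolding C1_in_chart_def by blast
  have cont: "continuous_on {a..b} (snd c \<circ> \<gamma>)"
    using D(3) has_vector_derivative_continuous continuous_on_eq_continuous_within by blast
  have DE: "D t \<in> E" if "t \<in> {a..b}" for t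
    using D(2) chart_image_subset[OF c(1)]
    by (intro derivative_in_subspace[OF model_space ab that _ D(3)[OF that]]) (auto simp: image_subset_iff)
  have D': "((snd c \<circ> \<gamma>) has_vector_derivative D t) (at t)" if "t \<in> {a<..<b}" for t
    using D(3)[of t] that at_within_interior[of t "{a..b}"] by auto
  have "speed \<A> g \<gamma> t = sqrt (g c (snd c (\<gamma> t)) (D t) (D t))" if "t \<in> {a<..<b}" for t
    using that DE[of t] by (intro speed_in_chart[OF c(1) _ _ D(2) cont D'[OF that]]) auto
  then show ?thesis using that[OF D(1,2) cont D(3) DE D'] by blast
qed

lemma metric_nonneg: "c \<in> \<A> \<Longrightarrow> x \<in> snd c ` fst c \<Longrightarrow> v \<in> E \<Longrightarrow> 0 \<le> g c x v v"
  using metric_pos[of "fst c" "snd c" x v] bilinear_lzero[OF metric_bilinear[of "fst c" "snd c" x]]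
  by (cases "v = 0") (auto intro: less_imp_le)

text \<open>Off the two end points the speed is a continuous function, and two points do not affect
  integrals.\<close>

lemma speed_integrable_piece:
  assumes c: "c \<in> \<A>" "C1_in_chart c \<gamma> a b" and ab: "a < b"
  shows "speed \<A> g \<gamma> integrable_on {a..b}" "0 \<le> integral {a..b} (speed \<A> g \<gamma>)"
proof -
  obtain D where D: "continuous_on {a..b} D" "\<gamma> ` {a..b} \<subseteq> fst c" "continuous_on {a..b} (snd c \<circ> \<gamma>)"
    "\<And>t. t \<in> {a..b} \<Longrightarrow> D t \<in> E"
    "\<And>t. t \<in> {a<..<b} \<Longrightarrow> speed \<A> g \<gamma> t = sqrt (g c (snd c (\<gamma> t)) (D t) (D t))"
    by (rule C1_in_chartE[OF assms]) blast
  let ?f = "\<lambda>t. sqrt (g c (snd c (\<gamma> t)) (D t) (D t))"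
  have "continuous_on {a..b} ?f"
    using D by (intro continuous_on_real_sqrt metric_continuous[OF c(1)]) (auto simp: o_def)
  then have int: "?f integrable_on {a..b}" by (rule integrable_continuous_real)
  have eq: "speed \<A> g \<gamma> t = ?f t" if "t \<in> {a..b} - {a, b}" for t using D(5)[of t] that by auto
  show "speed \<A> g \<gamma> integrable_on {a..b}"
    by (rule integrable_spike_finite[where S = "{a, b}", OF _ eq int]) auto
  have "integral {a..b} (speed \<A> g \<gamma>) = integral {a..b} ?f"
    by (rule integral_unique, rule has_integral_spike_finite[where S = "{a, b}", OF _ eq integrable_integral[OF int]]) simp
  also have "0 \<le> \<dots>"
    by (rule Henstock_Kurzweil_Integration.integral_nonneg[OF int])
      (use D in \<open>auto simp: image_subset_iff intro!: metric_nonneg[OF c(1)]\<close>)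
  finally show "0 \<le> integral {a..b} (speed \<A> g \<gamma>)" .
qed

lemma speed_integrable:
  assumes "pw_C1 \<gamma> a b"
  shows "speed \<A> g \<gamma> integrable_on {a..b} \<and> 0 \<le> integral {a..b} (speed \<A> g \<gamma>)"
  using assms
proof (induction rule: pw_C1.induct)
  case (combine a b c)
  have "a \<le> b" "b \<le> c" using pw_C1_less combine by (auto intro: less_imp_le)
  then have i: "speed \<A> g \<gamma> integrable_on {a..c}"
    using combine Henstock_Kurzweil_Integration.integrable_combine by blast
  then show ?case
    using Henstock_Kurzweil_Integration.integral_combine[OF \<open>a \<le> b\<close> \<open>b \<le> c\<close> i] combine by auto
qed (use speed_integrable_piece in blast)

lemma pw_C1_restrict:
  assumes "pw_C1 \<gamma> a b" "a \<le> a'" "a' < b'" "b' \<le> b"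
  shows "pw_C1 \<gamma> a' b'"
  using assms
proof (induction arbitrary: a' b' rule: pw_C1.induct)
  case (piece a b c)
  have sub: "{a'..b'} \<subseteq> {a..b}" using piece by auto
  obtain D where "\<gamma> ` {a..b} \<subseteq> fst c" "continuous_on {a..b} D"
    "\<forall>t\<in>{a..b}. ((snd c \<circ> \<gamma>) has_vector_derivative D t) (at t within {a..b})"
    using piece(3) unfolding C1_in_chart_def by blast
  then have "C1_in_chart c \<gamma> a' b'"
    unfolding C1_in_chart_def using sub
    by (intro conjI exI[of _ D] ballI)
      (auto intro: continuous_on_subset has_vector_derivative_within_subset[OF _ sub])
  then show ?case using piece by (auto intro: pw_C1.piece)
next
  case (combine a b c)
  consider "b' \<le> b" | "b \<le> a'" | "a' < b" "b < b'" by linarith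
  then show ?case
  proof cases
    case 3
    then have "pw_C1 \<gamma> a' b" "pw_C1 \<gamma> b b'" using combine by auto
    then show ?thesis by (rule pw_C1.combine)
  qed (use combine in auto)
qed

text \<open>\<open>k\<close> may be negative, so that both concatenation and reversal are covered;
  \<open>maps\<close> says that the affine map takes one interval onto the other in either
  case.\<close>

lemma pw_C1_affine_piece:
  assumes piece: "a < b" "c \<in> \<A>" "C1_in_chart c \<gamma> a b" and "k \<noteq> 0" and pq: "p < q"
    and maps: "\<And>t. k * t + e \<in> {a..b} \<longleftrightarrow> t \<in> {p..q}" "\<And>t. k * t + e \<in> {a<..<b} \<longleftrightarrow> t \<in> {p<..<q}"
    and \<gamma>': "\<And>t. t \<in> {p..q} \<Longrightarrow> \<gamma>' t = \<gamma> (k * t + e)"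
  shows "pw_C1 \<gamma>' p q" "integral {p..q} (speed \<A> g \<gamma>') = integral {a..b} (speed \<A> g \<gamma>)"
proof -
  obtain D where D: "continuous_on {a..b} D" "\<gamma> ` {a..b} \<subseteq> fst c"
    "\<And>t. t \<in> {a..b} \<Longrightarrow> ((snd c \<circ> \<gamma>) has_vector_derivative D t) (at t within {a..b})"
    "\<And>t. t \<in> {a..b} \<Longrightarrow> D t \<in> E"
    "\<And>t. t \<in> {a<..<b} \<Longrightarrow> speed \<A> g \<gamma> t = sqrt (g c (snd c (\<gamma> t)) (D t) (D t))"
    by (rule C1_in_chartE[OF piece(2,3,1)]) blast
  let ?h = "\<lambda>t. k * t + e"
  have h: "?h ` {p..q} \<subseteq> {a..b}" using maps by auto
  have D': "((snd c \<circ> \<gamma>') has_vector_derivative k *\<^sub>R D (?h t)) (at t within {p..q})" if t: "t \<in> {p..q}" for t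
  proof -
    have "(?h has_vector_derivative k) (at t within {p..q})" by (auto intro!: derivative_eq_intros)
    moreover have "((snd c \<circ> \<gamma>) has_vector_derivative D (?h t)) (at (?h t) within ?h ` {p..q})"
      by (rule has_vector_derivative_within_subset[OF D(3) h]) (use maps t in auto)
    ultimately have "((snd c \<circ> \<gamma> \<circ> ?h) has_vector_derivative k *\<^sub>R D (?h t)) (at t within {p..q})"
      by (rule vector_diff_chain_within)
    then show ?thesis
      by (rule has_vector_derivative_transform[OF t, rotated]) (use \<gamma>' in auto)
  qed
  have C1: "C1_in_chart c \<gamma>' p q"
    unfolding C1_in_chart_def
  proof (intro conjI exI[of _ "\<lambda>t. k *\<^sub>R D (?h t)"] ballI D')
    show "\<gamma>' ` {p..q} \<subseteq> fst c" using D(2) \<gamma>' maps by auto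
    show "continuous_on {p..q} (\<lambda>t. k *\<^sub>R D (?h t))"
      by (intro continuous_on_scaleR continuous_on_const continuous_on_compose2[OF D(1) _ h] continuous_intros)
  qed
  then have pw: "pw_C1 \<gamma>' p q" using pq piece(2) by (auto intro: pw_C1.piece)
  have DE: "k *\<^sub>R D (?h t) \<in> E" if "t \<in> {p..q}" for t
    using D(4) maps that subspace_scale[OF model_space] by auto
  have cont': "continuous_on {p..q} (snd c \<circ> \<gamma>')"
    using D' has_vector_derivative_continuous continuous_on_eq_continuous_within by blast
  \<comment> \<open>The factor \<open>\<bar>k\<bar>\<close> will cancel against the one from
    substitution in the integral.\<close>
  have sp: "speed \<A> g \<gamma>' t = \<bar>k\<bar> * speed \<A> g \<gamma> (?h t)" if t: "t \<in> {p<..<q}" for t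
  proof -
    have t': "t \<in> {p..q}" using t by auto
    have "\<gamma>' t \<in> fst c" using C1 t' by (auto simp: C1_in_chart_def)
    then have bl: "bilinear (g c (snd c (\<gamma>' t)))"
      using metric_bilinear[of "fst c" "snd c" "snd c (\<gamma>' t)"] piece(2) by simp
    have "((snd c \<circ> \<gamma>') has_vector_derivative k *\<^sub>R D (?h t)) (at t)"
      using D'[OF t'] t at_within_interior[of t "{p..q}"] by auto
    then have "speed \<A> g \<gamma>' t = sqrt (g c (snd c (\<gamma>' t)) (k *\<^sub>R D (?h t)) (k *\<^sub>R D (?h t)))"
      using t C1 DE[OF t'] by (intro speed_in_chart[OF piece(2) _ _ _ cont']) (auto simp: C1_in_chart_def)
    also have "\<dots> = sqrt (k\<^sup>2 * g c (snd c (\<gamma>' t)) (D (?h t)) (D (?h t)))"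
      by (simp add: bilinear_lmul[OF bl] bilinear_rmul[OF bl] power2_eq_square mult.assoc)
    also have "\<dots> = \<bar>k\<bar> * sqrt (g c (snd c (\<gamma> (?h t))) (D (?h t)) (D (?h t)))"
      using \<gamma>'[OF t'] by (simp add: real_sqrt_mult)
    also have "\<dots> = \<bar>k\<bar> * speed \<A> g \<gamma> (?h t)" using D(5)[of "?h t"] maps t by auto
    finally show ?thesis .
  qed
  have "(speed \<A> g \<gamma> has_integral integral {a..b} (speed \<A> g \<gamma>)) (cbox a b)"
    using speed_integrable_piece(1)[OF piece(2,3,1)] by (simp add: has_integral_integral cbox_interval)
  from has_integral_affinity[OF this \<open>k \<noteq> 0\<close>, of e]
  have "((\<lambda>t. speed \<A> g \<gamma> (?h t)) has_integral integral {a..b} (speed \<A> g \<gamma>) / \<bar>k\<bar>)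
      ((\<lambda>x. x / k - e / k) ` {a..b})" by (simp add: cbox_interval field_simps)
  moreover have "(\<lambda>x. x / k - e / k) ` {a..b} = {p..q}"
  proof (intro equalityI subsetI)
    fix t assume "t \<in> (\<lambda>x. x / k - e / k) ` {a..b}"
    then obtain x where "x \<in> {a..b}" "t = x / k - e / k" by blast
    then show "t \<in> {p..q}" using maps(1)[of t] \<open>k \<noteq> 0\<close> by (simp add: field_simps)
  next
    fix t assume "t \<in> {p..q}"
    then show "t \<in> (\<lambda>x. x / k - e / k) ` {a..b}"
      using maps(1)[of t] \<open>k \<noteq> 0\<close> by (intro image_eqI[of _ _ "?h t"]) (auto simp: field_simps)
  qed
  ultimately have "((\<lambda>t. speed \<A> g \<gamma> (?h t)) has_integral integral {a..b} (speed \<A> g \<gamma>) / \<bar>k\<bar>) {p..q}"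
    by simp
  from has_integral_mult_right[OF this, of "\<bar>k\<bar>"]
  have "((\<lambda>t. \<bar>k\<bar> * speed \<A> g \<gamma> (?h t)) has_integral \<bar>k\<bar> * (integral {a..b} (speed \<A> g \<gamma>) / \<bar>k\<bar>)) {p..q}" .
  then have hi: "((\<lambda>t. \<bar>k\<bar> * speed \<A> g \<gamma> (?h t)) has_integral integral {a..b} (speed \<A> g \<gamma>)) {p..q}"
    using \<open>k \<noteq> 0\<close> by simp
  have eq: "speed \<A> g \<gamma>' t = \<bar>k\<bar> * speed \<A> g \<gamma> (?h t)" if "t \<in> {p..q} - {p, q}" for t
    using sp that by auto
  have "(speed \<A> g \<gamma>' has_integral integral {a..b} (speed \<A> g \<gamma>)) {p..q}"
    by (rule has_integral_spike_finite[where S = "{p, q}", OF _ eq hi]) simp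
  then show "integral {p..q} (speed \<A> g \<gamma>') = integral {a..b} (speed \<A> g \<gamma>)" by (rule integral_unique)
  show "pw_C1 \<gamma>' p q" by (rule pw)
qed

lemma pw_C1_combine_length:
  assumes "pw_C1 \<gamma> a b" "pw_C1 \<gamma> b c"
  shows "pw_C1 \<gamma> a c"
    "integral {a..c} (speed \<A> g \<gamma>) = integral {a..b} (speed \<A> g \<gamma>) + integral {b..c} (speed \<A> g \<gamma>)"
proof -
  show pw: "pw_C1 \<gamma> a c" by (rule combine[OF assms])
  show "integral {a..c} (speed \<A> g \<gamma>) = integral {a..b} (speed \<A> g \<gamma>) + integral {b..c} (speed \<A> g \<gamma>)"
    using Henstock_Kurzweil_Integration.integral_combine[of a b c "speed \<A> g \<gamma>"] speed_integrable[OF pw]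
      pw_C1_less[OF assms(1)] pw_C1_less[OF assms(2)] by simp
qed

lemma pw_C1_affine:
  assumes "pw_C1 \<gamma> a b" "0 < k" "\<And>t. t \<in> {(a - e) / k..(b - e) / k} \<Longrightarrow> \<gamma>' t = \<gamma> (k * t + e)"
  shows "pw_C1 \<gamma>' ((a - e) / k) ((b - e) / k) \<and>
    integral {(a - e) / k..(b - e) / k} (speed \<A> g \<gamma>') = integral {a..b} (speed \<A> g \<gamma>)"
  using assms(1,3)
proof (induction rule: pw_C1.induct)
  case (piece a b c)
  show ?case
    by (intro conjI pw_C1_affine_piece[OF piece(1-3), where k = k and e = e])
      (use piece assms(2) in \<open>auto simp: field_simps\<close>)
next
  case (combine a b c)
  have "(a - e) / k \<le> (b - e) / k" "(b - e) / k \<le> (c - e) / k"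
    using pw_C1_less combine.hyps assms(2) by (auto intro!: divide_right_mono simp: less_imp_le)
  then have 1: "pw_C1 \<gamma>' ((a - e) / k) ((b - e) / k) \<and>
      integral {(a - e) / k..(b - e) / k} (speed \<A> g \<gamma>') = integral {a..b} (speed \<A> g \<gamma>)"
    and 2: "pw_C1 \<gamma>' ((b - e) / k) ((c - e) / k) \<and>
      integral {(b - e) / k..(c - e) / k} (speed \<A> g \<gamma>') = integral {b..c} (speed \<A> g \<gamma>)"
    by (auto intro!: combine.IH combine.prems)
  show ?case
    using pw_C1_combine_length[of \<gamma>' "(a - e) / k" "(b - e) / k" "(c - e) / k"] pw_C1_combine_length[OF combine.hyps] 1 2
    by simp
qed

lemma pw_C1_reverse:
  assumes "pw_C1 \<gamma> a b" "\<And>t. t \<in> {e - b..e - a} \<Longrightarrow> \<gamma>' t = \<gamma> (e - t)"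
  shows "pw_C1 \<gamma>' (e - b) (e - a) \<and>
    integral {e - b..e - a} (speed \<A> g \<gamma>') = integral {a..b} (speed \<A> g \<gamma>)"
  using assms
proof (induction rule: pw_C1.induct)
  case (piece a b c)
  show ?case
    by (intro conjI pw_C1_affine_piece[OF piece(1-3), where k = "-1" and e = e])
      (use piece in \<open>auto simp: field_simps\<close>)
next
  case (combine a b c)
  have "a \<le> b" "b \<le> c" using pw_C1_less combine.hyps by (auto simp: less_imp_le)
  then have 1: "pw_C1 \<gamma>' (e - b) (e - a) \<and> integral {e - b..e - a} (speed \<A> g \<gamma>') = integral {a..b} (speed \<A> g \<gamma>)"
    and 2: "pw_C1 \<gamma>' (e - c) (e - b) \<and> integral {e - c..e - b} (speed \<A> g \<gamma>') = integral {b..c} (speed \<A> g \<gamma>)"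
    by (auto intro!: combine.IH combine.prems)
  show ?case
    using pw_C1_combine_length[of \<gamma>' "e - c" "e - b" "e - a"] pw_C1_combine_length[OF combine.hyps] 1 2 by simp
qed

end

section \<open>The geodesic distance\<close>

text \<open>At break points the speed has an arbitrary value, so the estimate is available only
  inside; both functions are set to 0 at the ends.\<close>

lemma norm_integral_le_interior:
  fixes f :: "real \<Rightarrow> 'e::euclidean_space" and h :: "real \<Rightarrow> real"
  assumes f: "f integrable_on {a..b}" and h: "h integrable_on {a..b}"
    and le: "\<And>t. t \<in> {a<..<b} \<Longrightarrow> norm (f t) \<le> h t"
  shows "norm (integral {a..b} f) \<le> integral {a..b} h"
proof -
  define f' where "f' t = (if t \<in> {a<..<b} then f t else 0)" for t
  define h' where "h' t = (if t \<in> {a<..<b} then h t else 0)" for t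
  have ef: "f' t = f t" and eh: "h' t = h t" if "t \<in> {a..b} - {a, b}" for t using that by (auto simp: f'_def h'_def)
  have f': "(f' has_integral integral {a..b} f) {a..b}"
    by (rule has_integral_spike_finite[where S = "{a, b}", OF _ ef integrable_integral[OF f]]) simp
  have h': "(h' has_integral integral {a..b} h) {a..b}"
    by (rule has_integral_spike_finite[where S = "{a, b}", OF _ eh integrable_integral[OF h]]) simp
  have "norm (integral {a..b} f') \<le> integral {a..b} h'"
    by (rule Henstock_Kurzweil_Integration.integral_norm_bound_integral)
      (use f' h' le in \<open>auto simp: f'_def h'_def integrable_on_def\<close>)
  then show ?thesis using f' h' by (simp add: integral_unique)
qed

section \<open>Comparison of Riemannian and coordinate distances\<close>

context riemannian_manifold
begin

text \<open>The Riemannian norm lies between two multiples of the Euclidean one. Balls are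
  intersected with \<open>E\<close> because images of charts are open only in
  \<open>E\<close>.\<close>

definition metric_bounds :: "'a set \<times> ('a \<Rightarrow> 'e) \<Rightarrow> 'a \<Rightarrow> real \<Rightarrow> real \<Rightarrow> real \<Rightarrow> bool" where
  "metric_bounds c p \<rho> \<mu> \<Lambda> \<longleftrightarrow> c \<in> \<A> \<and> p \<in> fst c \<and> 0 < \<rho> \<and> 0 < \<mu> \<and> 0 < \<Lambda> \<and>
     cball (snd c p) \<rho> \<inter> E \<subseteq> snd c ` fst c \<and>
     (\<forall>x\<in>cball (snd c p) \<rho> \<inter> E. \<forall>v\<in>E. \<mu> * norm v \<le> sqrt (g c x v v) \<and> sqrt (g c x v v) \<le> \<Lambda> * norm v)"

lemma metric_boundsD:
  assumes "metric_bounds c p \<rho> \<mu> \<Lambda>"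
  shows "c \<in> \<A>" "p \<in> fst c" "0 < \<rho>" "0 < \<mu>" "0 < \<Lambda>" "cball (snd c p) \<rho> \<inter> E \<subseteq> snd c ` fst c"
    "\<And>x v. x \<in> cball (snd c p) \<rho> \<inter> E \<Longrightarrow> v \<in> E \<Longrightarrow> \<mu> * norm v \<le> sqrt (g c x v v)"
    "\<And>x v. x \<in> cball (snd c p) \<rho> \<inter> E \<Longrightarrow> v \<in> E \<Longrightarrow> sqrt (g c x v v) \<le> \<Lambda> * norm v"
  using assms unfolding metric_bounds_def by blast+

definition chart_ball :: "'a set \<times> ('a \<Rightarrow> 'e) \<Rightarrow> 'a \<Rightarrow> real \<Rightarrow> 'a set" where
  "chart_ball c p r = {z \<in> fst c. snd c z \<in> ball (snd c p) r}"

lemma openin_chart_ball: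
  assumes c: "c \<in> \<A>"
  shows "openin X (chart_ball c p r)"
proof -
  have "openin (subtopology X (fst c)) {z \<in> topspace (subtopology X (fst c)). snd c z \<in> ball (snd c p) r}"
    by (rule openin_continuous_map_preimage[OF continuous_chart[OF c]]) simp
  moreover have "{z \<in> topspace (subtopology X (fst c)). snd c z \<in> ball (snd c p) r} = chart_ball c p r"
    using chart_subset[OF c] by (auto simp: chart_ball_def)
  ultimately show ?thesis using chart_open[OF c] openin_trans_full by metis
qed

text \<open>The metric attains a positive minimum and a maximum on the compact set of pairs of a
  point of the ball and a unit vector of \<open>E\<close>; homogeneity does the rest.\<close>

lemma exists_metric_bounds:
  assumes p: "p \<in> W" and W: "openin X W"
  shows "\<exists>c \<rho> \<mu> \<Lambda>. metric_bounds c p \<rho> \<mu> \<Lambda> \<and> chart_ball c p \<rho> \<subseteq> W"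
proof -
  have "p \<in> topspace X" using p W openin_subset by blast
  then obtain U \<phi> where "(U, \<phi>) \<in> \<A>" "p \<in> U" unfolding charts_cover[symmetric] by blast
  then obtain c where c: "c \<in> \<A>" "p \<in> fst c" by (metis fst_conv)
  have "openin (top_of_set E) (snd c ` (fst c \<inter> W))" by (rule chart_image_open[OF c(1) W])
  then obtain \<rho> where \<rho>: "0 < \<rho>" "cball (snd c p) \<rho> \<inter> E \<subseteq> snd c ` (fst c \<inter> W)"
    using c p unfolding openin_contains_cball by blast
  define K where "K = cball (snd c p) \<rho> \<inter> E"
  define S where "S = sphere (0::'e) 1 \<inter> E"
  have cE: "closed E" by (rule closed_subspace[OF model_space])
  have K: "compact K" "K \<subseteq> snd c ` fst c" using \<rho>(2) cE by (auto simp: K_def intro: compact_Int_closed)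
  have S: "compact S" "S \<subseteq> E" using cE by (auto simp: S_def intro: compact_Int_closed)
  have pK: "snd c p \<in> K" using chart_image_subset[OF c(1)] c(2) \<rho>(1) by (auto simp: K_def)
  have "\<exists>\<mu> \<Lambda>. 0 < \<mu> \<and> 0 < \<Lambda> \<and> (\<forall>x\<in>K. \<forall>v\<in>E. \<mu> * norm v \<le> sqrt (g c x v v) \<and> sqrt (g c x v v) \<le> \<Lambda> * norm v)"
  proof (cases "S = {}")
    \<comment> \<open>Dimension 0: without unit vectors \<open>E\<close> is trivial, and the
      constants can be 1.\<close>
    case True
    have "v = 0" if "v \<in> E" for v
    proof (rule ccontr)
      assume "v \<noteq> 0"
      then have "(1 / norm v) *\<^sub>R v \<in> S" using that subspace_scale[OF model_space] by (simp add: S_def)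
      then show False using True by blast
    qed
    moreover have "g c x 0 0 = 0" if "x \<in> K" for x
      using bilinear_lzero[OF metric_bilinear[of "fst c" "snd c" x]] c that K(2) by auto
    ultimately have *: "\<forall>x\<in>K. \<forall>v\<in>E. 1 * norm v \<le> sqrt (g c x v v) \<and> sqrt (g c x v v) \<le> 1 * norm v"
      by (metis mult_zero_right norm_zero order_refl real_sqrt_zero)
    show ?thesis by (intro exI[of _ "1::real"] conjI *) simp_all
  next
    case False
    let ?Q = "\<lambda>z. g c (fst z) (snd z) (snd z)"
    have cont: "continuous_on (K \<times> S) ?Q"
      by (rule metric_continuous[OF c(1)]) (use K S in \<open>auto intro!: continuous_intros\<close>)
    have comp: "compact (K \<times> S)" "K \<times> S \<noteq> {}" using K S False pK by (auto intro: compact_Times)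
    obtain z where z: "z \<in> K \<times> S" "\<forall>y\<in>K \<times> S. ?Q z \<le> ?Q y" using continuous_attains_inf[OF comp cont] by blast
    obtain w where w: "w \<in> K \<times> S" "\<forall>y\<in>K \<times> S. ?Q y \<le> ?Q w" using continuous_attains_sup[OF comp cont] by blast
    have pos: "0 < ?Q y" if "y \<in> K \<times> S" for y
      using metric_pos[of "fst c" "snd c" "fst y" "snd y"] c that K(2) by (force simp: S_def)
    show ?thesis
    proof (rule exI[of _ "sqrt (?Q z)"], rule exI[of _ "sqrt (?Q w)"], intro conjI ballI)
      fix x v assume x: "x \<in> K" and v: "v \<in> E"
      have bl: "bilinear (g c x)" using metric_bilinear[of "fst c" "snd c" x] c x K(2) by auto
      have "sqrt (?Q z) * norm v \<le> sqrt (g c x v v) \<and> sqrt (g c x v v) \<le> sqrt (?Q w) * norm v"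
      proof (cases "v = 0")
        case True
        then show ?thesis by (simp add: bilinear_lzero[OF bl])
      next
        case False
        let ?u = "(1 / norm v) *\<^sub>R v"
        have u: "?u \<in> S" using False v subspace_scale[OF model_space] by (simp add: S_def)
        have vu: "v = norm v *\<^sub>R ?u" using False by simp
        have "g c x v v = g c x (norm v *\<^sub>R ?u) (norm v *\<^sub>R ?u)" using vu by simp
        also have "\<dots> = (norm v)\<^sup>2 * g c x ?u ?u"
          by (simp only: bilinear_lmul[OF bl] bilinear_rmul[OF bl] power2_eq_square mult.assoc mult.left_commute real_scaleR_def)
        finally have "sqrt (g c x v v) = norm v * sqrt (g c x ?u ?u)" by (simp add: real_sqrt_mult)
        moreover have "sqrt (?Q z) \<le> sqrt (g c x ?u ?u)" "sqrt (g c x ?u ?u) \<le> sqrt (?Q w)"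
          using z(2)[rule_format, of "(x, ?u)"] w(2)[rule_format, of "(x, ?u)"] x u
          by (auto simp only: real_sqrt_le_iff fst_conv snd_conv SigmaI)
        ultimately show ?thesis by (simp add: mult.commute mult_left_mono)
      qed
      then show "sqrt (?Q z) * norm v \<le> sqrt (g c x v v)" "sqrt (g c x v v) \<le> sqrt (?Q w) * norm v" by auto
    qed (use pos z w in auto)
  qed
  then obtain \<mu> \<Lambda> where "0 < \<mu>" "0 < \<Lambda>"
      "\<forall>x\<in>K. \<forall>v\<in>E. \<mu> * norm v \<le> sqrt (g c x v v) \<and> sqrt (g c x v v) \<le> \<Lambda> * norm v" by blast
  then have "metric_bounds c p \<rho> \<mu> \<Lambda>"
    unfolding metric_bounds_def using c \<rho> K(2) by (simp add: K_def)
  moreover have "chart_ball c p \<rho> \<subseteq> W"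
  proof
    fix z assume z: "z \<in> chart_ball c p \<rho>"
    then have "z \<in> fst c" "snd c z \<in> cball (snd c p) \<rho> \<inter> E"
      using chart_image_subset[OF c(1)] by (auto simp: chart_ball_def)
    then obtain y where "y \<in> fst c" "y \<in> W" "snd c z = snd c y" using \<rho>(2) by blast
    then show "z \<in> W" using chart_inj[OF c(1)] \<open>z \<in> fst c\<close> by (auto dest: inj_onD)
  qed
  ultimately show ?thesis by blast
qed

text \<open>The coordinate speed is at most the Riemannian speed divided by \<open>\<mu>\<close>. A
  piece may be given as C1 in some other chart \<open>c'\<close>, hence the change of chart.\<close>

lemma length_lower_bound:
  assumes b: "metric_bounds c p \<rho> \<mu> \<Lambda>" and \<gamma>: "pw_C1 \<gamma> a b"
    and "continuous_on {a..b} (snd c \<circ> \<gamma>)" "\<gamma> ` {a..b} \<subseteq> fst c" "\<And>t. t \<in> {a..b} \<Longrightarrow> snd c (\<gamma> t) \<in> cball (snd c p) \<rho>"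
  shows "\<mu> * norm (snd c (\<gamma> b) - snd c (\<gamma> a)) \<le> integral {a..b} (speed \<A> g \<gamma>)"
  using \<gamma> assms(3-)
proof (induction rule: pw_C1.induct)
  case (piece a b c')
  note B = metric_boundsD[OF b]
  obtain D where D: "\<gamma> ` {a..b} \<subseteq> fst c'" "continuous_on {a..b} (snd c' \<circ> \<gamma>)"
    "\<And>t. t \<in> {a..b} \<Longrightarrow> D t \<in> E"
    "\<And>t. t \<in> {a<..<b} \<Longrightarrow> ((snd c' \<circ> \<gamma>) has_vector_derivative D t) (at t)"
    "\<And>t. t \<in> {a<..<b} \<Longrightarrow> speed \<A> g \<gamma> t = sqrt (g c' (snd c' (\<gamma> t)) (D t) (D t))"
    by (rule C1_in_chartE[OF piece(2,3,1)]) blast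
  have E: "snd c (\<gamma> t) \<in> E" if "t \<in> {a..b}" for t using chart_image_subset[OF B(1)] piece(5) that by blast
  have "\<exists>w. ((snd c \<circ> \<gamma>) has_vector_derivative w) (at t) \<and> norm w \<le> speed \<A> g \<gamma> t / \<mu>" if t: "t \<in> {a<..<b}" for t
  proof -
    have t': "t \<in> {a..b}" using t by auto
    have \<gamma>t: "\<gamma> t \<in> fst c" using piece(5) t' by blast
    obtain w where w: "((snd c \<circ> \<gamma>) has_vector_derivative w) (at t)"
      "g c (snd c (\<gamma> t)) w w = g c' (snd c' (\<gamma> t)) (D t) (D t)"
      using change_of_chart[OF piece(2) B(1) _ _ D(1) \<gamma>t D(2) D(4)[OF t] D(3)[OF t']] t by auto
    have "w \<in> E"
      by (rule derivative_in_subspace[OF model_space piece(1) t' _ has_vector_derivative_at_within[OF w(1)]])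
        (use E in auto)
    then have "\<mu> * norm w \<le> speed \<A> g \<gamma> t"
      using B(7)[of "snd c (\<gamma> t)" w] piece(6)[OF t'] E[OF t'] w(2) D(5)[OF t] by auto
    then show ?thesis using w(1) B(4) by (auto simp: field_simps)
  qed
  then obtain w where w: "\<And>t. t \<in> {a<..<b} \<Longrightarrow> ((snd c \<circ> \<gamma>) has_vector_derivative w t) (at t)"
    "\<And>t. t \<in> {a<..<b} \<Longrightarrow> norm (w t) \<le> speed \<A> g \<gamma> t / \<mu>" by metis
  have int: "(w has_integral (snd c \<circ> \<gamma>) b - (snd c \<circ> \<gamma>) a) {a..b}"
    by (rule fundamental_theorem_of_calculus_interior) (use piece w in \<open>auto simp: o_def\<close>)
  have sp: "(\<lambda>t. speed \<A> g \<gamma> t / \<mu>) integrable_on {a..b}"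
    using speed_integrable_piece(1)[OF piece(2,3,1)] by (rule integrable_on_divide)
  have "norm (integral {a..b} w) \<le> integral {a..b} (\<lambda>t. speed \<A> g \<gamma> t / \<mu>)"
    by (rule norm_integral_le_interior) (use int w sp in \<open>auto simp: integrable_on_def\<close>)
  then show ?case
    using int B(4) by (simp add: integral_unique field_simps)
next
  case (combine a b c')
  note B = metric_boundsD[OF b]
  have ab: "a < b" "b < c'" using pw_C1_less combine.hyps by auto
  have 1: "\<mu> * norm (snd c (\<gamma> b) - snd c (\<gamma> a)) \<le> integral {a..b} (speed \<A> g \<gamma>)"
    by (rule combine.IH(1))
      (use combine.prems(2,3) ab in \<open>auto intro: continuous_on_subset[OF combine.prems(1)] simp: image_subset_iff simp del: o_apply comp_apply\<close>)
  have 2: "\<mu> * norm (snd c (\<gamma> c') - snd c (\<gamma> b)) \<le> integral {b..c'} (speed \<A> g \<gamma>)"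
    by (rule combine.IH(2))
      (use combine.prems(2,3) ab in \<open>auto intro: continuous_on_subset[OF combine.prems(1)] simp: image_subset_iff simp del: o_apply comp_apply\<close>)
  have "norm (snd c (\<gamma> c') - snd c (\<gamma> a)) \<le> norm (snd c (\<gamma> c') - snd c (\<gamma> b)) + norm (snd c (\<gamma> b) - snd c (\<gamma> a))"
    using norm_triangle_ineq[of "snd c (\<gamma> c') - snd c (\<gamma> b)" "snd c (\<gamma> b) - snd c (\<gamma> a)"] by simp
  from mult_left_mono[OF this, of \<mu>] show ?case
    using 1 2 B(4) pw_C1_combine_length(2)[OF combine.hyps] by (simp add: algebra_simps)
qed

definition curve :: "(real \<Rightarrow> 'a) \<Rightarrow> 'a \<Rightarrow> 'a \<Rightarrow> real \<Rightarrow> bool" where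
  "curve \<gamma> x y l \<longleftrightarrow> piecewise_C1_curve X \<A> \<gamma> \<and> \<gamma> 0 = x \<and> \<gamma> 1 = y \<and> riemannian_length \<A> g \<gamma> = l"

lemma curve_iff:
  "curve \<gamma> x y l \<longleftrightarrow> pathin X \<gamma> \<and> pw_C1 \<gamma> 0 1 \<and> \<gamma> 0 = x \<and> \<gamma> 1 = y \<and> integral {0..1} (speed \<A> g \<gamma>) = l"
  by (auto simp: curve_def piecewise_C1_curve_iff riemannian_length_def)

lemma curve_length_nonneg: "curve \<gamma> x y l \<Longrightarrow> 0 \<le> l"
  using speed_integrable by (auto simp: curve_iff)

lemma curve_ends: "curve \<gamma> x y l \<Longrightarrow> x \<in> topspace X \<and> y \<in> topspace X"
  using topspace_pathin[of X \<gamma> 0] topspace_pathin[of X \<gamma> 1] by (auto simp: curve_iff)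

lemma curve_join:
  assumes "curve \<gamma> x y l" "curve \<delta> y z m"
  shows "curve (join_path \<gamma> \<delta>) x z (l + m)"
proof -
  have \<gamma>: "pathin X \<gamma>" "pw_C1 \<gamma> 0 1" "\<gamma> 0 = x" "\<gamma> 1 = y" "integral {0..1} (speed \<A> g \<gamma>) = l"
    and \<delta>: "pathin X \<delta>" "pw_C1 \<delta> 0 1" "\<delta> 0 = y" "\<delta> 1 = z" "integral {0..1} (speed \<A> g \<delta>) = m"
    using assms by (auto simp: curve_iff)
  let ?j = "join_path \<gamma> \<delta>"
  have 1: "pw_C1 ?j 0 (1 / 2) \<and> integral {0..1 / 2} (speed \<A> g ?j) = l"
    using pw_C1_affine[OF \<gamma>(2), of 2 0 ?j] \<gamma>(5) by (auto simp: join_path_def)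
  have 2: "pw_C1 ?j (1 / 2) 1 \<and> integral {1 / 2..1} (speed \<A> g ?j) = m"
  proof -
    \<comment> \<open>At \<open>1 / 2\<close> the concatenation takes its value from
      \<open>\<gamma>\<close>, so the junction condition is used there.\<close>
    have "?j t = \<delta> (2 * t + - 1)" if "t \<in> {1 / 2..1}" for t
    proof (cases "t = 1 / 2")
      case True
      show ?thesis unfolding True using \<gamma>(4) \<delta>(3) by (simp add: join_path_def)
    qed (use that in \<open>auto simp: join_path_def\<close>)
    then show ?thesis using pw_C1_affine[OF \<delta>(2), of 2 "-1" ?j] \<delta>(5) by auto
  qed
  show ?thesis
    unfolding curve_iff
    using pathin_join_path[OF \<gamma>(1) \<delta>(1)] pw_C1_combine_length[of ?j 0 "1 / 2" 1] 1 2 \<gamma> \<delta> by auto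
qed

lemma curve_reverse:
  assumes "curve \<gamma> x y l"
  shows "curve (rev_path \<gamma>) y x l"
  using assms pw_C1_reverse[of \<gamma> 0 1 1 "rev_path \<gamma>"] pathin_rev_path[of X \<gamma>]
  by (auto simp: curve_iff rev_path_def)

text \<open>The coordinate segment stays in the convex set on which \<open>\<Lambda>\<close> bounds
  the metric.\<close>

lemma straight_curve:
  assumes b: "metric_bounds c p \<rho> \<mu> \<Lambda>" and xy: "x \<in> cball (snd c p) \<rho> \<inter> E" "y \<in> cball (snd c p) \<rho> \<inter> E"
  shows "\<exists>\<gamma> l. curve \<gamma> (chart_inv c x) (chart_inv c y) l \<and> l \<le> \<Lambda> * norm (y - x)"
proof -
  note B = metric_boundsD[OF b]
  let ?f = "\<lambda>t. (1 - t) *\<^sub>R x + t *\<^sub>R y"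
  define \<gamma> where "\<gamma> t = chart_inv c (?f t)" for t
  have conv: "convex (cball (snd c p) \<rho> \<inter> E)"
    by (intro convex_Int convex_cball subspace_imp_convex model_space)
  have f: "?f t \<in> cball (snd c p) \<rho> \<inter> E" if "t \<in> {0..1}" for t
    using convexD[OF conv xy, of "1 - t" t] that by auto
  then have fc: "?f t \<in> snd c ` fst c" if "t \<in> {0..1}" for t using B(6) that by blast
  have \<gamma>: "\<gamma> t \<in> fst c" "snd c (\<gamma> t) = ?f t" if "t \<in> {0..1}" for t
    using fc[OF that] B(1) by (auto simp: \<gamma>_def)
  have "continuous_map (top_of_set {0..1}) (top_of_set (snd c ` fst c)) ?f"
    using fc by (auto simp: continuous_map_in_subtopology intro!: continuous_intros)
  from continuous_map_compose[OF this continuous_chart_inv[OF B(1)]]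
  have path: "pathin X \<gamma>" by (simp add: pathin_def \<gamma>_def[abs_def] o_def)
  have "(?f has_vector_derivative (y - x)) (at t within {0..1})" for t
    by (auto intro!: derivative_eq_intros simp: algebra_simps)
  then have D: "((snd c \<circ> \<gamma>) has_vector_derivative (y - x)) (at t within {0..1})" if "t \<in> {0..1}" for t
    by (rule has_vector_derivative_transform[OF that, rotated]) (use \<gamma> in auto)
  have C1: "C1_in_chart c \<gamma> 0 1"
    unfolding C1_in_chart_def using \<gamma> D by (intro conjI exI[of _ "\<lambda>_. y - x"]) auto
  have pw: "pw_C1 \<gamma> 0 1" by (rule pw_C1.piece[OF _ B(1) C1]) simp
  have yx: "y - x \<in> E" using xy subspace_diff[OF model_space] by auto
  have cont: "continuous_on {0..1} (snd c \<circ> \<gamma>)"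
    using D has_vector_derivative_continuous continuous_on_eq_continuous_within by blast
  have "speed \<A> g \<gamma> t = sqrt (g c (?f t) (y - x) (y - x))" if t: "t \<in> {0<..<1}" for t
  proof -
    have "((snd c \<circ> \<gamma>) has_vector_derivative (y - x)) (at t)"
      using D[of t] t at_within_interior[of t "{0..1}"] by auto
    then show ?thesis
      using speed_in_chart[OF B(1) _ _ _ cont _ yx, of t] t \<gamma> by (auto simp: image_subset_iff)
  qed
  moreover have "\<bar>sqrt (g c (?f t) (y - x) (y - x))\<bar> \<le> \<Lambda> * norm (y - x)" if "t \<in> {0<..<1}" for t
  proof -
    have ft: "?f t \<in> cball (snd c p) \<rho> \<inter> E" using f that by simp
    have "0 \<le> \<mu> * norm (y - x)" using B(4) by simp
    then have "0 \<le> sqrt (g c (?f t) (y - x) (y - x))" using B(7)[OF ft yx] by (rule order_trans)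
    then show ?thesis using B(8)[OF ft yx] by (metis abs_of_nonneg)
  qed
  ultimately have "norm (speed \<A> g \<gamma> t) \<le> \<Lambda> * norm (y - x)" if "t \<in> {0<..<1}" for t
    using that by (metis real_norm_def)
  then have "norm (integral {0..1} (speed \<A> g \<gamma>)) \<le> integral {0..1} (\<lambda>t::real. \<Lambda> * norm (y - x))"
    using speed_integrable[OF pw] by (intro norm_integral_le_interior) auto
  then have "integral {0..1} (speed \<A> g \<gamma>) \<le> \<Lambda> * norm (y - x)" by simp
  then show ?thesis
    unfolding curve_iff using path pw by (intro exI[of _ \<gamma>] exI[of _ "integral {0..1} (speed \<A> g \<gamma>)"]) (auto simp: \<gamma>_def)
qed

lemma local_curve:
  assumes b: "metric_bounds c p \<rho> \<mu> \<Lambda>" and z: "z \<in> chart_ball c p \<rho>"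
  shows "\<exists>\<gamma> l. curve \<gamma> p z l \<and> l \<le> \<Lambda> * norm (snd c z - snd c p)"
proof -
  note B = metric_boundsD[OF b]
  have "snd c p \<in> cball (snd c p) \<rho> \<inter> E" "snd c z \<in> cball (snd c p) \<rho> \<inter> E"
    using z B chart_image_subset[OF B(1)] by (auto simp: chart_ball_def)
  from straight_curve[OF b this] show ?thesis using B z by (simp add: chart_ball_def)
qed

text \<open>To leave the coordinate ball the curve has to travel the coordinate distance
  \<open>r\<close>; up to the first moment outside, \<open>length_lower_bound\<close>
  applies.\<close>

lemma curve_exit:
  assumes b: "metric_bounds c p \<rho> \<mu> \<Lambda>" and r: "0 < r" "r \<le> \<rho>"
    and \<gamma>: "curve \<gamma> p q l" and q: "q \<notin> chart_ball c p r"
  shows "\<mu> * r \<le> l"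
proof -
  note B = metric_boundsD[OF b]
  have path: "pathin X \<gamma>" and pw: "pw_C1 \<gamma> 0 1" and ends: "\<gamma> 0 = p" "\<gamma> 1 = q"
    and l: "integral {0..1} (speed \<A> g \<gamma>) = l" using \<gamma> by (auto simp: curve_iff)
  let ?I = "top_of_set {0..1::real}"
  define T where "T = {t \<in> {0..1}. \<gamma> t \<notin> chart_ball c p r}"
  have "openin ?I {t \<in> topspace ?I. \<gamma> t \<in> chart_ball c p r}"
    by (rule openin_continuous_map_preimage[OF path[unfolded pathin_def] openin_chart_ball[OF B(1)]])
  then have "closedin ?I (topspace ?I - {t \<in> topspace ?I. \<gamma> t \<in> chart_ball c p r})" by blast
  moreover have "topspace ?I - {t \<in> topspace ?I. \<gamma> t \<in> chart_ball c p r} = T" by (auto simp: T_def)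
  ultimately have T: "closed T" using closedin_closed_trans[of "{0..1}" T] by auto
  have T1: "1 \<in> T" using q ends by (simp add: T_def)
  have T01: "T \<subseteq> {0..1}" by (auto simp: T_def)
  \<comment> \<open>The first time outside the open ball, attained because \<open>T\<close> is
    closed.\<close>
  define u where "u = Inf T"
  have uT: "u \<in> T" unfolding u_def by (rule closed_contains_Inf[OF _ _ T]) (use T1 T01 in \<open>auto intro!: bdd_belowI[of _ 0]\<close>)
  have before: "\<gamma> t \<in> chart_ball c p r" if "0 \<le> t" "t < u" for t
  proof (rule ccontr)
    assume "\<gamma> t \<notin> chart_ball c p r"
    then have "t \<in> T" using that uT by (auto simp: T_def)
    then have "u \<le> t" unfolding u_def by (rule cInf_lower) (use T01 in \<open>auto intro!: bdd_belowI[of _ 0]\<close>)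
    then show False using that by simp
  qed
  have "u \<noteq> 0" using uT ends B r by (auto simp: T_def chart_ball_def)
  then have u: "0 < u" "u \<le> 1" using uT T01 by force+
  \<comment> \<open>At time \<open>u\<close> the curve could have left the domain of the chart. The
    closed coordinate ball is compact, so its image \<open>K\<close> is closed in the Hausdorff
    space \<open>X\<close> and contains \<open>\<gamma> u\<close> as a limit.\<close>
  define K where "K = chart_inv c ` (cball (snd c p) r \<inter> E)"
  have cK: "cball (snd c p) r \<inter> E \<subseteq> snd c ` fst c" using B(6) r by (auto simp: subset_iff)
  have "compact (cball (snd c p) r \<inter> E)"
    by (intro compact_Int_closed compact_cball closed_subspace model_space)
  then have "compactin (top_of_set (snd c ` fst c)) (cball (snd c p) r \<inter> E)"
    using cK by (simp add: compactin_subtopology)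
  then have "compactin X K" unfolding K_def by (rule image_compactin[OF _ continuous_chart_inv[OF B(1)]])
  then have "closedin X K" by (rule compactin_imp_closedin[OF hausdorff])
  then have "closedin ?I {t \<in> topspace ?I. \<gamma> t \<in> K}"
    by (rule closedin_continuous_map_preimage[OF path[unfolded pathin_def]])
  then have "closed {t \<in> topspace ?I. \<gamma> t \<in> K}" using closedin_closed_trans[of "{0..1}"] by auto
  moreover have "{0..<u} \<subseteq> {t \<in> topspace ?I. \<gamma> t \<in> K}"
  proof
    fix t assume t: "t \<in> {0..<u}"
    then have "\<gamma> t \<in> fst c" "snd c (\<gamma> t) \<in> cball (snd c p) r"
      using before[of t] by (auto simp: chart_ball_def intro: less_imp_le)
    then have "\<gamma> t \<in> K"
      unfolding K_def using chart_image_subset[OF B(1)] B(1) by (intro image_eqI[of _ _ "snd c (\<gamma> t)"]) auto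
    then show "t \<in> {t \<in> topspace ?I. \<gamma> t \<in> K}" using t u by auto
  qed
  ultimately have "closure {0..<u} \<subseteq> {t \<in> topspace ?I. \<gamma> t \<in> K}" by (rule closure_minimal[rotated])
  moreover have "closure {0..<u} = {0..u}" using u by (simp add: closure_atLeastLessThan)
  ultimately have inK: "\<gamma> t \<in> K" if "t \<in> {0..u}" for t using that by blast
  have Kc: "z \<in> fst c \<and> snd c z \<in> cball (snd c p) r" if "z \<in> K" for z
    using that cK B(1) unfolding K_def by (auto simp: subset_iff intro: less_imp_le)
  have "continuous_map (top_of_set {0..u}) (subtopology X (fst c)) \<gamma>"
    unfolding continuous_map_in_subtopology
  proof
    show "continuous_map (top_of_set {0..u}) X \<gamma>"
      by (rule continuous_map_from_subtopology_mono[OF path[unfolded pathin_def]]) (use u in auto)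
  qed (use inK Kc in auto)
  from continuous_map_compose[OF this continuous_chart[OF B(1)]]
  have cont: "continuous_on {0..u} (snd c \<circ> \<gamma>)" by (simp add: o_def)
  have "\<mu> * norm (snd c (\<gamma> u) - snd c (\<gamma> 0)) \<le> integral {0..u} (speed \<A> g \<gamma>)"
    by (rule length_lower_bound[OF b pw_C1_restrict[OF pw] cont])
      (use u inK Kc r in \<open>auto simp: image_subset_iff intro: order_trans\<close>)
  moreover have "r \<le> norm (snd c (\<gamma> u) - snd c (\<gamma> 0))"
    using uT Kc[OF inK[of u]] u ends by (auto simp: T_def chart_ball_def dist_norm norm_minus_commute not_less)
  moreover have "integral {0..u} (speed \<A> g \<gamma>) \<le> l"
  proof (cases "u = 1")
    case False
    then have "pw_C1 \<gamma> 0 u" "pw_C1 \<gamma> u 1" using u by (auto intro!: pw_C1_restrict[OF pw])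
    then show ?thesis using pw_C1_combine_length(2)[of \<gamma> 0 u 1] speed_integrable[of \<gamma> u 1] l by simp
  qed (use l in simp)
  ultimately show ?thesis using B(4) mult_left_mono[of r "norm (snd c (\<gamma> u) - snd c (\<gamma> 0))" \<mu>] by linarith
qed

text \<open>The set of points reachable from \<open>x\<close> is open and closed, because every
  point has a neighbourhood reachable from it and curves can be reversed.\<close>

lemma exists_curve:
  assumes conn: "connected_space X" and x: "x \<in> topspace X" and y: "y \<in> topspace X"
  shows "\<exists>\<gamma> l. curve \<gamma> x y l"
proof -
  define S where "S = {y \<in> topspace X. \<exists>\<gamma> l. curve \<gamma> x y l}"
  have nbhd: "\<exists>V. openin X V \<and> z \<in> V \<and> (\<forall>w\<in>V. \<exists>\<gamma> l. curve \<gamma> z w l)" if z: "z \<in> topspace X" for z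
  proof -
    obtain c \<rho> \<mu> \<Lambda> where b: "metric_bounds c z \<rho> \<mu> \<Lambda>" using exists_metric_bounds[OF z] by blast
    note B = metric_boundsD[OF b]
    show ?thesis
    proof (intro exI[of _ "chart_ball c z \<rho>"] conjI ballI)
      show "openin X (chart_ball c z \<rho>)" by (rule openin_chart_ball[OF B(1)])
      show "z \<in> chart_ball c z \<rho>" using B(2,3) by (simp add: chart_ball_def)
      show "\<exists>\<gamma> l. curve \<gamma> z w l" if "w \<in> chart_ball c z \<rho>" for w using local_curve[OF b that] by blast
    qed
  qed
  have "openin X S"
  proof (subst openin_subopen, rule ballI)
    fix z assume z: "z \<in> S"
    then obtain V where V: "openin X V" "z \<in> V" "\<forall>w\<in>V. \<exists>\<gamma> l. curve \<gamma> z w l" using nbhd by (auto simp: S_def)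
    moreover have "V \<subseteq> S"
    proof
      fix w assume w: "w \<in> V"
      obtain \<gamma> l \<delta> m where "curve \<gamma> x z l" "curve \<delta> z w m" using V(3) w z by (auto simp: S_def)
      from curve_join[OF this] show "w \<in> S" using curve_ends by (auto simp: S_def)
    qed
    ultimately show "\<exists>T. openin X T \<and> z \<in> T \<and> T \<subseteq> S" by blast
  qed
  moreover have "openin X (topspace X - S)"
  proof (subst openin_subopen, rule ballI)
    fix z assume z: "z \<in> topspace X - S"
    then obtain V where V: "openin X V" "z \<in> V" "\<forall>w\<in>V. \<exists>\<gamma> l. curve \<gamma> z w l" using nbhd by blast
    moreover have "V \<subseteq> topspace X - S"
    proof
      fix w assume w: "w \<in> V"
      have "w \<notin> S"
      proof
        assume "w \<in> S"
        then obtain \<gamma> l \<delta> m where "curve \<gamma> x w l" "curve \<delta> z w m" using V(3) w by (auto simp: S_def)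
        then show False using curve_join[OF _ curve_reverse, of \<gamma> x w l \<delta> z m] z by (auto simp: S_def)
      qed
      then show "w \<in> topspace X - S" using V(1) w openin_subset by blast
    qed
    ultimately show "\<exists>T. openin X T \<and> z \<in> T \<and> T \<subseteq> topspace X - S" by blast
  qed
  then have "closedin X S" unfolding closedin_def S_def by auto
  moreover have "x \<in> S"
  proof -
    obtain V where "x \<in> V" "\<forall>w\<in>V. \<exists>\<gamma> l. curve \<gamma> x w l" using nbhd[OF x] by blast
    then show ?thesis using x by (auto simp: S_def)
  qed
  ultimately have "S = topspace X" using conn unfolding connected_space_clopen_in by blast
  then show ?thesis using y by (auto simp: S_def)
qed

end

section \<open>The geodesic distance as a metric of a length space\<close>

locale connected_riemannian_manifold = riemannian_manifold X E \<A> g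
  for X :: "'a topology" and E :: "'e::euclidean_space set" and \<A> and g +
  assumes connected: "connected_space X"
begin

abbreviation "gd \<equiv> geodesic_dist X \<A> g"

lemma gd_eq: "x \<in> topspace X \<Longrightarrow> y \<in> topspace X \<Longrightarrow> gd x y = Inf {l. \<exists>\<gamma>. curve \<gamma> x y l}"
  by (auto simp: geodesic_dist_def curve_def intro!: arg_cong[where f = Inf])

lemma gd_le: "curve \<gamma> x y l \<Longrightarrow> gd x y \<le> l"
  using curve_ends[of \<gamma> x y l] curve_length_nonneg
  by (auto simp: gd_eq intro!: cInf_lower bdd_belowI[of _ 0])

lemma gd_less:
  assumes "x \<in> topspace X" "y \<in> topspace X" "gd x y < R"
  shows "\<exists>\<gamma> l. curve \<gamma> x y l \<and> l < R"
proof -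
  have "{l. \<exists>\<gamma>. curve \<gamma> x y l} \<noteq> {}" using exists_curve[OF connected assms(1,2)] by blast
  moreover have "Inf {l. \<exists>\<gamma>. curve \<gamma> x y l} < R" using assms by (simp add: gd_eq)
  ultimately have "\<exists>l\<in>{l. \<exists>\<gamma>. curve \<gamma> x y l}. l < R" by (rule cInf_lessD)
  then show ?thesis by blast
qed

lemma gd_greatest:
  assumes "x \<in> topspace X" "y \<in> topspace X" "\<And>\<gamma> l. curve \<gamma> x y l \<Longrightarrow> b \<le> l"
  shows "b \<le> gd x y"
  using exists_curve[OF connected assms(1,2)] assms by (auto simp: gd_eq intro!: cInf_greatest)

lemma gd_nonneg: "0 \<le> gd x y"
proof (cases "x \<in> topspace X \<and> y \<in> topspace X")
  case True
  then show ?thesis using curve_length_nonneg by (intro gd_greatest) auto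
qed (auto simp: geodesic_dist_def)

text \<open>The counterpart of \<open>local_curve\<close>. It yields both that distinct points have
  positive distance and that geodesic balls are small in coordinates.\<close>

lemma gd_outside_chart_ball:
  assumes b: "metric_bounds c p \<rho> \<mu> \<Lambda>" and r: "0 < r" "r \<le> \<rho>" and q: "q \<in> topspace X" "q \<notin> chart_ball c p r"
  shows "\<mu> * r \<le> gd p q"
proof (rule gd_greatest[OF _ q(1)])
  show "p \<in> topspace X" using chart_subset[OF metric_boundsD(1)[OF b]] metric_boundsD(2)[OF b] by blast
qed (rule curve_exit[OF b r _ q(2)])

lemma gd_sym_le: "x \<in> topspace X \<Longrightarrow> y \<in> topspace X \<Longrightarrow> gd x y \<le> gd y x"
  by (rule gd_greatest) (auto intro: gd_le curve_reverse)

sublocale Metric_space "topspace X" gd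
proof
  fix x y z
  show "0 \<le> gd x y" by (rule gd_nonneg)
  show "gd x y = gd y x"
    using gd_sym_le[of x y] gd_sym_le[of y x]
    by (cases "x \<in> topspace X \<and> y \<in> topspace X") (auto simp: geodesic_dist_def)
  show "gd x z \<le> gd x y + gd y z" if xyz: "x \<in> topspace X" "y \<in> topspace X" "z \<in> topspace X"
  proof (rule field_le_epsilon)
    \<comment> \<open>The infima need not be attained, so almost optimal curves are
      concatenated.\<close>
    fix e :: real assume e: "0 < e"
    obtain \<gamma> l where 1: "curve \<gamma> x y l" "l < gd x y + e / 2" using gd_less[OF xyz(1,2), of "gd x y + e / 2"] e by auto
    obtain \<delta> m where 2: "curve \<delta> y z m" "m < gd y z + e / 2" using gd_less[OF xyz(2,3), of "gd y z + e / 2"] e by auto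
    show "gd x z \<le> gd x y + gd y z + e" using gd_le[OF curve_join[OF 1(1) 2(1)]] 1(2) 2(2) by linarith
  qed
  show "(gd x y = 0) = (x = y)" if xy: "x \<in> topspace X" "y \<in> topspace X"
  proof
    assume 0: "gd x y = 0"
    show "x = y"
    proof (rule ccontr)
      assume "x \<noteq> y"
      then have "x \<in> topspace X - {y}" using xy by simp
      moreover have "openin X (topspace X - {y})"
        using closedin_Hausdorff_singleton[OF hausdorff xy(2)] by blast
      ultimately obtain c \<rho> \<mu> \<Lambda> where b: "metric_bounds c x \<rho> \<mu> \<Lambda>" "chart_ball c x \<rho> \<subseteq> topspace X - {y}"
        using exists_metric_bounds[of x "topspace X - {y}"] by blast
      note B = metric_boundsD[OF b(1)]
      have "\<mu> * \<rho> \<le> gd x y" by (rule gd_outside_chart_ball[OF b(1) B(3) order_refl xy(2)]) (use b in blast)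
      then show False using 0 mult_pos_pos[OF B(4,3)] by linarith
    qed
  next
    assume "x = y"
    obtain c \<rho> \<mu> \<Lambda> where b: "metric_bounds c x \<rho> \<mu> \<Lambda>" using exists_metric_bounds[OF xy(1)] by blast
    note B = metric_boundsD[OF b(1)]
    obtain \<gamma> l where "curve \<gamma> x x l" "l \<le> 0"
      using local_curve[OF b, of x] B by (auto simp: chart_ball_def)
    then show "gd x y = 0" using gd_le[of \<gamma> x x l] gd_nonneg[of x y] \<open>x = y\<close> by simp
  qed
qed

text \<open>Coordinate balls lie in geodesic balls by the straight curves, and geodesic balls lie in
  coordinate balls by the exit estimate.\<close>

lemma mtopology_eq: "mtopology = X"
  unfolding topology_eq
proof (intro allI iffI)
  fix U assume U: "openin mtopology U"
  show "openin X U"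
  proof (subst openin_subopen, rule ballI)
    fix x assume x: "x \<in> U"
    obtain r where r: "0 < r" "mball x r \<subseteq> U" using U x by (auto simp: openin_mtopology)
    have xX: "x \<in> topspace X" using U x by (auto simp: openin_mtopology)
    obtain c \<rho> \<mu> \<Lambda> where b: "metric_bounds c x \<rho> \<mu> \<Lambda>" using exists_metric_bounds[OF xX] by blast
    note B = metric_boundsD[OF b]
    \<comment> \<open>The straight curve to a point within coordinate radius \<open>s\<close> is
      shorter than \<open>\<Lambda> * (r / \<Lambda>) = r\<close>.\<close>
    define s where "s = min \<rho> (r / \<Lambda>)"
    have s: "0 < s" "s \<le> \<rho>" "s \<le> r / \<Lambda>" using B r by (auto simp: s_def)
    have "chart_ball c x s \<subseteq> mball x r"
    proof
      fix z assume z: "z \<in> chart_ball c x s"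
      then have "z \<in> chart_ball c x \<rho>" using s by (auto simp: chart_ball_def)
      from local_curve[OF b this] obtain \<gamma> l where l: "curve \<gamma> x z l" "l \<le> \<Lambda> * norm (snd c z - snd c x)" by blast
      have "norm (snd c z - snd c x) < r / \<Lambda>"
        using z s by (auto simp: chart_ball_def dist_norm norm_minus_commute)
      then have "l < r" using l(2) B(5) by (auto simp: field_simps)
      then show "z \<in> mball x r" using gd_le[OF l(1)] curve_ends[OF l(1)] by auto
    qed
    then show "\<exists>T. openin X T \<and> x \<in> T \<and> T \<subseteq> U"
      using r openin_chart_ball[OF B(1), of x s] B(2) s(1) by (intro exI[of _ "chart_ball c x s"]) (auto simp: chart_ball_def)
  qed
next
  fix U assume U: "openin X U"
  show "openin mtopology U"
    unfolding openin_mtopology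
  proof (intro conjI allI impI)
    show "U \<subseteq> topspace X" using U openin_subset by blast
    fix x assume x: "x \<in> U"
    obtain c \<rho> \<mu> \<Lambda> where b: "metric_bounds c x \<rho> \<mu> \<Lambda>" "chart_ball c x \<rho> \<subseteq> U" using exists_metric_bounds[OF x U] by blast
    note B = metric_boundsD[OF b(1)]
    have "mball x (\<mu> * \<rho>) \<subseteq> U"
    proof
      fix z assume "z \<in> mball x (\<mu> * \<rho>)"
      then show "z \<in> U" using gd_outside_chart_ball[OF b(1) B(3) order_refl, of z] b(2) by force
    qed
    then show "\<exists>r>0. mball x r \<subseteq> U" using B by (intro exI[of _ "\<mu> * \<rho>"]) auto
  qed
qed

text \<open>The witness is the Riemannian arc length: every arc of the curve, reparametrized,
  competes in the infimum that defines the distance of its ends.\<close>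

lemma curve_length_at_most:
  assumes "curve \<gamma> x y l"
  shows "length_at_most gd \<gamma> l"
proof -
  have path: "pathin X \<gamma>" and pw: "pw_C1 \<gamma> 0 1" and l: "integral {0..1} (speed \<A> g \<gamma>) = l"
    using assms by (auto simp: curve_iff)
  show ?thesis
    unfolding length_at_most_def
  proof (intro exI[of _ "\<lambda>t. integral {0..t} (speed \<A> g \<gamma>)"] conjI allI impI)
    fix s t :: real assume st: "0 \<le> s" "s \<le> t" "t \<le> 1"
    show "gd (\<gamma> s) (\<gamma> t) \<le> integral {0..t} (speed \<A> g \<gamma>) - integral {0..s} (speed \<A> g \<gamma>)"
    proof (cases "s = t")
      \<comment> \<open>Piecewise curves live on nondegenerate intervals, so equal parameters are
        treated apart.\<close>
      case True
      then show ?thesis using topspace_pathin[OF path, of t] st by simp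
    next
      case False
      then have st': "s < t" using st by simp
      have pst: "pw_C1 \<gamma> s t" by (rule pw_C1_restrict[OF pw]) (use st st' in auto)
      have e: "segment \<gamma> s t u = \<gamma> ((t - s) * u + s)" for u by (simp add: segment_def algebra_simps)
      have "curve (segment \<gamma> s t) (\<gamma> s) (\<gamma> t) (integral {s..t} (speed \<A> g \<gamma>))"
        unfolding curve_iff
        using pw_C1_affine[OF pst, of "t - s" s "segment \<gamma> s t"] st' st e pathin_segment[OF path, of s t]
        by (auto simp: segment_def)
      then have "gd (\<gamma> s) (\<gamma> t) \<le> integral {s..t} (speed \<A> g \<gamma>)" by (rule gd_le)
      also have "\<dots> = integral {0..t} (speed \<A> g \<gamma>) - integral {0..s} (speed \<A> g \<gamma>)"
      proof -
        have "pw_C1 \<gamma> 0 t" by (rule pw_C1_restrict[OF pw]) (use st st' in auto)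
        then show ?thesis
          using Henstock_Kurzweil_Integration.integral_combine[of 0 s t "speed \<A> g \<gamma>"] speed_integrable st by simp
      qed
      finally show ?thesis .
    qed
  qed (use l in auto)
qed

text \<open>A ball of radius \<open>\<mu> * \<rho>\<close> lies in a coordinate ball, whose
  convexity allows paths with common ends to be deformed along straight lines in
  coordinates.\<close>

lemma compact_length_space:
  assumes "compact_space X"
  shows "compact_length_space (topspace X) gd"
proof
  show "compact_space mtopology" unfolding mtopology_eq by (rule assms)
next
  fix x y R assume xy: "x \<in> topspace X" "y \<in> topspace X" "gd x y < R"
  obtain \<gamma> l where \<gamma>: "curve \<gamma> x y l" "l < R" using gd_less[OF xy] by blast
  then show "\<exists>\<gamma> L. pathin mtopology \<gamma> \<and> \<gamma> 0 = x \<and> \<gamma> 1 = y \<and> length_at_most gd \<gamma> L \<and> L < R"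
    using curve_length_at_most[OF \<gamma>(1)] unfolding mtopology_eq by (auto simp: curve_iff)
next
  fix p assume p: "p \<in> topspace X"
  obtain c \<rho> \<mu> \<Lambda> where b: "metric_bounds c p \<rho> \<mu> \<Lambda>" using exists_metric_bounds[OF p] by blast
  note B = metric_boundsD[OF b]
  have sub: "mball p (\<mu> * \<rho>) \<subseteq> chart_ball c p \<rho>"
    using gd_outside_chart_ball[OF b B(3) order_refl] by force
  show "\<exists>\<epsilon>>0. \<forall>\<alpha> \<beta>. pathin mtopology \<alpha> \<longrightarrow> pathin mtopology \<beta> \<longrightarrow>
      \<alpha> ` {0..1} \<subseteq> mball p \<epsilon> \<longrightarrow> \<beta> ` {0..1} \<subseteq> mball p \<epsilon> \<longrightarrow> \<alpha> 0 = \<beta> 0 \<longrightarrow> \<alpha> 1 = \<beta> 1 \<longrightarrow>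
      (\<exists>H. continuous_map (prod_topology (top_of_set {0..1::real}) (top_of_set {0..1::real})) mtopology (\<lambda>(s, t). H s t) \<and>
        (\<forall>s\<in>{0..1}. H s 0 = \<alpha> 0 \<and> H s 1 = \<alpha> 1) \<and> (\<forall>t\<in>{0..1}. H 0 t = \<alpha> t \<and> H 1 t = \<beta> t))"
    unfolding mtopology_eq
  proof (intro exI[of _ "\<mu> * \<rho>"] conjI allI impI)
    fix \<alpha> \<beta> assume pa: "pathin X \<alpha>" "pathin X \<beta>" and im: "\<alpha> ` {0..1} \<subseteq> mball p (\<mu> * \<rho>)" "\<beta> ` {0..1} \<subseteq> mball p (\<mu> * \<rho>)"
      and ends: "\<alpha> 0 = \<beta> 0" "\<alpha> 1 = \<beta> 1"
    have lift: "continuous_on {0..1} (snd c \<circ> \<gamma>) \<and> (\<forall>t\<in>{0..1}. \<gamma> t \<in> fst c \<and> snd c (\<gamma> t) \<in> cball (snd c p) \<rho> \<inter> E)"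
      if "pathin X \<gamma>" "\<gamma> ` {0..1} \<subseteq> mball p (\<mu> * \<rho>)" for \<gamma>
    proof
      have cb: "\<gamma> ` {0..1} \<subseteq> chart_ball c p \<rho>" using that(2) sub by blast
      then show "\<forall>t\<in>{0..1}. \<gamma> t \<in> fst c \<and> snd c (\<gamma> t) \<in> cball (snd c p) \<rho> \<inter> E"
        using chart_image_subset[OF B(1)] by (auto simp: chart_ball_def image_subset_iff)
      then have "continuous_map (top_of_set {0..1}) (subtopology X (fst c)) \<gamma>"
        using that(1) by (auto simp: pathin_def continuous_map_in_subtopology)
      from continuous_map_compose[OF this continuous_chart[OF B(1)]]
      show "continuous_on {0..1} (snd c \<circ> \<gamma>)" by (simp add: o_def)
    qed
    note la = lift[OF pa(1) im(1)] and lb = lift[OF pa(2) im(2)]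
    define G where "G z = (1 - fst z) *\<^sub>R snd c (\<alpha> (snd z)) + fst z *\<^sub>R snd c (\<beta> (snd z))" for z :: "real \<times> real"
    define H where "H s t = chart_inv c (G (s, t))" for s t
    have conv: "convex (cball (snd c p) \<rho> \<inter> E)"
      by (intro convex_Int convex_cball subspace_imp_convex model_space)
    have Gin: "G z \<in> snd c ` fst c" if "z \<in> {0..1} \<times> {0..1}" for z
    proof -
      have "G z \<in> cball (snd c p) \<rho> \<inter> E"
        unfolding G_def using that la lb by (intro convexD[OF conv]) auto
      then show ?thesis using B(6) by blast
    qed
    have ca: "continuous_on ({0..1} \<times> {0..1}) (\<lambda>z::real \<times> real. snd c (\<alpha> (snd z)))"
      "continuous_on ({0..1} \<times> {0..1}) (\<lambda>z::real \<times> real. snd c (\<beta> (snd z)))"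
      using la lb
      by (auto intro!: continuous_on_compose2[where f = snd and s = "{0..1} \<times> {0..1}" and t = "{0..1}"] continuous_intros simp: o_def)
    have "continuous_on ({0..1} \<times> {0..1}) G"
      unfolding G_def by (intro continuous_intros ca)
    then have "continuous_map (top_of_set ({0..1} \<times> {0..1})) (top_of_set (snd c ` fst c)) G"
      using Gin by (auto simp: continuous_map_in_subtopology)
    from continuous_map_compose[OF this continuous_chart_inv[OF B(1)]]
    have "continuous_map (prod_topology (top_of_set {0..1::real}) (top_of_set {0..1::real})) X (\<lambda>(s, t). H s t)"
      by (simp add: H_def[abs_def] o_def case_prod_unfold)
    moreover have "\<forall>s\<in>{0..1}. H s 0 = \<alpha> 0 \<and> H s 1 = \<alpha> 1"
    proof -
      have "\<beta> 0 \<in> fst c" "\<beta> 1 \<in> fst c" using lb by auto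
      then show ?thesis using ends B(1) by (auto simp: H_def G_def simp flip: scaleR_add_left)
    qed
    moreover have "\<forall>t\<in>{0..1}. H 0 t = \<alpha> t \<and> H 1 t = \<beta> t"
      using la lb B(1) by (auto simp: H_def G_def)
    ultimately show "\<exists>H. continuous_map (prod_topology (top_of_set {0..1::real}) (top_of_set {0..1::real})) X (\<lambda>(s, t). H s t) \<and>
        (\<forall>s\<in>{0..1}. H s 0 = \<alpha> 0 \<and> H s 1 = \<alpha> 1) \<and> (\<forall>t\<in>{0..1}. H 0 t = \<alpha> t \<and> H 1 t = \<beta> t)" by blast
  qed (use B in auto)
qed

end

text \<open>Comparing the two filtrations with each other requires one of the isomorphisms onto (4)
  to be reversed.\<close>

lemma filtration_iso_sym:
  fixes Q :: "('f::field, 'v) persistence"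
  assumes iso: "filtration_H1_pers K \<cong>\<^sub>P Q"
    and closed: "\<And>r. 0 < r \<Longrightarrow> face_closed (K r)" and mono: "\<And>r s. 0 < r \<Longrightarrow> r < s \<Longrightarrow> K r \<subseteq> K s"
  shows "Q \<cong>\<^sub>P filtration_H1_pers K"
proof (rule pers_iso_sym[OF iso])
  fix r :: real assume r: "0 < r"
  note K = presents_simplicial_H1[OF closed[OF r]]
  show "vectorspace scalars (pspace (filtration_H1_pers K :: ('f, _) persistence) r)"
    using presents_vectorspace[OF K] by (simp add: filtration_H1_pers_def)
  fix s and x :: "('a list \<Rightarrow>\<^sub>0 'f) set set"
  assume rs: "r < s" and "x \<in> carrier (pspace (filtration_H1_pers K) r)"
  then obtain z where z: "x = simp_class (K r) z" "z \<in> simp_cycles (K r)"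
    using presentsD(4)[OF K] by (auto simp: filtration_H1_pers_def)
  have s: "0 < s" using r rs by simp
  show "pbond (filtration_H1_pers K) r s x \<in> carrier (pspace (filtration_H1_pers K) s)"
    using inclusion_H1_simp_class[OF closed[OF r] closed[OF s] mono[OF r rs] z(2)] z(2)
      simp_cycles_mono[OF mono[OF r rs]] presentsD(4)[OF presents_simplicial_H1[OF closed[OF s]]]
    by (auto simp: filtration_H1_pers_def z(1))
qed

context compact_length_space
begin

lemma rips_iso:
  "(filtration_H1_pers (\<lambda>r. rips_complex M d (4 * r)) :: ('f::field, _) persistence) \<cong>\<^sub>P
    quotient_pers (singular_H1 mtopology) (\<lambda>r. small_loop_span mtopology (loop_length d) (12 * r))"
proof -
  have "adapted_complex TYPE('f) M d (rips_complex M d (4 * r)) (4 * r) (12 * r)" if "0 < r" for r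
    \<comment> \<open>Here \<open>s = 4 * r\<close>, so loops are killed below
      \<open>3 * s = 12 * r\<close>.\<close>
    using adapted_rips[where s = "4 * r"] that by simp
  then show ?thesis by (rule filtration_iso) (auto simp: rips_complex_iff, fastforce)
qed

lemma cech_iso:
  fixes P defines "P \<equiv> filtration_H1_pers (\<lambda>r. cech_complex M d (3 * r)) :: ('f::field, _) persistence"
    and "Q \<equiv> quotient_pers (singular_H1 mtopology) (\<lambda>r. small_loop_span mtopology (loop_length d) (12 * r))"
  shows "P \<cong>\<^sub>P Q" "Q \<cong>\<^sub>P P"
proof -
  have adapted: "adapted_complex TYPE('f) M d (cech_complex M d (3 * r)) (6 * r) (12 * r)" if "0 < r" for r
    \<comment> \<open>Here \<open>s = 3 * r\<close>, so edges are bounded by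
      \<open>2 * s = 6 * r\<close> and loops are killed below \<open>4 * s = 12 * r\<close>.\<close>
    using adapted_cech[where s = "3 * r"] that by simp
  have mono: "cech_complex M d (3 * r) \<subseteq> cech_complex M d (3 * s)" if "r < s" for r s
    unfolding subset_iff cech_complex_iff using that by (force intro: less_trans)
  show iso: "P \<cong>\<^sub>P Q"
    unfolding P_def Q_def by (rule filtration_iso[OF adapted]) (auto intro: mono[THEN subsetD])
  show "Q \<cong>\<^sub>P P"
    unfolding P_def
    by (rule filtration_iso_sym[OF iso[unfolded P_def] adapted_complex.face_closed[OF adapted] mono])
qed

lemma loop_radius_span: "small_loop_span mtopology (loop_radius M d) b = small_loop_span mtopology (loop_length d) (2 * b)"
  by (simp add: small_loop_span_eq loop_span_eq)

lemma loop_diameter_span: "small_loop_span mtopology (loop_diameter d) b = small_loop_span mtopology (loop_length d) (2 * b)"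
  by (simp add: small_loop_span_eq loop_span_eq)

end

theorem theorem1p1:
  fixes X :: "'a topology"
    and E :: "'e::euclidean_space set"
    and \<A> :: "('a set \<times> ('a \<Rightarrow> 'e)) set"
    and g :: "'a set \<times> ('a \<Rightarrow> 'e) \<Rightarrow> 'e \<Rightarrow> 'e \<Rightarrow> 'e \<Rightarrow> real"
    and d :: "'a \<Rightarrow> 'a \<Rightarrow> real"
    and n :: nat
    and \<gamma>s :: "(real \<Rightarrow> 'a) list"
    and l :: "nat \<Rightarrow> ereal"
    and P1 P2 :: "('f::field, ('a list \<Rightarrow>\<^sub>0 'f) set set) persistence"
    and P3 P4 P5 :: "('f, (((nat \<Rightarrow> real) \<Rightarrow> 'a) \<Rightarrow>\<^sub>0 'f) set set) persistence"
    and P6 :: "('f, nat \<Rightarrow> 'f) persistence"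
  assumes "riemannian_manifold X E \<A> g"
    and "compact_space X"
    and "connected_space X"
    and "d = geodesic_dist X \<A> g"
    and "n = H1_dim TYPE('f) X"
    and "shortest_generating_set TYPE('f) X d \<gamma>s"
    and "\<And>i. i < n \<Longrightarrow> l i = loop_length d (\<gamma>s ! i)"
    and "P1 = filtration_H1_pers (\<lambda>r. rips_complex (topspace X) d (4 * r))"
    and "P2 = filtration_H1_pers (\<lambda>r. cech_complex (topspace X) d (3 * r))"
    and "P3 = quotient_pers (singular_H1 X)
                (\<lambda>r. small_loop_span X (loop_radius (topspace X) d) (6 * r))"
    and "P4 = quotient_pers (singular_H1 X) (\<lambda>r. small_loop_span X (loop_length d) (12 * r))"
    and "P5 = quotient_pers (singular_H1 X) (\<lambda>r. small_loop_span X (loop_diameter d) (6 * r))"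
    and "P6 = direct_sum_pers n (\<lambda>i. interval_pers (l i / 12))"
  shows "P1 \<cong>\<^sub>P P2 \<and> P1 \<cong>\<^sub>P P3 \<and> P1 \<cong>\<^sub>P P4 \<and> P1 \<cong>\<^sub>P P5 \<and> P1 \<cong>\<^sub>P P6 \<and>
         P2 \<cong>\<^sub>P P3 \<and> P2 \<cong>\<^sub>P P4 \<and> P2 \<cong>\<^sub>P P5 \<and> P2 \<cong>\<^sub>P P6 \<and>
         P3 \<cong>\<^sub>P P4 \<and> P3 \<cong>\<^sub>P P5 \<and> P3 \<cong>\<^sub>P P6 \<and>
         P4 \<cong>\<^sub>P P5 \<and> P4 \<cong>\<^sub>P P6 \<and>
         P5 \<cong>\<^sub>P P6"
proof -
  interpret connected_riemannian_manifold X E \<A> g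
    using assms(1,3) by (simp add: connected_riemannian_manifold_def connected_riemannian_manifold_axioms_def)
  interpret S: compact_length_space "topspace X" gd by (rule compact_length_space[OF assms(2)])
  interpret B: shortest_base X d \<gamma>s "TYPE('f)" by (unfold_locales) (rule assms(6))
  have n: "n = length \<gamma>s" using B.base(2) assms(5) by simp
  have 46: "P4 \<cong>\<^sub>P P6"
    unfolding assms(11,13) n by (rule B.interval_sum_iso(2)) (use assms(7) n in simp)
  have 14: "P1 \<cong>\<^sub>P P4" using S.rips_iso unfolding mtopology_eq assms(4,8,11) .
  have 24: "P2 \<cong>\<^sub>P P4" and 42: "P4 \<cong>\<^sub>P P2" using S.cech_iso unfolding mtopology_eq assms(4,9,11) by auto
  \<comment> \<open>Equality and not just isomorphism: radius below \<open>6 * r\<close> and length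
    below \<open>2 * (6 * r)\<close> span the same subspace. The same holds for the diameter
    below.\<close>
  have 3: "P3 = P4"
    unfolding assms(4,10,11) by (simp add: S.loop_radius_span[unfolded mtopology_eq])
  have 5: "P5 = P4"
    unfolding assms(4,11,12) by (simp add: S.loop_diameter_span[unfolded mtopology_eq])
  show ?thesis
    unfolding 3 5
    using 14 24 46 pers_iso_trans[OF 14 42] pers_iso_trans[OF 14 46] pers_iso_trans[OF 24 46] pers_iso_refl
    by blast
qed

end
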